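(* Consider a GRW spacetime $(I\times F,g^f=-d\tau^2+f^2g)$, $I=(a,b)$, which is globally hyperbolic and such that for some $c_0\in(a,b)$ $$\int_a^{c_0}f^{-2}\Big(\frac1{f^2}+1\Big)^{-1/2}d\tau=\infty,\qquad \int_{c_0}^bf^{-2}\Big(\frac1{f^2}+1\Big)^{-1/2}d\tau=\infty.$$ Fix $D_0\le0$ and a point $z_0=(t_0,x_0)$. If every geodesic $\gamma(t)=(\tau(t),\gamma_F(t))$ starting at $z_0$ and having associated values $D$, $c$ equal to $D_0$, $1$, respectively, is free of conjugate points, then the fiber $F$ can be covered topologically by $\mathbb{R}^n$, where $n=\dim F$.
   Context: $(F,g)$ is a connected Riemannian manifold, $I=(a,b)\subseteq\mathbb{R}$ an open interval ($-\infty\le a<b\le\infty$), $f:I\to(0,\infty)$ smooth. The GRW spacetime is $I\times F$ with Lorentz metric $g^f=-d\tau^2+f(\tau)^2g$. For a geodesic $\gamma=(\tau,\gamma_F)$ of $g^f$ the associated constants are $D=g^f(\frac{d\gamma}{dt},\frac{d\gamma}{dt})$ and $c=(f^4\circ\tau)\,g(\frac{d\gamma_F}{dt},\frac{d\gamma_F}{dt})$. Geodesics are assumed inextendible (maximal domain); "free of conjugate points" means no point is conjugate to $z_0$ along $\gamma$. *)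

theory Defs
  imports "HOL-Analysis.Analysis"
begin

section \<open>Smooth maps between Euclidean spaces\<close>

text \<open>Only meant for open \<open>S\<close>, since the derivatives are taken at \<open>x\<close> and not within \<open>S\<close>.\<close>

fun Ck_on :: "nat \<Rightarrow> 'a set \<Rightarrow> ('a::euclidean_space \<Rightarrow> 'b::euclidean_space) \<Rightarrow> bool" where
  "Ck_on 0 S f \<longleftrightarrow> continuous_on S f"
| "Ck_on (Suc k) S f \<longleftrightarrow>
     (\<forall>x\<in>S. f differentiable (at x)) \<and> (\<forall>v. Ck_on k S (\<lambda>x. frechet_derivative f (at x) v))"

definition smooth_on :: "'a set \<Rightarrow> ('a::euclidean_space \<Rightarrow> 'b::euclidean_space) \<Rightarrow> bool" where
  "smooth_on S f \<longleftrightarrow> (\<forall>k. Ck_on k S f)"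

section \<open>Semi-Riemannian manifolds\<close>

text \<open>
  A manifold is given by an indexed atlas. A tangent vector at \<open>p\<close> is represented by its
  coordinates in each chart around \<open>p\<close>, and \<open>metric M i p v w\<close> is the value of the metric tensor
  at \<open>p\<close> on the tangent vectors having coordinates \<open>v\<close> and \<open>w\<close> in the chart \<open>i\<close>. Indexing the charts
  lets a warped product use the index set of its fiber.
\<close>

record ('i, 'm, 'e) semi_riemannian =
  charts :: "'i set"
  cdom :: "'i \<Rightarrow> 'm set"
  coord :: "'i \<Rightarrow> 'm \<Rightarrow> 'e"
  metric :: "'i \<Rightarrow> 'm \<Rightarrow> 'e \<Rightarrow> 'e \<Rightarrow> real"

definition mcarrier :: "('i, 'm, 'e) semi_riemannian \<Rightarrow> 'm set" where
  "mcarrier M = (\<Union>i\<in>charts M. cdom M i)"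

definition chart_inv :: "('i, 'm, 'e) semi_riemannian \<Rightarrow> 'i \<Rightarrow> 'e \<Rightarrow> 'm" where
  "chart_inv M i = inv_into (cdom M i) (coord M i)"

text \<open>The derivative at \<open>p\<close> of a function \<open>h\<close> on the manifold, in the direction of the tangent vector
  whose coordinates in the chart \<open>i\<close> are \<open>v\<close>.\<close>

definition chart_deriv ::
  "('i, 'm, 'e::euclidean_space) semi_riemannian \<Rightarrow> 'i \<Rightarrow> ('m \<Rightarrow> 'b::euclidean_space) \<Rightarrow> 'm \<Rightarrow> 'e \<Rightarrow> 'b"
where
  "chart_deriv M i h p v = frechet_derivative (\<lambda>y. h (chart_inv M i y)) (at (coord M i p)) v"

definition smooth_manifold ::
  "('i, 'm::{t2_space,second_countable_topology}, 'e::euclidean_space) semi_riemannian \<Rightarrow> bool"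
where
  "smooth_manifold M \<longleftrightarrow>
     (\<forall>i\<in>charts M. open (cdom M i) \<and> open (coord M i ` cdom M i) \<and>
        homeomorphism (cdom M i) (coord M i ` cdom M i) (coord M i) (chart_inv M i)) \<and>
     (\<forall>i\<in>charts M. \<forall>j\<in>charts M.
        smooth_on (coord M i ` (cdom M i \<inter> cdom M j)) (\<lambda>y. coord M j (chart_inv M i y)))"

definition semi_riemannian_manifold ::
  "('i, 'm::{t2_space,second_countable_topology}, 'e::euclidean_space) semi_riemannian \<Rightarrow> bool"
where
  "semi_riemannian_manifold M \<longleftrightarrow>
     smooth_manifold M \<and>
     (\<forall>i\<in>charts M. \<forall>p\<in>cdom M i.
        bilinear (metric M i p) \<and>
        (\<forall>v w. metric M i p v w = metric M i p w v) \<and>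
        (\<forall>v. v \<noteq> 0 \<longrightarrow> (\<exists>w. metric M i p v w \<noteq> 0))) \<and>
     (\<forall>i\<in>charts M. \<forall>j\<in>charts M. \<forall>p\<in>cdom M i \<inter> cdom M j. \<forall>v w.
        metric M i p v w =
          metric M j p (chart_deriv M i (coord M j) p v) (chart_deriv M i (coord M j) p w)) \<and>
     (\<forall>i\<in>charts M. \<forall>v w.
        smooth_on (coord M i ` cdom M i) (\<lambda>y. metric M i (chart_inv M i y) v w))"

definition riemannian_manifold ::
  "('i, 'm::{t2_space,second_countable_topology}, 'e::euclidean_space) semi_riemannian \<Rightarrow> bool"
where
  "riemannian_manifold M \<longleftrightarrow>
     semi_riemannian_manifold M \<and>
     (\<forall>i\<in>charts M. \<forall>p\<in>cdom M i. \<forall>v. v \<noteq> 0 \<longrightarrow> metric M i p v v > 0)"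

section \<open>Levi-Civita connection and curvature in charts\<close>

text \<open>\<open>christoffel M i p v w\<close> is the vector \<open>\<Sum>k. (\<Sum>a b. \<Gamma>\<^sup>k\<^sub>a\<^sub>b v\<^sub>a w\<^sub>b) e\<^sub>k\<close>,
  characterised by the Koszul formula for constant coordinate vector fields.\<close>

definition christoffel ::
  "('i, 'm, 'e::euclidean_space) semi_riemannian \<Rightarrow> 'i \<Rightarrow> 'm \<Rightarrow> 'e \<Rightarrow> 'e \<Rightarrow> 'e"
where
  "christoffel M i p v w =
     (THE u. \<forall>z. 2 * metric M i p u z =
        chart_deriv M i (\<lambda>q. metric M i q w z) p v
        + chart_deriv M i (\<lambda>q. metric M i q v z) p w
        - chart_deriv M i (\<lambda>q. metric M i q v w) p z)"

text \<open>Sign convention: \<open>R(v,w)z = \<nabla>\<^sub>v\<nabla>\<^sub>w z - \<nabla>\<^sub>w\<nabla>\<^sub>v z - \<nabla>\<^bsub>[v,w]\<^esub> z\<close>.\<close>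

definition curvature ::
  "('i, 'm, 'e::euclidean_space) semi_riemannian \<Rightarrow> 'i \<Rightarrow> 'm \<Rightarrow> 'e \<Rightarrow> 'e \<Rightarrow> 'e \<Rightarrow> 'e"
where
  "curvature M i p v w z =
     chart_deriv M i (\<lambda>q. christoffel M i q w z) p v
     - chart_deriv M i (\<lambda>q. christoffel M i q v z) p w
     + christoffel M i p v (christoffel M i p w z)
     - christoffel M i p w (christoffel M i p v z)"

section \<open>Curves, geodesics and conjugate points\<close>

definition smooth_curve ::
  "('i, 'm::topological_space, 'e::euclidean_space) semi_riemannian \<Rightarrow> real set \<Rightarrow> (real \<Rightarrow> 'm) \<Rightarrow> bool"
where
  "smooth_curve M J \<gamma> \<longleftrightarrow>
     open J \<and> continuous_on J \<gamma> \<and> \<gamma> ` J \<subseteq> mcarrier M \<and>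
     (\<forall>i\<in>charts M. smooth_on {t\<in>J. \<gamma> t \<in> cdom M i} (\<lambda>t. coord M i (\<gamma> t)))"

text \<open>A vector field along \<open>\<gamma>\<close> is represented as \<open>X :: 'i \<Rightarrow> real \<Rightarrow> 'e\<close>, where \<open>X i t\<close> is the
  coordinate vector in the chart \<open>i\<close>; this is only relevant if \<open>\<gamma> t \<in> cdom M i\<close>.\<close>

definition velocity ::
  "('i, 'm, 'e::euclidean_space) semi_riemannian \<Rightarrow> (real \<Rightarrow> 'm) \<Rightarrow> 'i \<Rightarrow> real \<Rightarrow> 'e"
where
  "velocity M \<gamma> i t = vector_derivative (\<lambda>s. coord M i (\<gamma> s)) (at t)"

definition cov_deriv ::
  "('i, 'm, 'e::euclidean_space) semi_riemannian \<Rightarrow> (real \<Rightarrow> 'm) \<Rightarrow> ('i \<Rightarrow> real \<Rightarrow> 'e) \<Rightarrow> 'i \<Rightarrow> real \<Rightarrow> 'e"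
where
  "cov_deriv M \<gamma> X i t =
     vector_derivative (X i) (at t) + christoffel M i (\<gamma> t) (velocity M \<gamma> i t) (X i t)"

definition smooth_field_along ::
  "('i, 'm, 'e::euclidean_space) semi_riemannian \<Rightarrow> real set \<Rightarrow> (real \<Rightarrow> 'm) \<Rightarrow> ('i \<Rightarrow> real \<Rightarrow> 'e) \<Rightarrow> bool"
where
  "smooth_field_along M J \<gamma> X \<longleftrightarrow>
     (\<forall>i\<in>charts M. smooth_on {t\<in>J. \<gamma> t \<in> cdom M i} (X i)) \<and>
     (\<forall>i\<in>charts M. \<forall>j\<in>charts M. \<forall>t\<in>J. \<gamma> t \<in> cdom M i \<inter> cdom M j \<longrightarrow>
        X j t = chart_deriv M i (coord M j) (\<gamma> t) (X i t))"

definition geodesic ::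
  "('i, 'm::topological_space, 'e::euclidean_space) semi_riemannian \<Rightarrow> real set \<Rightarrow> (real \<Rightarrow> 'm) \<Rightarrow> bool"
where
  "geodesic M J \<gamma> \<longleftrightarrow>
     J \<noteq> {} \<and> is_interval J \<and> smooth_curve M J \<gamma> \<and>
     (\<forall>t\<in>J. \<forall>i\<in>charts M. \<gamma> t \<in> cdom M i \<longrightarrow> cov_deriv M \<gamma> (velocity M \<gamma>) i t = 0)"

definition inextendible_geodesic ::
  "('i, 'm::topological_space, 'e::euclidean_space) semi_riemannian \<Rightarrow> real set \<Rightarrow> (real \<Rightarrow> 'm) \<Rightarrow> bool"
where
  "inextendible_geodesic M J \<gamma> \<longleftrightarrow>
     geodesic M J \<gamma> \<and>
     (\<forall>J' \<beta>. geodesic M J' \<beta> \<and> J \<subseteq> J' \<and> (\<forall>t\<in>J. \<beta> t = \<gamma> t) \<longrightarrow> J' = J)"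

definition jacobi_field ::
  "('i, 'm, 'e::euclidean_space) semi_riemannian \<Rightarrow> real set \<Rightarrow> (real \<Rightarrow> 'm) \<Rightarrow> ('i \<Rightarrow> real \<Rightarrow> 'e) \<Rightarrow> bool"
where
  "jacobi_field M J \<gamma> Y \<longleftrightarrow>
     smooth_field_along M J \<gamma> Y \<and>
     (\<forall>t\<in>J. \<forall>i\<in>charts M. \<gamma> t \<in> cdom M i \<longrightarrow>
        cov_deriv M \<gamma> (cov_deriv M \<gamma> Y) i t
        + curvature M i (\<gamma> t) (Y i t) (velocity M \<gamma> i t) (velocity M \<gamma> i t) = 0)"

definition field_zero_at ::
  "('i, 'm, 'e::euclidean_space) semi_riemannian \<Rightarrow> (real \<Rightarrow> 'm) \<Rightarrow> ('i \<Rightarrow> real \<Rightarrow> 'e) \<Rightarrow> real \<Rightarrow> bool"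
where
  "field_zero_at M \<gamma> Y t \<longleftrightarrow> (\<forall>i\<in>charts M. \<gamma> t \<in> cdom M i \<longrightarrow> Y i t = 0)"

definition conjugate_along ::
  "('i, 'm, 'e::euclidean_space) semi_riemannian \<Rightarrow> real set \<Rightarrow> (real \<Rightarrow> 'm) \<Rightarrow> real \<Rightarrow> real \<Rightarrow> bool"
where
  "conjugate_along M J \<gamma> s t \<longleftrightarrow>
     s \<in> J \<and> t \<in> J \<and> s \<noteq> t \<and>
     (\<exists>Y. jacobi_field M J \<gamma> Y \<and> field_zero_at M \<gamma> Y s \<and> field_zero_at M \<gamma> Y t \<and>
        (\<exists>u\<in>J. \<not> field_zero_at M \<gamma> Y u))"

section \<open>Causality\<close>

text \<open>The time orientation is given by a timelike vector field \<open>T\<close>, with \<open>T i p\<close> its coordinates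
  at \<open>p\<close> in the chart \<open>i\<close>. The signature is \<open>(-,+,\<dots>,+)\<close>.\<close>

definition future_causal_vec ::
  "('i, 'm, 'e::euclidean_space) semi_riemannian \<Rightarrow> ('i \<Rightarrow> 'm \<Rightarrow> 'e) \<Rightarrow> 'i \<Rightarrow> 'm \<Rightarrow> 'e \<Rightarrow> bool"
where
  "future_causal_vec M T i p v \<longleftrightarrow> v \<noteq> 0 \<and> metric M i p v v \<le> 0 \<and> metric M i p (T i p) v < 0"

text \<open>Smoothness on the compact interval \<open>{s..t}\<close> means the existence of a smooth extension \<open>\<beta>\<close> to a
  neighbourhood, so the one-sided velocities at the break points of a piecewise smooth causal curve
  are future causal as well.\<close>

definition causal_segment ::
  "('i, 'm::topological_space, 'e::euclidean_space) semi_riemannian \<Rightarrow> ('i \<Rightarrow> 'm \<Rightarrow> 'e)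
     \<Rightarrow> (real \<Rightarrow> 'm) \<Rightarrow> real \<Rightarrow> real \<Rightarrow> bool"
where
  "causal_segment M T \<alpha> s t \<longleftrightarrow>
     s < t \<and>
     (\<exists>J \<beta>. {s..t} \<subseteq> J \<and> smooth_curve M J \<beta> \<and>
        (\<forall>u\<in>{s..t}. \<alpha> u = \<beta> u \<and>
           (\<forall>i\<in>charts M. \<beta> u \<in> cdom M i \<longrightarrow> future_causal_vec M T i (\<beta> u) (velocity M \<beta> i u))))"

inductive causal_curve ::
  "('i, 'm::topological_space, 'e::euclidean_space) semi_riemannian \<Rightarrow> ('i \<Rightarrow> 'm \<Rightarrow> 'e)
     \<Rightarrow> (real \<Rightarrow> 'm) \<Rightarrow> real \<Rightarrow> real \<Rightarrow> bool"
  for M T \<alpha>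
where
  segment: "causal_segment M T \<alpha> s t \<Longrightarrow> causal_curve M T \<alpha> s t"
| append: "causal_curve M T \<alpha> s r \<Longrightarrow> causal_segment M T \<alpha> r t \<Longrightarrow> causal_curve M T \<alpha> s t"

definition causal_future ::
  "('i, 'm::topological_space, 'e::euclidean_space) semi_riemannian \<Rightarrow> ('i \<Rightarrow> 'm \<Rightarrow> 'e) \<Rightarrow> 'm \<Rightarrow> 'm set"
where
  "causal_future M T p = {q\<in>mcarrier M. q = p \<or> (\<exists>\<alpha> s t. causal_curve M T \<alpha> s t \<and> \<alpha> s = p \<and> \<alpha> t = q)}"

definition causal_past ::
  "('i, 'm::topological_space, 'e::euclidean_space) semi_riemannian \<Rightarrow> ('i \<Rightarrow> 'm \<Rightarrow> 'e) \<Rightarrow> 'm \<Rightarrow> 'm set"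
where
  "causal_past M T q = {p\<in>mcarrier M. q \<in> causal_future M T p}"

definition strongly_causal ::
  "('i, 'm::topological_space, 'e::euclidean_space) semi_riemannian \<Rightarrow> ('i \<Rightarrow> 'm \<Rightarrow> 'e) \<Rightarrow> bool"
where
  "strongly_causal M T \<longleftrightarrow>
     (\<forall>p\<in>mcarrier M. \<forall>U. open U \<and> p \<in> U \<longrightarrow>
        (\<exists>V. open V \<and> p \<in> V \<and> V \<subseteq> U \<and>
           (\<forall>\<alpha> s t. causal_curve M T \<alpha> s t \<and> \<alpha> s \<in> V \<and> \<alpha> t \<in> V \<longrightarrow> \<alpha> ` {s..t} \<subseteq> U)))"

definition globally_hyperbolic ::
  "('i, 'm::topological_space, 'e::euclidean_space) semi_riemannian \<Rightarrow> ('i \<Rightarrow> 'm \<Rightarrow> 'e) \<Rightarrow> bool"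
where
  "globally_hyperbolic M T \<longleftrightarrow>
     strongly_causal M T \<and>
     (\<forall>p\<in>mcarrier M. \<forall>q\<in>mcarrier M. compact (causal_future M T p \<inter> causal_past M T q))"

section \<open>Generalized Robertson--Walker spacetimes\<close>

definition grw ::
  "ereal \<Rightarrow> ereal \<Rightarrow> (real \<Rightarrow> real) \<Rightarrow> ('i, 'm, 'e::euclidean_space) semi_riemannian
     \<Rightarrow> ('i, real \<times> 'm, real \<times> 'e) semi_riemannian"
where
  "grw a b f F =
     \<lparr> charts = charts F,
       cdom = (\<lambda>i. einterval a b \<times> cdom F i),
       coord = (\<lambda>i (\<tau>, x). (\<tau>, coord F i x)),
       metric = (\<lambda>i (\<tau>, x) (s, v) (s', v'). - (s * s') + (f \<tau>)\<^sup>2 * metric F i x v v') \<rparr>"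

text \<open>The coordinate vector field \<open>\<partial>\<^sub>\<tau>\<close>, which fixes the time orientation.\<close>

definition grw_time :: "'i \<Rightarrow> real \<times> 'm \<Rightarrow> real \<times> 'e::euclidean_space" where
  "grw_time = (\<lambda>i p. (1, 0))"

definition has_constant_D ::
  "('i, 'm, 'e::euclidean_space) semi_riemannian \<Rightarrow> real set \<Rightarrow> (real \<Rightarrow> 'm) \<Rightarrow> real \<Rightarrow> bool"
where
  "has_constant_D M J \<gamma> D \<longleftrightarrow>
     (\<forall>t\<in>J. \<forall>i\<in>charts M. \<gamma> t \<in> cdom M i \<longrightarrow>
        metric M i (\<gamma> t) (velocity M \<gamma> i t) (velocity M \<gamma> i t) = D)"

definition has_constant_c ::
  "('i, 'm, 'e::euclidean_space) semi_riemannian \<Rightarrow> (real \<Rightarrow> real) \<Rightarrow> real set \<Rightarrow> (real \<Rightarrow> real \<times> 'm)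
     \<Rightarrow> real \<Rightarrow> bool"
where
  "has_constant_c F f J \<gamma> c \<longleftrightarrow>
     (let \<tau> = fst \<circ> \<gamma>; \<gamma>\<^sub>F = snd \<circ> \<gamma> in
      \<forall>t\<in>J. \<forall>i\<in>charts F. \<gamma>\<^sub>F t \<in> cdom F i \<longrightarrow>
        f (\<tau> t) ^ 4 * metric F i (\<gamma>\<^sub>F t) (velocity F \<gamma>\<^sub>F i t) (velocity F \<gamma>\<^sub>F i t) = c)"

end

(* Let c be a geodesic of F from x0. Global hyperbolicity gives completeness of F at x0: with
   conformal time as clock, (tau, c) is a causal curve, and it stays in a compact causal diamond since
   one can return along c, so c can be extended. Hence exp at x0 is defined on all of R^n; it is C^1 by
   the theory of ordinary differential equations, and its differential is given by Jacobi fields.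
   A Jacobi field J along c with J(0) = 0 = J(1) is orthogonal to c', and then (0, J o s) is a Jacobi
   field along the spacetime geodesic (tau, c o s) with ds/dt = 1 / f(tau)^2 up to a factor; the
   divergent integrals ensure that s takes all real values. So the absence of conjugate points
   makes exp a local diffeomorphism. By the Gauss lemma |d exp(w)| >= |d|v|(w)|, so
   a lift of a curve of finite length through exp stays bounded. Therefore exp lifts straight
   segments in charts, and a local homeomorphism which lifts segments is a covering map. *)

theory Submission
  imports Defs
begin

section \<open>Smooth maps\<close>

text \<open>The hypothesis fixes \<open>D0\<close> and the value 1 of c, while exp must be
  nonsingular at vectors of every length: the length is absorbed by the parameter change, whose rate
  is \<open>1 / (len * f\<^sup>2)\<close>. The vector 0 has no such lift and is treated directly.
  The given integrand is ds/d\<tau> for D = -1 and is at most a constant times the one for any D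
  \<le> 0. Hence divergence also holds for \<open>D0\<close>, which makes s surjective, and for D =
  0, which makes conformal time surjective, as the completeness argument requires. Orthogonality
  enters because the \<tau>-component of the lifted Jacobi equation is a multiple of the first
  variation of the energy, which is constant along the geodesic and equals 2 g(v, w) at
  \<open>x0\<close>. The parameter interval of the lift may be bounded although s is onto, so
  inextendibility needs its own argument. Geodesics cross many charts; properties along them are
  therefore stated locally and propagated by connectedness of the parameter interval. Lifts through
  exp are bounded by a differential inequality for their squared length, without a length metric on
  F.\<close>

lemma frechet_derivative_cong_open:
  assumes "open S" "x \<in> S" "\<And>y. y \<in> S \<Longrightarrow> f y = g y"
  shows "frechet_derivative f (at x) = frechet_derivative g (at x)"
proof -
  have "(f has_derivative f') (at x) \<longleftrightarrow> (g has_derivative f') (at x)" for f'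
    using assms has_derivative_transform_within_open[of f f' x UNIV S g]
      has_derivative_transform_within_open[of g f' x UNIV S f] by auto
  then show ?thesis unfolding frechet_derivative_def by simp
qed

lemma differentiable_cong_open:
  assumes "open S" "x \<in> S" "\<And>y. y \<in> S \<Longrightarrow> f y = g y" "f differentiable (at x)"
  shows "g differentiable (at x)"
  using assms has_derivative_transform_within_open[of f _ x UNIV S g] unfolding differentiable_def
  by blast

section \<open>Closure properties of C^k functions\<close>

lemma Ck_on_cong:
  assumes "open S" "Ck_on k S f" "\<And>x. x \<in> S \<Longrightarrow> f x = g x"
  shows "Ck_on k S g"
  using assms(2,3)
proof (induction k arbitrary: f g)
  case 0
  then show ?case using continuous_on_cong[of S S f g] by simp
next
  case (Suc k)
  have 1: "frechet_derivative f (at x) = frechet_derivative g (at x)" if "x \<in> S" for x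
    using frechet_derivative_cong_open[OF assms(1) that Suc.prems(2)] .
  have "Ck_on k S (\<lambda>x. frechet_derivative g (at x) v)" for v
    by (rule Suc.IH[of "\<lambda>x. frechet_derivative f (at x) v"]) (use Suc.prems 1 in auto)
  moreover have "\<forall>x\<in>S. g differentiable (at x)"
    using differentiable_cong_open[OF assms(1) _ Suc.prems(2)] Suc.prems(1) by auto
  ultimately show ?case by simp
qed

lemma Ck_on_imp_continuous_on: "Ck_on k S f \<Longrightarrow> continuous_on S f"
  by (cases k) (auto intro!: continuous_at_imp_continuous_on differentiable_imp_continuous_within)

lemma Ck_on_SucD: "Ck_on (Suc k) S f \<Longrightarrow> Ck_on k S f"
proof (induction k arbitrary: f)
  case 0
  then show ?case using Ck_on_imp_continuous_on[of "Suc 0"] by auto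
next
  case (Suc k)
  then show ?case by (metis Ck_on.simps(2))
qed

lemma Ck_on_subset: "Ck_on k S f \<Longrightarrow> T \<subseteq> S \<Longrightarrow> Ck_on k T f"
  by (induction k arbitrary: f) (auto intro: continuous_on_subset)

text \<open>Allows the derivative to be supplied in closed form instead of as
  \<open>frechet_derivative\<close>.\<close>

lemma Ck_on_SucI:
  assumes "open S" "\<And>x. x \<in> S \<Longrightarrow> (f has_derivative f' x) (at x)" "\<And>v. Ck_on k S (\<lambda>x. f' x v)"
  shows "Ck_on (Suc k) S f"
proof -
  have "Ck_on k S (\<lambda>x. frechet_derivative f (at x) v)" for v
    by (rule Ck_on_cong[OF assms(1) assms(3)[of v]])
      (metis assms(2) frechet_derivative_at)
  then show ?thesis using assms(2) by (auto simp: differentiable_def)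
qed

lemma Ck_on_const: "open S \<Longrightarrow> Ck_on k S (\<lambda>x. c)"
proof (induction k arbitrary: c)
  case (Suc k)
  show ?case by (rule Ck_on_SucI[where f'="\<lambda>x v. 0"]) (use Suc in auto)
qed auto

lemma Ck_on_SucE:
  assumes "Ck_on (Suc k) S f"
  obtains f' where "\<And>x. x \<in> S \<Longrightarrow> (f has_derivative f' x) (at x)" "\<And>v. Ck_on k S (\<lambda>x. f' x v)"
    "Ck_on k S f"
  using that[of "\<lambda>x. frechet_derivative f (at x)"] assms Ck_on_SucD[OF assms]
  by (auto simp: frechet_derivative_works[symmetric])

lemma Ck_on_add: "open S \<Longrightarrow> Ck_on k S f \<Longrightarrow> Ck_on k S g \<Longrightarrow> Ck_on k S (\<lambda>x. f x + g x)"
proof (induction k arbitrary: f g)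
  case (Suc k)
  from Suc.prems obtain f' g' where
    f: "\<And>x. x \<in> S \<Longrightarrow> (f has_derivative f' x) (at x)" "\<And>v. Ck_on k S (\<lambda>x. f' x v)" and
    g: "\<And>x. x \<in> S \<Longrightarrow> (g has_derivative g' x) (at x)" "\<And>v. Ck_on k S (\<lambda>x. g' x v)"
    by (metis Ck_on_SucE)
  show ?case
    by (rule Ck_on_SucI[where f'="\<lambda>x v. f' x v + g' x v"]) (use Suc f g in \<open>auto intro!: derivative_intros\<close>)
qed (auto intro: continuous_intros)

lemma Ck_on_bilinear:
  assumes "bounded_bilinear B"
  shows "open S \<Longrightarrow> Ck_on k S f \<Longrightarrow> Ck_on k S g \<Longrightarrow> Ck_on k S (\<lambda>x. B (f x) (g x))"
proof (induction k arbitrary: f g)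
  case 0
  then show ?case using bounded_bilinear.continuous_on[OF assms] by auto
next
  case (Suc k)
  from Suc.prems obtain f' g' where
    f: "\<And>x. x \<in> S \<Longrightarrow> (f has_derivative f' x) (at x)" "\<And>v. Ck_on k S (\<lambda>x. f' x v)" "Ck_on k S f" and
    g: "\<And>x. x \<in> S \<Longrightarrow> (g has_derivative g' x) (at x)" "\<And>v. Ck_on k S (\<lambda>x. g' x v)" "Ck_on k S g"
    by (metis Ck_on_SucE)
  show ?case
    by (rule Ck_on_SucI[where f'="\<lambda>x v. B (f x) (g' x v) + B (f' x v) (g x)"])
      (use Suc f g in \<open>auto intro!: Ck_on_add bounded_bilinear.FDERIV[OF assms]\<close>)
qed

lemma Ck_on_linear_image:
  assumes "bounded_linear L"
  shows "open S \<Longrightarrow> Ck_on k S f \<Longrightarrow> Ck_on k S (\<lambda>x. L (f x))"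
proof (induction k arbitrary: f)
  case 0
  then show ?case using bounded_linear.continuous_on[OF assms] by auto
next
  case (Suc k)
  from Suc.prems obtain f' where
    f: "\<And>x. x \<in> S \<Longrightarrow> (f has_derivative f' x) (at x)" "\<And>v. Ck_on k S (\<lambda>x. f' x v)"
    by (metis Ck_on_SucE)
  show ?case
    by (rule Ck_on_SucI[where f'="\<lambda>x v. L (f' x v)"])
      (use Suc f in \<open>auto intro!: bounded_linear.has_derivative[OF assms]\<close>)
qed

lemma Ck_on_linear: "bounded_linear L \<Longrightarrow> open S \<Longrightarrow> Ck_on k S L"
proof (cases k)
  case (Suc n)
  assume "bounded_linear L" "open S"
  then show ?thesis unfolding Suc
    by (intro Ck_on_SucI[where f'="\<lambda>x. L"]) (auto intro: Ck_on_const bounded_linear_imp_has_derivative)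
qed (simp add: linear_continuous_on)

lemma Ck_on_sum:
  "open S \<Longrightarrow> (\<And>i. i \<in> I \<Longrightarrow> Ck_on k S (f i)) \<Longrightarrow> Ck_on k S (\<lambda>x. \<Sum>i\<in>I. f i x)"
  by (induction I rule: infinite_finite_induct) (auto intro: Ck_on_const Ck_on_add)

text \<open>\<open>Ck_on\<close> speaks of derivatives in fixed directions; this expansion reduces
  vectors that vary with the point to the fixed basis directions.\<close>

lemma has_derivative_sum_Basis:
  fixes f' :: "'a::euclidean_space \<Rightarrow> 'b::real_normed_vector"
  assumes "bounded_linear f'"
  shows "f' v = (\<Sum>b\<in>Basis. (v \<bullet> b) *\<^sub>R f' b)"
proof -
  interpret bounded_linear f' by fact
  have "f' v = f' (\<Sum>b\<in>Basis. (v \<bullet> b) *\<^sub>R b)" by (simp add: euclidean_representation)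
  then show ?thesis by (simp add: sum scaleR)
qed

text \<open>In the chain rule the base point and the vector both move. Expanding the vector in the
  basis separates them, and the induction hypothesis applies to the derivative of \<open>f\<close>
  in each basis direction, composed with \<open>g\<close>.\<close>

lemma Ck_on_compose:
  assumes "open S" "open T"
  shows "Ck_on k T f \<Longrightarrow> Ck_on k S g \<Longrightarrow> g ` S \<subseteq> T \<Longrightarrow> Ck_on k S (\<lambda>x. f (g x))"
proof (induction k arbitrary: f g)
  case 0
  then show ?case using continuous_on_compose2[of T f S g] by auto
next
  case (Suc k)
  from Suc.prems obtain f' g' where
    f: "\<And>x. x \<in> T \<Longrightarrow> (f has_derivative f' x) (at x)" "\<And>v. Ck_on k T (\<lambda>x. f' x v)" "Ck_on k T f" and
    g: "\<And>x. x \<in> S \<Longrightarrow> (g has_derivative g' x) (at x)" "\<And>v. Ck_on k S (\<lambda>x. g' x v)" "Ck_on k S g"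
    by (metis Ck_on_SucE)
  have d: "((\<lambda>x. f (g x)) has_derivative (\<lambda>v. \<Sum>b\<in>Basis. (g' x v \<bullet> b) *\<^sub>R f' (g x) b)) (at x)"
    if "x \<in> S" for x
  proof -
    have gx: "g x \<in> T" using Suc.prems that by auto
    have "((\<lambda>x. f (g x)) has_derivative (\<lambda>v. f' (g x) (g' x v))) (at x)"
      using has_derivative_compose[OF g(1)[OF that] f(1)[OF gx]] .
    moreover have "f' (g x) (g' x v) = (\<Sum>b\<in>Basis. (g' x v \<bullet> b) *\<^sub>R f' (g x) b)" for v
      by (rule has_derivative_sum_Basis) (rule has_derivative_bounded_linear[OF f(1)[OF gx]])
    ultimately show ?thesis by simp
  qed
  show ?case
  proof (rule Ck_on_SucI[OF assms(1) d])
    show "Ck_on k S (\<lambda>x. \<Sum>b\<in>Basis. (g' x v \<bullet> b) *\<^sub>R f' (g x) b)" for v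
      by (intro Ck_on_sum assms Ck_on_bilinear[OF bounded_bilinear_scaleR]
          Ck_on_linear_image[OF bounded_linear_inner_left] g(2) Suc.IH[OF f(2) g(3)] Suc.prems)
  qed
qed

lemma Ck_on_inverse:
  fixes f :: "'a::euclidean_space \<Rightarrow> real"
  assumes "open S" "\<And>x. x \<in> S \<Longrightarrow> f x \<noteq> 0"
  shows "Ck_on k S f \<Longrightarrow> Ck_on k S (\<lambda>x. inverse (f x))"
proof (induction k)
  case 0
  then show ?case using assms by (auto intro!: continuous_intros)
next
  case (Suc k)
  from Suc.prems obtain f' where
    f: "\<And>x. x \<in> S \<Longrightarrow> (f has_derivative f' x) (at x)" "\<And>v. Ck_on k S (\<lambda>x. f' x v)" "Ck_on k S f"
    by (metis Ck_on_SucE)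
  have i: "Ck_on k S (\<lambda>x. inverse (f x))" using Suc f by simp
  show ?case
  proof (rule Ck_on_SucI[OF assms(1)])
    show "((\<lambda>x. inverse (f x)) has_derivative (\<lambda>v. - (inverse (f x) * f' x v * inverse (f x)))) (at x)"
      if "x \<in> S" for x
      using Deriv.has_derivative_inverse[OF assms(2)[OF that] f(1)[OF that]] .
    show "Ck_on k S (\<lambda>x. - (inverse (f x) * f' x v * inverse (f x)))" for v
      by (intro Ck_on_linear_image[OF bounded_linear_minus[OF bounded_linear_ident]] assms
          Ck_on_bilinear[OF bounded_bilinear_mult] i f)
  qed
qed

text \<open>The derivative involves the square root itself only through its inverse, so the
  induction hypothesis one order lower suffices.\<close>

lemma Ck_on_sqrt:
  fixes f :: "'a::euclidean_space \<Rightarrow> real"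
  assumes "open S" "\<And>x. x \<in> S \<Longrightarrow> f x > 0"
  shows "Ck_on k S f \<Longrightarrow> Ck_on k S (\<lambda>x. sqrt (f x))"
proof (induction k)
  case 0
  then show ?case using assms by (auto intro!: continuous_intros)
next
  case (Suc k)
  from Suc.prems obtain f' where
    f: "\<And>x. x \<in> S \<Longrightarrow> (f has_derivative f' x) (at x)" "\<And>v. Ck_on k S (\<lambda>x. f' x v)" "Ck_on k S f"
    by (metis Ck_on_SucE)
  have i: "Ck_on k S (\<lambda>x. inverse (sqrt (f x)))"
    by (rule Ck_on_inverse[OF assms(1)]) (use Suc f assms(2) in \<open>auto simp: less_imp_neq[THEN not_sym]\<close>)
  show ?case
  proof (rule Ck_on_SucI[OF assms(1)])
    show "((\<lambda>x. sqrt (f x)) has_derivative (\<lambda>v. (1/2) *\<^sub>R (inverse (sqrt (f x)) * f' x v))) (at x)"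
      if "x \<in> S" for x
      by (rule has_derivative_eq_rhs, rule has_derivative_real_sqrt[OF assms(2)[OF that] f(1)[OF that]])
        (auto simp: field_simps)
    show "Ck_on k S (\<lambda>x. (1/2) *\<^sub>R (inverse (sqrt (f x)) * f' x v))" for v
      by (intro Ck_on_linear_image[OF bounded_linear_scaleR_right] assms
          Ck_on_bilinear[OF bounded_bilinear_mult] i f)
  qed
qed

section \<open>The same closure properties for smooth functions\<close>

named_theorems smooth_intros

lemma smooth_on_cong:
  "open S \<Longrightarrow> smooth_on S f \<Longrightarrow> (\<And>x. x \<in> S \<Longrightarrow> f x = g x) \<Longrightarrow> smooth_on S g"
  unfolding smooth_on_def using Ck_on_cong by blast

lemma smooth_on_subset: "smooth_on S f \<Longrightarrow> T \<subseteq> S \<Longrightarrow> smooth_on T f"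
  unfolding smooth_on_def using Ck_on_subset by blast

lemma smooth_on_const [smooth_intros]: "open S \<Longrightarrow> smooth_on S (\<lambda>x. c)"
  by (simp add: smooth_on_def Ck_on_const)

lemma smooth_on_linear: "bounded_linear L \<Longrightarrow> open S \<Longrightarrow> smooth_on S L"
  by (simp add: smooth_on_def Ck_on_linear)

lemma smooth_on_ident [smooth_intros]: "open S \<Longrightarrow> smooth_on S (\<lambda>x. x)"
  by (simp add: smooth_on_linear)

lemma smooth_on_add [smooth_intros]:
  "open S \<Longrightarrow> smooth_on S f \<Longrightarrow> smooth_on S g \<Longrightarrow> smooth_on S (\<lambda>x. f x + g x)"
  by (simp add: smooth_on_def Ck_on_add)

lemma smooth_on_bilinear:
  "bounded_bilinear B \<Longrightarrow> open S \<Longrightarrow> smooth_on S f \<Longrightarrow> smooth_on S g \<Longrightarrow> smooth_on S (\<lambda>x. B (f x) (g x))"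
  by (simp add: smooth_on_def Ck_on_bilinear)

lemmas smooth_on_scaleR [smooth_intros] = smooth_on_bilinear[OF bounded_bilinear_scaleR]
lemmas smooth_on_mult [smooth_intros] = smooth_on_bilinear[OF bounded_bilinear_mult]

lemma smooth_on_linear_image:
  "bounded_linear L \<Longrightarrow> open S \<Longrightarrow> smooth_on S f \<Longrightarrow> smooth_on S (\<lambda>x. L (f x))"
  by (simp add: smooth_on_def Ck_on_linear_image)

lemmas smooth_on_inner_left [smooth_intros] = smooth_on_linear_image[OF bounded_linear_inner_left]
lemmas smooth_on_minus [smooth_intros] =
  smooth_on_linear_image[OF bounded_linear_minus[OF bounded_linear_ident]]
lemmas smooth_on_fst [smooth_intros] = smooth_on_linear_image[OF bounded_linear_fst]
lemmas smooth_on_snd [smooth_intros] = smooth_on_linear_image[OF bounded_linear_snd]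

lemma smooth_on_diff [smooth_intros]:
  "open S \<Longrightarrow> smooth_on S f \<Longrightarrow> smooth_on S g \<Longrightarrow> smooth_on S (\<lambda>x. f x - g x)"
  using smooth_on_add[of S f "\<lambda>x. - g x"] smooth_on_minus[of S g] by simp

lemma smooth_on_sum [smooth_intros]:
  "open S \<Longrightarrow> (\<And>i. i \<in> I \<Longrightarrow> smooth_on S (f i)) \<Longrightarrow> smooth_on S (\<lambda>x. \<Sum>i\<in>I. f i x)"
  by (simp add: smooth_on_def Ck_on_sum)

lemma smooth_on_prod [smooth_intros]:
  fixes f :: "'i \<Rightarrow> 'a::euclidean_space \<Rightarrow> real"
  shows "open S \<Longrightarrow> (\<And>i. i \<in> I \<Longrightarrow> smooth_on S (f i)) \<Longrightarrow> smooth_on S (\<lambda>x. \<Prod>i\<in>I. f i x)"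
  by (induction I rule: infinite_finite_induct) (auto intro: smooth_on_const smooth_on_mult)

lemma smooth_on_power [smooth_intros]:
  fixes f :: "'a::euclidean_space \<Rightarrow> real"
  shows "open S \<Longrightarrow> smooth_on S f \<Longrightarrow> smooth_on S (\<lambda>x. f x ^ n)"
  by (induction n) (auto intro: smooth_on_const smooth_on_mult)

lemma smooth_on_Pair [smooth_intros]:
  assumes "open S" "smooth_on S f" "smooth_on S g"
  shows "smooth_on S (\<lambda>x. (f x, g x))"
proof -
  have "smooth_on S (\<lambda>x. (f x, 0) + (0, g x))"
    by (intro smooth_on_add assms smooth_on_linear_image[where f=f] smooth_on_linear_image[where f=g]
        bounded_linear_Pair bounded_linear_ident bounded_linear_zero)
  then show ?thesis by simp
qed

lemma smooth_on_compose:
  "open S \<Longrightarrow> open T \<Longrightarrow> smooth_on T f \<Longrightarrow> smooth_on S g \<Longrightarrow> g ` S \<subseteq> T \<Longrightarrow> smooth_on S (\<lambda>x. f (g x))"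
  by (simp add: smooth_on_def Ck_on_compose)

lemma smooth_on_inverse [smooth_intros]:
  fixes f :: "'a::euclidean_space \<Rightarrow> real"
  shows "open S \<Longrightarrow> smooth_on S f \<Longrightarrow> (\<And>x. x \<in> S \<Longrightarrow> f x \<noteq> 0) \<Longrightarrow> smooth_on S (\<lambda>x. inverse (f x))"
  by (simp add: smooth_on_def Ck_on_inverse)

lemma smooth_on_divide [smooth_intros]:
  fixes f :: "'a::euclidean_space \<Rightarrow> real"
  shows "open S \<Longrightarrow> smooth_on S f \<Longrightarrow> smooth_on S g \<Longrightarrow> (\<And>x. x \<in> S \<Longrightarrow> g x \<noteq> 0) \<Longrightarrow> smooth_on S (\<lambda>x. f x / g x)"
  using smooth_on_mult[of S f "\<lambda>x. inverse (g x)"] smooth_on_inverse[of S g] by (simp add: divide_inverse)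

lemma smooth_on_sqrt [smooth_intros]:
  fixes f :: "'a::euclidean_space \<Rightarrow> real"
  shows "open S \<Longrightarrow> smooth_on S f \<Longrightarrow> (\<And>x. x \<in> S \<Longrightarrow> f x > 0) \<Longrightarrow> smooth_on S (\<lambda>x. sqrt (f x))"
  by (simp add: smooth_on_def Ck_on_sqrt)

lemma smooth_on_components:
  assumes "open S" "\<And>b. b \<in> Basis \<Longrightarrow> smooth_on S (\<lambda>x. f x \<bullet> b)"
  shows "smooth_on S f"
proof -
  have "smooth_on S (\<lambda>x. \<Sum>b\<in>Basis. (f x \<bullet> b) *\<^sub>R b)"
    by (intro smooth_on_sum smooth_on_scaleR smooth_on_const assms)
  then show ?thesis by (simp add: euclidean_representation)
qed

lemma smooth_on_imp_continuous_on: "smooth_on S f \<Longrightarrow> continuous_on S f"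
  unfolding smooth_on_def using Ck_on_imp_continuous_on by blast

lemma smooth_on_has_derivative:
  assumes "smooth_on S f" "x \<in> S"
  shows "(f has_derivative frechet_derivative f (at x)) (at x)"
proof -
  have "Ck_on (Suc 0) S f" using assms(1) unfolding smooth_on_def by blast
  then show ?thesis using assms(2) by (simp add: frechet_derivative_works[symmetric])
qed

lemma smooth_on_deriv:
  assumes "smooth_on S f"
  shows "smooth_on S (\<lambda>x. frechet_derivative f (at x) v)"
  unfolding smooth_on_def
proof
  fix k
  have "Ck_on (Suc k) S f" using assms unfolding smooth_on_def by blast
  then show "Ck_on k S (\<lambda>x. frechet_derivative f (at x) v)" by simp
qed

lemma smooth_on_derivI:
  assumes "open S" "\<And>x. x \<in> S \<Longrightarrow> (f has_derivative f' x) (at x)" "\<And>v. smooth_on S (\<lambda>x. f' x v)"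
  shows "smooth_on S f"
  unfolding smooth_on_def
proof
  fix k show "Ck_on k S f"
    by (rule Ck_on_SucD[OF Ck_on_SucI[where f'=f']]) (use assms in \<open>auto simp: smooth_on_def\<close>)
qed

lemma smooth_on_deriv_app:
  assumes "open S" "open R" "open T" "smooth_on S f" "smooth_on R g" "g ` R \<subseteq> S" "smooth_on R h"
  shows "smooth_on R (\<lambda>x. frechet_derivative f (at (g x)) (h x))"
proof -
  have "smooth_on R (\<lambda>x. \<Sum>b\<in>Basis. (h x \<bullet> b) *\<^sub>R frechet_derivative f (at (g x)) b)"
    by (intro smooth_intros assms smooth_on_compose[where f="\<lambda>x. frechet_derivative f (at x) _" and g=g and T=S]
        smooth_on_deriv)
  then show ?thesis
  proof (rule smooth_on_cong[OF assms(2)])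
    fix x assume "x \<in> R"
    then have "g x \<in> S" using assms by auto
    then show "(\<Sum>b\<in>Basis. (h x \<bullet> b) *\<^sub>R frechet_derivative f (at (g x)) b) =
      frechet_derivative f (at (g x)) (h x)"
      using has_derivative_sum_Basis[OF has_derivative_bounded_linear[OF smooth_on_has_derivative[OF assms(4)]]]
      by metis
  qed
qed

text \<open>Bootstrapping: if \<open>z\<close> is C^k then so is its derivative
  \<open>X (z t)\<close>, hence \<open>z\<close> is C^(k+1).\<close>

lemma smooth_on_ode:
  fixes z :: "real \<Rightarrow> 'a::euclidean_space"
  assumes "open J" "open U" "smooth_on U X"
    "\<And>t. t \<in> J \<Longrightarrow> z t \<in> U" "\<And>t. t \<in> J \<Longrightarrow> (z has_vector_derivative X (z t)) (at t)"
  shows "smooth_on J z"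
  unfolding smooth_on_def
proof
  fix k show "Ck_on k J z"
  proof (induction k)
    case 0
    show ?case using assms(5)
      by (auto intro!: continuous_at_imp_continuous_on has_vector_derivative_continuous)
  next
    case (Suc k)
    show ?case
    proof (rule Ck_on_SucI[OF assms(1)])
      show "(z has_derivative (\<lambda>v. v *\<^sub>R X (z t))) (at t)" if "t \<in> J" for t
        using assms(5)[OF that] by (simp add: has_vector_derivative_def)
      show "Ck_on k J (\<lambda>t. v *\<^sub>R X (z t))" for v
      proof (rule Ck_on_linear_image[OF bounded_linear_scaleR_right assms(1)])
        show "Ck_on k J (\<lambda>t. X (z t))"
          by (rule Ck_on_compose[OF assms(1,2) _ Suc]) (use assms(3,4) in \<open>auto simp: smooth_on_def\<close>)
      qed
    qed
  qed
qed

section \<open>Bounds on derivatives over compact sets\<close>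

lemma norm_linear_le_Basis:
  fixes f' :: "'a::euclidean_space \<Rightarrow> 'b::real_normed_vector"
  assumes "bounded_linear f'"
  shows "norm (f' v) \<le> (\<Sum>b\<in>Basis. norm (f' b)) * norm v"
proof -
  have "norm (f' v) \<le> (\<Sum>b\<in>Basis. norm ((v \<bullet> b) *\<^sub>R f' b))"
    unfolding has_derivative_sum_Basis[OF assms, of v] by (rule norm_sum)
  also have "\<dots> \<le> (\<Sum>b\<in>Basis. norm (f' b) * norm v)"
    by (intro sum_mono) (simp add: mult.commute[of "norm (f' _)"] mult_right_mono Basis_le_norm)
  finally show ?thesis by (simp add: sum_distrib_right)
qed

lemma C1_deriv_bound:
  fixes f' :: "'c::topological_space \<Rightarrow> 'a::euclidean_space \<Rightarrow> 'b::real_normed_vector"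
  assumes "compact K" "\<And>x. x \<in> K \<Longrightarrow> bounded_linear (f' x)" "\<And>v. continuous_on K (\<lambda>x. f' x v)"
  obtains L where "L \<ge> 0" "\<And>x v. x \<in> K \<Longrightarrow> norm (f' x v) \<le> L * norm v"
proof -
  have "continuous_on K (\<lambda>x. \<Sum>b\<in>Basis. norm (f' x b))"
    by (intro continuous_intros assms)
  then have "bounded ((\<lambda>x. \<Sum>b\<in>Basis. norm (f' x b)) ` K)"
    using assms(1) compact_continuous_image compact_imp_bounded by blast
  then obtain L where L: "L > 0" "\<And>x. x \<in> K \<Longrightarrow> norm (\<Sum>b\<in>Basis. norm (f' x b)) \<le> L"
    by (auto simp: bounded_pos)
  show ?thesis
  proof (rule that[of L])
    show "norm (f' x v) \<le> L * norm v" if "x \<in> K" for x v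
      using norm_linear_le_Basis[OF assms(2)[OF that], of v] L(2)[OF that]
      by (smt (verit) mult_right_mono norm_ge_zero real_norm_def)
  qed (use L in auto)
qed

lemma smooth_on_lipschitz:
  fixes f :: "'a::euclidean_space \<Rightarrow> 'b::euclidean_space"
  assumes "smooth_on S f" "compact K" "convex K" "K \<subseteq> S"
  obtains L where "L \<ge> 0" "\<And>x y. x \<in> K \<Longrightarrow> y \<in> K \<Longrightarrow> norm (f x - f y) \<le> L * norm (x - y)"
    "\<And>x v. x \<in> K \<Longrightarrow> norm (frechet_derivative f (at x) v) \<le> L * norm v"
proof -
  have d: "(f has_derivative frechet_derivative f (at x)) (at x)" if "x \<in> K" for x
    using smooth_on_has_derivative assms that by blast
  obtain L where L: "L \<ge> 0" "\<And>x v. x \<in> K \<Longrightarrow> norm (frechet_derivative f (at x) v) \<le> L * norm v"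
  proof (rule C1_deriv_bound[OF assms(2), of "\<lambda>x. frechet_derivative f (at x)"])
    show "bounded_linear (frechet_derivative f (at x))" if "x \<in> K" for x
      using d[OF that] has_derivative_bounded_linear by blast
    show "continuous_on K (\<lambda>x. frechet_derivative f (at x) v)" for v
      using smooth_on_imp_continuous_on[OF smooth_on_deriv[OF assms(1)]] assms(4) continuous_on_subset by blast
  qed blast
  show ?thesis
  proof (rule that[OF L(1)])
    show "norm (f x - f y) \<le> L * norm (x - y)" if "x \<in> K" "y \<in> K" for x y
      by (rule differentiable_bound[OF assms(3) _ _ that, where f'="\<lambda>x. frechet_derivative f (at x)"])
        (use d[THEN has_derivative_at_withinI] L in \<open>auto intro!: onorm_le\<close>)
  qed (use L in auto)
qed

section \<open>Mean value estimates and symmetry of second derivatives\<close>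

lemma vector_mvt_bound:
  fixes \<phi> :: "real \<Rightarrow> 'a::real_normed_vector"
  assumes "a \<le> b" "\<And>s. s \<in> {a..b} \<Longrightarrow> (\<phi> has_vector_derivative \<phi>' s) (at s)"
    "\<And>s. s \<in> {a..b} \<Longrightarrow> norm (\<phi>' s) \<le> B"
  shows "norm (\<phi> b - \<phi> a) \<le> B * (b - a)"
proof -
  have d: "(\<phi> has_derivative (\<lambda>h. h *\<^sub>R \<phi>' s)) (at s within {a..b})" if "s \<in> {a..b}" for s
    using assms(2)[OF that] has_derivative_at_withinI unfolding has_vector_derivative_def by blast
  have "onorm (\<lambda>h. h *\<^sub>R \<phi>' s) \<le> B" if "s \<in> {a..b}" for s
    by (rule onorm_le) (use assms(3)[OF that] in \<open>simp add: mult.commute[of B] mult_left_mono\<close>)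
  then have "norm (\<phi> b - \<phi> a) \<le> B * norm (b - a)"
    using assms(1) by (intro differentiable_bound[OF _ d]) auto
  then show ?thesis using assms(1) by simp
qed

text \<open>The second difference is the increment over [0, t] of s \<mapsto> f(x + sv + tw) - f(x +
  sv). After subtraction of the bilinear main term its derivative is of size e * t, because y
  \<mapsto> \<open>f' y v\<close> is differentiable at \<open>x\<close>; the mean value bound gives
  the second factor t.\<close>

lemma second_difference_bound:
  fixes f :: "'a::euclidean_space \<Rightarrow> 'b::real_normed_vector"
  assumes "open S" "x \<in> S" "\<And>y. y \<in> S \<Longrightarrow> (f has_derivative f' y) (at y)"
    "((\<lambda>y. f' y v) has_derivative A) (at x)" "e > 0"
  shows "\<forall>\<^sub>F t in at_right 0. norm (f (x + t *\<^sub>R v + t *\<^sub>R w) - f (x + t *\<^sub>R v) - f (x + t *\<^sub>R w) + f x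
            - (t * t) *\<^sub>R A w) \<le> e * (t * t)"
proof -
  \<comment> \<open>The linearisation of y \<mapsto> \<open>f' y v\<close> is used at distances up
    to t(|v| + |w|) and t|v|; C is the sum of the two coefficients, and the summand 1 keeps it
    positive.\<close>
  define C where "C = 2 * norm v + norm w + 1"
  have C: "C > 0" unfolding C_def by (smt (verit) norm_ge_zero)
  have A: "bounded_linear A" using assms(4) has_derivative_bounded_linear by blast
  interpret A: bounded_linear A by fact
  obtain d1 where d1: "d1 > 0" "\<And>y. norm (y - x) < d1 \<Longrightarrow>
      norm (f' y v - f' x v - A (y - x)) \<le> (e / C) * norm (y - x)"
    using assms(4) \<open>e > 0\<close> C unfolding has_derivative_at_alt
    by (metis divide_pos_pos)
  obtain d2 where d2: "d2 > 0" "ball x d2 \<subseteq> S" using assms(1,2) open_contains_ball by blast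
  define d where "d = min d1 d2 / C"
  have "d > 0" using d1 d2 C by (simp add: d_def)
  have main: "norm (f (x + t *\<^sub>R v + t *\<^sub>R w) - f (x + t *\<^sub>R v) - f (x + t *\<^sub>R w) + f x
            - (t * t) *\<^sub>R A w) \<le> e * (t * t)" if t: "t > 0" "t < d" for t
  proof -
    define \<phi> where "\<phi> s = f (x + s *\<^sub>R v + t *\<^sub>R w) - f (x + s *\<^sub>R v) - (s * t) *\<^sub>R A w" for s
    define \<phi>' where "\<phi>' s = f' (x + s *\<^sub>R v + t *\<^sub>R w) v - f' (x + s *\<^sub>R v) v - t *\<^sub>R A w" for s
    have tC: "t * C < min d1 d2" using t C by (simp add: d_def field_simps)
    have near: "norm (s *\<^sub>R v + t *\<^sub>R w) \<le> t * (norm v + norm w)" "norm (s *\<^sub>R v) \<le> t * norm v"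
      if "s \<in> {0..t}" for s
    proof -
      have "s * norm v \<le> t * norm v" using that by (intro mult_right_mono) auto
      then show "norm (s *\<^sub>R v) \<le> t * norm v" using that t by simp
      then show "norm (s *\<^sub>R v + t *\<^sub>R w) \<le> t * (norm v + norm w)"
        using norm_triangle_ineq[of "s *\<^sub>R v" "t *\<^sub>R w"] t by (simp add: distrib_left)
    qed
    have nearC: "t * (norm v + norm w) < min d1 d2" "t * norm v < min d1 d2"
      using tC mult_left_mono[of "norm v + norm w" C t] mult_left_mono[of "norm v" C t] t
      by (simp_all only: C_def) (smt (verit) norm_ge_zero)+
    have "norm (\<phi> t - \<phi> 0) \<le> (e * t) * (t - 0)"
    proof (rule vector_mvt_bound[where \<phi>'=\<phi>'])
      fix s assume s: "s \<in> {0..t}"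
      have 1: "x + s *\<^sub>R v + t *\<^sub>R w \<in> S"
      proof (rule subsetD[OF d2(2)])
        have "x - (x + s *\<^sub>R v + t *\<^sub>R w) = - (s *\<^sub>R v + t *\<^sub>R w)" by simp
        then have "dist x (x + s *\<^sub>R v + t *\<^sub>R w) = norm (s *\<^sub>R v + t *\<^sub>R w)"
          by (simp only: dist_norm norm_minus_cancel)
        then show "x + s *\<^sub>R v + t *\<^sub>R w \<in> ball x d2" using near[OF s] nearC by simp
      qed
      have 2: "x + s *\<^sub>R v \<in> S"
        using near[OF s] nearC by (intro subsetD[OF d2(2)]) (auto simp: dist_norm norm_minus_commute)
      have l1: "((\<lambda>s. x + s *\<^sub>R v + t *\<^sub>R w) has_derivative (\<lambda>h. h *\<^sub>R v)) (at s)"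
        by (auto intro!: derivative_eq_intros)
      have l2: "((\<lambda>s. x + s *\<^sub>R v) has_derivative (\<lambda>h. h *\<^sub>R v)) (at s)"
        by (auto intro!: derivative_eq_intros)
      have l3: "((\<lambda>s. (s * t) *\<^sub>R A w) has_derivative (\<lambda>h. (h * t) *\<^sub>R A w)) (at s)"
        by (auto intro!: derivative_eq_intros)
      have b1: "f' y (h *\<^sub>R v) = h *\<^sub>R f' y v" if "y \<in> S" for y h
        using has_derivative_linear[OF assms(3)[OF that]] by (simp add: linear_scale)
      show "(\<phi> has_vector_derivative \<phi>' s) (at s)"
        unfolding \<phi>_def \<phi>'_def has_vector_derivative_def
        by (rule has_derivative_eq_rhs, rule has_derivative_diff, rule has_derivative_diff,
            rule has_derivative_compose[OF l1 assms(3)[OF 1]], rule has_derivative_compose[OF l2 assms(3)[OF 2]],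
            rule l3) (use 1 2 in \<open>auto simp: b1 algebra_simps\<close>)
      have e1: "norm (f' (x + s *\<^sub>R v + t *\<^sub>R w) v - f' x v - A (s *\<^sub>R v + t *\<^sub>R w)) \<le> (e / C) * (t * (norm v + norm w))"
      proof -
        have "norm (f' (x + s *\<^sub>R v + t *\<^sub>R w) v - f' x v - A (s *\<^sub>R v + t *\<^sub>R w)) \<le> (e / C) * norm (s *\<^sub>R v + t *\<^sub>R w)"
          using d1(2)[of "x + s *\<^sub>R v + t *\<^sub>R w"] near(1)[OF s] nearC by (simp add: add.assoc)
        also have "\<dots> \<le> (e / C) * (t * (norm v + norm w))"
          using near(1)[OF s] \<open>e > 0\<close> C by (intro mult_left_mono) auto
        finally show ?thesis .
      qed
      have e2: "norm (f' (x + s *\<^sub>R v) v - f' x v - A (s *\<^sub>R v)) \<le> (e / C) * (t * norm v)"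
      proof -
        have "norm (f' (x + s *\<^sub>R v) v - f' x v - A (s *\<^sub>R v)) \<le> (e / C) * norm (s *\<^sub>R v)"
          using d1(2)[of "x + s *\<^sub>R v"] near(2)[OF s] nearC by simp
        also have "\<dots> \<le> (e / C) * (t * norm v)"
          using near(2)[OF s] \<open>e > 0\<close> C by (intro mult_left_mono) auto
        finally show ?thesis .
      qed
      have "\<phi>' s = (f' (x + s *\<^sub>R v + t *\<^sub>R w) v - f' x v - A (s *\<^sub>R v + t *\<^sub>R w))
          - (f' (x + s *\<^sub>R v) v - f' x v - A (s *\<^sub>R v))"
        by (simp add: \<phi>'_def A.add A.scaleR)
      then have "norm (\<phi>' s) \<le> (e / C) * (t * (norm v + norm w)) + (e / C) * (t * norm v)"
        by (simp only: norm_triangle_le_diff[OF add_mono[OF e1 e2]])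
      also have "\<dots> = (e / C) * t * (2 * norm v + norm w)" by (simp add: algebra_simps)
      also have "\<dots> \<le> (e / C) * t * C"
        using \<open>e > 0\<close> C t by (intro mult_left_mono) (auto simp: C_def)
      also have "\<dots> = e * t" using C by simp
      finally show "norm (\<phi>' s) \<le> e * t" .
    qed (use t in auto)
    moreover have "\<phi> t - \<phi> 0 = f (x + t *\<^sub>R v + t *\<^sub>R w) - f (x + t *\<^sub>R v) - f (x + t *\<^sub>R w) + f x
            - (t * t) *\<^sub>R A w" by (simp add: \<phi>_def)
    ultimately show ?thesis by (simp add: mult.assoc)
  qed
  then show ?thesis unfolding eventually_at_right_field using \<open>d > 0\<close> by blast
qed

text \<open>The second difference is symmetric in \<open>v\<close> and \<open>w\<close>, so
  \<open>A w\<close> and \<open>B v\<close> are both its leading coefficient at order t^2. An error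
  of a quarter of their distance on each side is already contradictory.\<close>

lemma second_derivative_symmetric:
  fixes f :: "'a::euclidean_space \<Rightarrow> 'b::real_normed_vector"
  assumes "open S" "x \<in> S" "\<And>y. y \<in> S \<Longrightarrow> (f has_derivative f' y) (at y)"
    "((\<lambda>y. f' y v) has_derivative A) (at x)" "((\<lambda>y. f' y w) has_derivative B) (at x)"
  shows "A w = B v"
proof (rule ccontr)
  assume "A w \<noteq> B v"
  then have p: "norm (A w - B v) / 4 > 0" by simp
  define e where "e = norm (A w - B v) / 4"
  define R where "R t = f (x + t *\<^sub>R v + t *\<^sub>R w) - f (x + t *\<^sub>R v) - f (x + t *\<^sub>R w) + f x" for t
  have "\<forall>\<^sub>F t in at_right (0::real). norm (R t - (t * t) *\<^sub>R A w) \<le> e * (t * t)"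
    using second_difference_bound[OF assms(1-4) p, of w] by (simp add: R_def e_def)
  moreover have "\<forall>\<^sub>F t in at_right (0::real). norm (R t - (t * t) *\<^sub>R B v) \<le> e * (t * t)"
    using second_difference_bound[OF assms(1-3,5) p, of v] by (simp add: R_def e_def algebra_simps)
  ultimately have "\<forall>\<^sub>F t in at_right (0::real). norm (R t - (t * t) *\<^sub>R A w) \<le> e * (t * t) \<and>
      norm (R t - (t * t) *\<^sub>R B v) \<le> e * (t * t) \<and> t > 0"
    by (intro eventually_conj eventually_at_right_less) auto
  then obtain t :: real where t: "norm (R t - (t * t) *\<^sub>R A w) \<le> e * (t * t)"
      "norm (R t - (t * t) *\<^sub>R B v) \<le> e * (t * t)" "t > 0"
    using eventually_happens'[of "at_right (0::real)"] by auto
  have "norm ((t * t) *\<^sub>R (A w - B v)) \<le> 2 * e * (t * t)"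
  proof -
    have "(t * t) *\<^sub>R (A w - B v) = (R t - (t * t) *\<^sub>R B v) - (R t - (t * t) *\<^sub>R A w)"
      by (simp add: algebra_simps)
    then show ?thesis
      using t norm_triangle_ineq4[of "R t - (t * t) *\<^sub>R B v" "R t - (t * t) *\<^sub>R A w"] by simp
  qed
  then have "(t * t) * norm (A w - B v) \<le> (t * t) * (2 * e)" using t by simp
  then have "norm (A w - B v) \<le> 2 * e" using t(3) by simp
  then show False using p by (simp add: e_def)
qed

section \<open>Ordinary differential equations\<close>

text \<open>The squared norm is used because the norm need not be differentiable at 0. Splitting
  2|e|K into |e|^2 + K^2 produces the rate 2L + 1 and makes \<open>h\<close> nonincreasing. Only the
  form of the bound matters later: it is linear in the initial value and in K.\<close>

lemma gronwall_forward:
  fixes e :: "real \<Rightarrow> 'a::real_inner"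
  assumes "0 \<le> T" "0 \<le> L" "0 \<le> K"
    and der: "\<And>t. t \<in> {0..T} \<Longrightarrow> (e has_vector_derivative e' t) (at t)"
    and bnd: "\<And>t. t \<in> {0..T} \<Longrightarrow> norm (e' t) \<le> L * norm (e t) + K"
  shows "norm (e T) \<le> (norm (e 0) + K * (1 + T)) * exp ((2*L+1) * T)"
proof -
  define c where "c = 2 * L + 1"
  define h where "h t = (e t \<bullet> e t) * exp (- (c * t)) - K^2 * t" for t
  have "h 0 \<ge> h T"
  proof (rule DERIV_nonpos_imp_nonincreasing[OF assms(1)])
    fix t assume t: "0 \<le> t" "t \<le> T"
    have d: "(e has_vector_derivative e' t) (at t)" using der t by simp
    have "((\<lambda>t. e t \<bullet> e t) has_vector_derivative (e t \<bullet> e' t + e' t \<bullet> e t)) (at t)"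
      by (rule bounded_bilinear.has_vector_derivative[OF bounded_bilinear_inner d d])
    then have d2: "((\<lambda>t. e t \<bullet> e t) has_real_derivative 2 * (e t \<bullet> e' t)) (at t)"
      by (simp add: has_real_derivative_iff_has_vector_derivative inner_commute)
    have dh: "(h has_real_derivative (2 * (e t \<bullet> e' t) - c * (e t \<bullet> e t)) * exp (- (c * t)) - K^2) (at t)"
      unfolding h_def by (auto intro!: derivative_eq_intros d2 simp: algebra_simps)
    have "2 * (e t \<bullet> e' t) \<le> 2 * (norm (e t) * norm (e' t))"
      using norm_cauchy_schwarz[of "e t" "e' t"] by simp
    also have "\<dots> \<le> 2 * (norm (e t) * (L * norm (e t) + K))"
      using bnd[of t] t by (intro mult_left_mono) auto
    also have "\<dots> = 2 * L * (norm (e t))^2 + 2 * (norm (e t) * K)"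
      by (simp add: power2_eq_square algebra_simps)
    also have "\<dots> \<le> 2 * L * (norm (e t))^2 + ((norm (e t))^2 + K^2)"
      using sum_squares_bound[of "norm (e t)" K] by simp
    also have "\<dots> = c * (e t \<bullet> e t) + K^2"
      by (simp add: c_def power2_norm_eq_inner algebra_simps)
    finally have 1: "2 * (e t \<bullet> e' t) - c * (e t \<bullet> e t) \<le> K^2" by simp
    have "exp (- (c * t)) \<le> 1" using t assms by (simp add: c_def)
    then have "(2 * (e t \<bullet> e' t) - c * (e t \<bullet> e t)) * exp (- (c * t)) \<le> K^2 * 1"
      using 1 by (meson exp_ge_zero mult_mono mult_right_mono order_trans zero_le_power2 mult_left_mono)
    then show "\<exists>y. (h has_real_derivative y) (at t) \<and> y \<le> 0" using dh by auto
  qed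
  then have "(e T \<bullet> e T) * exp (- (c * T)) \<le> e 0 \<bullet> e 0 + K^2 * T" by (simp add: h_def)
  then have "(e T \<bullet> e T) * exp (- (c * T)) * exp (c * T) \<le> (e 0 \<bullet> e 0 + K^2 * T) * exp (c * T)"
    by (intro mult_right_mono) auto
  then have 1: "(norm (e T))^2 \<le> ((norm (e 0))^2 + K^2 * T) * exp (c * T)"
    by (simp add: power2_norm_eq_inner exp_minus field_simps)
  have 2: "(norm (e 0))^2 + K^2 * T \<le> (norm (e 0) + K * (1 + T))^2"
  proof -
    have "K^2 * T \<le> K^2 * (1+T)^2" using assms(1)
      by (intro mult_left_mono) (auto simp: power2_eq_square algebra_simps)
    moreover have "0 \<le> 2 * norm (e 0) * (K * (1 + T))" using assms by auto
    moreover have "(norm (e 0) + K * (1 + T))^2 = (norm (e 0))^2 + K^2 * (1+T)^2 + 2 * norm (e 0) * (K * (1 + T))"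
      by (simp only: power2_sum power_mult_distrib)
    ultimately show ?thesis by linarith
  qed
  have 3: "exp (c * T) \<le> (exp (c * T))^2"
    using assms by (simp add: power2_eq_square c_def)
  have "((norm (e 0))^2 + K^2 * T) * exp (c * T) \<le> (norm (e 0) + K * (1 + T))^2 * (exp (c * T))^2"
    by (rule mult_mono[OF 2 3]) auto
  then have "(norm (e T))^2 \<le> ((norm (e 0) + K * (1 + T)) * exp (c * T))^2"
    using 1 by (simp only: power_mult_distrib)
  moreover have "0 \<le> (norm (e 0) + K * (1 + T)) * exp (c * T)"
    using assms(1,3) by (intro mult_nonneg_nonneg add_nonneg_nonneg) auto
  ultimately show ?thesis
    unfolding c_def[symmetric] by (rule power2_le_imp_le)
qed

text \<open>Negative times follow by reversing the curve; the bound is made uniform over |t| <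
  d.\<close>

lemma gronwall:
  fixes e :: "real \<Rightarrow> 'a::real_inner"
  assumes "0 \<le> L" "0 \<le> K" "\<bar>t\<bar> < d"
    and der: "\<And>t. \<bar>t\<bar> < d \<Longrightarrow> (e has_vector_derivative e' t) (at t)"
    and bnd: "\<And>t. \<bar>t\<bar> < d \<Longrightarrow> norm (e' t) \<le> L * norm (e t) + K"
  shows "norm (e t) \<le> (norm (e 0) + K * (1 + d)) * exp ((2*L+1) * d)"
proof -
  have "norm (e t) \<le> (norm (e 0) + K * (1 + \<bar>t\<bar>)) * exp ((2*L+1) * \<bar>t\<bar>)"
  proof (cases "t \<ge> 0")
    case True
    then show ?thesis using gronwall_forward[of t L K e e'] assms by auto
  next
    case False
    have "norm ((\<lambda>s. e (-s)) (-t)) \<le> (norm ((\<lambda>s. e (-s)) 0) + K * (1 + (-t))) * exp ((2*L+1) * (-t))"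
    proof (rule gronwall_forward[of "-t" L K _ "\<lambda>s. - e' (-s)"])
      fix s assume s: "s \<in> {0..-t}"
      have "((\<lambda>s. e (- s)) has_vector_derivative (-1) *\<^sub>R e' (-s)) (at s)"
        by (rule vector_diff_chain_at[of uminus "-1" s e "e' (-s)", unfolded o_def])
          (use s assms in \<open>auto intro!: derivative_eq_intros der\<close>)
      then show "((\<lambda>s. e (- s)) has_vector_derivative - e' (-s)) (at s)" by simp
      show "norm (- e' (- s)) \<le> L * norm (e (- s)) + K" using bnd[of "-s"] s assms(3) by auto
    qed (use False assms in auto)
    then show ?thesis using False by simp
  qed
  also have "\<dots> \<le> (norm (e 0) + K * (1 + d)) * exp ((2*L+1) * d)"
    using assms by (intro mult_mono add_mono mult_left_mono) auto
  finally show ?thesis .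
qed

section \<open>Existence of solutions by the contraction principle\<close>

lemma integral_lipschitz:
  fixes h :: "real \<Rightarrow> 'a::banach"
  assumes "continuous_on {a..b} h" "\<And>s. s \<in> {a..b} \<Longrightarrow> norm (h s) \<le> B" "u \<in> {a..b}" "w \<in> {a..b}"
  shows "norm (integral {a..u} h - integral {a..w} h) \<le> B * norm (u - w)"
proof (rule differentiable_bound[of "{a..b}" "\<lambda>u. integral {a..u} h" "\<lambda>s k. k *\<^sub>R h s"])
  show "((\<lambda>u. integral {a..u} h) has_derivative (\<lambda>k. k *\<^sub>R h x)) (at x within {a..b})" if "x \<in> {a..b}" for x
    using integral_has_vector_derivative[OF assms(1) that] by (simp add: has_vector_derivative_def)
  show "onorm (\<lambda>k. k *\<^sub>R h x) \<le> B" if "x \<in> {a..b}" for x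
    by (rule onorm_le) (use assms(2)[OF that] in \<open>simp add: mult.commute[of B] mult_left_mono\<close>)
qed (use assms in auto)

text \<open>The integral operator contracts the complete space of bounded continuous functions on
  the whole line.\<close>

lemma picard_lindeloef_global:
  fixes X :: "'a::euclidean_space \<Rightarrow> 'a"
  assumes "0 \<le> L" "0 < \<delta>" "\<delta> * L < 1"
    and lip: "\<And>x y. norm (X x - X y) \<le> L * norm (x - y)"
    and bnd: "\<And>x. norm (X x) \<le> M"
  obtains \<phi> where "\<phi> 0 = z" "\<And>t. \<bar>t\<bar> < \<delta> \<Longrightarrow> (\<phi> has_vector_derivative X (\<phi> t)) (at t)"
proof -
  have M: "M \<ge> 0" using bnd[of z] norm_ge_zero order_trans by blast
  have X: "continuous_on UNIV X"
  proof (rule continuous_onI)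
    fix x e assume "e > (0::real)"
    show "\<exists>d>0. \<forall>y\<in>UNIV. dist y x < d \<longrightarrow> dist (X y) (X x) \<le> e"
    proof (intro exI conjI ballI impI)
      show "e / (L + 1) > 0" using assms \<open>e > 0\<close> by simp
      fix y assume "dist y x < e / (L+1)"
      then have "(L + 1) * norm (y - x) \<le> e" using assms by (simp add: field_simps dist_norm)
      then show "dist (X y) (X x) \<le> e" using lip[of y x] by (simp add: dist_norm algebra_simps) (smt (verit) norm_ge_zero)
    qed
  qed
  \<comment> \<open>Clamping the time to [-\<delta>, \<delta>] keeps the images of the operator
    bounded on the whole line and bounds the Lipschitz factor by \<delta> * L. On the open interval
    it changes nothing.\<close>
  define c where "c t = max (-\<delta>) (min \<delta> t)" for t
  have c: "c t \<in> {-\<delta>..\<delta>}" for t using assms by (auto simp: c_def)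
  have cc: "continuous_on UNIV c" unfolding c_def by (intro continuous_intros)
  define F where "F \<phi> u = integral {-\<delta>..u} (\<lambda>s. X (apply_bcontfun \<phi> s))" for \<phi> :: "real \<Rightarrow>\<^sub>C 'a" and u
  have Xc: "continuous_on A (\<lambda>s. X (apply_bcontfun \<phi> s))" for \<phi> :: "real \<Rightarrow>\<^sub>C 'a" and A
    by (rule continuous_on_compose2[OF X]) auto
  define P where "P \<phi> = Bcontfun (\<lambda>t. z + F \<phi> (c t) - F \<phi> 0)" for \<phi> :: "real \<Rightarrow>\<^sub>C 'a"
  have P: "apply_bcontfun (P \<phi>) t = z + F \<phi> (c t) - F \<phi> 0" for \<phi> :: "real \<Rightarrow>\<^sub>C 'a" and t
  proof -
    have "(\<lambda>t. z + F \<phi> (c t) - F \<phi> 0) \<in> bcontfun"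
      unfolding bcontfun_def
    proof (intro CollectI conjI)
      have "continuous_on {-\<delta>..\<delta>} (F \<phi>)"
        unfolding F_def by (rule indefinite_integral_continuous_1) (rule integrable_continuous_real[OF Xc])
      then show "continuous_on UNIV (\<lambda>t. z + F \<phi> (c t) - F \<phi> 0)"
        by (intro continuous_intros continuous_on_compose2[OF _ cc]) (use c in auto)
      have "norm (z + F \<phi> (c t) - F \<phi> 0) \<le> norm z + M * \<delta>" for t
      proof -
        have "norm (F \<phi> (c t) - F \<phi> 0) \<le> M * norm (c t - 0)"
          unfolding F_def by (rule integral_lipschitz[of _ \<delta>]) (use c assms Xc bnd in auto)
        also have "\<dots> \<le> M * \<delta>" using c[of t] M by (intro mult_left_mono) auto
        finally show ?thesis using norm_triangle_ineq[of z "F \<phi> (c t) - F \<phi> 0"] by (simp add: algebra_simps)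
      qed
      then show "bounded (range (\<lambda>t. z + F \<phi> (c t) - F \<phi> 0))" unfolding bounded_iff by blast
    qed
    then show ?thesis by (simp add: P_def Bcontfun_inverse)
  qed
  have "\<exists>!\<phi>. P \<phi> = \<phi>"
  proof (rule banach_fix_type[of "\<delta> * L"])
    show "\<forall>\<phi> \<psi>. dist (P \<phi>) (P \<psi>) \<le> \<delta> * L * dist \<phi> \<psi>"
    proof (intro allI dist_bound)
      fix \<phi> \<psi> :: "real \<Rightarrow>\<^sub>C 'a" and t :: real
      let ?h = "\<lambda>s. X (apply_bcontfun \<phi> s) - X (apply_bcontfun \<psi> s)"
      have i: "F \<phi> u - F \<psi> u = integral {-\<delta>..u} ?h" for u
        unfolding F_def by (rule Henstock_Kurzweil_Integration.integral_diff[symmetric])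
          (auto intro: integrable_continuous_real Xc)
      have "dist (apply_bcontfun (P \<phi>) t) (apply_bcontfun (P \<psi>) t) = norm (integral {-\<delta>..c t} ?h - integral {-\<delta>..0} ?h)"
        by (simp add: P dist_norm i[symmetric] algebra_simps)
      also have "\<dots> \<le> (L * dist \<phi> \<psi>) * norm (c t - 0)"
      proof (rule integral_lipschitz[of _ \<delta>])
        show "norm (?h s) \<le> L * dist \<phi> \<psi>" for s
          using lip[of "\<phi> s" "\<psi> s"] mult_left_mono[OF dist_bounded[of \<phi> s \<psi>] assms(1)]
          by (simp add: dist_norm)
      qed (use c assms in \<open>auto intro!: continuous_intros Xc\<close>)
      also have "\<dots> \<le> (L * dist \<phi> \<psi>) * \<delta>"
        using c[of t] assms by (intro mult_left_mono) auto
      finally show "dist (apply_bcontfun (P \<phi>) t) (apply_bcontfun (P \<psi>) t) \<le> \<delta> * L * dist \<phi> \<psi>"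
        by (simp add: mult_ac)
    qed
  qed (use assms in auto)
  then obtain \<phi> where "P \<phi> = \<phi>" by blast
  then have \<phi>: "apply_bcontfun \<phi> t = z + F \<phi> (c t) - F \<phi> 0" for t using P[of \<phi> t] by simp
  show ?thesis
  proof (rule that[of "apply_bcontfun \<phi>"])
    show "apply_bcontfun \<phi> 0 = z" using \<phi>[of 0] assms by (simp add: c_def)
    fix t assume t: "\<bar>t\<bar> < \<delta>"
    have "((\<lambda>u. F \<phi> u) has_vector_derivative X (apply_bcontfun \<phi> t)) (at t within {-\<delta>..\<delta>})"
      unfolding F_def by (rule integral_has_vector_derivative[OF Xc]) (use t in auto)
    then have "(F \<phi> has_vector_derivative X (apply_bcontfun \<phi> t)) (at t within {-\<delta><..<\<delta>})"
      by (rule has_vector_derivative_within_subset) auto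
    then have "(F \<phi> has_vector_derivative X (apply_bcontfun \<phi> t)) (at t)"
      using t by (subst (asm) has_vector_derivative_within_open) auto
    then have "((\<lambda>t. z + F \<phi> t - F \<phi> 0) has_vector_derivative X (apply_bcontfun \<phi> t)) (at t)"
      by (auto intro!: derivative_eq_intros)
    then show "(apply_bcontfun \<phi> has_vector_derivative X (apply_bcontfun \<phi> t)) (at t)"
      by (rule has_vector_derivative_transform_within_open[of _ _ _ "{-\<delta><..<\<delta>}"])
        (use t in \<open>auto simp: \<phi> c_def\<close>)
  qed
qed

text \<open>A single time \<delta> serves all starting points in the half ball: their solutions need
  at least that long to leave the full ball.\<close>

lemma ode_local_existence:
  fixes X :: "'a::euclidean_space \<Rightarrow> 'a"
  assumes "open U" "smooth_on U X" "z0 \<in> U"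
  obtains R \<delta> \<phi> where "R > 0" "\<delta> > 0" "\<delta> \<le> 1" "cball z0 R \<subseteq> U"
    "\<And>z. z \<in> cball z0 (R/2) \<Longrightarrow> \<phi> z 0 = z"
    "\<And>z t. z \<in> cball z0 (R/2) \<Longrightarrow> \<bar>t\<bar> < \<delta> \<Longrightarrow> \<phi> z t \<in> cball z0 R"
    "\<And>z t. z \<in> cball z0 (R/2) \<Longrightarrow> \<bar>t\<bar> < \<delta> \<Longrightarrow> (\<phi> z has_vector_derivative X (\<phi> z t)) (at t)"
proof -
  obtain R where R: "R > 0" "cball z0 R \<subseteq> U" using assms open_contains_cball by blast
  let ?K = "cball z0 R"
  obtain L where L: "L \<ge> 0" "\<And>x y. x \<in> ?K \<Longrightarrow> y \<in> ?K \<Longrightarrow> norm (X x - X y) \<le> L * norm (x - y)"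
    using smooth_on_lipschitz[OF assms(2) compact_cball convex_cball R(2)] by metis
  have "bounded (X ` ?K)"
    by (intro compact_imp_bounded compact_continuous_image compact_cball)
      (use smooth_on_imp_continuous_on[OF assms(2)] R continuous_on_subset in blast)
  then obtain M where M: "M > 0" "\<And>x. x \<in> ?K \<Longrightarrow> norm (X x) \<le> M" by (auto simp: bounded_pos)
  \<comment> \<open>Composition with the nearest-point projection makes the field bounded and
    Lipschitz on the whole space and leaves it unchanged on the ball.\<close>
  define Y where "Y x = X (closest_point ?K x)" for x
  have cp: "closest_point ?K x \<in> ?K" for x by (rule closest_point_in_set) (use R in auto)
  have Ylip: "norm (Y x - Y y) \<le> L * norm (x - y)" for x y
  proof -
    have "norm (Y x - Y y) \<le> L * norm (closest_point ?K x - closest_point ?K y)"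
      unfolding Y_def by (rule L(2)[OF cp cp])
    also have "\<dots> \<le> L * norm (x - y)"
      using closest_point_lipschitz[of ?K x y] R L(1) by (intro mult_left_mono) (auto simp: dist_norm)
    finally show ?thesis .
  qed
  have Ybnd: "norm (Y x) \<le> M" for x unfolding Y_def by (rule M(2)[OF cp])
  \<comment> \<open>The second bound makes the operator a contraction; the third makes the distance
    travelled at speed M at most R/2.\<close>
  define \<delta> where "\<delta> = min 1 (min (1 / (2 * (L + 1))) (R / (2 * M)))"
  have \<delta>: "\<delta> > 0" "\<delta> \<le> 1" using L R M by (auto simp: \<delta>_def)
  have \<delta>L: "\<delta> * L < 1"
  proof -
    have "\<delta> * (L + 1) \<le> (1 / (2 * (L + 1))) * (L + 1)" using L by (intro mult_right_mono) (auto simp: \<delta>_def)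
    also have "\<dots> = 1 / 2" using L by (simp add: field_simps)
    finally show ?thesis using \<delta> L by (simp add: algebra_simps)
  qed
  have \<delta>M: "M * \<delta> \<le> R / 2"
  proof -
    have "M * \<delta> \<le> M * (R / (2 * M))" using M by (intro mult_left_mono) (auto simp: \<delta>_def)
    then show ?thesis using M by simp
  qed
  have "\<exists>\<phi>. \<phi> 0 = z \<and> (\<forall>t. \<bar>t\<bar> < \<delta> \<longrightarrow> (\<phi> has_vector_derivative Y (\<phi> t)) (at t))" for z
    using picard_lindeloef_global[OF L(1) \<delta>(1) \<delta>L Ylip Ybnd, of z] by metis
  then obtain \<phi> where \<phi>: "\<And>z. \<phi> z 0 = z" "\<And>z t. \<bar>t\<bar> < \<delta> \<Longrightarrow> (\<phi> z has_vector_derivative Y (\<phi> z t)) (at t)"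
    by metis
  have conf: "\<phi> z t \<in> ?K" if z: "z \<in> cball z0 (R/2)" and t: "\<bar>t\<bar> < \<delta>" for z t
  proof -
    have "norm (\<phi> z t - z) \<le> M * \<bar>t\<bar>"
    proof (cases "t \<ge> 0")
      case True
      have "norm (\<phi> z t - \<phi> z 0) \<le> M * (t - 0)"
        by (rule vector_mvt_bound[OF True \<phi>(2) Ybnd]) (use t in auto)
      then show ?thesis using True \<phi>(1) by simp
    next
      case False
      have "norm (\<phi> z 0 - \<phi> z t) \<le> M * (0 - t)"
        by (rule vector_mvt_bound[OF _ \<phi>(2) Ybnd]) (use t False in auto)
      then show ?thesis using False \<phi>(1) by (simp add: norm_minus_commute)
    qed
    also have "\<dots> \<le> M * \<delta>" using t M by (intro mult_left_mono) auto
    also have "\<dots> \<le> R / 2" by (rule \<delta>M)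
    finally have "dist (\<phi> z t) z \<le> R / 2" by (simp add: dist_norm)
    then show ?thesis using z dist_triangle[of z0 "\<phi> z t" z] by (simp add: dist_commute)
  qed
  show ?thesis
  proof (rule that[OF R(1) \<delta> R(2), of \<phi>])
    fix z t assume zt: "z \<in> cball z0 (R/2)" "\<bar>t\<bar> < \<delta>"
    have "Y (\<phi> z t) = X (\<phi> z t)" unfolding Y_def using closest_point_self[OF conf[OF zt]] by simp
    then show "(\<phi> z has_vector_derivative X (\<phi> z t)) (at t)" using \<phi>(2)[OF zt(2), of z] by simp
  qed (use \<phi> conf in auto)
qed

section \<open>Differentiability of the flow in the initial point\<close>

lemma has_derivative_from_quadratic:
  fixes f :: "'a::real_normed_vector \<Rightarrow> 'b::real_normed_vector"
  assumes "open S" "z \<in> S" "bounded_linear D"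
    "\<And>y. y \<in> S \<Longrightarrow> norm (f y - f z - D (y - z)) \<le> C * (norm (y - z))^2"
  shows "(f has_derivative D) (at z)"
  unfolding has_derivative_at_alt
proof (intro conjI allI impI)
  fix e :: real assume "e > 0"
  obtain d where d: "d > 0" "ball z d \<subseteq> S" using assms open_contains_ball by blast
  define d' where "d' = min d (e / (\<bar>C\<bar> + 1))"
  have "d' > 0" using d \<open>e > 0\<close> by (simp add: d'_def)
  moreover have "norm (f y - f z - D (y - z)) \<le> e * norm (y - z)" if y: "norm (y - z) < d'" for y
  proof -
    have "y \<in> S" using y d by (auto simp: d'_def dist_norm norm_minus_commute)
    then have "norm (f y - f z - D (y - z)) \<le> C * (norm (y - z))^2" using assms(4) by blast
    also have "\<dots> \<le> (\<bar>C\<bar> + 1) * (norm (y - z))^2" by (intro mult_right_mono) auto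
    also have "\<dots> = ((\<bar>C\<bar> + 1) * norm (y - z)) * norm (y - z)" by (simp add: power2_eq_square)
    also have "\<dots> \<le> e * norm (y - z)"
    proof (rule mult_right_mono)
      have "norm (y - z) \<le> e / (\<bar>C\<bar> + 1)" using y by (simp add: d'_def)
      then show "(\<bar>C\<bar> + 1) * norm (y - z) \<le> e" by (simp add: field_simps)
    qed simp
    finally show ?thesis .
  qed
  ultimately show "\<exists>d>0. \<forall>y. norm (y - z) < d \<longrightarrow> norm (f y - f z - D (y - z)) \<le> e * norm (y - z)" by blast
qed (use assms in auto)

text \<open>The flow \<open>\<phi>\<close> and its derivative \<open>\<psi>\<close> are the two components of the flow of the field
  \<open>(z, w) \<mapsto> (X z, DX z w)\<close>; as it is linear in \<open>w\<close>, it suffices to solve it for small \<open>w\<close>.\<close>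

theorem smooth_local_flow:
  fixes X :: "'a::euclidean_space \<Rightarrow> 'a"
  assumes U: "open U" and X: "smooth_on U X" and z0: "z0 \<in> U"
  obtains r \<delta> \<phi> \<psi> where "r > 0" "\<delta> > 0" "ball z0 r \<subseteq> U"
    "\<And>z. z \<in> ball z0 r \<Longrightarrow> \<phi> z 0 = z"
    "\<And>z t. z \<in> ball z0 r \<Longrightarrow> \<bar>t\<bar> < \<delta> \<Longrightarrow> \<phi> z t \<in> U"
    "\<And>z t. z \<in> ball z0 r \<Longrightarrow> \<bar>t\<bar> < \<delta> \<Longrightarrow> (\<phi> z has_vector_derivative X (\<phi> z t)) (at t)"
    "\<And>z t. z \<in> ball z0 r \<Longrightarrow> \<bar>t\<bar> < \<delta> \<Longrightarrow> ((\<lambda>z. \<phi> z t) has_derivative (\<lambda>w. \<psi> z w t)) (at z)"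
    "\<And>w t. \<bar>t\<bar> < \<delta> \<Longrightarrow> continuous_on (ball z0 r) (\<lambda>z. \<psi> z w t)"
    "\<And>z w. z \<in> ball z0 r \<Longrightarrow> \<psi> z w 0 = w"
    "\<And>z w t. z \<in> ball z0 r \<Longrightarrow> \<bar>t\<bar> < \<delta> \<Longrightarrow>
       (\<psi> z w has_vector_derivative frechet_derivative X (at (\<phi> z t)) (\<psi> z w t)) (at t)"
proof -
  define DX where "DX z = frechet_derivative X (at z)" for z
  have DX: "(X has_derivative DX z) (at z)" if "z \<in> U" for z
    unfolding DX_def by (rule smooth_on_has_derivative[OF X that])
  define X1 :: "'a \<times> 'a \<Rightarrow> 'a \<times> 'a" where "X1 p = (X (fst p), DX (fst p) (snd p))" for p
  have oU: "open (U \<times> (UNIV :: 'a set))" using U by (simp add: open_Times)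
  have X1: "smooth_on (U \<times> UNIV) X1"
    unfolding X1_def DX_def
    by (intro smooth_on_Pair oU smooth_on_compose[OF oU U X] smooth_on_deriv_app[OF U oU U X]
        smooth_on_fst smooth_on_snd smooth_on_ident) auto
  obtain R \<delta> \<Phi> where R: "R > 0" "\<delta> > 0" "\<delta> \<le> 1" "cball (z0, 0) R \<subseteq> U \<times> (UNIV :: 'a set)" and
    \<Phi>: "\<And>z. z \<in> cball (z0, 0) (R/2) \<Longrightarrow> \<Phi> z 0 = z"
    "\<And>z t. z \<in> cball (z0, 0) (R/2) \<Longrightarrow> \<bar>t\<bar> < \<delta> \<Longrightarrow> \<Phi> z t \<in> cball (z0, 0) R"
    "\<And>z t. z \<in> cball (z0, 0) (R/2) \<Longrightarrow> \<bar>t\<bar> < \<delta> \<Longrightarrow> (\<Phi> z has_vector_derivative X1 (\<Phi> z t)) (at t)"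
    using ode_local_existence[OF oU X1, of "(z0, 0)"] z0 by (metis SigmaI UNIV_I)
  define K where "K = cball z0 R"
  have in1: "(z, w) \<in> cball (z0, 0) (R/2)" if "z \<in> ball z0 (R/4)" "norm w \<le> R/4" for z and w :: 'a
  proof -
    have "norm ((z0 - z, - w)) \<le> norm (z0 - z) + norm (- w)" by (rule norm_Pair_le)
    then show ?thesis using that by (simp add: dist_norm)
  qed
  have in2: "fst p \<in> K" "norm (snd p) \<le> R" if "p \<in> cball (z0, 0) R" for p :: "'a \<times> 'a"
  proof -
    have "dist (fst p) z0 \<le> R"
      using that dist_fst_le[of p "(z0,0)"] by (simp add: dist_commute)
    then show "fst p \<in> K" by (simp add: K_def dist_commute)
    show "norm (snd p) \<le> R"
      using that dist_snd_le[of p "(z0,0)"] by (simp add: dist_commute)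
  qed
  have KU: "K \<subseteq> U"
  proof
    fix x assume "x \<in> K"
    then have "(x, 0) \<in> cball (z0, 0::'a) R" by (simp add: K_def dist_Pair_Pair)
    then show "x \<in> U" using R(4) by blast
  qed
  obtain L where L: "L \<ge> 0" "\<And>x y. x \<in> K \<Longrightarrow> y \<in> K \<Longrightarrow> norm (X x - X y) \<le> L * norm (x - y)"
    "\<And>x v. x \<in> K \<Longrightarrow> norm (DX x v) \<le> L * norm v"
    using smooth_on_lipschitz[OF X _ _ KU] unfolding DX_def K_def by (metis compact_cball convex_cball)
  \<comment> \<open>A Lipschitz constant for \<open>X1\<close> over unit vectors in the second slot
    bounds the change of \<open>DX\<close> between two base points, and by homogeneity does so for
    all vectors.\<close>
  obtain L1 where L1: "L1 \<ge> 0" "\<And>x y. x \<in> K \<times> cball 0 1 \<Longrightarrow> y \<in> K \<times> cball 0 1 \<Longrightarrow> norm (X1 x - X1 y) \<le> L1 * norm (x - y)"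
  proof (rule smooth_on_lipschitz[OF X1])
    show "compact (K \<times> cball (0::'a) 1)" "convex (K \<times> cball (0::'a) 1)"
      unfolding K_def by (auto intro: compact_Times convex_Times)
  qed (use KU in auto)
  have lin: "linear (DX x)" if "x \<in> K" for x
    using has_derivative_linear[OF DX] that KU by blast
  have DXlip: "norm (DX x v - DX y v) \<le> L1 * norm (x - y) * norm v" if "x \<in> K" "y \<in> K" for x y v
  proof (cases "v = 0")
    case True then show ?thesis using lin that by (simp add: linear_0)
  next
    case False
    define u where "u = v /\<^sub>R norm v"
    have u: "norm u \<le> 1" "v = norm v *\<^sub>R u" using False by (auto simp: u_def)
    have "norm (DX x u - DX y u) \<le> norm (X1 (x,u) - X1 (y,u))"
      unfolding X1_def using norm_snd_le[of "DX x u - DX y u" "X x - X y"] by simp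
    also have "\<dots> \<le> L1 * norm ((x,u) - (y,u))" by (rule L1(2)) (use that u in auto)
    finally have 1: "norm (DX x u - DX y u) \<le> L1 * norm (x - y)" by (simp add: norm_Pair)
    have "DX x v - DX y v = norm v *\<^sub>R (DX x u - DX y u)"
      by (subst u(2), subst (2) u(2)) (simp only: linear_scale[OF lin] that scaleR_diff_right)
    then have "norm (DX x v - DX y v) = norm v * norm (DX x u - DX y u)" by simp
    also have "\<dots> \<le> norm v * (L1 * norm (x - y))" using 1 by (intro mult_left_mono) auto
    finally show ?thesis by (simp add: mult_ac)
  qed
  have taylor: "norm (X b - X a - DX a (b - a)) \<le> L1 * (norm (b - a))^2" if ab: "a \<in> K" "b \<in> K" for a b
  proof -
    have seg: "a + s *\<^sub>R (b - a) \<in> K" if "s \<in> {0..1}" for s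
      using convex_cball[of z0 R] ab that unfolding K_def convex_alt
      by (smt (verit, best) add.commute add_diff_cancel_left' atLeastAtMost_iff diff_add_cancel diff_add_eq scaleR_collapse scaleR_diff_right)
    have "norm ((X (a + 1 *\<^sub>R (b - a)) - 1 *\<^sub>R DX a (b - a)) - (X (a + 0 *\<^sub>R (b - a)) - 0 *\<^sub>R DX a (b - a)))
       \<le> L1 * (norm (b - a))^2 * (1 - 0)"
    proof (rule vector_mvt_bound[where \<phi>="\<lambda>s. X (a + s *\<^sub>R (b - a)) - s *\<^sub>R DX a (b - a)"
          and \<phi>'="\<lambda>s. DX (a + s *\<^sub>R (b - a)) (b - a) - DX a (b - a)"])
      fix s :: real assume s: "s \<in> {0..1}"
      have l: "((\<lambda>s. a + s *\<^sub>R (b - a)) has_derivative (\<lambda>h. h *\<^sub>R (b - a))) (at s)"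
        by (auto intro!: derivative_eq_intros)
      have "((\<lambda>s. X (a + s *\<^sub>R (b - a))) has_derivative (\<lambda>h. DX (a + s *\<^sub>R (b - a)) (h *\<^sub>R (b - a)))) (at s)"
        by (rule has_derivative_compose[OF l DX]) (use seg[OF s] KU in blast)
      then have "((\<lambda>s. X (a + s *\<^sub>R (b - a))) has_vector_derivative (DX (a + s *\<^sub>R (b - a)) (b - a))) (at s)"
        unfolding has_vector_derivative_def using linear_scale[OF lin[OF seg[OF s]]] by simp
      then show "((\<lambda>s. X (a + s *\<^sub>R (b - a)) - s *\<^sub>R DX a (b - a)) has_vector_derivative
          DX (a + s *\<^sub>R (b - a)) (b - a) - DX a (b - a)) (at s)"
        by (auto intro!: derivative_eq_intros)
      have "norm (DX (a + s *\<^sub>R (b - a)) (b - a) - DX a (b - a)) \<le> L1 * norm (a + s *\<^sub>R (b - a) - a) * norm (b - a)"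
        by (rule DXlip[OF seg[OF s] ab(1)])
      also have "\<dots> \<le> L1 * (1 * norm (b - a)) * norm (b - a)"
        using s L1(1) by (intro mult_right_mono mult_left_mono) (auto simp: mult_left_le_one_le)
      finally show "norm (DX (a + s *\<^sub>R (b - a)) (b - a) - DX a (b - a)) \<le> L1 * (norm (b - a))^2"
        by (simp add: power2_eq_square mult_ac)
    qed auto
    then show ?thesis by (simp add: algebra_simps)
  qed
  define r where "r = R / 4"
  have r: "r > 0" using R by (simp add: r_def)
  define \<phi> where "\<phi> z t = fst (\<Phi> (z, 0) t)" for z t
  \<comment> \<open>The flow of \<open>X1\<close> is available for second components of norm at most
    r. A vector \<open>w\<close> is shrunk by \<open>k w\<close> to fit, and the solution is scaled
    back by linearity.\<close>
  define k :: "'a \<Rightarrow> real" where "k w = r / (1 + norm w)" for w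
  have k: "k w > 0" "norm (k w *\<^sub>R w) \<le> R / 4" for w
  proof -
    have p: "1 + norm w > 0" by (smt (verit) norm_ge_zero)
    then show "k w > 0" using r by (simp add: k_def)
    have "norm (k w *\<^sub>R w) = r * (norm w / (1 + norm w))" using p r by (simp add: k_def)
    also have "\<dots> \<le> r * 1" using p r by (intro mult_left_mono) auto
    finally show "norm (k w *\<^sub>R w) \<le> R / 4" by (simp add: r_def)
  qed
  define \<psi> where "\<psi> z w t = (1 / k w) *\<^sub>R snd (\<Phi> (z, k w *\<^sub>R w) t)" for z w t
  have inK: "fst (\<Phi> (z, w) t) \<in> K" if "z \<in> ball z0 r" "norm w \<le> r" "\<bar>t\<bar> < \<delta>" for z w t
    using in2(1)[OF \<Phi>(2)[OF in1]] that by (simp add: r_def)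
  have d1: "((\<lambda>t. fst (\<Phi> (z, w) t)) has_vector_derivative X (fst (\<Phi> (z, w) t))) (at t)"
     and d2: "((\<lambda>t. snd (\<Phi> (z, w) t)) has_vector_derivative DX (fst (\<Phi> (z, w) t)) (snd (\<Phi> (z, w) t))) (at t)"
    if "z \<in> ball z0 r" "norm w \<le> r" "\<bar>t\<bar> < \<delta>" for z w t
  proof -
    have d: "(\<Phi> (z, w) has_vector_derivative X1 (\<Phi> (z, w) t)) (at t)"
      using \<Phi>(3)[OF in1] that by (simp add: r_def)
    show "((\<lambda>t. fst (\<Phi> (z, w) t)) has_vector_derivative X (fst (\<Phi> (z, w) t))) (at t)"
      using bounded_linear.has_vector_derivative[OF bounded_linear_fst d] by (simp add: X1_def)
    show "((\<lambda>t. snd (\<Phi> (z, w) t)) has_vector_derivative DX (fst (\<Phi> (z, w) t)) (snd (\<Phi> (z, w) t))) (at t)"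
      using bounded_linear.has_vector_derivative[OF bounded_linear_snd d] by (simp add: X1_def)
  qed
  define E where "E = exp ((2*L+1) * \<delta>)"
  have E: "E > 0" by (simp add: E_def)
  \<comment> \<open>Both first components solve the equation of \<open>X\<close> with the same
    initial value, so Gronwall with vanishing defect makes the first component independent of
    \<open>w\<close>.\<close>
  have fstw: "fst (\<Phi> (z, w) t) = \<phi> z t" if "z \<in> ball z0 r" "norm w \<le> r" "\<bar>t\<bar> < \<delta>" for z w t
  proof -
    let ?e = "\<lambda>t. fst (\<Phi> (z, w) t) - fst (\<Phi> (z, 0) t)"
    have "norm (?e t) \<le> (norm (?e 0) + 0 * (1 + \<delta>)) * exp ((2*L+1) * \<delta>)"
    proof (rule gronwall[OF L(1) _ that(3)])
      fix s assume s: "\<bar>s\<bar> < \<delta>"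
      show "(?e has_vector_derivative (X (fst (\<Phi> (z, w) s)) - X (fst (\<Phi> (z, 0) s)))) (at s)"
        using d1[OF that(1,2) s] d1[OF that(1) _ s, of 0] r by (auto intro!: derivative_intros)
      show "norm (X (fst (\<Phi> (z, w) s)) - X (fst (\<Phi> (z, 0) s))) \<le> L * norm (?e s) + 0"
        using L(2)[OF inK[OF that(1,2) s] inK[OF that(1) _ s, of 0]] r by simp
    qed auto
    moreover have "?e 0 = 0" using \<Phi>(1)[OF in1] that r by (simp add: r_def)
    ultimately show ?thesis by (simp add: \<phi>_def)
  qed
  have \<phi>0: "\<phi> z 0 = z" if "z \<in> ball z0 r" for z
    using \<Phi>(1)[OF in1[of z 0]] that r by (simp add: \<phi>_def r_def)
  have \<phi>K: "\<phi> z t \<in> K" if "z \<in> ball z0 r" "\<bar>t\<bar> < \<delta>" for z t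
    unfolding \<phi>_def by (rule inK) (use that r in auto)
  have \<phi>d: "(\<phi> z has_vector_derivative X (\<phi> z t)) (at t)" if "z \<in> ball z0 r" "\<bar>t\<bar> < \<delta>" for z t
    unfolding \<phi>_def by (rule d1) (use that r in auto)
  have \<psi>0: "\<psi> z w 0 = w" if "z \<in> ball z0 r" for z w
    using \<Phi>(1)[OF in1[OF that[unfolded r_def] k(2)]] k(1)[of w] by (simp add: \<psi>_def)
  have \<psi>d: "(\<psi> z w has_vector_derivative DX (\<phi> z t) (\<psi> z w t)) (at t)"
    if "z \<in> ball z0 r" "\<bar>t\<bar> < \<delta>" for z w t
  proof -
    have kr: "norm (k w *\<^sub>R w) \<le> r" using k(2) by (simp add: r_def)
    have "(\<psi> z w has_vector_derivative (1 / k w) *\<^sub>R DX (\<phi> z t) (snd (\<Phi> (z, k w *\<^sub>R w) t))) (at t)"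
      unfolding \<psi>_def fstw[OF that(1) kr that(2), symmetric]
      by (rule bounded_linear.has_vector_derivative[OF bounded_linear_scaleR_right d2[OF that(1) kr that(2)]])
    then show ?thesis
      by (simp add: \<psi>_def linear_scale[OF lin[OF \<phi>K[OF that]]])
  qed
  have \<psi>_bound: "norm (\<psi> z w t) \<le> norm w * E" if z: "z \<in> ball z0 r" and t: "\<bar>t\<bar> < \<delta>" for z w t
  proof -
    have "norm (\<psi> z w t) \<le> (norm (\<psi> z w 0) + 0 * (1 + \<delta>)) * exp ((2*L+1) * \<delta>)"
      by (rule gronwall[OF L(1) _ t \<psi>d[OF z]]) (use L(3)[OF \<phi>K[OF z]] in auto)
    then show ?thesis by (simp add: \<psi>0[OF z] E_def)
  qed
  have \<phi>_lip: "norm (\<phi> y t - \<phi> z t) \<le> norm (y - z) * E"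
    if y: "y \<in> ball z0 r" and z: "z \<in> ball z0 r" and t: "\<bar>t\<bar> < \<delta>" for y z t
  proof -
    let ?e = "\<lambda>t. \<phi> y t - \<phi> z t"
    have "norm (?e t) \<le> (norm (?e 0) + 0 * (1 + \<delta>)) * exp ((2*L+1) * \<delta>)"
      by (rule gronwall[OF L(1) _ t has_vector_derivative_diff[OF \<phi>d[OF y] \<phi>d[OF z]]])
        (use L(2)[OF \<phi>K[OF y] \<phi>K[OF z]] in auto)
    then show ?thesis by (simp add: \<phi>0[OF z] \<phi>0[OF y] E_def)
  qed
  have \<psi>_linear: "\<psi> z (a *\<^sub>R v + b *\<^sub>R w) t = a *\<^sub>R \<psi> z v t + b *\<^sub>R \<psi> z w t"
    if z: "z \<in> ball z0 r" and t: "\<bar>t\<bar> < \<delta>" for z v w a b t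
  proof -
    let ?e = "\<lambda>t. \<psi> z (a *\<^sub>R v + b *\<^sub>R w) t - (a *\<^sub>R \<psi> z v t + b *\<^sub>R \<psi> z w t)"
    have "norm (?e t) \<le> (norm (?e 0) + 0 * (1 + \<delta>)) * exp ((2*L+1) * \<delta>)"
    proof (rule gronwall[OF L(1) _ t])
      fix s assume s: "\<bar>s\<bar> < \<delta>"
      show "(?e has_vector_derivative DX (\<phi> z s) (\<psi> z (a *\<^sub>R v + b *\<^sub>R w) s) -
          (a *\<^sub>R DX (\<phi> z s) (\<psi> z v s) + b *\<^sub>R DX (\<phi> z s) (\<psi> z w s))) (at s)"
        by (intro has_vector_derivative_diff has_vector_derivative_add \<psi>d[OF z s]
            bounded_linear.has_vector_derivative[OF bounded_linear_scaleR_right])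
      show "norm (DX (\<phi> z s) (\<psi> z (a *\<^sub>R v + b *\<^sub>R w) s) -
          (a *\<^sub>R DX (\<phi> z s) (\<psi> z v s) + b *\<^sub>R DX (\<phi> z s) (\<psi> z w s))) \<le> L * norm (?e s) + 0"
        using L(3)[OF \<phi>K[OF z s], of "?e s"]
        by (simp add: linear_diff[OF lin[OF \<phi>K[OF z s]]] linear_add[OF lin[OF \<phi>K[OF z s]]]
            linear_scale[OF lin[OF \<phi>K[OF z s]]])
    qed auto
    then show ?thesis by (simp add: \<psi>0[OF z])
  qed
  have \<psi>_bl: "bounded_linear (\<lambda>w. \<psi> z w t)" if z: "z \<in> ball z0 r" and t: "\<bar>t\<bar> < \<delta>" for z t
  proof (rule bounded_linear_intro[of _ E])
    show "\<psi> z (x + y) t = \<psi> z x t + \<psi> z y t" for x y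
      using \<psi>_linear[OF z t, of 1 x 1 y] by simp
    show "\<psi> z (c *\<^sub>R x) t = c *\<^sub>R \<psi> z x t" for c x
      using \<psi>_linear[OF z t, of c x 0 x] by simp
  qed (rule \<psi>_bound[OF z t])
  \<comment> \<open>The error of the linear approximation starts at 0 and satisfies the linearised
    equation up to the Taylor remainder of \<open>X\<close>, which is quadratic in |y - z|. Gronwall
    turns this into a quadratic bound on the error.\<close>
  have \<phi>_deriv: "((\<lambda>z. \<phi> z t) has_derivative (\<lambda>w. \<psi> z w t)) (at z)"
    if z: "z \<in> ball z0 r" and t: "\<bar>t\<bar> < \<delta>" for z t
  proof (rule has_derivative_from_quadratic[OF open_ball z \<psi>_bl[OF z t]])
    fix y assume y: "y \<in> ball z0 r"
    let ?e = "\<lambda>t. \<phi> y t - \<phi> z t - \<psi> z (y - z) t"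
    let ?K = "L1 * (norm (y - z) * E)^2"
    have "norm (?e t) \<le> (norm (?e 0) + ?K * (1 + \<delta>)) * exp ((2*L+1) * \<delta>)"
    proof (rule gronwall[OF L(1) _ t])
      fix s assume s: "\<bar>s\<bar> < \<delta>"
      let ?e' = "X (\<phi> y s) - X (\<phi> z s) - DX (\<phi> z s) (\<psi> z (y - z) s)"
      show "(?e has_vector_derivative ?e') (at s)"
        by (intro has_vector_derivative_diff \<psi>d[OF z s] \<phi>d[OF z s] \<phi>d[OF y s])
      have "?e' = DX (\<phi> z s) (?e s) + (X (\<phi> y s) - X (\<phi> z s) - DX (\<phi> z s) (\<phi> y s - \<phi> z s))"
        by (simp add: linear_diff[OF lin[OF \<phi>K[OF z s]]])
      also have "norm \<dots> \<le> L * norm (?e s) + L1 * (norm (\<phi> y s - \<phi> z s))^2"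
        by (rule norm_triangle_le[OF add_mono[OF L(3)[OF \<phi>K[OF z s]] taylor[OF \<phi>K[OF z s] \<phi>K[OF y s]]]])
      also have "\<dots> \<le> L * norm (?e s) + ?K"
        by (intro add_left_mono mult_left_mono power_mono \<phi>_lip[OF y z s] L1) auto
      finally show "norm ?e' \<le> L * norm (?e s) + ?K" .
    qed (use L1 in auto)
    then show "norm (\<phi> y t - \<phi> z t - \<psi> z (y - z) t) \<le> (L1 * E^2 * (1 + \<delta>) * E) * (norm (y - z))^2"
      by (simp add: \<psi>0[OF z] \<phi>0[OF y] \<phi>0[OF z] E_def power_mult_distrib mult_ac)
  qed
  \<comment> \<open>Here the defect is the difference of \<open>DX\<close> along the two base
    solutions, which is linear in |y - z|; this yields continuity of the derivative of the
    flow.\<close>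
  have \<psi>_lip: "norm (\<psi> y w t - \<psi> z w t) \<le> (L1 * E * E * (1 + \<delta>) * E * norm w) * norm (y - z)"
    if y: "y \<in> ball z0 r" and z: "z \<in> ball z0 r" and t: "\<bar>t\<bar> < \<delta>" for y z w t
  proof -
    let ?e = "\<lambda>t. \<psi> y w t - \<psi> z w t"
    let ?K = "L1 * (norm (y - z) * E) * (norm w * E)"
    have "norm (?e t) \<le> (norm (?e 0) + ?K * (1 + \<delta>)) * exp ((2*L+1) * \<delta>)"
    proof (rule gronwall[OF L(1) _ t])
      fix s assume s: "\<bar>s\<bar> < \<delta>"
      let ?e' = "DX (\<phi> y s) (\<psi> y w s) - DX (\<phi> z s) (\<psi> z w s)"
      show "(?e has_vector_derivative ?e') (at s)"
        by (intro has_vector_derivative_diff \<psi>d[OF z s] \<psi>d[OF y s])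
      have "?e' = DX (\<phi> y s) (?e s) + (DX (\<phi> y s) (\<psi> z w s) - DX (\<phi> z s) (\<psi> z w s))"
        by (simp add: linear_diff[OF lin[OF \<phi>K[OF y s]]])
      also have "norm \<dots> \<le> L * norm (?e s) + L1 * norm (\<phi> y s - \<phi> z s) * norm (\<psi> z w s)"
        by (rule norm_triangle_le[OF add_mono[OF L(3)[OF \<phi>K[OF y s]] DXlip[OF \<phi>K[OF y s] \<phi>K[OF z s]]]])
      also have "\<dots> \<le> L * norm (?e s) + ?K"
        using \<phi>_lip[OF y z s] \<psi>_bound[OF z s, of w] L1(1) E
        by (intro add_left_mono mult_mono mult_left_mono) auto
      finally show "norm ?e' \<le> L * norm (?e s) + ?K" .
    qed (use L1 E in auto)
    then show ?thesis by (simp add: \<psi>0[OF z] \<psi>0[OF y] E_def mult_ac)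
  qed
  have \<psi>_cont: "continuous_on (ball z0 r) (\<lambda>z. \<psi> z w t)" if t: "\<bar>t\<bar> < \<delta>" for w t
  proof -
    have "(L1 * E * E * (1 + \<delta>) * E * norm w)-lipschitz_on (ball z0 r) (\<lambda>z. \<psi> z w t)"
      by (rule lipschitz_onI) (use \<psi>_lip[OF _ _ t] L1(1) E R(2) in \<open>auto simp: dist_norm\<close>)
    then show ?thesis by (rule lipschitz_on_continuous_on)
  qed
  have "ball z0 r \<subseteq> K" using R(1) by (auto simp: K_def r_def)
  then show ?thesis
    using that[OF r R(2), of \<phi> \<psi>] KU \<phi>0 \<phi>K \<phi>d \<phi>_deriv \<psi>_cont \<psi>0 \<psi>d unfolding DX_def by blast
qed

text \<open>Near \<open>t0\<close> both solutions stay in a compact ball on which the field is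
  Lipschitz, and Gronwall with initial difference 0 forces them to agree.\<close>

lemma ode_unique_local:
  fixes X :: "'a::euclidean_space \<Rightarrow> 'a"
  assumes "open U" "smooth_on U X" "x t0 \<in> U" "x t0 = y t0" "d > 0"
    "\<And>t. \<bar>t - t0\<bar> < d \<Longrightarrow> (x has_vector_derivative X (x t)) (at t)"
    "\<And>t. \<bar>t - t0\<bar> < d \<Longrightarrow> (y has_vector_derivative X (y t)) (at t)"
  obtains e where "e > 0" "e \<le> d" "\<And>t. \<bar>t - t0\<bar> < e \<Longrightarrow> x t = y t"
proof -
  obtain R where R: "R > 0" "cball (x t0) R \<subseteq> U" using assms open_contains_cball by blast
  let ?K = "cball (x t0) R"
  obtain L where L: "L \<ge> 0" "\<And>a b. a \<in> ?K \<Longrightarrow> b \<in> ?K \<Longrightarrow> norm (X a - X b) \<le> L * norm (a - b)"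
    using smooth_on_lipschitz[OF assms(2) compact_cball convex_cball R(2)] by metis
  have cx: "isCont x t0" "isCont y t0"
    using assms(5) has_vector_derivative_continuous[OF assms(6)[of t0]]
      has_vector_derivative_continuous[OF assms(7)[of t0]] by auto
  obtain e1 where e1: "e1 > 0" "\<And>t. \<bar>t - t0\<bar> < e1 \<Longrightarrow> dist (x t) (x t0) < R"
    using cx(1) R(1) unfolding continuous_at_eps_delta by (metis dist_real_def)
  obtain e2 where e2: "e2 > 0" "\<And>t. \<bar>t - t0\<bar> < e2 \<Longrightarrow> dist (y t) (y t0) < R"
    using cx(2) R(1) unfolding continuous_at_eps_delta by (metis dist_real_def)
  define e where "e = min d (min e1 e2)"
  have e: "e > 0" "e \<le> d" using assms e1 e2 by (auto simp: e_def)
  have K: "x t \<in> ?K" "y t \<in> ?K" if "\<bar>t - t0\<bar> < e" for t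
    using e1(2)[of t] e2(2)[of t] that assms(4) by (auto simp: e_def dist_commute)
  show ?thesis
  proof (rule that[OF e])
    fix t assume t: "\<bar>t - t0\<bar> < e"
    let ?g = "\<lambda>s. x (t0 + s) - y (t0 + s)"
    have "norm (?g (t - t0)) \<le> (norm (?g 0) + 0 * (1 + e)) * exp ((2*L+1) * e)"
    proof (rule gronwall[OF L(1) _ t])
      fix s :: real assume s: "\<bar>s\<bar> < e"
      have l: "((\<lambda>s. t0 + s) has_vector_derivative 1) (at s)" by (auto intro!: derivative_eq_intros)
      have "((\<lambda>s. x (t0 + s)) has_vector_derivative X (x (t0 + s))) (at s)"
        using vector_diff_chain_at[OF l assms(6)[of "t0 + s"]] s e by (simp add: o_def)
      moreover have "((\<lambda>s. y (t0 + s)) has_vector_derivative X (y (t0 + s))) (at s)"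
        using vector_diff_chain_at[OF l assms(7)[of "t0 + s"]] s e by (simp add: o_def)
      ultimately show "(?g has_vector_derivative X (x (t0 + s)) - X (y (t0 + s))) (at s)"
        by (rule has_vector_derivative_diff)
      show "norm (X (x (t0 + s)) - X (y (t0 + s))) \<le> L * norm (?g s) + 0"
        using L(2)[OF K] s by simp
    qed auto
    then show "x t = y t" using assms(4) by simp
  qed
qed

section \<open>Fields of bilinear forms\<close>

lemma bilinear_sum_Basis:
  fixes B :: "'a::euclidean_space \<Rightarrow> 'b::euclidean_space \<Rightarrow> 'c::real_normed_vector"
  assumes "bilinear B"
  shows "B v w = (\<Sum>a\<in>Basis. \<Sum>b\<in>Basis. ((v \<bullet> a) * (w \<bullet> b)) *\<^sub>R B a b)"
proof -
  have "B v w = B (\<Sum>a\<in>Basis. (v \<bullet> a) *\<^sub>R a) (\<Sum>b\<in>Basis. (w \<bullet> b) *\<^sub>R b)"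
    by (simp add: euclidean_representation)
  also have "\<dots> = (\<Sum>(a,b)\<in>Basis \<times> Basis. B ((v \<bullet> a) *\<^sub>R a) ((w \<bullet> b) *\<^sub>R b))"
    by (rule bilinear_sum[OF assms])
  also have "\<dots> = (\<Sum>(a,b)\<in>Basis \<times> Basis. ((v \<bullet> a) * (w \<bullet> b)) *\<^sub>R B a b)"
    by (simp add: bilinear_lmul[OF assms] bilinear_rmul[OF assms] mult.commute[of "w \<bullet> _"])
  finally show ?thesis by (simp add: sum.cartesian_product)
qed

text \<open>Smoothness of the finitely many coefficients \<open>B y a b\<close> is transferred to
  moving arguments; it serves the metric and the Christoffel symbols alike.\<close>

lemma smooth_on_bilinear_field:
  fixes B :: "'d::euclidean_space \<Rightarrow> 'a::euclidean_space \<Rightarrow> 'b::euclidean_space \<Rightarrow> 'c::euclidean_space"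
  assumes "open R" "open S" "\<And>y. y \<in> S \<Longrightarrow> bilinear (B y)" "\<And>v w. smooth_on S (\<lambda>y. B y v w)"
    "smooth_on R p" "p ` R \<subseteq> S" "smooth_on R v" "smooth_on R w"
  shows "smooth_on R (\<lambda>x. B (p x) (v x) (w x))"
proof (rule smooth_on_cong[OF assms(1)])
  show "smooth_on R (\<lambda>x. \<Sum>a\<in>Basis. \<Sum>b\<in>Basis. ((v x \<bullet> a) * (w x \<bullet> b)) *\<^sub>R B (p x) a b)"
    by (intro smooth_intros assms smooth_on_compose[OF assms(1,2,4,5,6)])
  show "(\<Sum>a\<in>Basis. \<Sum>b\<in>Basis. ((v x \<bullet> a) * (w x \<bullet> b)) *\<^sub>R B (p x) a b) = B (p x) (v x) (w x)"
    if "x \<in> R" for x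
    by (rule bilinear_sum_Basis[symmetric], rule assms(3)) (use assms(6) that in auto)
qed

text \<open>The three-term product rule for a bilinear form evaluated along a moving point and two
  moving vectors. It is applied summand by summand in the basis expansion and then
  reassembled.\<close>

lemma has_derivative_bilinear_field:
  fixes B :: "'d::euclidean_space \<Rightarrow> 'a::euclidean_space \<Rightarrow> 'b::euclidean_space \<Rightarrow> 'c::euclidean_space"
  assumes S: "open S" "\<And>y. y \<in> S \<Longrightarrow> bilinear (B y)" "\<And>v w. smooth_on S (\<lambda>y. B y v w)"
    and p: "p x \<in> S" "(p has_derivative p') (at x)"
    and v: "(v has_derivative v') (at x)" and w: "(w has_derivative w') (at x)"
  shows "((\<lambda>x. B (p x) (v x) (w x)) has_derivative
     (\<lambda>h. frechet_derivative (\<lambda>y. B y (v x) (w x)) (at (p x)) (p' h) + B (p x) (v' h) (w x) + B (p x) (v x) (w' h))) (at x)"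
proof -
  let ?D = "\<lambda>a b. frechet_derivative (\<lambda>y. B y a b) (at (p x))"
  have D: "((\<lambda>y. B y a b) has_derivative ?D a b) (at (p x))" for a b
    by (rule smooth_on_has_derivative[OF S(3) p(1)])
  have Dsum: "?D a b k = (\<Sum>c\<in>Basis. \<Sum>d\<in>Basis. ((a \<bullet> c) * (b \<bullet> d)) *\<^sub>R ?D c d k)" for a b k
  proof -
    have "((\<lambda>y. \<Sum>c\<in>Basis. \<Sum>d\<in>Basis. ((a \<bullet> c) * (b \<bullet> d)) *\<^sub>R B y c d) has_derivative
        (\<lambda>k. \<Sum>c\<in>Basis. \<Sum>d\<in>Basis. ((a \<bullet> c) * (b \<bullet> d)) *\<^sub>R ?D c d k)) (at (p x))"
      by (intro has_derivative_sum has_derivative_scaleR_right D)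
    then have "((\<lambda>y. B y a b) has_derivative
        (\<lambda>k. \<Sum>c\<in>Basis. \<Sum>d\<in>Basis. ((a \<bullet> c) * (b \<bullet> d)) *\<^sub>R ?D c d k)) (at (p x))"
      by (rule has_derivative_transform_within_open[OF _ S(1) p(1)])
        (simp only: bilinear_sum_Basis[OF S(2), symmetric])
    from frechet_derivative_at[OF this, symmetric] show ?thesis by (rule fun_cong)
  qed
  obtain d where d: "d > 0" "\<And>y. dist y x < d \<Longrightarrow> p y \<in> S"
  proof -
    have "isCont p x" using p(2) has_derivative_continuous by blast
    then have "\<forall>\<^sub>F y in nhds x. p y \<in> S"
      using S(1) p(1) by (simp add: continuous_at_open eventually_nhds)
    then show ?thesis using that unfolding eventually_nhds_metric by blast
  qed
  let ?E = "\<lambda>c d h. ((v x \<bullet> c) * (w x \<bullet> d)) *\<^sub>R ?D c d (p' h) +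
      ((v x \<bullet> c) * (w' h \<bullet> d) + (v' h \<bullet> c) * (w x \<bullet> d)) *\<^sub>R B (p x) c d"
  have "((\<lambda>x. \<Sum>c\<in>Basis. \<Sum>d\<in>Basis. ((v x \<bullet> c) * (w x \<bullet> d)) *\<^sub>R B (p x) c d) has_derivative
      (\<lambda>h. \<Sum>c\<in>Basis. \<Sum>d\<in>Basis. ?E c d h)) (at x)"
    by (intro has_derivative_sum has_derivative_scaleR has_derivative_mult
        bounded_linear.has_derivative[OF bounded_linear_inner_left] v w has_derivative_compose[OF p(2) D])
  then have "((\<lambda>x. B (p x) (v x) (w x)) has_derivative (\<lambda>h. \<Sum>c\<in>Basis. \<Sum>d\<in>Basis. ?E c d h)) (at x)"
    by (rule has_derivative_transform_within[where d=d])
      (use d bilinear_sum_Basis[OF S(2)] in \<open>auto simp: dist_commute\<close>)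
  moreover have "(\<Sum>c\<in>Basis. \<Sum>d\<in>Basis. ?E c d h) =
      ?D (v x) (w x) (p' h) + B (p x) (v' h) (w x) + B (p x) (v x) (w' h)" for h
    unfolding Dsum[of "v x" "w x"] bilinear_sum_Basis[OF S(2)[OF p(1)], of "v' h" "w x"]
      bilinear_sum_Basis[OF S(2)[OF p(1)], of "v x" "w' h"] sum.distrib[symmetric]
    by (intro sum.cong refl) (simp add: algebra_simps)
  ultimately show ?thesis by simp
qed

lemma smooth_on_vec:
  fixes f :: "'a::euclidean_space \<Rightarrow> real ^ 'n"
  assumes "open S" "\<And>k. smooth_on S (\<lambda>x. f x $ k)"
  shows "smooth_on S f"
  by (rule smooth_on_components) (use assms in \<open>auto simp: Basis_vec_def inner_axis\<close>)

lemma smooth_on_local: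
  assumes "\<And>x. x \<in> S \<Longrightarrow> \<exists>T. open T \<and> x \<in> T \<and> smooth_on T f"
  shows "smooth_on S f"
proof -
  have "Ck_on k S f" if "\<And>x. x \<in> S \<Longrightarrow> \<exists>T. open T \<and> x \<in> T \<and> Ck_on k T f" for k and f :: "'a \<Rightarrow> 'b"
    using that
  proof (induction k arbitrary: f)
    case 0
    show ?case unfolding Ck_on.simps
    proof (rule continuous_at_imp_continuous_on, rule ballI)
      fix x assume "x \<in> S"
      then obtain T where "open T" "x \<in> T" "continuous_on T f" using 0 by auto
      then show "isCont f x" by (simp add: continuous_on_eq_continuous_at)
    qed
  next
    case (Suc k)
    show ?case unfolding Ck_on.simps
    proof (intro conjI ballI allI)
      show "f differentiable at x" if "x \<in> S" for x using Suc.prems[OF that] by auto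
      show "Ck_on k S (\<lambda>x. frechet_derivative f (at x) v)" for v
        by (rule Suc.IH) (use Suc.prems in fastforce)
    qed
  qed
  note local = this
  show ?thesis unfolding smooth_on_def
  proof
    fix k show "Ck_on k S f"
    proof (rule local)
      fix x assume "x \<in> S"
      then obtain T where "open T" "x \<in> T" "smooth_on T f" using assms by blast
      then show "\<exists>T. open T \<and> x \<in> T \<and> Ck_on k T f" unfolding smooth_on_def by blast
    qed
  qed
qed

section \<open>Christoffel symbols\<close>

text \<open>Solving g(u, .) = l is a linear system with matrix \<open>A\<close>. Cramer's rule gives
  the solution as a rational expression in the entries, which is what makes its smooth dependence on
  parameters visible.\<close>

lemma nondegenerate_solve:
  fixes g :: "real ^ 'n \<Rightarrow> real ^ 'n \<Rightarrow> real"
  assumes g: "bilinear g" "\<And>v. v \<noteq> 0 \<Longrightarrow> \<exists>w. g v w \<noteq> 0" and l: "linear l"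
  defines "A \<equiv> (\<chi> a b. g (axis b 1) (axis a 1))"
  shows "det A \<noteq> 0"
    and "(THE u. \<forall>z. g u z = l z) = (\<chi> k. det (\<chi> i j. if j = k then l (axis i 1) else A $ i $ j) / det A)"
    and "g (THE u. \<forall>z. g u z = l z) z = l z"
proof -
  have Au: "(A *v u) $ a = g u (axis a 1)" for u a
  proof -
    have "g u (axis a 1) = g (\<Sum>b\<in>UNIV. (u $ b) *\<^sub>R axis b 1) (axis a 1)"
      by (simp only: basis_expansion[of u, unfolded scalar_mult_eq_scaleR])
    also have "\<dots> = (\<Sum>b\<in>UNIV. u $ b * g (axis b 1) (axis a 1))"
      using linear_sum[of "\<lambda>x. g x (axis a 1)" "\<lambda>b. (u $ b) *\<^sub>R axis b 1" UNIV] g(1)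
      by (simp add: bilinear_def linear_scale[of "\<lambda>x. g x (axis a 1)"])
    finally show ?thesis by (simp add: A_def matrix_vector_mult_def mult.commute)
  qed
  have eq: "(\<forall>z. g u z = l z) \<longleftrightarrow> A *v u = (\<chi> i. l (axis i 1))" for u
  proof
    assume "A *v u = (\<chi> i. l (axis i 1))"
    then have 1: "g u (axis a 1) = l (axis a 1)" for a using Au[of u a] by simp
    have "g u = l"
      by (rule linear_eq_stdbasis) (use g(1) l 1 in \<open>auto simp: bilinear_def Basis_vec_def\<close>)
    then show "\<forall>z. g u z = l z" by simp
  qed (auto simp: vec_eq_iff Au)
  have inj: "u = 0" if "A *v u = 0" for u
  proof (rule ccontr)
    assume "u \<noteq> 0"
    then obtain w where w: "g u w \<noteq> 0" using g(2) by blast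
    have "g u = (\<lambda>z. 0)"
      by (rule linear_eq_stdbasis)
        (use g(1) Au[of u] that in \<open>auto simp: bilinear_def Basis_vec_def intro: module_hom_zero\<close>)
    then show False using w by simp
  qed
  show det: "det A \<noteq> 0"
    using inj invertible_det_nz[of A] invertible_left_inverse[of A] matrix_left_invertible_ker[of A] by blast
  have uniq: "(\<forall>z. g u z = l z) \<longleftrightarrow>
      u = (\<chi> k. det (\<chi> i j. if j = k then l (axis i 1) else A $ i $ j) / det A)" for u
    unfolding eq cramer[OF det] by (simp only: vec_lambda_beta)
  show the: "(THE u. \<forall>z. g u z = l z) = (\<chi> k. det (\<chi> i j. if j = k then l (axis i 1) else A $ i $ j) / det A)"
    using uniq by (intro the_equality) blast+
  show "g (THE u. \<forall>z. g u z = l z) z = l z" unfolding the using uniq by blast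
qed

lemma smooth_on_det:
  fixes A :: "'a::euclidean_space \<Rightarrow> real ^ 'n ^ 'n"
  assumes "open S" "\<And>i j. smooth_on S (\<lambda>x. A x $ i $ j)"
  shows "smooth_on S (\<lambda>x. det (A x))"
  unfolding det_def by (intro smooth_on_sum smooth_on_mult smooth_on_prod smooth_on_const assms)

text \<open>The model space is \<open>real ^ 'n\<close> so that determinants, and with them Cramer's
  rule, are available for the Christoffel symbols.\<close>

locale riemannian =
  fixes F :: "('i, 'm::{t2_space,second_countable_topology}, real ^ 'n) semi_riemannian"
  assumes riem: "riemannian_manifold F"
begin

abbreviation "V i \<equiv> coord F i ` cdom F i"
abbreviation "VV i j \<equiv> coord F i ` (cdom F i \<inter> cdom F j)"
definition "cm i y v w = metric F i (chart_inv F i y) v w"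
definition "Gam i y v w = christoffel F i (chart_inv F i y) v w"
definition "tr i j y = coord F j (chart_inv F i y)"
abbreviation "Dtr i j y \<equiv> frechet_derivative (tr i j) (at y)"
definition spray :: "'i \<Rightarrow> (real ^ 'n) \<times> (real ^ 'n) \<Rightarrow> (real ^ 'n) \<times> (real ^ 'n)" where
  "spray i z = (snd z, - Gam i (fst z) (snd z) (snd z))"

lemma semi: "semi_riemannian_manifold F"
  using riem unfolding riemannian_manifold_def by (rule conjunct1)

lemma smf: "smooth_manifold F"
  using semi unfolding semi_riemannian_manifold_def by (rule conjunct1)

section \<open>Metric, Christoffel symbols and geodesic spray in one chart\<close>

context fixes i assumes i: "i \<in> charts F"
begin

lemma open_cdom: "open (cdom F i)" and open_V: "open (V i)"
  and homeo: "homeomorphism (cdom F i) (V i) (coord F i) (chart_inv F i)"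
  using smf i unfolding smooth_manifold_def by auto

lemma chart_inv_coord: "p \<in> cdom F i \<Longrightarrow> chart_inv F i (coord F i p) = p"
  and coord_chart_inv: "y \<in> V i \<Longrightarrow> coord F i (chart_inv F i y) = y"
  and chart_inv_in: "y \<in> V i \<Longrightarrow> chart_inv F i y \<in> cdom F i"
  using homeo unfolding homeomorphism_def by auto

lemma cont_coord: "continuous_on (cdom F i) (coord F i)"
  and cont_chart_inv: "continuous_on (V i) (chart_inv F i)"
  using homeo unfolding homeomorphism_def by auto

lemma cm_metric: "cm i y = metric F i (chart_inv F i y)"
  by (intro ext) (simp add: cm_def)

lemma metric_bilinear: "p \<in> cdom F i \<Longrightarrow> bilinear (metric F i p)"
  using semi i unfolding semi_riemannian_manifold_def by blast

lemma metric_sym: "p \<in> cdom F i \<Longrightarrow> metric F i p v w = metric F i p w v"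
  using semi i unfolding semi_riemannian_manifold_def by blast

lemma metric_pos: "p \<in> cdom F i \<Longrightarrow> v \<noteq> 0 \<Longrightarrow> metric F i p v v > 0"
  using riem i unfolding riemannian_manifold_def by blast

lemma cm_bilinear: "y \<in> V i \<Longrightarrow> bilinear (cm i y)"
  unfolding cm_metric by (rule metric_bilinear[OF chart_inv_in])

lemma cm_sym: "y \<in> V i \<Longrightarrow> cm i y v w = cm i y w v"
  unfolding cm_metric by (rule metric_sym[OF chart_inv_in])

lemma cm_pos: "y \<in> V i \<Longrightarrow> v \<noteq> 0 \<Longrightarrow> cm i y v v > 0"
  unfolding cm_metric by (rule metric_pos[OF chart_inv_in])

lemma cm_smooth: "smooth_on (V i) (\<lambda>y. cm i y v w)"
  using semi i unfolding semi_riemannian_manifold_def cm_metric by blast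

lemma cm_nondeg: "y \<in> V i \<Longrightarrow> v \<noteq> 0 \<Longrightarrow> \<exists>w. cm i y v w \<noteq> 0"
  using cm_pos by (metis less_irrefl)

abbreviation "Dcm y v w \<equiv> frechet_derivative (\<lambda>y. cm i y v w) (at y)"

text \<open>The Christoffel symbols of the first kind, with lowered index, in coordinates.\<close>

definition "koszul y v w z = (Dcm y w z v + Dcm y v z w - Dcm y v w z) / 2"

lemma Dcm: "y \<in> V i \<Longrightarrow> ((\<lambda>y. cm i y v w) has_derivative Dcm y v w) (at y)"
  by (rule smooth_on_has_derivative[OF cm_smooth])

lemma Dcm_linear: "y \<in> V i \<Longrightarrow> linear (Dcm y v w)"
  using Dcm has_derivative_linear by blast

lemma Dcm_lin:
  assumes y: "y \<in> V i"
  shows "linear (\<lambda>v. Dcm y v w k)" "linear (\<lambda>w. Dcm y v w k)"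
proof -
  have 1: "Dcm y (a *\<^sub>R v + b *\<^sub>R v') w = (\<lambda>k. a * Dcm y v w k + b * Dcm y v' w k)" for a b v v' w
  proof (rule frechet_derivative_at[symmetric])
    have "((\<lambda>y. a * cm i y v w + b * cm i y v' w) has_derivative (\<lambda>k. a * Dcm y v w k + b * Dcm y v' w k)) (at y)"
      by (intro has_derivative_add has_derivative_mult_right Dcm y)
    then show "((\<lambda>y. cm i y (a *\<^sub>R v + b *\<^sub>R v') w) has_derivative (\<lambda>k. a * Dcm y v w k + b * Dcm y v' w k)) (at y)"
      by (rule has_derivative_transform_within_open[OF _ open_V y])
        (simp add: bilinear_ladd[OF cm_bilinear] bilinear_lmul[OF cm_bilinear])
  qed
  have s: "Dcm y v w = Dcm y w v" for v w
    by (rule frechet_derivative_cong_open[OF open_V y cm_sym])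
  show l: "linear (\<lambda>v. Dcm y v w k)" for w
    using fun_cong[OF 1[of 1 _ 1 _ w], where x=k] fun_cong[OF 1[of _ _ 0 0 w], where x=k]
    by (intro linearI) auto
  show "linear (\<lambda>w. Dcm y v w k)"
    unfolding s[of v] by (rule l)
qed

lemma koszul_linear:
  assumes y: "y \<in> V i"
  shows "linear (koszul y v w)" "linear (\<lambda>v. koszul y v w z)" "linear (\<lambda>w. koszul y v w z)"
proof -
  have k: "koszul y v w z = (1/2) *\<^sub>R (Dcm y w z v + Dcm y v z w - Dcm y v w z)" for v w z
    by (simp add: koszul_def)
  show "linear (koszul y v w)" unfolding k[abs_def]
    by (intro linear_compose_scale_right linear_compose_add linear_compose_sub Dcm_lin[OF y] Dcm_linear[OF y])
  show "linear (\<lambda>v. koszul y v w z)" unfolding k[abs_def]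
    by (intro linear_compose_scale_right linear_compose_add linear_compose_sub Dcm_lin[OF y] Dcm_linear[OF y])
  show "linear (\<lambda>w. koszul y v w z)" unfolding k[abs_def]
    by (intro linear_compose_scale_right linear_compose_add linear_compose_sub Dcm_lin[OF y] Dcm_linear[OF y])
qed

lemma koszul_sym: "y \<in> V i \<Longrightarrow> koszul y v w z = koszul y w v z"
  using frechet_derivative_cong_open[OF open_V, of y "\<lambda>y. cm i y v w" "\<lambda>y. cm i y w v"] cm_sym
  by (simp add: koszul_def)

lemma Gam_eq:
  assumes y: "y \<in> V i"
  shows "Gam i y v w = (THE u. \<forall>z. cm i y u z = koszul y v w z)"
proof -
  have c: "coord F i (chart_inv F i y) = y" using coord_chart_inv[OF y] .
  show ?thesis unfolding Gam_def christoffel_def chart_deriv_def c koszul_def cm_def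
    by (rule arg_cong[of _ _ The], rule ext) (auto simp: field_simps)
qed

lemma Gam_char: "y \<in> V i \<Longrightarrow> cm i y (Gam i y v w) z = koszul y v w z"
  unfolding Gam_eq by (rule nondegenerate_solve(3)[OF cm_bilinear cm_nondeg koszul_linear(1)])

lemma cm_eqI:
  assumes "y \<in> V i" "\<And>z. cm i y u z = cm i y u' z" shows "u = u'"
proof (rule ccontr)
  assume "u \<noteq> u'"
  then have "cm i y (u - u') (u - u') > 0" using cm_pos[OF assms(1)] by simp
  then show False using assms(2)[of "u - u'"] by (simp add: bilinear_lsub[OF cm_bilinear[OF assms(1)]])
qed

lemma Gam_bilinear: assumes y: "y \<in> V i" shows "bilinear (Gam i y)"
  unfolding bilinear_def
proof (intro conjI allI linearI)
  note b = bilinear_ladd[OF cm_bilinear[OF y]] bilinear_lmul[OF cm_bilinear[OF y]]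
  fix x c w
  show "Gam i y x (c + w) = Gam i y x c + Gam i y x w" "Gam i y (c + w) x = Gam i y c x + Gam i y w x"
    by (rule cm_eqI[OF y], simp add: b Gam_char[OF y] linear_add[OF koszul_linear(3)[OF y]] linear_add[OF koszul_linear(2)[OF y]])+
next
  note b = bilinear_ladd[OF cm_bilinear[OF y]] bilinear_lmul[OF cm_bilinear[OF y]]
  fix x w and c :: real
  show "Gam i y x (c *\<^sub>R w) = c *\<^sub>R Gam i y x w" "Gam i y (c *\<^sub>R w) x = c *\<^sub>R Gam i y w x"
    by (rule cm_eqI[OF y], simp add: b Gam_char[OF y] linear_scale[OF koszul_linear(3)[OF y]] linear_scale[OF koszul_linear(2)[OF y]])+
qed

lemma Gam_sym: assumes y: "y \<in> V i" shows "Gam i y v w = Gam i y w v"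
  by (rule cm_eqI[OF y]) (simp only: Gam_char[OF y], rule koszul_sym[OF y])

text \<open>By Cramer's rule the symbols are rational in the metric coefficients and their first
  derivatives, with the non-vanishing determinant as denominator.\<close>

lemma Gam_smooth: "smooth_on (V i) (\<lambda>y. Gam i y v w)"
proof (rule smooth_on_cong[OF open_V])
  define A where "A y = (\<chi> a b. cm i y (axis b 1) (axis a 1))" for y
  define G where "G y = (\<chi> k. det (\<chi> i j. if j = k then koszul y v w (axis i 1) else A y $ i $ j) / det (A y))" for y
  have "smooth_on (V i) (\<lambda>y. koszul y v w z)" for z
    unfolding koszul_def
    by (intro smooth_on_divide smooth_on_add smooth_on_diff smooth_on_deriv smooth_on_const cm_smooth open_V) auto
  then have s: "smooth_on (V i) (\<lambda>y. if P then koszul y v w z else A y $ a $ b)" for P z a b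
    by (cases P) (auto simp: A_def cm_smooth)
  have "det (A y) \<noteq> 0" if "y \<in> V i" for y
    unfolding A_def by (rule nondegenerate_solve(1)[OF cm_bilinear cm_nondeg koszul_linear(1)]) (use that in auto)
  then show "smooth_on (V i) G"
    unfolding G_def
    by (intro smooth_on_vec open_V) (auto intro!: smooth_on_divide smooth_on_det open_V s simp: A_def cm_smooth)
  show "G y = Gam i y v w" if y: "y \<in> V i" for y
    unfolding Gam_eq[OF y] G_def A_def
    by (rule nondegenerate_solve(2)[OF cm_bilinear[OF y] cm_nondeg[OF y] koszul_linear(1)[OF y], symmetric])
qed

lemma spray_smooth: "smooth_on (V i \<times> UNIV) (spray i)"
proof -
  have o: "open (V i \<times> (UNIV :: (real ^ 'n) set))" by (simp add: open_Times open_V)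
  show ?thesis unfolding spray_def
    by (intro smooth_on_Pair smooth_on_minus smooth_on_bilinear_field[OF o open_V Gam_bilinear Gam_smooth]
        smooth_on_fst smooth_on_snd smooth_on_ident o) auto
qed

end

section \<open>Change of charts\<close>

context fixes i j assumes i: "i \<in> charts F" and j: "j \<in> charts F"
begin

lemma VV_eq: "VV i j = V i \<inter> chart_inv F i -` cdom F j"
proof (intro equalityI subsetI)
  fix y assume "y \<in> VV i j"
  then show "y \<in> V i \<inter> chart_inv F i -` cdom F j" using chart_inv_coord[OF i] by auto
next
  fix y assume "y \<in> V i \<inter> chart_inv F i -` cdom F j"
  then show "y \<in> VV i j" using chart_inv_in[OF i] coord_chart_inv[OF i, of y] by (metis IntD1 IntD2 IntI image_eqI vimage_eq)
qed

lemma open_VV: "open (VV i j)"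
  unfolding VV_eq by (rule continuous_open_preimage[OF cont_chart_inv[OF i] open_V[OF i] open_cdom[OF j]])

lemma tr_smooth: "smooth_on (VV i j) (tr i j)"
  using smf i j unfolding smooth_manifold_def tr_def[abs_def] by blast

lemma Dtr: "y \<in> VV i j \<Longrightarrow> (tr i j has_derivative Dtr i j y) (at y)"
  by (rule smooth_on_has_derivative[OF tr_smooth])

lemma Dtr_linear: "y \<in> VV i j \<Longrightarrow> linear (Dtr i j y)"
  using Dtr has_derivative_linear by blast

lemma chart_deriv_coord: "chart_deriv F i (coord F j) p = Dtr i j (coord F i p)"
  by (intro ext) (simp add: chart_deriv_def tr_def[abs_def])

lemma tr_in: "y \<in> VV i j \<Longrightarrow> tr i j y \<in> VV j i"
  using chart_inv_coord[OF i] by (auto simp: tr_def)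

lemma chart_inv_tr: "y \<in> VV i j \<Longrightarrow> chart_inv F j (tr i j y) = chart_inv F i y"
  using chart_inv_coord[OF i] chart_inv_coord[OF j] by (auto simp: tr_def)

lemma tr_tr: "y \<in> VV i j \<Longrightarrow> tr j i (tr i j y) = y"
  using chart_inv_coord[OF i] chart_inv_coord[OF j] by (auto simp: tr_def)

lemma cm_tr: "y \<in> VV i j \<Longrightarrow> cm i y v w = cm j (tr i j y) (Dtr i j y v) (Dtr i j y w)"
proof -
  assume y: "y \<in> VV i j"
  then have p: "chart_inv F i y \<in> cdom F i \<inter> cdom F j" "coord F i (chart_inv F i y) = y"
    using coord_chart_inv[OF i, of y] chart_inv_in[OF i, of y] VV_eq by auto
  have "metric F i p v w = metric F j p (chart_deriv F i (coord F j) p v) (chart_deriv F i (coord F j) p w)"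
    if "p \<in> cdom F i \<inter> cdom F j" for p
    using semi i j that unfolding semi_riemannian_manifold_def by blast
  from this[OF p(1)] show ?thesis
    unfolding chart_deriv_coord p(2) cm_def chart_inv_tr[OF y] .
qed

definition "D2tr y v = frechet_derivative (\<lambda>y. Dtr i j y v) (at y)"

lemma D2tr: "y \<in> VV i j \<Longrightarrow> ((\<lambda>y. Dtr i j y v) has_derivative D2tr y v) (at y)"
  unfolding D2tr_def by (rule smooth_on_has_derivative[OF smooth_on_deriv[OF tr_smooth]])

lemma D2tr_sym: "y \<in> VV i j \<Longrightarrow> D2tr y v w = D2tr y w v"
  by (rule second_derivative_symmetric[OF open_VV _ Dtr D2tr D2tr])

end

section \<open>Transformation law of the Christoffel symbols and of the spray\<close>

context fixes i j assumes i: "i \<in> charts F" and j: "j \<in> charts F"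
begin

text \<open>Obtained by differentiating the invariance \<open>cm_tr\<close> of the metric; the last
  two terms come from the change of the transition derivative.\<close>

lemma Dcm_tr:
  assumes y: "y \<in> VV i j"
  shows "Dcm i y v w k = Dcm j (tr i j y) (Dtr i j y v) (Dtr i j y w) (Dtr i j y k)
     + cm j (tr i j y) (D2tr i j y v k) (Dtr i j y w) + cm j (tr i j y) (Dtr i j y v) (D2tr i j y w k)"
proof -
  have ty: "tr i j y \<in> V j" using tr_in[OF i j y] by auto
  have "((\<lambda>y. cm j (tr i j y) (Dtr i j y v) (Dtr i j y w)) has_derivative
    (\<lambda>k. Dcm j (tr i j y) (Dtr i j y v) (Dtr i j y w) (Dtr i j y k)
     + cm j (tr i j y) (D2tr i j y v k) (Dtr i j y w) + cm j (tr i j y) (Dtr i j y v) (D2tr i j y w k))) (at y)"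
    by (rule has_derivative_bilinear_field[OF open_V[OF j] cm_bilinear[OF j] cm_smooth[OF j] ty
          Dtr[OF i j y] D2tr[OF i j y] D2tr[OF i j y]])
  then have "((\<lambda>y. cm i y v w) has_derivative
    (\<lambda>k. Dcm j (tr i j y) (Dtr i j y v) (Dtr i j y w) (Dtr i j y k)
     + cm j (tr i j y) (D2tr i j y v k) (Dtr i j y w) + cm j (tr i j y) (Dtr i j y v) (D2tr i j y w k))) (at y)"
    by (rule has_derivative_transform_within_open[OF _ open_VV[OF i j] y]) (simp add: cm_tr[OF i j])
  from frechet_derivative_at[OF this, symmetric] show ?thesis by (rule fun_cong)
qed

text \<open>The inhomogeneous transformation law on the diagonal, which is the part that the
  geodesic equation sees. Both sides are compared through their products with an arbitrary vector,
  where \<open>Gam_char\<close> and \<open>Dcm_tr\<close> apply.\<close>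

lemma Gam_tr:
  assumes y: "y \<in> VV i j"
  shows "Gam j (tr i j y) (Dtr i j y u) (Dtr i j y u) = Dtr i j y (Gam i y u u) - D2tr i j y u u"
proof (rule cm_eqI[OF j])
  show ty: "tr i j y \<in> V j" using tr_in[OF i j y] by auto
  fix \<zeta>
  have yi: "y \<in> V i" using y by auto
  \<comment> \<open>The derivative of the inverse transition inverts \<open>Dtr\<close>, so every
    test vector is the image of some \<open>z\<close>.\<close>
  define z where "z = Dtr j i (tr i j y) \<zeta>"
  have z: "Dtr i j y z = \<zeta>"
  proof -
    have "((\<lambda>x. tr i j (tr j i x)) has_derivative (\<lambda>v. Dtr i j (tr j i (tr i j y)) (Dtr j i (tr i j y) v))) (at (tr i j y))"
      by (rule has_derivative_compose[OF Dtr[OF j i tr_in[OF i j y]]])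
        (simp add: tr_tr[OF i j y] Dtr[OF i j y])
    moreover have "((\<lambda>x. tr i j (tr j i x)) has_derivative (\<lambda>v. v)) (at (tr i j y))"
      by (rule has_derivative_transform_within_open[OF has_derivative_ident open_VV[OF j i] tr_in[OF i j y]])
        (simp add: tr_tr[OF j i])
    ultimately have "(\<lambda>v. Dtr i j (tr j i (tr i j y)) (Dtr j i (tr i j y) v)) = (\<lambda>v. v)"
      by (rule has_derivative_unique)
    from fun_cong[OF this, of \<zeta>] show ?thesis by (simp add: z_def tr_tr[OF i j y])
  qed
  note s = cm_sym[OF j ty]
  have "cm j (tr i j y) (Dtr i j y (Gam i y u u)) (Dtr i j y z) = koszul i y u u z"
    using Gam_char[OF i yi] cm_tr[OF i j y] by metis
  also have "\<dots> = Dcm i y u z u - Dcm i y u u z / 2" unfolding koszul_def[OF i] by (simp add: field_simps)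
  \<comment> \<open>The two terms with the mixed second derivative of the transition map cancel
    because that derivative is symmetric.\<close>
  also have "\<dots> = koszul j (tr i j y) (Dtr i j y u) (Dtr i j y u) (Dtr i j y z)
      + cm j (tr i j y) (D2tr i j y u u) (Dtr i j y z)"
    unfolding Dcm_tr[OF y] koszul_def[OF j] s[of "Dtr i j y u"] D2tr_sym[OF i j y, of z u]
    by (simp add: field_simps s[of "Dtr i j y u"])
  finally show "cm j (tr i j y) (Gam j (tr i j y) (Dtr i j y u) (Dtr i j y u)) \<zeta> =
      cm j (tr i j y) (Dtr i j y (Gam i y u u) - D2tr i j y u u) \<zeta>"
    unfolding Gam_char[OF j ty] z[symmetric] by (simp add: bilinear_lsub[OF cm_bilinear[OF j ty]])
qed

text \<open>The tangent map of the transition function, acting on position and velocity.\<close>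

definition "Ttr z = (tr i j (fst z), Dtr i j (fst z) (snd z))"

text \<open>The second derivative of the transition map, which appears when the transformed velocity
  is differentiated, is the inhomogeneous term of \<open>Gam_tr\<close>; hence integral curves go to
  integral curves.\<close>

lemma spray_Ttr:
  assumes z: "(z has_vector_derivative spray i (z t)) (at t)" and zt: "fst (z t) \<in> VV i j"
  shows "((\<lambda>s. Ttr (z s)) has_vector_derivative spray j (Ttr (z t))) (at t)"
proof -
  let ?x = "\<lambda>s. fst (z s)" and ?u = "\<lambda>s. snd (z s)"
  let ?y = "fst (z t)"
  have x: "(?x has_vector_derivative ?u t) (at t)"
    using bounded_linear.has_vector_derivative[OF bounded_linear_fst z] by (simp add: spray_def)
  have u: "(?u has_vector_derivative - Gam i (?x t) (?u t) (?u t)) (at t)"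
    using bounded_linear.has_vector_derivative[OF bounded_linear_snd z] by (simp add: spray_def)
  have 1: "((\<lambda>s. tr i j (?x s)) has_vector_derivative Dtr i j ?y (?u t)) (at t)"
    using has_derivative_compose[OF x[unfolded has_vector_derivative_def] Dtr[OF i j zt]]
    by (simp add: has_vector_derivative_def linear_scale[OF Dtr_linear[OF i j zt]])
  \<comment> \<open>\<open>Dtr\<close> is linear in one vector only; the dummy real slot, filled
    with 1, turns it into a bilinear field so that the product rule applies.\<close>
  let ?B = "\<lambda>y v (r::real). r *\<^sub>R Dtr i j y v"
  have fr: "frechet_derivative (\<lambda>y. 1 *\<^sub>R Dtr i j y (?u t)) (at ?y) = D2tr i j ?y (?u t)"
    by (simp add: D2tr_def[OF i j])
  have "((\<lambda>s. ?B (?x s) (?u s) 1) has_derivative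
     (\<lambda>h. frechet_derivative (\<lambda>y. 1 *\<^sub>R Dtr i j y (?u t)) (at ?y) (h *\<^sub>R ?u t)
       + ?B ?y (h *\<^sub>R (- Gam i (?x t) (?u t) (?u t))) 1 + ?B ?y (?u t) 0)) (at t)"
    by (rule has_derivative_bilinear_field[OF open_VV[OF i j] _ _ zt x[unfolded has_vector_derivative_def]
          u[unfolded has_vector_derivative_def] has_derivative_const])
      (auto simp: bilinear_def intro!: linearI smooth_on_linear_image[OF bounded_linear_scaleR_right open_VV[OF i j]]
        smooth_on_deriv[OF tr_smooth[OF i j]]
        simp: linear_add[OF Dtr_linear[OF i j]] linear_scale[OF Dtr_linear[OF i j]] algebra_simps)
  then have 2: "((\<lambda>s. Dtr i j (?x s) (?u s)) has_vector_derivative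
      D2tr i j ?y (?u t) (?u t) - Dtr i j ?y (Gam i ?y (?u t) (?u t))) (at t)"
    unfolding fr has_vector_derivative_def
    by (simp add: linear_scale[OF Dtr_linear[OF i j zt]] linear_neg[OF Dtr_linear[OF i j zt]]
        linear_scale[OF has_derivative_linear[OF D2tr[OF i j zt]]] algebra_simps)
  show ?thesis
    using has_vector_derivative_Pair[OF 1 2]
    by (simp add: Ttr_def spray_def Gam_tr[OF zt])
qed

end

end

section \<open>Geodesics as local solutions of the spray equation\<close>

lemma open_real_ball_ex:
  fixes T :: "real set"
  assumes "open T" "t \<in> T"
  obtains e where "e > 0" "\<And>s. \<bar>s - t\<bar> < e \<Longrightarrow> s \<in> T"
  using assms unfolding open_dist by (metis dist_real_def)

lemma continuous_near:
  fixes x :: "real \<Rightarrow> 'a::topological_space"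
  assumes "isCont x t" "open S" "x t \<in> S"
  obtains e where "e > 0" "\<And>s. \<bar>s - t\<bar> < e \<Longrightarrow> x s \<in> S"
proof -
  have "\<forall>\<^sub>F s in nhds t. x s \<in> S"
    using assms by (simp add: continuous_at_open eventually_nhds)
  then show ?thesis using that unfolding eventually_nhds_metric by (metis dist_real_def)
qed

lemma has_vector_derivative_transform_near:
  fixes x :: "real \<Rightarrow> 'a::real_normed_vector"
  assumes "(x has_vector_derivative x') (at t)" "e > 0" "\<And>s. \<bar>s - t\<bar> < e \<Longrightarrow> x s = y s"
  shows "(y has_vector_derivative x') (at t)"
  by (rule has_vector_derivative_transform_within_open[OF assms(1), of "ball t e"])
    (use assms in \<open>auto simp: dist_real_def abs_minus_commute\<close>)

context riemannian
begin

definition "gstate i \<gamma> t = (coord F i (\<gamma> t), velocity F \<gamma> i t)"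

text \<open>Near \<open>t\<close> the curve is a geodesic, as seen in one chart; by \<open>germ_chart\<close> below the chart is irrelevant.\<close>

definition "geo_germ \<gamma> t \<longleftrightarrow> (\<exists>i\<in>charts F. \<exists>e>0. \<exists>z. \<forall>s. \<bar>s - t\<bar> < e \<longrightarrow>
   fst (z s) \<in> V i \<and> \<gamma> s = chart_inv F i (fst (z s)) \<and> (z has_vector_derivative spray i (z s)) (at s))"

text \<open>The first component of the spray is the velocity, so an integral curve is determined by
  its base curve: it must be the position and velocity of \<gamma>.\<close>

lemma gstate_eqI:
  assumes i: "i \<in> charts F"
    and z: "\<And>s. \<bar>s - t\<bar> < e \<Longrightarrow> fst (z s) \<in> V i"
    "\<And>s. \<bar>s - t\<bar> < e \<Longrightarrow> \<gamma> s = chart_inv F i (fst (z s))"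
    "\<And>s. \<bar>s - t\<bar> < e \<Longrightarrow> (z has_vector_derivative spray i (z s)) (at s)"
    and s: "\<bar>s - t\<bar> < e"
  shows "gstate i \<gamma> s = z s" "(gstate i \<gamma> has_vector_derivative spray i (gstate i \<gamma> s)) (at s)" "\<gamma> s \<in> cdom F i"
proof -
  have g: "gstate i \<gamma> r = z r" if r: "\<bar>r - t\<bar> < e" for r
  proof -
    have c: "coord F i (\<gamma> q) = fst (z q)" if "\<bar>q - t\<bar> < e" for q
      using z(1,2)[OF that] coord_chart_inv[OF i] by simp
    have "((\<lambda>s. fst (z s)) has_vector_derivative snd (z r)) (at r)"
      using bounded_linear.has_vector_derivative[OF bounded_linear_fst z(3)[OF r]] by (simp add: spray_def)
    then have "((\<lambda>s. coord F i (\<gamma> s)) has_vector_derivative snd (z r)) (at r)"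
      by (rule has_vector_derivative_transform_near[where e="e - \<bar>r - t\<bar>"]) (use r c in auto)
    then show ?thesis using c[OF r] vector_derivative_at
      by (auto simp: gstate_def velocity_def prod_eq_iff)
  qed
  show "gstate i \<gamma> s = z s" by (rule g[OF s])
  show "(gstate i \<gamma> has_vector_derivative spray i (gstate i \<gamma> s)) (at s)"
    unfolding g[OF s]
    by (rule has_vector_derivative_transform_near[OF z(3)[OF s], where e="e - \<bar>s - t\<bar>"]) (use s g in auto)
  show "\<gamma> s \<in> cdom F i" using z(1,2)[OF s] chart_inv_in[OF i] by simp
qed

text \<open>The tangent map of the transition function carries the spray of one chart to that of
  another, so a germ can be read in any chart around the point.\<close>

lemma germ_chart:
  assumes "geo_germ \<gamma> t" and j: "j \<in> charts F" and tj: "\<gamma> t \<in> cdom F j"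
  obtains e where "e > 0" "\<And>s. \<bar>s - t\<bar> < e \<Longrightarrow> \<gamma> s \<in> cdom F j"
    "\<And>s. \<bar>s - t\<bar> < e \<Longrightarrow> (gstate j \<gamma> has_vector_derivative spray j (gstate j \<gamma> s)) (at s)"
proof -
  obtain i e z where i: "i \<in> charts F" and e: "e > 0" and
    z: "\<And>s. \<bar>s - t\<bar> < e \<Longrightarrow> fst (z s) \<in> V i" "\<And>s. \<bar>s - t\<bar> < e \<Longrightarrow> \<gamma> s = chart_inv F i (fst (z s))"
     "\<And>s. \<bar>s - t\<bar> < e \<Longrightarrow> (z has_vector_derivative spray i (z s)) (at s)"
    using assms(1) unfolding geo_germ_def by blast
  have "isCont z t" using z(3)[of t] e has_vector_derivative_continuous by auto
  then have "isCont (\<lambda>s. fst (z s)) t" by (rule isCont_fst)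
  moreover have "fst (z t) \<in> VV i j" using z(1,2)[of t] e tj by (auto simp: VV_eq[OF i j])
  ultimately obtain d where d: "d > 0" "\<And>s. \<bar>s - t\<bar> < d \<Longrightarrow> fst (z s) \<in> VV i j"
    using continuous_near[OF _ open_VV[OF i j]] by blast
  define e' where "e' = min d e"
  have e': "e' > 0" using d e by (simp add: e'_def)
  have T: "fst (Ttr i j (z s)) \<in> V j" "\<gamma> s = chart_inv F j (fst (Ttr i j (z s)))"
    "((\<lambda>s. Ttr i j (z s)) has_vector_derivative spray j (Ttr i j (z s))) (at s)" if s: "\<bar>s - t\<bar> < e'" for s
  proof -
    have v: "fst (z s) \<in> VV i j" using d(2) s by (simp add: e'_def)
    show "fst (Ttr i j (z s)) \<in> V j" using tr_in[OF i j v] by (auto simp: Ttr_def[OF i j])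
    show "\<gamma> s = chart_inv F j (fst (Ttr i j (z s)))" using z(2) s chart_inv_tr[OF i j v] by (simp add: Ttr_def[OF i j] e'_def)
    show "((\<lambda>s. Ttr i j (z s)) has_vector_derivative spray j (Ttr i j (z s))) (at s)"
      by (rule spray_Ttr[OF i j z(3) v]) (use s in \<open>auto simp: e'_def\<close>)
  qed
  show ?thesis by (rule that[OF e']) (use gstate_eqI[OF j T] in blast)+
qed

lemma germ_gstate_deriv:
  assumes "geo_germ \<gamma> t" "i \<in> charts F" "\<gamma> t \<in> cdom F i"
  shows "(gstate i \<gamma> has_vector_derivative spray i (gstate i \<gamma> t)) (at t)"
proof -
  obtain e where e: "e > 0" "\<And>s. \<bar>s - t\<bar> < e \<Longrightarrow> \<gamma> s \<in> cdom F i"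
    "\<And>s. \<bar>s - t\<bar> < e \<Longrightarrow> (gstate i \<gamma> has_vector_derivative spray i (gstate i \<gamma> s)) (at s)"
    using germ_chart[OF assms] by blast
  show ?thesis using e(1) e(3)[of t] by simp
qed

section \<open>Elementary properties and uniqueness of geodesics\<close>

lemma germ_cong:
  assumes "geo_germ \<gamma> t" "d > 0" "\<And>s. \<bar>s - t\<bar> < d \<Longrightarrow> \<gamma> s = \<beta> s"
  shows "geo_germ \<beta> t"
proof -
  obtain i e z where i: "i \<in> charts F" and e: "e > 0" and
    z: "\<And>s. \<bar>s - t\<bar> < e \<Longrightarrow> fst (z s) \<in> V i \<and> \<gamma> s = chart_inv F i (fst (z s)) \<and> (z has_vector_derivative spray i (z s)) (at s)"
    using assms(1) unfolding geo_germ_def by blast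
  show ?thesis unfolding geo_germ_def
  proof (rule bexI[OF _ i], intro exI conjI allI impI)
    fix s assume s: "\<bar>s - t\<bar> < min d e"
    show "fst (z s) \<in> V i" "(z has_vector_derivative spray i (z s)) (at s)" using z[of s] s by auto
    show "\<beta> s = chart_inv F i (fst (z s))" using z[of s] assms(3)[of s] s by simp
  qed (use assms(2) e in simp)
qed

lemma germ_in: "geo_germ \<gamma> t \<Longrightarrow> \<gamma> t \<in> mcarrier F"
proof -
  assume "geo_germ \<gamma> t"
  then obtain i e z where i: "i \<in> charts F" and e: "e > (0::real)" and
    z: "\<And>s. \<bar>s - t\<bar> < e \<Longrightarrow> fst (z s) \<in> V i \<and> \<gamma> s = chart_inv F i (fst (z s)) \<and> (z has_vector_derivative spray i (z s)) (at s)"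
    unfolding geo_germ_def by blast
  then have "\<gamma> t \<in> cdom F i" using z[of t] chart_inv_in[OF i] by auto
  then show ?thesis using i by (auto simp: mcarrier_def)
qed

lemma germ_obtain_chart:
  assumes "geo_germ \<gamma> t"
  obtains i where "i \<in> charts F" "\<gamma> t \<in> cdom F i"
  using germ_in[OF assms] unfolding mcarrier_def by blast

lemma germ_isCont:
  assumes "geo_germ \<gamma> t" shows "isCont \<gamma> t"
proof -
  obtain i where i: "i \<in> charts F" "\<gamma> t \<in> cdom F i" using germ_obtain_chart[OF assms] .
  obtain e where e: "e > 0" "\<And>s. \<bar>s - t\<bar> < e \<Longrightarrow> \<gamma> s \<in> cdom F i"
    "\<And>s. \<bar>s - t\<bar> < e \<Longrightarrow> (gstate i \<gamma> has_vector_derivative spray i (gstate i \<gamma> s)) (at s)"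
    using germ_chart[OF assms i] by blast
  have "isCont (gstate i \<gamma>) t" using e(3)[of t] e(1) has_vector_derivative_continuous by auto
  then have c: "isCont (\<lambda>s. coord F i (\<gamma> s)) t" using isCont_fst by (fastforce simp: gstate_def)
  have "isCont (\<lambda>s. chart_inv F i (coord F i (\<gamma> s))) t"
    by (rule isCont_o2[OF c]) (use cont_chart_inv[OF i(1)] open_V[OF i(1)] i(2) continuous_on_eq_continuous_at in blast)
  moreover have "\<forall>\<^sub>F s in nhds t. chart_inv F i (coord F i (\<gamma> s)) = \<gamma> s"
    unfolding eventually_nhds_metric by (rule exI[of _ e]) (use e chart_inv_coord[OF i(1)] in \<open>auto simp: dist_real_def\<close>)
  ultimately show ?thesis by (simp only: isCont_cong)
qed

lemma open_VU: "i \<in> charts F \<Longrightarrow> open (V i \<times> (UNIV :: (real ^ 'n) set))"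
  using open_V by (simp add: open_Times)

lemma germ_smooth:
  assumes "open J" "\<And>t. t \<in> J \<Longrightarrow> geo_germ \<gamma> t" "i \<in> charts F"
  shows "smooth_on {t\<in>J. \<gamma> t \<in> cdom F i} (gstate i \<gamma>)"
proof (rule smooth_on_local)
  fix t assume t: "t \<in> {t\<in>J. \<gamma> t \<in> cdom F i}"
  obtain e where e: "e > 0" "\<And>s. \<bar>s - t\<bar> < e \<Longrightarrow> \<gamma> s \<in> cdom F i"
    "\<And>s. \<bar>s - t\<bar> < e \<Longrightarrow> (gstate i \<gamma> has_vector_derivative spray i (gstate i \<gamma> s)) (at s)"
    using germ_chart[OF assms(2) assms(3)] t by (metis (no_types, lifting) mem_Collect_eq)
  have "smooth_on (ball t e) (gstate i \<gamma>)"
    by (rule smooth_on_ode[OF open_ball open_VU[OF assms(3)] spray_smooth[OF assms(3)]])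
      (use e in \<open>auto simp: dist_real_def abs_minus_commute gstate_def\<close>)
  then show "\<exists>T. open T \<and> t \<in> T \<and> smooth_on T (gstate i \<gamma>)"
    using e(1) by (intro exI[of _ "ball t e"]) auto
qed

lemma germ_preimage_open:
  assumes "open J" "\<And>t. t \<in> J \<Longrightarrow> geo_germ \<gamma> t" "open S"
  shows "open {t\<in>J. \<gamma> t \<in> S}"
proof -
  have "continuous_on J \<gamma>" using assms germ_isCont continuous_at_imp_continuous_on by blast
  moreover have "{t\<in>J. \<gamma> t \<in> S} = J \<inter> \<gamma> -` S" by auto
  ultimately show ?thesis using continuous_open_preimage[OF _ assms(1,3)] by simp
qed

lemma germ_unique_local:
  assumes "geo_germ \<gamma> t" "geo_germ \<beta> t" "i \<in> charts F" "\<gamma> t \<in> cdom F i" "\<gamma> t = \<beta> t" "gstate i \<gamma> t = gstate i \<beta> t"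
  obtains e where "e > 0" "\<And>s. \<bar>s - t\<bar> < e \<Longrightarrow> \<gamma> s = \<beta> s"
proof -
  obtain e1 where e1: "e1 > 0" "\<And>s. \<bar>s - t\<bar> < e1 \<Longrightarrow> \<gamma> s \<in> cdom F i"
    "\<And>s. \<bar>s - t\<bar> < e1 \<Longrightarrow> (gstate i \<gamma> has_vector_derivative spray i (gstate i \<gamma> s)) (at s)"
    using germ_chart[OF assms(1,3,4)] by blast
  obtain e2 where e2: "e2 > 0" "\<And>s. \<bar>s - t\<bar> < e2 \<Longrightarrow> \<beta> s \<in> cdom F i"
    "\<And>s. \<bar>s - t\<bar> < e2 \<Longrightarrow> (gstate i \<beta> has_vector_derivative spray i (gstate i \<beta> s)) (at s)"
    using germ_chart[OF assms(2,3)] assms(4,5) by metis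
  have "gstate i \<gamma> t \<in> V i \<times> UNIV" using assms(4) by (auto simp: gstate_def)
  then obtain e where e: "e > 0" "e \<le> min e1 e2" "\<And>s. \<bar>s - t\<bar> < e \<Longrightarrow> gstate i \<gamma> s = gstate i \<beta> s"
    using ode_unique_local[OF open_VU[OF assms(3)] spray_smooth[OF assms(3)], of "gstate i \<gamma>" t "gstate i \<beta>" "min e1 e2"]
      assms(6) e1 e2 by (metis min_less_iff_conj)
  show ?thesis
  proof (rule that[OF e(1)])
    fix s assume s: "\<bar>s - t\<bar> < e"
    have "coord F i (\<gamma> s) = coord F i (\<beta> s)" using e(3)[OF s] by (simp add: gstate_def)
    moreover have "\<gamma> s \<in> cdom F i" "\<beta> s \<in> cdom F i" using e1(2)[of s] e2(2)[of s] s e(2) by auto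
    ultimately show "\<gamma> s = \<beta> s" using chart_inv_coord[OF assms(3)] by metis
  qed
qed

lemma gstate_cong:
  assumes "d > 0" "\<And>s. \<bar>s - t\<bar> < d \<Longrightarrow> \<gamma> s = \<beta> s"
  shows "gstate i \<gamma> t = gstate i \<beta> t"
proof -
  have 1: "((\<lambda>s. coord F i (\<gamma> s)) has_vector_derivative v) (at t) \<longleftrightarrow> ((\<lambda>s. coord F i (\<beta> s)) has_vector_derivative v) (at t)" for v
    using has_vector_derivative_transform_near[OF _ assms(1), of "\<lambda>s. coord F i (\<gamma> s)" v t "\<lambda>s. coord F i (\<beta> s)"]
      has_vector_derivative_transform_near[OF _ assms(1), of "\<lambda>s. coord F i (\<beta> s)" v t "\<lambda>s. coord F i (\<gamma> s)"] assms(2)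
    by auto
  show ?thesis using assms by (simp add: gstate_def velocity_def vector_derivative_def 1)
qed

text \<open>The set of parameters around which the curves agree is open and relatively closed in
  \<open>J\<close>. Agreement is required on a neighbourhood so that the velocities are compared
  too.\<close>

lemma germ_unique:
  assumes J: "open J" "connected J" "t0 \<in> J" and g: "\<And>t. t \<in> J \<Longrightarrow> geo_germ \<gamma> t" and b: "\<And>t. t \<in> J \<Longrightarrow> geo_germ \<beta> t"
    and i: "i \<in> charts F" "\<gamma> t0 \<in> cdom F i" "\<gamma> t0 = \<beta> t0" "gstate i \<gamma> t0 = gstate i \<beta> t0" and t: "t \<in> J"
  shows "\<gamma> t = \<beta> t"
proof -
  define A where "A = {t\<in>J. \<exists>e>0. \<forall>s. \<bar>s - t\<bar> < e \<longrightarrow> \<gamma> s = \<beta> s}"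
  have "t0 \<in> A"
  proof -
    obtain e where "e > 0" "\<And>s. \<bar>s - t0\<bar> < e \<Longrightarrow> \<gamma> s = \<beta> s"
      using germ_unique_local[OF g[OF J(3)] b[OF J(3)] i] by blast
    then show ?thesis using J(3) unfolding A_def by blast
  qed
  have oA: "open A" unfolding open_dist
  proof (intro ballI)
    fix t assume "t \<in> A"
    then obtain e where e: "e > 0" "\<And>s. \<bar>s - t\<bar> < e \<Longrightarrow> \<gamma> s = \<beta> s" and tJ: "t \<in> J" unfolding A_def by blast
    obtain d where d: "d > 0" "\<And>s. \<bar>s - t\<bar> < d \<Longrightarrow> s \<in> J" using open_real_ball_ex[OF J(1) tJ] by blast
    have "s \<in> A" if "\<bar>s - t\<bar> < min d e" for s
      unfolding A_def using that d(2) by (auto intro!: exI[of _ "e - \<bar>s - t\<bar>"] e(2))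
    then show "\<exists>e>0. \<forall>y. dist y t < e \<longrightarrow> y \<in> A" using d(1) e(1) by (intro exI[of _ "min d e"]) (auto simp: dist_real_def)
  qed
  \<comment> \<open>At a limit of parameters of agreement the positions agree because the space is
    Hausdorff, and the states agree by continuity in a chart; local uniqueness then gives agreement
    around the limit.\<close>
  have oB: "open (J - A)" unfolding open_dist
  proof (intro ballI)
    fix t assume t: "t \<in> J - A"
    show "\<exists>e>0. \<forall>y. dist y t < e \<longrightarrow> y \<in> J - A"
    proof (rule ccontr)
      assume neg: "\<not> (\<exists>e>0. \<forall>y. dist y t < e \<longrightarrow> y \<in> J - A)"
      obtain d where d: "d > 0" "\<And>s. \<bar>s - t\<bar> < d \<Longrightarrow> s \<in> J" using open_real_ball_ex[OF J(1), of t] t by blast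
      have acc: "\<exists>s. \<bar>s - t\<bar> < e \<and> s \<in> A" if "e > 0" for e
      proof -
        have "min d e > 0" using d(1) that by simp
        then obtain s where s: "dist s t < min d e" "s \<notin> J - A" using neg by blast
        then show ?thesis using d(2)[of s] by (auto simp: dist_real_def)
      qed
      have tJ: "t \<in> J" using t by blast
      have cg: "isCont \<gamma> t" "isCont \<beta> t" by (rule germ_isCont[OF g[OF tJ]], rule germ_isCont[OF b[OF tJ]])
      have eq: "\<gamma> t = \<beta> t"
      proof (rule ccontr)
        assume ne: "\<gamma> t \<noteq> \<beta> t"
        obtain P Q where PQ: "open P" "open Q" "\<gamma> t \<in> P" "\<beta> t \<in> Q" "P \<inter> Q = {}"
          using hausdorff[OF ne] by blast
        obtain e1 where e1: "e1 > 0" "\<And>s. \<bar>s - t\<bar> < e1 \<Longrightarrow> \<gamma> s \<in> P" using continuous_near[OF cg(1) PQ(1,3)] by blast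
        obtain e2 where e2: "e2 > 0" "\<And>s. \<bar>s - t\<bar> < e2 \<Longrightarrow> \<beta> s \<in> Q" using continuous_near[OF cg(2) PQ(2,4)] by blast
        obtain s where s: "\<bar>s - t\<bar> < min e1 e2" "s \<in> A" using acc[of "min e1 e2"] e1 e2 by auto
        have "\<gamma> s = \<beta> s" using s(2) unfolding A_def by auto
        then show False using e1(2)[of s] e2(2)[of s] s(1) PQ(5) by auto
      qed
      obtain i where i: "i \<in> charts F" "\<gamma> t \<in> cdom F i" using germ_obtain_chart[OF g[OF tJ]] by blast
      have c: "isCont (\<lambda>s. gstate i \<gamma> s - gstate i \<beta> s) t"
        by (rule isCont_diff[OF has_vector_derivative_continuous[OF germ_gstate_deriv[OF g[OF tJ] i]]
              has_vector_derivative_continuous[OF germ_gstate_deriv[OF b[OF tJ] i(1) i(2)[unfolded eq]]]])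
      have st: "gstate i \<gamma> t = gstate i \<beta> t"
      proof (rule ccontr)
        assume "gstate i \<gamma> t \<noteq> gstate i \<beta> t"
        then have "gstate i \<gamma> t - gstate i \<beta> t \<in> - {0}" by simp
        then obtain e where e: "e > 0" "\<And>s. \<bar>s - t\<bar> < e \<Longrightarrow> gstate i \<gamma> s - gstate i \<beta> s \<in> - {0}"
          using continuous_near[OF c, of "- {0}"] by blast
        obtain s where s: "\<bar>s - t\<bar> < e" "s \<in> A" using acc[OF e(1)] by auto
        then obtain e' where "e' > 0" "\<And>r. \<bar>r - s\<bar> < e' \<Longrightarrow> \<gamma> r = \<beta> r" unfolding A_def by blast
        then show False using gstate_cong[of e' s \<gamma> \<beta> i] e(2)[OF s(1)] by simp
      qed
      obtain e where "e > 0" "\<And>s. \<bar>s - t\<bar> < e \<Longrightarrow> \<gamma> s = \<beta> s"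
        using germ_unique_local[OF g[OF tJ] b[OF tJ] i eq st] by blast
      then have "t \<in> A" using tJ unfolding A_def by blast
      then show False using t by blast
    qed
  qed
  have "J \<subseteq> A"
  proof (rule ccontr)
    assume "\<not> J \<subseteq> A"
    then have "A \<inter> J \<noteq> {}" "(J - A) \<inter> J \<noteq> {}" using \<open>t0 \<in> A\<close> J(3) by auto
    then show False using connectedD[OF J(2) oA oB] by blast
  qed
  then have "t \<in> A" using t by blast
  then show ?thesis unfolding A_def by auto
qed

end

section \<open>Extension of geodesics\<close>

context riemannian
begin

section \<open>Conservation of energy and affine reparametrisation\<close>

definition "energy i z = cm i (fst z) (snd z) (snd z)"

lemma gstate_tr:
  assumes i: "i \<in> charts F" and j: "j \<in> charts F" and g: "geo_germ \<gamma> t" and t: "\<gamma> t \<in> cdom F i \<inter> cdom F j"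
  shows "gstate j \<gamma> t = Ttr i j (gstate i \<gamma> t)"
proof -
  obtain e where e: "e > 0" "\<And>s. \<bar>s - t\<bar> < e \<Longrightarrow> \<gamma> s \<in> cdom F i \<inter> cdom F j"
    using continuous_near[OF germ_isCont[OF g] open_Int[OF open_cdom[OF i] open_cdom[OF j]] t] by blast
  have v: "coord F i (\<gamma> t) \<in> VV i j" using t by auto
  have "((\<lambda>s. coord F i (\<gamma> s)) has_vector_derivative velocity F \<gamma> i t) (at t)"
    using bounded_linear.has_vector_derivative[OF bounded_linear_fst germ_gstate_deriv[OF g i]] t
    by (simp add: spray_def gstate_def)
  from has_derivative_compose[OF this[unfolded has_vector_derivative_def] Dtr[OF i j v]]
  have "((\<lambda>s. tr i j (coord F i (\<gamma> s))) has_vector_derivative Dtr i j (coord F i (\<gamma> t)) (velocity F \<gamma> i t)) (at t)"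
    by (simp add: has_vector_derivative_def linear_scale[OF Dtr_linear[OF i j v]])
  then have "((\<lambda>s. coord F j (\<gamma> s)) has_vector_derivative Dtr i j (coord F i (\<gamma> t)) (velocity F \<gamma> i t)) (at t)"
    by (rule has_vector_derivative_transform_near[OF _ e(1)])
      (use e(2) chart_inv_coord[OF i] in \<open>simp add: tr_def\<close>)
  then show ?thesis
    using vector_derivative_at t chart_inv_coord[OF i] by (simp add: gstate_def velocity_def Ttr_def[OF i j] tr_def)
qed

lemma energy_tr:
  assumes i: "i \<in> charts F" and j: "j \<in> charts F" and g: "geo_germ \<gamma> t" and t: "\<gamma> t \<in> cdom F i \<inter> cdom F j"
  shows "energy j (gstate j \<gamma> t) = energy i (gstate i \<gamma> t)"
proof -
  have v: "coord F i (\<gamma> t) \<in> VV i j" using t by auto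
  show ?thesis unfolding gstate_tr[OF assms] energy_def Ttr_def[OF i j]
    by (simp add: gstate_def cm_tr[OF i j v])
qed

lemma energy_has_derivative:
  assumes i: "i \<in> charts F" and z: "fst z \<in> V i"
  shows "(energy i has_derivative (\<lambda>k. Dcm i (fst z) (snd z) (snd z) (fst k) + 2 * cm i (fst z) (snd z) (snd k))) (at z)"
proof -
  have "((\<lambda>z. cm i (fst z) (snd z) (snd z)) has_derivative (\<lambda>k. Dcm i (fst z) (snd z) (snd z) (fst k) +
      cm i (fst z) (snd k) (snd z) + cm i (fst z) (snd z) (snd k))) (at z)"
    by (rule has_derivative_bilinear_field[where p=fst and v=snd and w=snd and x=z,
          OF open_V[OF i] cm_bilinear[OF i] cm_smooth[OF i] z])
      (assumption | rule bounded_linear_imp_has_derivative bounded_linear_fst bounded_linear_snd)+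
  moreover have "Dcm i (fst z) (snd z) (snd z) (fst k) + cm i (fst z) (snd k) (snd z) + cm i (fst z) (snd z) (snd k) =
      Dcm i (fst z) (snd z) (snd z) (fst k) + 2 * cm i (fst z) (snd z) (snd k)" for k
    using cm_sym[OF i z, of "snd k" "snd z"] by linarith
  ultimately show ?thesis unfolding energy_def[abs_def] by simp
qed

text \<open>The derivative of the energy along the spray vanishes: testing \<open>Gam_char\<close>
  with the velocity itself leaves half the derivative of the metric.\<close>

lemma energy_spray:
  assumes i: "i \<in> charts F" and z: "fst z \<in> V i"
  shows "Dcm i (fst z) (snd z) (snd z) (fst (spray i z)) + 2 * cm i (fst z) (snd z) (snd (spray i z)) = 0"
  using Gam_char[OF i z, of "snd z" "snd z" "snd z"] cm_sym[OF i z]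
  by (simp add: spray_def bilinear_rneg[OF cm_bilinear[OF i z]] koszul_def[OF i])

text \<open>A chart is chosen at each parameter. By invariance of the energy the resulting function
  is locally the energy in one fixed chart, so its derivative is 0 everywhere.\<close>

lemma energy_const:
  assumes g: "\<And>t. t \<in> {\<alpha><..<\<beta>} \<Longrightarrow> geo_germ \<gamma> t" and s: "s \<in> {\<alpha><..<\<beta>}" and t: "t \<in> {\<alpha><..<\<beta>}"
    and i: "i \<in> charts F" "\<gamma> s \<in> cdom F i" and j: "j \<in> charts F" "\<gamma> t \<in> cdom F j"
  shows "energy i (gstate i \<gamma> s) = energy j (gstate j \<gamma> t)"
proof -
  define ch where "ch t = (SOME i. i \<in> charts F \<and> \<gamma> t \<in> cdom F i)" for t
  have ch: "ch t \<in> charts F" "\<gamma> t \<in> cdom F (ch t)" if "t \<in> {\<alpha><..<\<beta>}" for t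
    using someI_ex[of "\<lambda>i. i \<in> charts F \<and> \<gamma> t \<in> cdom F i"] germ_obtain_chart[OF g[OF that]]
    unfolding ch_def by blast+
  define E where "E t = energy (ch t) (gstate (ch t) \<gamma> t)" for t
  have E: "E t = energy i (gstate i \<gamma> t)" if "t \<in> {\<alpha><..<\<beta>}" "i \<in> charts F" "\<gamma> t \<in> cdom F i" for i t
    unfolding E_def by (rule energy_tr[OF that(2) ch(1)[OF that(1)] g[OF that(1)]]) (use that ch(2)[OF that(1)] in auto)
  have "(E has_real_derivative 0) (at t)" if t: "t \<in> {\<alpha><..<\<beta>}" for t
  proof -
    let ?i = "ch t"
    note c = ch[OF t]
    obtain e where e: "e > 0" "\<And>s. \<bar>s - t\<bar> < e \<Longrightarrow> s \<in> {\<alpha><..<\<beta>}"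
      using open_real_ball_ex[OF open_greaterThanLessThan t] by blast
    obtain d where d: "d > 0" "\<And>s. \<bar>s - t\<bar> < d \<Longrightarrow> \<gamma> s \<in> cdom F ?i"
      using continuous_near[OF germ_isCont[OF g[OF t]] open_cdom[OF c(1)] c(2)] by blast
    have v: "fst (gstate ?i \<gamma> t) \<in> V ?i" using c(2) by (simp add: gstate_def)
    have "((\<lambda>s. energy ?i (gstate ?i \<gamma> s)) has_derivative (\<lambda>h. h * 0)) (at t)"
      by (rule has_derivative_eq_rhs[OF has_derivative_compose[OF
            germ_gstate_deriv[OF g[OF t] c, unfolded has_vector_derivative_def] energy_has_derivative[OF c(1) v]]])
        (use energy_spray[OF c(1) v] in \<open>auto simp: fun_eq_iff linear_scale[OF Dcm_linear[OF c(1) v]]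
            bilinear_rmul[OF cm_bilinear[OF c(1) v]] algebra_simps distrib_left[symmetric]\<close>)
    then have "((\<lambda>s. energy ?i (gstate ?i \<gamma> s)) has_vector_derivative 0) (at t)"
      by (simp add: has_vector_derivative_def)
    then have "(E has_vector_derivative 0) (at t)"
      by (rule has_vector_derivative_transform_near[where e="min d e"])
        (use d e c E in \<open>auto\<close>)
    then show ?thesis by (simp add: has_real_derivative_iff_has_vector_derivative)
  qed
  then have "E s = E t" using DERIV_isconst3[of \<alpha> \<beta> s t E] s t by auto
  then show ?thesis using E[OF s i] E[OF t j] by simp
qed

text \<open>The velocity is scaled by \<open>a\<close> and the spray is quadratic in it. The value
  -1 of \<open>a\<close> reverses a geodesic; general slopes are needed for causal curves that run
  back along it.\<close>

lemma germ_affine: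
  assumes "geo_germ \<gamma> (a * t + b)"
  shows "geo_germ (\<lambda>s. \<gamma> (a * s + b)) t"
proof -
  obtain i e z where i: "i \<in> charts F" and e: "e > (0::real)" and
    z: "\<And>s. \<bar>s - (a * t + b)\<bar> < e \<Longrightarrow> fst (z s) \<in> V i \<and> \<gamma> s = chart_inv F i (fst (z s)) \<and> (z has_vector_derivative spray i (z s)) (at s)"
    using assms(1) unfolding geo_germ_def by blast
  define y where "y s = (fst (z (a * s + b)), a *\<^sub>R snd (z (a * s + b)))" for s
  show ?thesis unfolding geo_germ_def
  proof (rule bexI[OF _ i], intro exI conjI allI impI)
    show "e / (\<bar>a\<bar> + 1) > 0" using e by simp
    fix s assume s: "\<bar>s - t\<bar> < e / (\<bar>a\<bar> + 1)"
    have "\<bar>a * s + b - (a * t + b)\<bar> = \<bar>a\<bar> * \<bar>s - t\<bar>" by (simp add: abs_mult[symmetric] algebra_simps)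
    also have "\<dots> \<le> (\<bar>a\<bar> + 1) * \<bar>s - t\<bar>" by (intro mult_right_mono) auto
    also have "\<dots> < e" using s by (simp add: field_simps)
    finally have r: "\<bar>a * s + b - (a * t + b)\<bar> < e" .
    note zz = z[OF r]
    have v: "fst (z (a * s + b)) \<in> V i" using zz by blast
    show "fst (y s) \<in> V i" "\<gamma> (a * s + b) = chart_inv F i (fst (y s))" using zz by (auto simp: y_def)
    have l: "((\<lambda>s. a * s + b) has_vector_derivative a) (at s)"
      by (auto intro!: derivative_eq_intros simp: has_real_derivative_iff_has_vector_derivative[symmetric])
    have "((\<lambda>s. z (a * s + b)) has_vector_derivative a *\<^sub>R spray i (z (a * s + b))) (at s)"
      using vector_diff_chain_at[OF l] zz by (auto simp: o_def)
    from has_vector_derivative_Pair[OF bounded_linear.has_vector_derivative[OF bounded_linear_fst this]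
        bounded_linear.has_vector_derivative[OF bounded_linear_scaleR_right[of a] bounded_linear.has_vector_derivative[OF bounded_linear_snd this]]]
    show "(y has_vector_derivative spray i (y s)) (at s)"
      by (simp add: y_def[abs_def] spray_def bilinear_lmul[OF Gam_bilinear[OF i v]] bilinear_rmul[OF Gam_bilinear[OF i v]])
  qed
qed

lemma gstate_affine:
  assumes g: "geo_germ \<gamma> (a * t + b)" and i: "i \<in> charts F" "\<gamma> (a * t + b) \<in> cdom F i"
  shows "gstate i (\<lambda>s. \<gamma> (a * s + b)) t = (coord F i (\<gamma> (a * t + b)), a *\<^sub>R velocity F \<gamma> i (a * t + b))"
proof -
  have "((\<lambda>s. coord F i (\<gamma> s)) has_vector_derivative velocity F \<gamma> i (a * t + b)) (at (a * t + b))"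
    using bounded_linear.has_vector_derivative[OF bounded_linear_fst germ_gstate_deriv[OF g i]]
    by (simp add: spray_def gstate_def)
  moreover have "((\<lambda>s. a * s + b) has_vector_derivative a) (at t)"
    by (auto intro!: derivative_eq_intros simp: has_real_derivative_iff_has_vector_derivative[symmetric])
  ultimately have "((\<lambda>s. coord F i (\<gamma> (a * s + b))) has_vector_derivative a *\<^sub>R velocity F \<gamma> i (a * t + b)) (at t)"
    using vector_diff_chain_at by (fastforce simp: o_def)
  then show ?thesis using vector_derivative_at by (auto simp: gstate_def velocity_def)
qed

text \<open>The flow of the spray read as geodesics started at an arbitrary parameter T; the time
  \<delta> is the same for all initial states in the ball.\<close>

lemma geodesic_local_flow:
  assumes i: "i \<in> charts F" and z0: "fst z0 \<in> V i"
  obtains r \<delta> \<phi> \<psi> where "r > 0" "\<delta> > 0"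
    "\<And>z. z \<in> ball z0 r \<Longrightarrow> \<phi> z 0 = z"
    "\<And>z t. z \<in> ball z0 r \<Longrightarrow> \<bar>t\<bar> < \<delta> \<Longrightarrow> ((\<lambda>z. \<phi> z t) has_derivative (\<lambda>w. \<psi> z w t)) (at z)"
    "\<And>w t. \<bar>t\<bar> < \<delta> \<Longrightarrow> continuous_on (ball z0 r) (\<lambda>z. \<psi> z w t)"
    "\<And>z w. z \<in> ball z0 r \<Longrightarrow> \<psi> z w 0 = w"
    "\<And>z w t. z \<in> ball z0 r \<Longrightarrow> \<bar>t\<bar> < \<delta> \<Longrightarrow>
       (\<psi> z w has_vector_derivative frechet_derivative (spray i) (at (\<phi> z t)) (\<psi> z w t)) (at t)"
    "\<And>z T s. z \<in> ball z0 r \<Longrightarrow> \<bar>s - T\<bar> < \<delta> \<Longrightarrow> geo_germ (\<lambda>s. chart_inv F i (fst (\<phi> z (s - T)))) s"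
    "\<And>z T s. z \<in> ball z0 r \<Longrightarrow> \<bar>s - T\<bar> < \<delta> \<Longrightarrow> gstate i (\<lambda>s. chart_inv F i (fst (\<phi> z (s - T)))) s = \<phi> z (s - T)"
    "\<And>z T s. z \<in> ball z0 r \<Longrightarrow> \<bar>s - T\<bar> < \<delta> \<Longrightarrow> chart_inv F i (fst (\<phi> z (s - T))) \<in> cdom F i"
proof -
  have z0': "z0 \<in> V i \<times> UNIV" using z0 by (cases z0) auto
  obtain r \<delta> \<phi> \<psi> where p: "r > 0" "\<delta> > 0" "ball z0 r \<subseteq> V i \<times> UNIV"
    "\<And>z. z \<in> ball z0 r \<Longrightarrow> \<phi> z 0 = z"
    "\<And>z t. z \<in> ball z0 r \<Longrightarrow> \<bar>t\<bar> < \<delta> \<Longrightarrow> \<phi> z t \<in> V i \<times> UNIV"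
    "\<And>z t. z \<in> ball z0 r \<Longrightarrow> \<bar>t\<bar> < \<delta> \<Longrightarrow> (\<phi> z has_vector_derivative spray i (\<phi> z t)) (at t)"
    "\<And>z t. z \<in> ball z0 r \<Longrightarrow> \<bar>t\<bar> < \<delta> \<Longrightarrow> ((\<lambda>z. \<phi> z t) has_derivative (\<lambda>w. \<psi> z w t)) (at z)"
    "\<And>w t. \<bar>t\<bar> < \<delta> \<Longrightarrow> continuous_on (ball z0 r) (\<lambda>z. \<psi> z w t)"
    "\<And>z w. z \<in> ball z0 r \<Longrightarrow> \<psi> z w 0 = w"
    "\<And>z w t. z \<in> ball z0 r \<Longrightarrow> \<bar>t\<bar> < \<delta> \<Longrightarrow>
       (\<psi> z w has_vector_derivative frechet_derivative (spray i) (at (\<phi> z t)) (\<psi> z w t)) (at t)"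
    by (rule smooth_local_flow[OF open_VU[OF i] spray_smooth[OF i] z0'], rule that)
  have d: "((\<lambda>s. \<phi> z (s - T)) has_vector_derivative spray i (\<phi> z (s - T))) (at s)"
    if "z \<in> ball z0 r" "\<bar>s - T\<bar> < \<delta>" for z s T
  proof -
    have "((\<lambda>s. s - T) has_vector_derivative 1) (at s)"
      by (auto intro!: derivative_eq_intros simp: has_real_derivative_iff_has_vector_derivative[symmetric])
    from vector_diff_chain_at[OF this p(6)[OF that]] show ?thesis by (simp add: o_def)
  qed
  have v: "fst (\<phi> z (s - T)) \<in> V i" if "z \<in> ball z0 r" "\<bar>s - T\<bar> < \<delta>" for z s T
    using p(5)[OF that] by (cases "\<phi> z (s - T)") auto
  note st = gstate_eqI[OF i, where \<gamma>="\<lambda>s. chart_inv F i (fst (\<phi> z (s - T)))" and z="\<lambda>s. \<phi> z (s - T)" and t=T and e=\<delta> for z T,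
      OF v refl d]
  have g: "geo_germ (\<lambda>s. chart_inv F i (fst (\<phi> z (s - T)))) s" if zs: "z \<in> ball z0 r" "\<bar>s - T\<bar> < \<delta>" for z s T
    unfolding geo_germ_def
  proof (rule bexI[OF _ i], intro exI conjI allI impI)
    show "\<delta> - \<bar>s - T\<bar> > 0" using zs by simp
    fix q assume "\<bar>q - s\<bar> < \<delta> - \<bar>s - T\<bar>"
    then have q: "\<bar>q - T\<bar> < \<delta>" by simp
    show "fst (\<phi> z (q - T)) \<in> V i" by (rule v[OF zs(1) q])
    show "((\<lambda>s. \<phi> z (s - T)) has_vector_derivative spray i (\<phi> z (q - T))) (at q)" by (rule d[OF zs(1) q])
  qed (rule refl)
  show ?thesis
    by (rule that[OF p(1,2,4,7,8,9,10) g st(1,3)])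
qed

section \<open>Extension of a geodesic beyond a finite end\<close>

lemma germ_glue:
  assumes c: "\<And>t. t \<in> {\<alpha><..<\<beta>} \<Longrightarrow> geo_germ c t" and d: "\<And>t. t \<in> {\<alpha>'<..<\<beta>'} \<Longrightarrow> geo_germ d t"
    and o: "\<alpha> \<le> \<alpha>'" "\<alpha>' < \<beta>" "\<beta> \<le> \<beta>'" and cd: "\<And>t. t \<in> {\<alpha>'<..<\<beta>} \<Longrightarrow> c t = d t"
    and t: "t \<in> {\<alpha><..<\<beta>'}"
  shows "geo_germ (\<lambda>s. if s < \<beta> then c s else d s) t"
proof (cases "t < \<beta>")
  case True
  then show ?thesis by (intro germ_cong[OF c, of t "\<beta> - t"]) (use t in auto)
next
  case False
  have "(if s < \<beta> then c s else d s) = d s" if "\<bar>s - t\<bar> < t - \<alpha>'" for s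
    using that cd[of s] by auto
  note eq = this
  show ?thesis by (rule germ_cong[OF d, of t "t - \<alpha>'"]) (use t False o eq in auto)
qed

text \<open>If no point of \<open>K\<close> were visited by \<open>c\<close> arbitrarily late,
  finitely many neighbourhoods that are eventually avoided would cover \<open>K\<close>, and
  parameters close to \<beta> would have no place to go.\<close>

lemma compact_cluster_point:
  assumes K: "compact K" and c: "\<And>t. t \<in> {\<alpha>..<\<beta>} \<Longrightarrow> c t \<in> K" and "\<alpha> < (\<beta>::real)"
  obtains p where "p \<in> K" "\<And>U t. open U \<Longrightarrow> p \<in> U \<Longrightarrow> t < \<beta> \<Longrightarrow> \<exists>s\<in>{max \<alpha> t<..<\<beta>}. c s \<in> U"
proof -
  define hit where "hit U t \<longleftrightarrow> (\<exists>s\<in>{max \<alpha> t<..<\<beta>}. c s \<in> U)" for U t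
  have "\<exists>p\<in>K. \<forall>U t. open U \<and> p \<in> U \<and> t < \<beta> \<longrightarrow> hit U t"
  proof (rule ccontr)
    assume "\<not> ?thesis"
    then have "\<forall>p\<in>K. \<exists>x. open (fst x) \<and> p \<in> fst x \<and> snd x < \<beta> \<and> \<not> hit (fst x) (snd x)" by auto
    from bchoice[OF this] obtain x where
      x: "\<forall>p\<in>K. open (fst (x p)) \<and> p \<in> fst (x p) \<and> snd (x p) < \<beta> \<and> \<not> hit (fst (x p)) (snd (x p))" by blast
    define U where "U p = fst (x p)" for p
    define t where "t p = snd (x p)" for p
    have U: "open (U p) \<and> p \<in> U p \<and> t p < \<beta> \<and> (\<forall>s\<in>{max \<alpha> (t p)<..<\<beta>}. c s \<notin> U p)" if "p \<in> K" for p
      using x that by (simp add: U_def t_def hit_def)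
    have oU: "\<And>p. p \<in> K \<Longrightarrow> open (U p)" and KU: "K \<subseteq> (\<Union>p\<in>K. U p)" using U by blast+
    obtain D where D: "D \<subseteq> K" "finite D" "K \<subseteq> (\<Union>p\<in>D. U p)"
      by (rule compactE_image[OF K oU KU])
    have tm: "Max (insert \<alpha> (t ` D)) < \<beta>" using D U assms(3) by (subst Max_less_iff) auto
    then obtain s where s: "Max (insert \<alpha> (t ` D)) < s" "s < \<beta>" using dense by blast
    have ms: "\<alpha> < s" "\<And>p. p \<in> D \<Longrightarrow> t p < s" using s(1) D(2) by (auto simp: Max_less_iff)
    have "c s \<in> K" using c[of s] ms s by auto
    then obtain p where p: "p \<in> D" "c s \<in> U p" using D(3) by blast
    have "s \<in> {max \<alpha> (t p)<..<\<beta>}" using ms p s by auto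
    then show False using U[of p] p D(1) by blast
  qed
  then obtain p where p: "p \<in> K" "\<And>U t. open U \<Longrightarrow> p \<in> U \<Longrightarrow> t < \<beta> \<Longrightarrow> hit U t" by blast
  show ?thesis by (rule that[OF p(1)]) (use p(2) in \<open>simp add: hit_def\<close>)
qed

text \<open>The minimum over \<open>K\<close> times the unit sphere, extended by homogeneity. It
  converts a bound on the energy into a bound on velocity coordinates.\<close>

lemma cm_lower_bound:
  assumes i: "i \<in> charts F" and K: "compact K" "K \<subseteq> V i"
  obtains m where "m > 0" "\<And>y v. y \<in> K \<Longrightarrow> cm i y v v \<ge> m * (norm v)\<^sup>2"
proof -
  let ?S = "K \<times> sphere (0 :: real ^ 'n) 1"
  have o: "open (V i \<times> (UNIV :: (real ^ 'n) set))" by (rule open_VU[OF i])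
  have "smooth_on (V i \<times> UNIV) (\<lambda>z. cm i (fst z) (snd z) (snd z))"
    by (intro smooth_on_bilinear_field[OF o open_V[OF i] cm_bilinear[OF i] cm_smooth[OF i]]
        smooth_on_fst smooth_on_snd smooth_on_ident o) auto
  then have c: "continuous_on ?S (\<lambda>z. cm i (fst z) (snd z) (snd z))"
    by (rule continuous_on_subset[OF smooth_on_imp_continuous_on]) (use K(2) in auto)
  have scale: "cm i y v v = (norm v)\<^sup>2 * cm i y (v /\<^sub>R norm v) (v /\<^sub>R norm v)" if "y \<in> K" "v \<noteq> 0" for y v
  proof -
    have y: "y \<in> V i" using that K by blast
    show ?thesis using that(2)
      by (simp add: bilinear_lmul[OF cm_bilinear[OF i y]] bilinear_rmul[OF cm_bilinear[OF i y]]
          power2_eq_square field_simps)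
  qed
  show ?thesis
  proof (cases "?S = {}")
    case True
    have False if "y \<in> K" for y using True that by (auto simp: sphere_def) (metis norm_axis_1)
    then show ?thesis using that[of 1] by auto
  next
    case False
    have "compact ?S" by (intro compact_Times K compact_sphere)
    then obtain z where z: "z \<in> ?S" "\<And>x. x \<in> ?S \<Longrightarrow> cm i (fst z) (snd z) (snd z) \<le> cm i (fst x) (snd x) (snd x)"
      using continuous_attains_inf[OF _ False c] by blast
    define m where "m = cm i (fst z) (snd z) (snd z)"
    have zz: "fst z \<in> V i" "snd z \<noteq> 0" using z(1) K(2) by auto
    have "m > 0" unfolding m_def by (rule cm_pos[OF i zz])
    moreover have "cm i y v v \<ge> m * (norm v)\<^sup>2" if y: "y \<in> K" for y v
    proof (cases "v = 0")
      case True
      then show ?thesis using bilinear_lzero[OF cm_bilinear[OF i]] y K(2) by auto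
    next
      case False
      have "m \<le> cm i y (v /\<^sub>R norm v) (v /\<^sub>R norm v)"
        using z(2)[of "(y, v /\<^sub>R norm v)"] y False by (simp add: m_def)
      then show ?thesis unfolding scale[OF y False] by (simp only: mult.commute[of m] mult_left_mono zero_le_power2)
    qed
    ultimately show ?thesis using that by blast
  qed
qed

text \<open>Along parameters tending to \<beta> the positions approach a cluster point and the
  velocities are bounded by the constant energy, so the states have a limit \<open>z\<close>. Near
  \<open>z\<close> the flow exists for a uniform time \<delta>; started from a state at a parameter
  closer than \<delta> to \<beta>, it runs past \<beta>.\<close>

lemma geodesic_extend:
  assumes g: "\<And>t. t \<in> {\<alpha><..<\<beta>} \<Longrightarrow> geo_germ c t" and ab: "\<alpha> < t1" "t1 < \<beta>"
    and K: "compact K" "K \<subseteq> mcarrier F" "\<And>t. t \<in> {t1..<\<beta>} \<Longrightarrow> c t \<in> K"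
  obtains d e where "e > 0" "\<And>t. t \<in> {\<alpha><..<\<beta> + e} \<Longrightarrow> geo_germ d t" "\<And>t. t \<in> {\<alpha><..<\<beta>} \<Longrightarrow> d t = c t"
proof -
  obtain p where p: "p \<in> K" "\<And>U t. open U \<Longrightarrow> p \<in> U \<Longrightarrow> t < \<beta> \<Longrightarrow> \<exists>s\<in>{max t1 t<..<\<beta>}. c s \<in> U"
    using compact_cluster_point[where c=c, OF K(1,3) ab(2)] by blast
  obtain i where i: "i \<in> charts F" "p \<in> cdom F i" using p(1) K(2) unfolding mcarrier_def by blast
  obtain r where r: "r > 0" "cball (coord F i p) r \<subseteq> V i"
    using open_V[OF i(1)] i(2) open_contains_cball by (metis imageI)
  let ?B = "cball (coord F i p) r"
  obtain m where m: "m > 0" "\<And>y v. y \<in> ?B \<Longrightarrow> cm i y v v \<ge> m * (norm v)\<^sup>2"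
    using cm_lower_bound[OF i(1) compact_cball r(2)] by blast
  obtain j0 where j0: "j0 \<in> charts F" "c t1 \<in> cdom F j0" using germ_obtain_chart[OF g] ab by force
  define e0 where "e0 = energy j0 (gstate j0 c t1)"
  \<comment> \<open>With energy \<open>e0\<close> and the lower bound m |v|^2 of the metric, R
    bounds the velocity coordinates.\<close>
  define R where "R = sqrt (e0 / m)"
  define U where "U = cdom F i \<inter> coord F i -` ball (coord F i p) r"
  have U: "open U" "p \<in> U" unfolding U_def
    using continuous_open_preimage[OF cont_coord[OF i(1)] open_cdom[OF i(1)] open_ball] i(2) r(1) by auto
  have "\<exists>s\<in>{max t1 (\<beta> - 1 / Suc n)<..<\<beta>}. c s \<in> U" for n by (rule p(2)[OF U]) simp
  then obtain s where s: "\<And>n. s n \<in> {max t1 (\<beta> - 1 / Suc n)<..<\<beta>}" "\<And>n. c (s n) \<in> U" by metis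
  define Q where "Q = ?B \<times> cball (0 :: real ^ 'n) R"
  have sQ: "gstate i c (s n) \<in> Q" for n
  proof -
    have ci: "c (s n) \<in> cdom F i" "coord F i (c (s n)) \<in> ?B" using s(2)[of n] by (auto simp: U_def)
    have "energy i (gstate i c (s n)) = e0"
      unfolding e0_def by (rule energy_const[OF g, where \<alpha>=\<alpha> and \<beta>=\<beta>]) (use s(1)[of n] ab i j0 ci in auto)
    then have "m * (norm (velocity F c i (s n)))\<^sup>2 \<le> e0"
      using m(2)[OF ci(2), of "velocity F c i (s n)"] by (simp add: energy_def gstate_def)
    then have "(norm (velocity F c i (s n)))\<^sup>2 \<le> e0 / m" using m(1) by (simp add: field_simps)
    then have "norm (velocity F c i (s n)) \<le> R" unfolding R_def by (rule real_le_rsqrt)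
    then show ?thesis using ci(2) by (simp add: Q_def gstate_def)
  qed
  have "compact Q" unfolding Q_def by (intro compact_Times compact_cball)
  then have "seq_compact Q" using compact_imp_seq_compact by blast
  then obtain z k where z: "z \<in> Q" "strict_mono k" "((\<lambda>n. gstate i c (s n)) \<circ> k) \<longlonglongrightarrow> z"
    using sQ unfolding seq_compact_def by metis
  have zV: "fst z \<in> V i" using z(1) r(2) by (auto simp: Q_def)
  obtain \<rho> \<delta> \<phi> \<psi> where f: "\<rho> > 0" "\<delta> > 0"
    "\<And>y. y \<in> ball z \<rho> \<Longrightarrow> \<phi> y 0 = y"
    "\<And>y t. y \<in> ball z \<rho> \<Longrightarrow> \<bar>t\<bar> < \<delta> \<Longrightarrow> ((\<lambda>y. \<phi> y t) has_derivative (\<lambda>w. \<psi> y w t)) (at y)"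
    "\<And>w t. \<bar>t\<bar> < \<delta> \<Longrightarrow> continuous_on (ball z \<rho>) (\<lambda>y. \<psi> y w t)"
    "\<And>y w. y \<in> ball z \<rho> \<Longrightarrow> \<psi> y w 0 = w"
    "\<And>y w t. y \<in> ball z \<rho> \<Longrightarrow> \<bar>t\<bar> < \<delta> \<Longrightarrow>
       (\<psi> y w has_vector_derivative frechet_derivative (spray i) (at (\<phi> y t)) (\<psi> y w t)) (at t)"
    "\<And>y T s. y \<in> ball z \<rho> \<Longrightarrow> \<bar>s - T\<bar> < \<delta> \<Longrightarrow> geo_germ (\<lambda>s. chart_inv F i (fst (\<phi> y (s - T)))) s"
    "\<And>y T s. y \<in> ball z \<rho> \<Longrightarrow> \<bar>s - T\<bar> < \<delta> \<Longrightarrow> gstate i (\<lambda>s. chart_inv F i (fst (\<phi> y (s - T)))) s = \<phi> y (s - T)"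
    "\<And>y T s. y \<in> ball z \<rho> \<Longrightarrow> \<bar>s - T\<bar> < \<delta> \<Longrightarrow> chart_inv F i (fst (\<phi> y (s - T))) \<in> cdom F i"
    by (rule geodesic_local_flow[OF i(1) zV], rule that)
  have "\<forall>\<^sub>F n in sequentially. dist ((\<lambda>n. gstate i c (s n)) (k n)) z < \<rho>"
    using tendstoD[OF z(3) f(1)] by (simp add: o_def)
  moreover have "\<forall>\<^sub>F n in sequentially. 1 / Suc n < \<delta>"
    using order_tendstoD(2)[OF LIMSEQ_Suc[OF lim_1_over_n] f(2)] by simp
  ultimately have "\<forall>\<^sub>F n in sequentially. dist (gstate i c (s (k n))) z < \<rho> \<and> 1 / Suc n < \<delta>"
    by (rule eventually_conj)
  then obtain n where n: "dist (gstate i c (s (k n))) z < \<rho>" "1 / Suc n < \<delta>"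
    using eventually_happens'[OF sequentially_bot] by blast
  define T where "T = s (k n)"
  define y where "y = gstate i c T"
  have y: "y \<in> ball z \<rho>" using n(1) by (simp add: y_def T_def dist_commute)
  \<comment> \<open>Passing to the subsequence only moves the parameter closer to \<beta>, so
    \<open>T\<close> is still within \<delta> of it.\<close>
  have "1 / Suc (k n) \<le> 1 / Suc n" using strict_mono_imp_increasing[OF z(2), of n] by (simp add: frac_le)
  then have T: "t1 < T" "T < \<beta>" "\<beta> - \<delta> < T" using s(1)[of "k n"] n(2) by (auto simp: T_def)
  have ci: "c T \<in> cdom F i" using s(2)[of "k n"] by (simp add: U_def T_def)
  define d where "d = (\<lambda>s. chart_inv F i (fst (\<phi> y (s - T))))"
  have dg: "geo_germ d s" if "\<bar>s - T\<bar> < \<delta>" for s unfolding d_def by (rule f(8)[OF y that])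
  have dT: "d T = c T" "gstate i d T = gstate i c T"
    using f(3)[OF y] f(9)[OF y, of T T] f(2) chart_inv_coord[OF i(1) ci]
    by (auto simp: d_def y_def gstate_def)
  have eq: "c t = d t" if "t \<in> {max \<alpha> (T - \<delta>)<..<\<beta>}" for t
    by (rule germ_unique[OF open_greaterThanLessThan connected_Ioo, of T "max \<alpha> (T - \<delta>)" \<beta> c d i t])
      (use g dg dT i ci T that ab f(2) in \<open>auto simp: abs_less_iff\<close>)
  show ?thesis
  proof (rule that[of "T + \<delta> - \<beta>" "\<lambda>s. if s < \<beta> then c s else d s"])
    fix t assume "t \<in> {\<alpha><..<\<beta> + (T + \<delta> - \<beta>)}"
    then show "geo_germ (\<lambda>s. if s < \<beta> then c s else d s) t"
      by (intro germ_glue[OF g, of \<alpha> \<beta> "max \<alpha> (T - \<delta>)" "T + \<delta>"] dg) (use T ab f(2) eq in auto)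
  qed (use T in auto)
qed

end

section \<open>The exponential map at a point\<close>

text \<open>Completeness at \<open>x0\<close> is encoded as precompactness of forward halves of
  geodesics starting there; backward halves are obtained by reversal.\<close>

locale complete_from = riemannian F
  for F :: "('i, 'm::{t2_space,second_countable_topology}, real ^ 'n) semi_riemannian" +
  fixes x0 :: 'm and i0 :: 'i
  assumes i0: "i0 \<in> charts F" "x0 \<in> cdom F i0"
    and precompact: "\<And>c \<alpha> \<beta>. \<alpha> < 0 \<Longrightarrow> 0 < \<beta> \<Longrightarrow> (\<And>t. t \<in> {\<alpha><..<\<beta>} \<Longrightarrow> geo_germ c t) \<Longrightarrow> c 0 = x0 \<Longrightarrow>
       \<exists>K. compact K \<and> K \<subseteq> mcarrier F \<and> c ` {0..<\<beta>} \<subseteq> K"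
begin

section \<open>Existence of geodesics from the base point for all parameters\<close>

definition "geo_upto v T c \<longleftrightarrow> (\<forall>t. \<bar>t\<bar> < T \<longrightarrow> geo_germ c t) \<and> c 0 = x0 \<and> gstate i0 c 0 = (coord F i0 x0, v)"

lemma geo_upto_unique:
  assumes "geo_upto v T c" "geo_upto v S d" "\<bar>t\<bar> < T" "\<bar>t\<bar> < S"
  shows "c t = d t"
  by (rule germ_unique[OF open_greaterThanLessThan connected_Ioo, of 0 "- min T S" "min T S" c d i0 t])
    (use assms i0 in \<open>auto simp: geo_upto_def abs_less_iff\<close>)

lemma geo_upto_start: "\<exists>T>0. \<exists>c. geo_upto v T c"
proof -
  have zV: "fst (coord F i0 x0, v) \<in> V i0" using i0 by simp
  obtain \<rho> \<delta> \<phi> \<psi> where f: "\<rho> > 0" "\<delta> > 0"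
    "\<And>y. y \<in> ball (coord F i0 x0, v) \<rho> \<Longrightarrow> \<phi> y 0 = y"
    "\<And>y t. y \<in> ball (coord F i0 x0, v) \<rho> \<Longrightarrow> \<bar>t\<bar> < \<delta> \<Longrightarrow> ((\<lambda>y. \<phi> y t) has_derivative (\<lambda>w. \<psi> y w t)) (at y)"
    "\<And>w t. \<bar>t\<bar> < \<delta> \<Longrightarrow> continuous_on (ball (coord F i0 x0, v) \<rho>) (\<lambda>y. \<psi> y w t)"
    "\<And>y w. y \<in> ball (coord F i0 x0, v) \<rho> \<Longrightarrow> \<psi> y w 0 = w"
    "\<And>y w t. y \<in> ball (coord F i0 x0, v) \<rho> \<Longrightarrow> \<bar>t\<bar> < \<delta> \<Longrightarrow>
       (\<psi> y w has_vector_derivative frechet_derivative (spray i0) (at (\<phi> y t)) (\<psi> y w t)) (at t)"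
    "\<And>y T s. y \<in> ball (coord F i0 x0, v) \<rho> \<Longrightarrow> \<bar>s - T\<bar> < \<delta> \<Longrightarrow> geo_germ (\<lambda>s. chart_inv F i0 (fst (\<phi> y (s - T)))) s"
    "\<And>y T s. y \<in> ball (coord F i0 x0, v) \<rho> \<Longrightarrow> \<bar>s - T\<bar> < \<delta> \<Longrightarrow> gstate i0 (\<lambda>s. chart_inv F i0 (fst (\<phi> y (s - T)))) s = \<phi> y (s - T)"
    "\<And>y T s. y \<in> ball (coord F i0 x0, v) \<rho> \<Longrightarrow> \<bar>s - T\<bar> < \<delta> \<Longrightarrow> chart_inv F i0 (fst (\<phi> y (s - T))) \<in> cdom F i0"
    by (rule geodesic_local_flow[OF i0(1) zV], rule that)
  let ?z = "(coord F i0 x0, v)"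
  have z: "?z \<in> ball ?z \<rho>" using f(1) by simp
  have "geo_upto v \<delta> (\<lambda>s. chart_inv F i0 (fst (\<phi> ?z (s - 0))))"
    unfolding geo_upto_def
    using f(2) f(3)[OF z] f(8)[OF z, of _ 0] f(9)[OF z, of 0 0] chart_inv_coord[OF i0] by simp
  then show ?thesis using f(2) by blast
qed

text \<open>Extension at the right end, reversal, extension at the right end again, and reversal
  back. The second extension is applied to the curve already enlarged on the other side.\<close>

lemma geo_upto_extend:
  assumes T: "T > 0" and c: "geo_upto v T c"
  obtains S d where "S > T" "geo_upto v S d"
proof -
  have g: "\<And>t. t \<in> {-T<..<T} \<Longrightarrow> geo_germ c t" and c0: "c 0 = x0" "gstate i0 c 0 = (coord F i0 x0, v)"
    using c by (auto simp: geo_upto_def abs_less_iff)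
  obtain K where K: "compact K" "K \<subseteq> mcarrier F" "c ` {0..<T} \<subseteq> K"
    using precompact[of "-T" T c] T g c0(1) by auto
  have cK: "c t \<in> K" if "t \<in> {0..<T}" for t using K(3) that by blast
  obtain d e where d: "e > 0" "\<And>t. t \<in> {-T<..<T + e} \<Longrightarrow> geo_germ d t" "\<And>t. t \<in> {-T<..<T} \<Longrightarrow> d t = c t"
    using geodesic_extend[OF g _ T K(1,2) cK] T by (metis neg_less_0_iff_less)
  define d' where "d' = (\<lambda>s. d ((-1) * s + 0))"
  have d'g: "geo_germ d' t" if "t \<in> {-(T+e)<..<T}" for t
    unfolding d'_def by (rule germ_affine) (use d(2) that in auto)
  have d'0: "d' 0 = x0" using d(3)[of 0] T c0 by (simp add: d'_def)
  obtain K' where K': "compact K'" "K' \<subseteq> mcarrier F" "d' ` {0..<T} \<subseteq> K'"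
    using precompact[of "-(T+e)" T d'] T d(1) d'g d'0 by auto
  have dK: "d' t \<in> K'" if "t \<in> {0..<T}" for t using K'(3) that by blast
  obtain h e' where h: "e' > 0" "\<And>t. t \<in> {-(T+e)<..<T + e'} \<Longrightarrow> geo_germ h t" "\<And>t. t \<in> {-(T+e)<..<T} \<Longrightarrow> h t = d' t"
    using geodesic_extend[OF d'g _ T K'(1,2) dK] T d(1) by (metis add_pos_pos neg_less_0_iff_less)
  define k where "k = (\<lambda>s. h ((-1) * s + 0))"
  have kg: "geo_germ k t" if "\<bar>t\<bar> < min (T + e) (T + e')" for t
    unfolding k_def by (rule germ_affine) (use h(2)[of "-t"] that in \<open>auto simp: abs_less_iff\<close>)
  have kc: "k t = c t" if "\<bar>t\<bar> < T" for t
    using h(3)[of "-t"] d(3)[of t] that d(1) by (auto simp: k_def d'_def abs_less_iff)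
  have "gstate i0 k 0 = gstate i0 c 0" by (rule gstate_cong[OF T]) (use kc in auto)
  then have "geo_upto v (min (T + e) (T + e')) k"
    using kg kc[of 0] T c0 by (simp add: geo_upto_def)
  then show ?thesis using that[of "min (T + e) (T + e')" k] d(1) h(1) by auto
qed

text \<open>If some length were not reached, the geodesics of lengths below the supremum would glue,
  by uniqueness, to one of the supremal length, and that one extends.\<close>

lemma geo_upto_all: "\<exists>c. geo_upto v T c"
proof (rule ccontr)
  assume no: "\<not> ?thesis"
  define TT where "TT = {T. T > 0 \<and> (\<exists>c. geo_upto v T c)}"
  have mono: "geo_upto v S c" if "geo_upto v R c" "S \<le> R" for R S c
    using that by (auto simp: geo_upto_def)
  have bdd: "S \<le> T" if "S \<in> TT" for S
    using that no mono[of S _ T] by (force simp: TT_def)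
  then have ba: "bdd_above TT" by (rule bdd_aboveI)
  obtain S0 where S0: "S0 \<in> TT" using geo_upto_start[of v] unfolding TT_def by blast
  define R where "R = Sup TT"
  have R: "R > 0" using cSup_upper[OF S0 ba] S0 by (simp add: TT_def R_def)
  have "\<exists>c. geo_upto v S c" if SR: "S < R" for S
  proof -
    obtain Q where "Q \<in> TT" "S < Q"
      using less_cSupE[OF SR[unfolded R_def]] S0 by blast
    then show ?thesis using mono[of Q _ S] by (auto simp: TT_def)
  qed
  then obtain C where C: "\<And>S. S < R \<Longrightarrow> geo_upto v S (C S)" by metis
  \<comment> \<open>The radius halfway between |t| and R lies above |t| and below R, so the chosen
    geodesic exists and is defined at t.\<close>
  define c where "c t = C ((\<bar>t\<bar> + R) / 2) t" for t
  have cC: "c t = C S t" if "\<bar>t\<bar> < S" "S < R" for t S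
    unfolding c_def by (rule geo_upto_unique[OF C C]) (use that in auto)
  have "geo_upto v R c" unfolding geo_upto_def
  proof (intro conjI allI impI)
    fix t assume t: "\<bar>t\<bar> < R"
    define S where "S = (\<bar>t\<bar> + R) / 2"
    have S: "\<bar>t\<bar> < S" "S < R" using t by (auto simp: S_def)
    show "geo_germ c t"
      by (rule germ_cong[of "C S" t "S - \<bar>t\<bar>"]) (use C[OF S(2)] S cC[of _ S] in \<open>auto simp: geo_upto_def\<close>)
  next
    have 1: "geo_upto v (R/2) (C (R/2))" using C[of "R/2"] R by simp
    then show "c 0 = x0" using cC[of 0 "R/2"] R by (simp add: geo_upto_def)
    have "gstate i0 c 0 = gstate i0 (C (R/2)) 0"
      by (rule gstate_cong[of "R/2"]) (use R cC[of _ "R/2"] in auto)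
    then show "gstate i0 c 0 = (coord F i0 x0, v)" using 1 by (simp add: geo_upto_def)
  qed
  then obtain S d where S: "S > R" "geo_upto v S d" using geo_upto_extend[OF R] by blast
  then have "S \<in> TT" using R by (auto simp: TT_def)
  then show False using cSup_upper[OF _ ba, of S] S(1) by (simp add: R_def)
qed

text \<open>The complete geodesic from \<open>x0\<close> whose velocity at \<open>0\<close> is \<open>v\<close> in the chart \<open>i0\<close>.\<close>

definition "geo v t = (SOME c. geo_upto v (\<bar>t\<bar> + 1) c) t"

lemma geo_eq: "geo_upto v T c \<Longrightarrow> \<bar>t\<bar> < T \<Longrightarrow> geo v t = c t"
  unfolding geo_def
  by (rule geo_upto_unique[OF someI_ex[OF geo_upto_all]]) auto

lemma geo_upto_geo: "geo_upto v T (geo v)"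
proof -
  have g: "geo_germ (geo v) t" and s: "geo v 0 = x0 \<and> gstate i0 (geo v) 0 = (coord F i0 x0, v)" for t
  proof -
    obtain c where c: "geo_upto v (\<bar>t\<bar> + 1) c" using geo_upto_all by blast
    have e: "c s = geo v s" if "\<bar>s - t\<bar> < 1" for s using geo_eq[OF c, of s] that by simp
    show "geo_germ (geo v) t"
      by (rule germ_cong[of c t 1]) (use c e in \<open>auto simp: geo_upto_def\<close>)
    have "gstate i0 (geo v) 0 = gstate i0 c 0"
      by (rule gstate_cong[of 1]) (use geo_eq[OF c] in auto)
    then show "geo v 0 = x0 \<and> gstate i0 (geo v) 0 = (coord F i0 x0, v)"
      using geo_eq[OF c, of 0] c by (simp add: geo_upto_def)
  qed
  show ?thesis using g s by (simp add: geo_upto_def)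
qed

lemma geo_germ_geo: "geo_germ (geo v) t"
  and geo_0: "geo v 0 = x0"
  and gstate_geo_0: "gstate i0 (geo v) 0 = (coord F i0 x0, v)"
  using geo_upto_geo[of v "\<bar>t\<bar> + 1"] by (auto simp: geo_upto_def)

lemma geo_const: "geo 0 t = x0"
proof -
  have "geo_upto 0 (\<bar>t\<bar> + 1) (\<lambda>t. x0)"
    unfolding geo_upto_def geo_germ_def
  proof (intro conjI allI impI)
    fix t
    show "\<exists>i\<in>charts F. \<exists>e>0. \<exists>z. \<forall>s. \<bar>s - t\<bar> < e \<longrightarrow> fst (z s) \<in> V i \<and> x0 = chart_inv F i (fst (z s)) \<and>
         (z has_vector_derivative spray i (z s)) (at s)"
    proof (rule bexI[OF _ i0(1)], rule exI[of _ 1], intro conjI exI[of _ "\<lambda>s. (coord F i0 x0, 0)"] allI impI)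
      have "bilinear (Gam i0 (coord F i0 x0))" using i0 by (intro Gam_bilinear) auto
      then show "((\<lambda>s. (coord F i0 x0, 0)) has_vector_derivative spray i0 (coord F i0 x0, 0)) (at s)" for s :: real
        by (simp add: spray_def bilinear_lzero zero_prod_def[symmetric])
    qed (use i0 chart_inv_coord[OF i0] in auto)
    show "gstate i0 (\<lambda>t. x0) 0 = (coord F i0 x0, 0)"
      by (simp add: gstate_def velocity_def)
  qed simp
  then show ?thesis using geo_eq by fastforce
qed

section \<open>Continuously differentiable dependence on the initial velocity\<close>

definition "gs i v t = gstate i (geo v) t"
definition "Dgs i v t = frechet_derivative (\<lambda>v. gs i v t) (at v)"

text \<open>The state at the fixed time \<open>t\<close> is C^1 in the initial velocity near
  \<open>v\<close>. Continuity is asked of each directional derivative, which in finite dimensions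
  gives continuity of the derivative as an operator.\<close>

definition "C1_near i t v \<longleftrightarrow> (\<exists>N. open N \<and> v \<in> N \<and> (\<forall>u\<in>N. geo u t \<in> cdom F i \<and>
    ((\<lambda>v. gs i v t) has_derivative Dgs i u t) (at u)) \<and> (\<forall>w. continuous_on N (\<lambda>u. Dgs i u t w)))"

lemma C1_nearI:
  assumes "open N" "v \<in> N" "\<And>u. u \<in> N \<Longrightarrow> geo u t \<in> cdom F i"
    "\<And>u. u \<in> N \<Longrightarrow> ((\<lambda>v. gs i v t) has_derivative D u) (at u)" "\<And>w. continuous_on N (\<lambda>u. D u w)"
  shows "C1_near i t v"
proof -
  have D: "Dgs i u t = D u" if "u \<in> N" for u
    unfolding Dgs_def by (rule frechet_derivative_at[symmetric, OF assms(4)[OF that]])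
  have "continuous_on N (\<lambda>u. Dgs i u t w)" for w
    using assms(5)[of w] D by (simp cong: continuous_on_cong)
  then show ?thesis unfolding C1_near_def using assms D by (intro exI[of _ N]) auto
qed

lemma gs_V: "geo v t \<in> cdom F i \<Longrightarrow> fst (gs i v t) \<in> V i"
  by (simp add: gs_def gstate_def)

text \<open>Near parameter T of \<open>geo v\<close>, every geodesic whose state falls into the ball
  is given by one local flow. Starting parameters S other than T are allowed, so that information
  can be passed between any two nearby parameters.\<close>

lemma flow_window:
  assumes i: "i \<in> charts F" and vT: "geo v T \<in> cdom F i"
  obtains \<rho> \<delta> \<phi> \<psi> \<eta> where "\<delta> > 0" "\<eta> > 0"
    "\<And>z. z \<in> ball (gs i v T) \<rho> \<Longrightarrow> \<phi> z 0 = z"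
    "\<And>z t. z \<in> ball (gs i v T) \<rho> \<Longrightarrow> \<bar>t\<bar> < \<delta> \<Longrightarrow> ((\<lambda>z. \<phi> z t) has_derivative (\<lambda>w. \<psi> z w t)) (at z)"
    "\<And>w t. \<bar>t\<bar> < \<delta> \<Longrightarrow> continuous_on (ball (gs i v T) \<rho>) (\<lambda>z. \<psi> z w t)"
    "\<And>z w. z \<in> ball (gs i v T) \<rho> \<Longrightarrow> \<psi> z w 0 = w"
    "\<And>z w t. z \<in> ball (gs i v T) \<rho> \<Longrightarrow> \<bar>t\<bar> < \<delta> \<Longrightarrow>
       (\<psi> z w has_vector_derivative frechet_derivative (spray i) (at (\<phi> z t)) (\<psi> z w t)) (at t)"
    "\<And>s. \<bar>s - T\<bar> < \<eta> \<Longrightarrow> geo v s \<in> cdom F i \<and> gs i v s \<in> ball (gs i v T) \<rho>"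
    "\<And>u S s. geo u S \<in> cdom F i \<Longrightarrow> gs i u S \<in> ball (gs i v T) \<rho> \<Longrightarrow> \<bar>s - S\<bar> < \<delta> \<Longrightarrow>
       geo u s \<in> cdom F i \<and> gs i u s = \<phi> (gs i u S) (s - S)"
proof -
  obtain \<rho> \<delta> \<phi> \<psi> where f: "\<rho> > 0" "\<delta> > 0"
    "\<And>y. y \<in> ball (gs i v T) \<rho> \<Longrightarrow> \<phi> y 0 = y"
    "\<And>y t. y \<in> ball (gs i v T) \<rho> \<Longrightarrow> \<bar>t\<bar> < \<delta> \<Longrightarrow> ((\<lambda>y. \<phi> y t) has_derivative (\<lambda>w. \<psi> y w t)) (at y)"
    "\<And>w t. \<bar>t\<bar> < \<delta> \<Longrightarrow> continuous_on (ball (gs i v T) \<rho>) (\<lambda>y. \<psi> y w t)"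
    "\<And>y w. y \<in> ball (gs i v T) \<rho> \<Longrightarrow> \<psi> y w 0 = w"
    "\<And>y w t. y \<in> ball (gs i v T) \<rho> \<Longrightarrow> \<bar>t\<bar> < \<delta> \<Longrightarrow>
       (\<psi> y w has_vector_derivative frechet_derivative (spray i) (at (\<phi> y t)) (\<psi> y w t)) (at t)"
    "\<And>y T' s. y \<in> ball (gs i v T) \<rho> \<Longrightarrow> \<bar>s - T'\<bar> < \<delta> \<Longrightarrow> geo_germ (\<lambda>s. chart_inv F i (fst (\<phi> y (s - T')))) s"
    "\<And>y T' s. y \<in> ball (gs i v T) \<rho> \<Longrightarrow> \<bar>s - T'\<bar> < \<delta> \<Longrightarrow> gstate i (\<lambda>s. chart_inv F i (fst (\<phi> y (s - T')))) s = \<phi> y (s - T')"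
    "\<And>y T' s. y \<in> ball (gs i v T) \<rho> \<Longrightarrow> \<bar>s - T'\<bar> < \<delta> \<Longrightarrow> chart_inv F i (fst (\<phi> y (s - T'))) \<in> cdom F i"
    by (rule geodesic_local_flow[OF i gs_V[OF vT]], rule that)
  have c: "isCont (gs i v) T" unfolding gs_def[abs_def]
    by (rule has_vector_derivative_continuous[OF germ_gstate_deriv[OF geo_germ_geo i vT]])
  obtain e1 where e1: "e1 > 0" "\<And>s. \<bar>s - T\<bar> < e1 \<Longrightarrow> gs i v s \<in> ball (gs i v T) \<rho>"
    using continuous_near[OF c open_ball, of "gs i v T" \<rho>] f(1) by auto
  obtain e2 where e2: "e2 > 0" "\<And>s. \<bar>s - T\<bar> < e2 \<Longrightarrow> geo v s \<in> cdom F i"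
    using continuous_near[OF germ_isCont[OF geo_germ_geo] open_cdom[OF i] vT] by blast
  have flow: "geo u s \<in> cdom F i \<and> gs i u s = \<phi> (gs i u S) (s - S)"
    if u: "geo u S \<in> cdom F i" "gs i u S \<in> ball (gs i v T) \<rho>" and s: "\<bar>s - S\<bar> < \<delta>" for u S s
  proof -
    let ?d = "\<lambda>s. chart_inv F i (fst (\<phi> (gs i u S) (s - S)))"
    have d0: "geo u S = ?d S" "gstate i (geo u) S = gstate i ?d S"
      using f(3)[OF u(2)] f(9)[OF u(2), of S S] f(2) chart_inv_coord[OF i u(1)]
      by (auto simp: gs_def gstate_def)
    have e: "geo u q = ?d q" if q: "\<bar>q - S\<bar> < \<delta>" for q
      by (rule germ_unique[OF open_greaterThanLessThan connected_Ioo, of S "S - \<delta>" "S + \<delta>" "geo u" ?d i q])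
        (use f(2) q geo_germ_geo f(8)[OF u(2)] i u(1) d0 in \<open>auto simp: abs_less_iff\<close>)
    have "gstate i (geo u) s = gstate i ?d s"
      by (rule gstate_cong[of "\<delta> - \<bar>s - S\<bar>"]) (use e s in auto)
    then show ?thesis using e[OF s] f(10)[OF u(2) s] f(9)[OF u(2) s] by (simp add: gs_def)
  qed
  show ?thesis
  proof (rule that[of \<delta> "min e1 e2", OF f(2) _ f(3-7) _ flow])
    show "min e1 e2 > 0" using e1 e2 by simp
    show "geo v s \<in> cdom F i \<and> gs i v s \<in> ball (gs i v T) \<rho>" if "\<bar>s - T\<bar> < min e1 e2" for s
      using e1(2)[of s] e2(2)[of s] that by simp
  qed
qed

text \<open>In the second chart the state is the one in the first chart followed by the smooth
  tangent map \<open>Ttr\<close>.\<close>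

lemma C1_near_chart:
  assumes "C1_near i t v" and i: "i \<in> charts F" and j: "j \<in> charts F" "geo v t \<in> cdom F j"
  shows "C1_near j t v"
proof -
  obtain N where N: "open N" "v \<in> N" "\<And>u. u \<in> N \<Longrightarrow> geo u t \<in> cdom F i"
    "\<And>u. u \<in> N \<Longrightarrow> ((\<lambda>v. gs i v t) has_derivative Dgs i u t) (at u)" "\<And>w. continuous_on N (\<lambda>u. Dgs i u t w)"
    using assms(1) unfolding C1_near_def by blast
  have "continuous_on N (\<lambda>u. gs i u t)" by (rule has_derivative_continuous_on[OF has_derivative_at_withinI[OF N(4)]])
  then have oN': "open (N \<inter> (\<lambda>u. gs i u t) -` (VV i j \<times> UNIV))"
    by (intro continuous_open_preimage N open_Times open_VV i j open_UNIV)
  let ?N = "N \<inter> (\<lambda>u. gs i u t) -` (VV i j \<times> UNIV)"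
  have inj: "geo u t \<in> cdom F i \<inter> cdom F j" if "u \<in> ?N" for u
  proof -
    have "coord F i (geo u t) \<in> VV i j" using that by (auto simp: gs_def gstate_def)
    then have "chart_inv F i (coord F i (geo u t)) \<in> cdom F j" using VV_eq[OF i j(1)] by blast
    then show ?thesis using N(3)[of u] that chart_inv_coord[OF i] by simp
  qed
  have o: "open (VV i j \<times> (UNIV :: (real ^ 'n) set))" by (intro open_Times open_VV i j open_UNIV)
  have Ts: "smooth_on (VV i j \<times> UNIV) (Ttr i j)"
    unfolding Ttr_def[OF i j(1), abs_def]
    by (intro smooth_on_Pair o smooth_on_compose[OF o open_VV[OF i j(1)] tr_smooth[OF i j(1)]]
      smooth_on_deriv_app[OF open_VV[OF i j(1)] o o tr_smooth[OF i j(1)]] smooth_on_fst smooth_on_snd smooth_on_ident) auto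
  have e: "gs j u t = Ttr i j (gs i u t)" if "u \<in> ?N" for u
    unfolding gs_def by (rule gstate_tr[OF i j(1) geo_germ_geo inj[OF that]])
  show ?thesis
  proof (rule C1_nearI[where N="?N" and D="\<lambda>u w. frechet_derivative (Ttr i j) (at (gs i u t)) (Dgs i u t w)"])
    show "open ?N" by (rule oN')
    show "v \<in> ?N" using N(2) N(3)[OF N(2)] j(2) by (auto simp: gs_def gstate_def)
    show "geo u t \<in> cdom F j" if "u \<in> ?N" for u using inj[OF that] by blast
    show "((\<lambda>v. gs j v t) has_derivative (\<lambda>w. frechet_derivative (Ttr i j) (at (gs i u t)) (Dgs i u t w))) (at u)" if u: "u \<in> ?N" for u
    proof -
      have "((\<lambda>v. Ttr i j (gs i v t)) has_derivative (\<lambda>w. frechet_derivative (Ttr i j) (at (gs i u t)) (Dgs i u t w))) (at u)"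
        by (rule has_derivative_compose[OF N(4) smooth_on_has_derivative[OF Ts]]) (use u in auto)
      then show ?thesis
        by (rule has_derivative_transform_within_open[OF _ oN' u]) (simp add: e)
    qed
    show "continuous_on ?N (\<lambda>u. frechet_derivative (Ttr i j) (at (gs i u t)) (Dgs i u t w))" for w
    proof -
      have "smooth_on ((VV i j \<times> UNIV) \<times> UNIV) (\<lambda>p. frechet_derivative (Ttr i j) (at (fst p)) (snd p))"
        by (intro smooth_on_deriv_app[OF o _ o Ts] smooth_on_fst smooth_on_snd smooth_on_ident open_Times o open_UNIV) auto
      then have "continuous_on ((VV i j \<times> UNIV) \<times> UNIV) (\<lambda>p. frechet_derivative (Ttr i j) (at (fst p)) (snd p))"
        by (rule smooth_on_imp_continuous_on)
      moreover have "continuous_on ?N (\<lambda>u. (gs i u t, Dgs i u t w))"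
        by (intro continuous_on_Pair continuous_on_subset[OF \<open>continuous_on N (\<lambda>u. gs i u t)\<close>] continuous_on_subset[OF N(5)]) auto
      ultimately have "continuous_on ?N (\<lambda>u. (\<lambda>p. frechet_derivative (Ttr i j) (at (fst p)) (snd p)) (gs i u t, Dgs i u t w))"
        by (rule continuous_on_compose2) auto
      then show ?thesis by simp
    qed
  qed
qed

lemma C1_near_0: "C1_near i0 0 v"
proof (rule C1_nearI[where N=UNIV and D="\<lambda>u w. (0, w)"])
  show "((\<lambda>v. gs i0 v 0) has_derivative (\<lambda>w. (0, w))) (at u)" for u
    by (simp add: gs_def gstate_geo_0) (intro derivative_intros)
qed (use i0 geo_0 in auto)

text \<open>The state at \<open>s\<close> is the flow applied to the state at \<open>S\<close>, so
  differentiability passes by the chain rule from any parameter of the window to any other, forward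
  or backward.\<close>

lemma C1_near_flow:
  assumes i: "i \<in> charts F" and vT: "geo v T \<in> cdom F i"
  obtains \<eta> where "\<eta> > 0" "\<And>s. \<bar>s - T\<bar> < \<eta> \<Longrightarrow> geo v s \<in> cdom F i"
    "\<And>S s. \<bar>S - T\<bar> < \<eta> \<Longrightarrow> \<bar>s - T\<bar> < \<eta> \<Longrightarrow> C1_near i S v \<Longrightarrow> C1_near i s v"
proof -
  obtain \<rho> \<delta> \<phi> \<psi> \<eta> where f: "\<delta> > 0" "\<eta> > 0"
    "\<And>z. z \<in> ball (gs i v T) \<rho> \<Longrightarrow> \<phi> z 0 = z"
    "\<And>z t. z \<in> ball (gs i v T) \<rho> \<Longrightarrow> \<bar>t\<bar> < \<delta> \<Longrightarrow> ((\<lambda>z. \<phi> z t) has_derivative (\<lambda>w. \<psi> z w t)) (at z)"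
    "\<And>w t. \<bar>t\<bar> < \<delta> \<Longrightarrow> continuous_on (ball (gs i v T) \<rho>) (\<lambda>z. \<psi> z w t)"
    "\<And>z w. z \<in> ball (gs i v T) \<rho> \<Longrightarrow> \<psi> z w 0 = w"
    "\<And>z w t. z \<in> ball (gs i v T) \<rho> \<Longrightarrow> \<bar>t\<bar> < \<delta> \<Longrightarrow>
       (\<psi> z w has_vector_derivative frechet_derivative (spray i) (at (\<phi> z t)) (\<psi> z w t)) (at t)"
    "\<And>s. \<bar>s - T\<bar> < \<eta> \<Longrightarrow> geo v s \<in> cdom F i \<and> gs i v s \<in> ball (gs i v T) \<rho>"
    "\<And>u S s. geo u S \<in> cdom F i \<Longrightarrow> gs i u S \<in> ball (gs i v T) \<rho> \<Longrightarrow> \<bar>s - S\<bar> < \<delta> \<Longrightarrow>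
       geo u s \<in> cdom F i \<and> gs i u s = \<phi> (gs i u S) (s - S)"
    by (rule flow_window[OF i vT], rule that)
  show ?thesis
  proof (rule that[of "min \<eta> (\<delta>/2)"])
    show "min \<eta> (\<delta>/2) > 0" using f by simp
    show "geo v s \<in> cdom F i" if "\<bar>s - T\<bar> < min \<eta> (\<delta>/2)" for s using f(8)[of s] that by simp
    fix S s assume S: "\<bar>S - T\<bar> < min \<eta> (\<delta>/2)" and s: "\<bar>s - T\<bar> < min \<eta> (\<delta>/2)" and C: "C1_near i S v"
    have sS: "\<bar>s - S\<bar> < \<delta>" using S s by linarith
    obtain N where N: "open N" "v \<in> N" "\<And>u. u \<in> N \<Longrightarrow> geo u S \<in> cdom F i"
      "\<And>u. u \<in> N \<Longrightarrow> ((\<lambda>v. gs i v S) has_derivative Dgs i u S) (at u)" "\<And>w. continuous_on N (\<lambda>u. Dgs i u S w)"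
      using C unfolding C1_near_def by blast
    have cN: "continuous_on N (\<lambda>u. gs i u S)" by (rule has_derivative_continuous_on[OF has_derivative_at_withinI[OF N(4)]])
    let ?N = "N \<inter> (\<lambda>u. gs i u S) -` ball (gs i v T) \<rho>"
    have oN: "open ?N" by (rule continuous_open_preimage[OF cN N(1) open_ball])
    have fl: "geo u s \<in> cdom F i" "gs i u s = \<phi> (gs i u S) (s - S)" if "u \<in> ?N" for u
      using f(9)[OF N(3) _ sS, of u] that by auto
    show "C1_near i s v"
    proof (rule C1_nearI[where N="?N" and D="\<lambda>u w. \<psi> (gs i u S) (Dgs i u S w) (s - S)", OF oN])
      show "v \<in> ?N" using N(2) f(8)[of S] S by auto
      show "geo u s \<in> cdom F i" if "u \<in> ?N" for u using fl(1)[OF that] .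
      show "((\<lambda>v. gs i v s) has_derivative (\<lambda>w. \<psi> (gs i u S) (Dgs i u S w) (s - S))) (at u)" if u: "u \<in> ?N" for u
      proof -
        have "((\<lambda>v. \<phi> (gs i v S) (s - S)) has_derivative (\<lambda>w. \<psi> (gs i u S) (Dgs i u S w) (s - S))) (at u)"
          by (rule has_derivative_compose[OF N(4) f(4)]) (use u sS in auto)
        then show ?thesis
          by (rule has_derivative_transform_within_open[OF _ oN u]) (simp add: fl(2))
      qed
      show "continuous_on ?N (\<lambda>u. \<psi> (gs i u S) (Dgs i u S w) (s - S))" for w
      proof -
        have "continuous_on ?N (\<lambda>u. \<Sum>b\<in>Basis. (Dgs i u S w \<bullet> b) *\<^sub>R \<psi> (gs i u S) b (s - S))"
          by (intro continuous_on_sum continuous_on_scaleR continuous_on_inner continuous_on_const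
              continuous_on_subset[OF N(5)] continuous_on_compose2[OF f(5)[OF sS] continuous_on_subset[OF cN]]) auto
        moreover have "(\<Sum>b\<in>Basis. (Dgs i u S w \<bullet> b) *\<^sub>R \<psi> (gs i u S) b (s - S)) = \<psi> (gs i u S) (Dgs i u S w) (s - S)"
          if "u \<in> ?N" for u
          by (rule has_derivative_sum_Basis[symmetric, OF has_derivative_bounded_linear[OF f(4)]]) (use that sS in auto)
        ultimately show ?thesis by (rule continuous_on_eq)
      qed
    qed
  qed
qed

text \<open>The property holds at parameter 0, where the state is affine in the velocity, and the
  flow windows make its truth locally constant in the parameter.\<close>

lemma C1_near_all:
  assumes i: "i \<in> charts F" "geo v t \<in> cdom F i"
  shows "C1_near i t v"
proof -
  define P where "P t \<longleftrightarrow> (\<exists>i\<in>charts F. geo v t \<in> cdom F i \<and> C1_near i t v)" for t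
  have loc: "\<exists>\<eta>>0. \<forall>s S. \<bar>s - T\<bar> < \<eta> \<and> \<bar>S - T\<bar> < \<eta> \<and> P S \<longrightarrow> P s" for T
  proof -
    obtain i where i: "i \<in> charts F" "geo v T \<in> cdom F i" using germ_obtain_chart[OF geo_germ_geo] by blast
    obtain \<eta> where \<eta>: "\<eta> > 0" "\<And>s. \<bar>s - T\<bar> < \<eta> \<Longrightarrow> geo v s \<in> cdom F i"
      "\<And>S s. \<bar>S - T\<bar> < \<eta> \<Longrightarrow> \<bar>s - T\<bar> < \<eta> \<Longrightarrow> C1_near i S v \<Longrightarrow> C1_near i s v"
      using C1_near_flow[OF i] by blast
    have "P s" if "\<bar>s - T\<bar> < \<eta>" "\<bar>S - T\<bar> < \<eta>" "P S" for s S
    proof -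
      have "C1_near i S v" using that(3) C1_near_chart[OF _ _ i(1) \<eta>(2)[OF that(2)]] unfolding P_def by blast
      then show ?thesis using \<eta>(2,3) that(1,2) i(1) unfolding P_def by blast
    qed
    then show ?thesis using \<eta>(1) by blast
  qed
  have o: "open {t. P t}" "open {t. \<not> P t}"
    unfolding open_dist dist_real_def
    using loc by (simp, metis abs_zero diff_self)+
  have "P 0" unfolding P_def using C1_near_0 i0 geo_0 by auto
  have "P t"
  proof (rule ccontr)
    assume "\<not> P t"
    then show False
      using connectedD[OF connected_UNIV o] \<open>P 0\<close> by blast
  qed
  then show ?thesis using C1_near_chart[OF _ _ i] unfolding P_def by blast
qed

lemma gs_has_derivative:
  assumes "i \<in> charts F" "geo v t \<in> cdom F i"
  shows "((\<lambda>v. gs i v t) has_derivative Dgs i v t) (at v)"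
  using C1_near_all[OF assms] unfolding C1_near_def by blast

text \<open>Near \<open>T\<close> the derivative of the state is the derivative of the flow applied
  to its value at \<open>T\<close>, so it satisfies the variational equation of the spray.\<close>

lemma Dgs_ode:
  assumes i: "i \<in> charts F" and vT: "geo v T \<in> cdom F i"
  shows "((\<lambda>t. Dgs i v t w) has_vector_derivative frechet_derivative (spray i) (at (gs i v T)) (Dgs i v T w)) (at T)"
proof -
  obtain \<rho> \<delta> \<phi> \<psi> \<eta> where f: "\<delta> > 0" "\<eta> > 0"
    "\<And>z. z \<in> ball (gs i v T) \<rho> \<Longrightarrow> \<phi> z 0 = z"
    "\<And>z t. z \<in> ball (gs i v T) \<rho> \<Longrightarrow> \<bar>t\<bar> < \<delta> \<Longrightarrow> ((\<lambda>z. \<phi> z t) has_derivative (\<lambda>w. \<psi> z w t)) (at z)"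
    "\<And>w t. \<bar>t\<bar> < \<delta> \<Longrightarrow> continuous_on (ball (gs i v T) \<rho>) (\<lambda>z. \<psi> z w t)"
    "\<And>z w. z \<in> ball (gs i v T) \<rho> \<Longrightarrow> \<psi> z w 0 = w"
    "\<And>z w t. z \<in> ball (gs i v T) \<rho> \<Longrightarrow> \<bar>t\<bar> < \<delta> \<Longrightarrow>
       (\<psi> z w has_vector_derivative frechet_derivative (spray i) (at (\<phi> z t)) (\<psi> z w t)) (at t)"
    "\<And>s. \<bar>s - T\<bar> < \<eta> \<Longrightarrow> geo v s \<in> cdom F i \<and> gs i v s \<in> ball (gs i v T) \<rho>"
    "\<And>u S s. geo u S \<in> cdom F i \<Longrightarrow> gs i u S \<in> ball (gs i v T) \<rho> \<Longrightarrow> \<bar>s - S\<bar> < \<delta> \<Longrightarrow>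
       geo u s \<in> cdom F i \<and> gs i u s = \<phi> (gs i u S) (s - S)"
    by (rule flow_window[OF i vT], rule that)
  let ?b = "ball (gs i v T) \<rho>"
  have gb: "gs i v T \<in> ?b" using f(8)[of T] f(2) by simp
  obtain N where N: "open N" "v \<in> N" "\<And>u. u \<in> N \<Longrightarrow> geo u T \<in> cdom F i"
    "\<And>u. u \<in> N \<Longrightarrow> ((\<lambda>v. gs i v T) has_derivative Dgs i u T) (at u)"
    using C1_near_all[OF i vT] unfolding C1_near_def by blast
  have cN: "continuous_on N (\<lambda>u. gs i u T)" by (rule has_derivative_continuous_on[OF has_derivative_at_withinI[OF N(4)]])
  let ?N = "N \<inter> (\<lambda>u. gs i u T) -` ?b"
  have oN: "open ?N" by (rule continuous_open_preimage[OF cN N(1) open_ball])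
  have vN: "v \<in> ?N" using N(2) gb by simp
  have D: "Dgs i v s w = \<psi> (gs i v T) (Dgs i v T w) (s - T)" if s: "\<bar>s - T\<bar> < \<delta>" for s
  proof -
    have "((\<lambda>u. \<phi> (gs i u T) (s - T)) has_derivative (\<lambda>w. \<psi> (gs i v T) (Dgs i v T w) (s - T))) (at v)"
      by (rule has_derivative_compose[OF N(4)[OF N(2)] f(4)[OF gb s]])
    then have "((\<lambda>u. gs i u s) has_derivative (\<lambda>w. \<psi> (gs i v T) (Dgs i v T w) (s - T))) (at v)"
      by (rule has_derivative_transform_within_open[OF _ oN vN]) (use f(9)[OF N(3) _ s] in auto)
    from frechet_derivative_at[OF this, symmetric] show ?thesis unfolding Dgs_def by (rule fun_cong)
  qed
  have l: "((\<lambda>s. s - T) has_vector_derivative 1) (at T)"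
    by (auto intro!: derivative_eq_intros simp: has_real_derivative_iff_has_vector_derivative[symmetric])
  have "(\<psi> (gs i v T) (Dgs i v T w) has_vector_derivative frechet_derivative (spray i) (at (gs i v T)) (Dgs i v T w)) (at (T - T))"
    using f(7)[OF gb, of 0 "Dgs i v T w"] f(1) f(3)[OF gb] f(6)[OF gb] by simp
  from vector_diff_chain_at[OF l this]
  have "((\<lambda>s. \<psi> (gs i v T) (Dgs i v T w) (s - T)) has_vector_derivative frechet_derivative (spray i) (at (gs i v T)) (Dgs i v T w)) (at T)"
    by (simp only: o_def scaleR_one)
  then show ?thesis by (rule has_vector_derivative_transform_near[OF _ f(1)]) (rule D[symmetric])
qed

end

section \<open>Covering maps from local homeomorphisms with segment lifting\<close>

text \<open>The local hypothesis says that the truth value of \<open>P\<close> is constant near each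
  point; then the sets where it is true and false are both open in \<open>A\<close>.\<close>

lemma connected_local_induct:
  fixes A :: "'a::topological_space set"
  assumes A: "connected A" "a \<in> A" "P a"
    and loc: "\<And>t. t \<in> A \<Longrightarrow> \<exists>W. open W \<and> t \<in> W \<and> (\<forall>s\<in>A \<inter> W. \<forall>r\<in>A \<inter> W. P r \<longrightarrow> P s)"
    and t: "t \<in> A"
  shows "P t"
proof (rule ccontr)
  assume nt: "\<not> P t"
  define W where "W x = (SOME W. open W \<and> x \<in> W \<and> (\<forall>s\<in>A \<inter> W. \<forall>r\<in>A \<inter> W. P r \<longrightarrow> P s))" for x
  have W: "open (W x)" "x \<in> W x" "\<And>s r. s \<in> A \<inter> W x \<Longrightarrow> r \<in> A \<inter> W x \<Longrightarrow> P r \<Longrightarrow> P s" if "x \<in> A" for x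
    using someI_ex[OF loc[OF that], folded W_def] by blast+
  define X where "X = (\<Union>x\<in>{x\<in>A. P x}. W x)"
  define Y where "Y = (\<Union>x\<in>{x\<in>A. \<not> P x}. W x)"
  have "open X" "open Y" using W(1) by (auto simp: X_def Y_def)
  moreover have "A \<subseteq> X \<union> Y" using W(2) by (auto simp: X_def Y_def)
  moreover have "X \<inter> Y \<inter> A = {}"
  proof -
    have "P s" if "x \<in> A" "P x" "s \<in> A" "s \<in> W x" for x s
      by (rule W(3)[OF that(1), of s x]) (use that W(2) in auto)
    moreover have "\<not> P s" if "x \<in> A" "\<not> P x" "s \<in> A" "s \<in> W x" for x s
      using W(3)[OF that(1), of x s] that W(2) by auto
    ultimately show ?thesis unfolding X_def Y_def by blast
  qed
  moreover have "a \<in> X \<inter> A" "t \<in> Y \<inter> A" using W(2) A t nt by (auto simp: X_def Y_def)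
  ultimately show False using connectedD[OF A(1)] by blast
qed

text \<open>A covering map over one evenly covered chart ball: \<open>q\<close> is the map read in
  the chart and \<open>B\<close> the convex ball. Lifts of straight segments are enough because a
  section over \<open>B\<close> is built along segments from one point.\<close>

locale segment_lifting =
  fixes q :: "'a::euclidean_space \<Rightarrow> 'b::euclidean_space" and U :: "'a set" and B :: "'b set"
  assumes U: "open U" and B: "open B" "convex B" and qU: "q ` U \<subseteq> B"
    and local_homeo: "\<And>x. x \<in> U \<Longrightarrow> \<exists>N W g. open N \<and> x \<in> N \<and> N \<subseteq> U \<and> open W \<and> homeomorphism N W q g"
    and lifting: "\<And>x b. x \<in> U \<Longrightarrow> b \<in> B \<Longrightarrow> \<exists>\<sigma>. continuous_on {0..1} \<sigma> \<and> \<sigma> ` {0..1} \<subseteq> U \<and> \<sigma> 0 = x \<and>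
        (\<forall>t\<in>{0..1}. q (\<sigma> t) = q x + t *\<^sub>R (b - q x))"
begin

text \<open>Where the lifts agree, injectivity of \<open>q\<close> on a neighbourhood keeps them
  equal; where they differ, disjoint neighbourhoods keep them apart.\<close>

lemma lift_unique:
  fixes f g :: "'c::topological_space \<Rightarrow> 'a"
  assumes T: "connected T" "continuous_on T f" "continuous_on T g" "f ` T \<subseteq> U"
    "\<And>t. t \<in> T \<Longrightarrow> q (f t) = q (g t)" "t0 \<in> T" "f t0 = g t0" "t \<in> T"
  shows "f t = g t"
proof (rule connected_local_induct[where P="\<lambda>t. f t = g t", OF T(1,6,7) _ T(8)])
  fix t assume t: "t \<in> T"
  show "\<exists>W. open W \<and> t \<in> W \<and> (\<forall>s\<in>T \<inter> W. \<forall>r\<in>T \<inter> W. f r = g r \<longrightarrow> f s = g s)"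
  proof (cases "f t = g t")
    case True
    have "f t \<in> U" using T(4) t by blast
    from local_homeo[OF this] obtain N W h where N: "open N" "f t \<in> N" "homeomorphism N W q h" by blast
    obtain A1 where A1: "open A1" "A1 \<inter> T = f -` N \<inter> T" using iffD1[OF continuous_on_open_invariant T(2), rule_format, OF N(1)] by blast
    obtain A2 where A2: "open A2" "A2 \<inter> T = g -` N \<inter> T" using iffD1[OF continuous_on_open_invariant T(3), rule_format, OF N(1)] by blast
    have "f s = g s" if "s \<in> T \<inter> (A1 \<inter> A2)" for s
    proof -
      have "f s \<in> N" "g s \<in> N" using that A1(2) A2(2) by auto
      then show ?thesis using T(5)[of s] that homeomorphism_apply1[OF N(3)] by (metis IntD1)
    qed
    moreover have "t \<in> A1 \<inter> A2" using A1(2) A2(2) N(2) True t by auto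
    ultimately show ?thesis using A1(1) A2(1) by (intro exI[of _ "A1 \<inter> A2"]) auto
  next
    case False
    obtain P Q where PQ: "open P" "open Q" "f t \<in> P" "g t \<in> Q" "P \<inter> Q = {}" using hausdorff[OF False] by blast
    obtain A1 where A1: "open A1" "A1 \<inter> T = f -` P \<inter> T" using iffD1[OF continuous_on_open_invariant T(2), rule_format, OF PQ(1)] by blast
    obtain A2 where A2: "open A2" "A2 \<inter> T = g -` Q \<inter> T" using iffD1[OF continuous_on_open_invariant T(3), rule_format, OF PQ(2)] by blast
    have "f s \<noteq> g s" if "s \<in> T \<inter> (A1 \<inter> A2)" for s
    proof -
      have "f s \<in> P" "g s \<in> Q" using that A1(2) A2(2) by auto
      then show ?thesis using PQ(5) by auto
    qed
    moreover have "t \<in> A1 \<inter> A2" using A1(2) A2(2) PQ t by auto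
    ultimately show ?thesis using A1(1) A2(1) by (intro exI[of _ "A1 \<inter> A2"]) auto
  qed
qed

text \<open>The section sends \<open>b\<close> to the end point of the lifted segment from
  \<open>q x\<close> to \<open>b\<close>. What has to be proved is that this end point depends
  continuously on \<open>b\<close>.\<close>

lemma section_exists:
  assumes x: "x \<in> U"
  obtains s where "continuous_on B s" "s ` B \<subseteq> U" "\<And>b. b \<in> B \<Longrightarrow> q (s b) = b" "s (q x) = x"
proof -
  define c where "c = q x"
  have c: "c \<in> B" using x qU by (auto simp: c_def)
  obtain \<sigma> where \<sigma>: "\<And>b. b \<in> B \<Longrightarrow> continuous_on {0..1} (\<sigma> b)" "\<And>b. b \<in> B \<Longrightarrow> \<sigma> b ` {0..1} \<subseteq> U"
    "\<And>b. b \<in> B \<Longrightarrow> \<sigma> b 0 = x" "\<And>b t. b \<in> B \<Longrightarrow> t \<in> {0..1} \<Longrightarrow> q (\<sigma> b t) = c + t *\<^sub>R (b - c)"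
    using bchoice[of B "\<lambda>b \<sigma>. continuous_on {0..1} \<sigma> \<and> \<sigma> ` {0..1} \<subseteq> U \<and> \<sigma> 0 = x \<and>
        (\<forall>t\<in>{0..1}. q (\<sigma> t) = c + t *\<^sub>R (b - c))"] lifting[OF x] unfolding c_def by blast
  have cont: "continuous (at b0 within B) (\<lambda>b. \<sigma> b t)" if b0: "b0 \<in> B" and t: "t \<in> {0..1}" for b0 t
  \<comment> \<open>Continuity in b at \<open>b0\<close> is propagated along the segment from
    parameter 0, where all lifts sit at \<open>x\<close>, to the parameter t.\<close>
  proof (rule connected_local_induct[where P="\<lambda>t. continuous (at b0 within B) (\<lambda>b. \<sigma> b t)" and A="{0..1::real}" and a=0, OF _ _ _ _ t])
    have "continuous (at b0 within B) (\<lambda>b. x)" by simp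
    then show "continuous (at b0 within B) (\<lambda>b. \<sigma> b 0)"
      unfolding continuous_within by (rule Lim_transform_eventually[THEN tendsto_eq_rhs])
        (use \<sigma>(3) b0 in \<open>auto simp: eventually_at_filter\<close>)
  next
    fix t :: real assume t: "t \<in> {0..1}"
    have "\<sigma> b0 t \<in> U" using \<sigma>(2)[OF b0] t by auto
    from local_homeo[OF this] obtain N W g where N: "open N" "\<sigma> b0 t \<in> N" "N \<subseteq> U" "open W" "homeomorphism N W q g"
      by blast
    have gc: "continuous_on W g" and gN: "g ` W \<subseteq> N" and qN: "q ` N = W" and qg: "\<And>y. y \<in> W \<Longrightarrow> q (g y) = y"
      and gq: "\<And>y. y \<in> N \<Longrightarrow> g (q y) = y"
      using N(5) unfolding homeomorphism_def by auto
    have "q (\<sigma> b0 t) \<in> W" using N(2) qN by blast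
    then have "c + t *\<^sub>R (b0 - c) \<in> W" using \<sigma>(4)[OF b0 t] by simp
    moreover have "isCont (\<lambda>p. c + fst p *\<^sub>R (snd p - c)) (t, b0)" by (intro continuous_intros)
    ultimately have "\<forall>\<^sub>F p in nhds (t, b0). c + fst p *\<^sub>R (snd p - c) \<in> W"
      using N(4) by (simp add: continuous_at_open eventually_nhds)
    then obtain \<eta> where \<eta>: "\<eta> > 0" "\<And>p. dist p (t, b0) < \<eta> \<Longrightarrow> c + fst p *\<^sub>R (snd p - c) \<in> W"
      unfolding eventually_nhds_metric by blast
    obtain A where A: "open A" "A \<inter> {0..1} = \<sigma> b0 -` N \<inter> {0..1}"
      using iffD1[OF continuous_on_open_invariant \<sigma>(1)[OF b0], rule_format, OF N(1)] by blast
    have AN: "s \<in> A \<longleftrightarrow> \<sigma> b0 s \<in> N" if "s \<in> {0..1}" for s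
    proof -
      have "s \<in> A \<inter> {0..1} \<longleftrightarrow> s \<in> \<sigma> b0 -` N \<inter> {0..1}" by (simp only: A(2))
      then show ?thesis using that by simp
    qed
    have tA: "t \<in> A" using AN[OF t] N(2) by simp
    obtain e where e: "e > 0" "\<And>s. \<bar>s - t\<bar> < e \<Longrightarrow> s \<in> A" using open_real_ball_ex[OF A(1) tA] by blast
    define d where "d = min e (\<eta> / 2)"
    have d: "d > 0" and de: "d \<le> e" using e \<eta> by (auto simp: d_def)
    have inW: "c + s *\<^sub>R (b - c) \<in> W" if "\<bar>s - t\<bar> < d" "dist b b0 < \<eta> / 2" for s b
    proof -
      have "dist (s, b) (t, b0) \<le> dist s t + dist b b0"
        unfolding dist_Pair_Pair by (rule order_trans[OF sqrt_sum_squares_le_sum]) auto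
      then have "dist (s, b) (t, b0) < \<eta>" using that by (simp add: d_def dist_real_def)
      from \<eta>(2)[OF this] show ?thesis by simp
    qed
    show "\<exists>W. open W \<and> t \<in> W \<and> (\<forall>s\<in>{0..1} \<inter> W. \<forall>r\<in>{0..1} \<inter> W.
        continuous (at b0 within B) (\<lambda>b. \<sigma> b r) \<longrightarrow> continuous (at b0 within B) (\<lambda>b. \<sigma> b s))"
    proof (rule exI[of _ "{t-d<..<t+d}"], intro conjI ballI impI)
      fix s r assume s: "s \<in> {0..1} \<inter> {t-d<..<t+d}" and r: "r \<in> {0..1} \<inter> {t-d<..<t+d}"
        and cr: "continuous (at b0 within B) (\<lambda>b. \<sigma> b r)"
      have "r \<in> A" by (rule e(2)) (use r de in \<open>auto simp: abs_less_iff\<close>)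
      then have "\<sigma> b0 r \<in> N" using AN[of r] r by simp
      then have "\<forall>\<^sub>F b in at b0 within B. \<sigma> b r \<in> N"
        using cr N(1) unfolding continuous_within by (rule topological_tendstoD[rotated 2])
      moreover have "\<forall>\<^sub>F b in at b0 within B. dist b b0 < \<eta> / 2"
        using \<eta>(1) by (auto simp: eventually_at intro!: exI[of _ "\<eta>/2"])
      moreover have "\<forall>\<^sub>F b in at b0 within B. b \<in> B" by (simp add: eventually_at_filter)
      \<comment> \<open>For b close to \<open>b0\<close> the lift is inside N at parameter r; by
        uniqueness of lifts it then equals \<open>g\<close> of the segment on the whole window,
        which is continuous in b.\<close>
      ultimately have "\<forall>\<^sub>F b in at b0 within B. g (c + s *\<^sub>R (b - c)) = \<sigma> b s"
      proof eventually_elim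
        case (elim b)
        have "\<sigma> b s = (\<lambda>s. g (c + s *\<^sub>R (b - c))) s"
        proof (rule lift_unique[of "{0..1} \<inter> {t-d<..<t+d}" "\<sigma> b" "\<lambda>s. g (c + s *\<^sub>R (b - c))" r s])
          show "connected ({0..1} \<inter> {t-d<..<t+d})" by (intro convex_connected convex_Int) auto
          show "continuous_on ({0..1} \<inter> {t-d<..<t+d}) (\<sigma> b)" using \<sigma>(1)[OF elim(3)] continuous_on_subset by blast
          show "continuous_on ({0..1} \<inter> {t-d<..<t+d}) (\<lambda>s. g (c + s *\<^sub>R (b - c)))"
            by (rule continuous_on_compose2[OF gc]) (use inW elim(2) in \<open>auto intro!: continuous_intros simp: abs_less_iff\<close>)
          show "\<sigma> b ` ({0..1} \<inter> {t-d<..<t+d}) \<subseteq> U" using \<sigma>(2)[OF elim(3)] by auto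
          show "q (\<sigma> b u) = q (g (c + u *\<^sub>R (b - c)))" if "u \<in> {0..1} \<inter> {t-d<..<t+d}" for u
            using \<sigma>(4)[OF elim(3), of u] qg[OF inW[OF _ elim(2), of u]] that by (simp add: abs_less_iff)
          show "\<sigma> b r = g (c + r *\<^sub>R (b - c))"
            using gq[OF elim(1)] \<sigma>(4)[OF elim(3), of r] r by simp
        qed (use s r in auto)
        then show ?case by simp
      qed
      moreover have "((\<lambda>b. g (c + s *\<^sub>R (b - c))) \<longlongrightarrow> g (c + s *\<^sub>R (b0 - c))) (at b0 within B)"
      proof -
        have "c + s *\<^sub>R (b0 - c) \<in> W" by (rule inW) (use s \<eta> in \<open>auto simp: abs_less_iff\<close>)
        then have "isCont g (c + s *\<^sub>R (b0 - c))" using gc N(4) by (simp add: continuous_on_eq_continuous_at)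
        then show ?thesis by (rule isCont_tendsto_compose) (intro tendsto_intros)
      qed
      moreover have "g (c + s *\<^sub>R (b0 - c)) = \<sigma> b0 s"
      proof -
        have "s \<in> A" by (rule e(2)) (use s de in \<open>auto simp: abs_less_iff\<close>)
        then have "\<sigma> b0 s \<in> N" using AN[of s] s by simp
        from gq[OF this] show ?thesis using \<sigma>(4)[OF b0, of s] s by simp
      qed
      ultimately show "continuous (at b0 within B) (\<lambda>b. \<sigma> b s)"
        unfolding continuous_within using Lim_transform_eventually by fastforce
    qed (use d in auto)
  qed auto
  show ?thesis
  proof (rule that[of "\<lambda>b. \<sigma> b 1"])
    show "continuous_on B (\<lambda>b. \<sigma> b 1)" using cont[of _ 1] by (simp add: continuous_on_eq_continuous_within)
    show "(\<lambda>b. \<sigma> b 1) ` B \<subseteq> U" using \<sigma>(2) by fastforce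
    show "q (\<sigma> b 1) = b" if "b \<in> B" for b using \<sigma>(4)[OF that, of 1] by simp
    \<comment> \<open>The segment from \<open>c\<close> to itself is constant, and by uniqueness so
      is its lift.\<close>
    have "\<sigma> c 1 = (\<lambda>t. x) (1::real)"
      by (rule lift_unique[of "{0..1}" "\<sigma> c" "\<lambda>t. x" 0 1]) (use \<sigma>[OF c] c in \<open>auto simp: c_def\<close>)
    then show "\<sigma> (q x) 1 = x" by (simp add: c_def)
  qed
qed

section \<open>Sections and the sheets they define\<close>

definition "is_section s \<longleftrightarrow> continuous_on B s \<and> s ` B \<subseteq> U \<and> (\<forall>b\<in>B. q (s b) = b)"

text \<open>A common point lies over a single base point because \<open>q\<close> inverts both
  sections; uniqueness of lifts over the connected set \<open>B\<close> does the rest.\<close>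

lemma sections_disjoint:
  assumes "is_section s" "is_section s'" "b \<in> B" "b' \<in> B" "s b = s' b'"
  shows "s ` B = s' ` B"
proof -
  have "b = b'" using assms unfolding is_section_def by metis
  have "s a = s' a" if "a \<in> B" for a
    by (rule lift_unique[OF convex_connected[OF B(2)] _ _ _ _ assms(3) _ that])
      (use assms \<open>b = b'\<close> in \<open>auto simp: is_section_def\<close>)
  then show ?thesis by auto
qed

text \<open>In a neighbourhood on which \<open>q\<close> is injective, a point x with s(q x) in the
  same neighbourhood must equal s(q x), so it belongs to the sheet.\<close>

lemma section_open:
  assumes "is_section s" shows "open (s ` B)"
  unfolding open_subopen[of "s ` B"]
proof
  fix y assume "y \<in> s ` B"
  then obtain b where b: "b \<in> B" "y = s b" by blast
  have s: "continuous_on B s" "s ` B \<subseteq> U" "\<And>b. b \<in> B \<Longrightarrow> q (s b) = b" using assms unfolding is_section_def by auto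
  have "y \<in> U" using b s by blast
  from local_homeo[OF this] obtain N W g where N: "open N" "y \<in> N" "N \<subseteq> U" "open W" "homeomorphism N W q g" by blast
  have qc: "continuous_on N q" and qi: "\<And>x. x \<in> N \<Longrightarrow> g (q x) = x"
    using N(5) unfolding homeomorphism_def by auto
  have oB: "open (B \<inter> s -` N)" by (rule continuous_open_preimage[OF s(1) B(1) N(1)])
  have "open (N \<inter> q -` (B \<inter> s -` N))" by (rule continuous_open_preimage[OF qc N(1) oB])
  moreover have "y \<in> N \<inter> q -` (B \<inter> s -` N)" using N(2) b s(3) by auto
  moreover have "N \<inter> q -` (B \<inter> s -` N) \<subseteq> s ` B"
  proof
    fix x assume x: "x \<in> N \<inter> q -` (B \<inter> s -` N)"
    then have "g (q (s (q x))) = s (q x)" using qi by auto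
    moreover have "q (s (q x)) = q x" using s(3) x by auto
    ultimately have "s (q x) = x" using qi x by auto
    then show "x \<in> s ` B" using x by (metis IntD1 IntD2 image_eqI vimage_eq)
  qed
  ultimately show "\<exists>T. open T \<and> y \<in> T \<and> T \<subseteq> s ` B" by blast
qed

lemma section_homeomorphism:
  assumes "is_section s" shows "homeomorphism (s ` B) B q s"
proof -
  have s: "continuous_on B s" "s ` B \<subseteq> U" "\<And>b. b \<in> B \<Longrightarrow> q (s b) = b" using assms unfolding is_section_def by auto
  have "continuous_on U q"
  proof (rule continuous_at_imp_continuous_on, rule ballI)
    fix x assume "x \<in> U"
    from local_homeo[OF this] obtain N W g where N: "open N" "x \<in> N" "homeomorphism N W q g" by blast
    then show "isCont q x" unfolding homeomorphism_def using continuous_on_eq_continuous_at by blast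
  qed
  then have "continuous_on (s ` B) q" using s(2) continuous_on_subset by blast
  moreover have "q ` (s ` B) = B" unfolding image_image using s(3) by simp
  ultimately show ?thesis unfolding homeomorphism_def using s by auto
qed

end

text \<open>The sheets over T are the images of all sections: they exhaust the preimage by
  \<open>section_exists\<close> and are open, pairwise equal or disjoint, and mapped
  homeomorphically.\<close>

lemma covering_spaceI_segment_lifting:
  fixes p :: "'a::euclidean_space \<Rightarrow> 'm::topological_space"
  assumes "continuous_on UNIV p" and ran: "range p = S"
    and loc: "\<And>y. y \<in> S \<Longrightarrow> \<exists>T h k (B::'b::euclidean_space set). y \<in> T \<and> open T \<and> T \<subseteq> S \<and> homeomorphism T B h k \<and>
       segment_lifting (\<lambda>x. h (p x)) (p -` T) B"
  shows "covering_space UNIV p S"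
  unfolding covering_space_def
proof (intro conjI assms(1) ballI)
  show "range p = S" by (rule ran)
  fix y assume "y \<in> S"
  from loc[OF this] obtain T h k and B :: "'b set" where T: "y \<in> T" "open T" "T \<subseteq> S" "homeomorphism T B h k"
    and sl: "segment_lifting (\<lambda>x. h (p x)) (p -` T) B" by blast
  interpret segment_lifting "\<lambda>x. h (p x)" "p -` T" B by (rule sl)
  have hk: "\<And>x. x \<in> T \<Longrightarrow> k (h x) = x" "\<And>b. b \<in> B \<Longrightarrow> h (k b) = b" "k ` B = T" "h ` T = B"
     "continuous_on T h" "continuous_on B k"
    using T(4) unfolding homeomorphism_def by auto
  define vv where "vv = {s ` B |s. is_section s}"
  show "\<exists>T. y \<in> T \<and> openin (top_of_set S) T \<and> (\<exists>v. \<Union> v = UNIV \<inter> p -` T \<and> (\<forall>u\<in>v. openin (top_of_set UNIV) u) \<and>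
      pairwise disjnt v \<and> (\<forall>u\<in>v. \<exists>q. homeomorphism u T p q))"
  proof (intro exI[of _ T] conjI exI[of _ vv] ballI)
    show "openin (top_of_set S) T" by (rule open_subset[OF T(3,2)])
    show "\<Union> vv = UNIV \<inter> p -` T"
    proof (intro equalityI subsetI)
      fix x assume "x \<in> \<Union> vv"
      then obtain s where "is_section s" "x \<in> s ` B" unfolding vv_def by blast
      then show "x \<in> UNIV \<inter> p -` T" unfolding is_section_def by blast
    next
      fix x assume x: "x \<in> UNIV \<inter> p -` T"
      then have xU: "x \<in> p -` T" by blast
      obtain s where s: "continuous_on B s" "s ` B \<subseteq> p -` T" "\<And>b. b \<in> B \<Longrightarrow> h (p (s b)) = b" "s (h (p x)) = x"
        by (rule section_exists[OF xU], rule that)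
      have "is_section s" using s unfolding is_section_def by blast
      moreover have "x \<in> s ` B" using s(4) qU xU by (metis image_eqI image_subset_iff)
      ultimately show "x \<in> \<Union> vv" unfolding vv_def by blast
    qed
    show "openin (top_of_set UNIV) u" if "u \<in> vv" for u
      using that section_open unfolding vv_def by auto
    show "pairwise disjnt vv"
    proof (rule pairwiseI)
      fix u w assume "u \<in> vv" "w \<in> vv" "u \<noteq> w"
      then obtain s s' where ss: "is_section s" "is_section s'" "u = s ` B" "w = s' ` B" unfolding vv_def by blast
      show "disjnt u w"
      proof (rule ccontr)
        assume "\<not> disjnt u w"
        then obtain b b' where "b \<in> B" "b' \<in> B" "s b = s' b'" unfolding disjnt_def ss(3,4) by blast
        from sections_disjoint[OF ss(1,2) this] show False using \<open>u \<noteq> w\<close> ss by simp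
      qed
    qed
    show "\<exists>q. homeomorphism u T p q" if "u \<in> vv" for u
    proof -
      obtain s where s: "is_section s" "u = s ` B" using \<open>u \<in> vv\<close> unfolding vv_def by blast
      have "homeomorphism u T (k \<circ> (\<lambda>x. h (p x))) (s \<circ> h)"
        unfolding s(2) by (rule homeomorphism_compose[OF section_homeomorphism[OF s(1)] homeomorphism_symD[OF T(4)]])
      then have "homeomorphism u T p (s \<circ> h)"
      proof (rule homeomorphism_cong)
        show "p x = (k \<circ> (\<lambda>x. h (p x))) x" if "x \<in> u" for x
        proof -
          have "p x \<in> T" using s that unfolding is_section_def by blast
          then show ?thesis using hk(1) by simp
        qed
      qed auto
      then show ?thesis by blast
    qed
  qed (use T in auto)
qed

section \<open>The Gauss lemma\<close>

context complete_from
begin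

text \<open>\<open>jac i v w\<close> is the Jacobi field along \<open>geo v\<close> with value \<open>0\<close> and derivative \<open>w\<close> at \<open>0\<close>, in the
  chart \<open>i\<close>.\<close>

definition "jac i v w t = fst (Dgs i v t w)"
definition "cm0 = cm i0 (coord F i0 x0)"

lemma gs_fst: "fst (gs i v t) = coord F i (geo v t)"
  by (simp add: gs_def gstate_def)

lemma gs_deriv:
  "i \<in> charts F \<Longrightarrow> geo v t \<in> cdom F i \<Longrightarrow> (gs i v has_vector_derivative spray i (gs i v t)) (at t)"
  using germ_gstate_deriv[OF geo_germ_geo] by (simp add: gs_def[abs_def])

lemma energy_geo:
  assumes i: "i \<in> charts F" "geo v t \<in> cdom F i"
  shows "energy i (gs i v t) = cm0 v v"
proof -
  have "energy i (gstate i (geo v) t) = energy i0 (gstate i0 (geo v) 0)"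
    by (rule energy_const[where \<alpha>="-(\<bar>t\<bar>+1)" and \<beta>="\<bar>t\<bar>+1"]) (use geo_germ_geo i i0 geo_0 in auto)
  then show ?thesis by (simp add: gs_def gstate_geo_0 energy_def cm0_def)
qed

lemma cm0_bilinear: "bilinear cm0"
  and cm0_sym: "cm0 v w = cm0 w v"
  and cm0_pos: "v \<noteq> 0 \<Longrightarrow> cm0 v v > 0"
  unfolding cm0_def using i0 by (auto intro!: cm_bilinear cm_pos intro: cm_sym)

text \<open>Both sides are the derivative at \<open>v\<close> in direction \<open>w\<close> of the
  energy at parameter \<open>t\<close>; by conservation that energy is \<open>cm0 u u\<close> for
  the initial velocity u.\<close>

lemma denergy:
  assumes i: "i \<in> charts F" "geo v t \<in> cdom F i"
  shows "Dcm i (fst (gs i v t)) (snd (gs i v t)) (snd (gs i v t)) (jac i v w t)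
     + 2 * cm i (fst (gs i v t)) (snd (gs i v t)) (snd (Dgs i v t w)) = 2 * cm0 v w"
proof -
  obtain N where N: "open N" "v \<in> N" "\<And>u. u \<in> N \<Longrightarrow> geo u t \<in> cdom F i"
    using C1_near_all[OF i] unfolding C1_near_def by blast
  have 1: "((\<lambda>u. energy i (gs i u t)) has_derivative
     (\<lambda>w. Dcm i (fst (gs i v t)) (snd (gs i v t)) (snd (gs i v t)) (fst (Dgs i v t w))
     + 2 * cm i (fst (gs i v t)) (snd (gs i v t)) (snd (Dgs i v t w)))) (at v)"
    by (rule has_derivative_compose[OF gs_has_derivative[OF i] energy_has_derivative[OF i(1) gs_V[OF i(2)]]])
  interpret c: bounded_bilinear cm0
    using cm0_bilinear bilinear_conv_bounded_bilinear by blast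
  have "((\<lambda>u. cm0 u u) has_derivative (\<lambda>w. cm0 v w + cm0 w v)) (at v)"
    by (rule c.FDERIV) (rule has_derivative_ident)+
  then have "((\<lambda>u. energy i (gs i u t)) has_derivative (\<lambda>w. cm0 v w + cm0 w v)) (at v)"
    by (rule has_derivative_transform_within_open[OF _ N(1,2)]) (rule energy_geo[OF i(1) N(3), symmetric])
  from fun_cong[OF has_derivative_unique[OF 1 this], of w] show ?thesis
    using cm0_sym[of w v] by (simp add: jac_def)
qed

text \<open>The field is the derivative of the end point with respect to the initial velocity, so it
  transforms by the chain rule.\<close>

lemma jac_tr:
  assumes i: "i \<in> charts F" "geo v t \<in> cdom F i" and j: "j \<in> charts F" "geo v t \<in> cdom F j"
  shows "jac j v w t = Dtr i j (coord F i (geo v t)) (jac i v w t)"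
proof -
  obtain N where N: "open N" "v \<in> N" "\<And>u. u \<in> N \<Longrightarrow> geo u t \<in> cdom F i"
    using C1_near_all[OF i] unfolding C1_near_def by blast
  have v: "coord F i (geo v t) \<in> VV i j" using i j by auto
  have fi: "((\<lambda>u. coord F i (geo u t)) has_derivative (\<lambda>w. jac i v w t)) (at v)"
    if "i \<in> charts F" "geo v t \<in> cdom F i" for i
    using has_derivative_fst[OF gs_has_derivative[OF that]] by (simp add: gs_fst jac_def)
  have "((\<lambda>u. tr i j (coord F i (geo u t))) has_derivative (\<lambda>w. Dtr i j (coord F i (geo v t)) (jac i v w t))) (at v)"
    by (rule has_derivative_compose[OF fi[OF i] Dtr[OF i(1) j(1) v]])
  then have "((\<lambda>u. coord F j (geo u t)) has_derivative (\<lambda>w. Dtr i j (coord F i (geo v t)) (jac i v w t))) (at v)"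
    by (rule has_derivative_transform_within_open[OF _ N(1,2)]) (simp add: tr_def chart_inv_coord[OF i(1) N(3)])
  from fun_cong[OF has_derivative_unique[OF fi[OF j] this]] show ?thesis .
qed

lemma Dgs_0: "Dgs i0 v 0 w = (0, w)"
proof -
  have "((\<lambda>u. gs i0 u 0) has_derivative (\<lambda>w. (0, w))) (at v)"
    by (simp add: gs_def gstate_geo_0) (intro derivative_intros)
  moreover have x: "geo v 0 \<in> cdom F i0" using i0 by (simp add: geo_0)
  ultimately show ?thesis
    using fun_cong[OF has_derivative_unique[OF gs_has_derivative[OF i0(1) x]]] by blast
qed

lemma jac_0: "i \<in> charts F \<Longrightarrow> geo v 0 \<in> cdom F i \<Longrightarrow> jac i v w 0 = 0"
proof -
  assume i: "i \<in> charts F" "geo v 0 \<in> cdom F i"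
  have x: "geo v 0 \<in> cdom F i0" using i0 by (simp add: geo_0)
  have j0: "jac i0 v w 0 = 0" by (simp add: jac_def Dgs_0)
  have "coord F i0 (geo v 0) \<in> VV i0 i" using i i0 x by auto
  then show ?thesis
    unfolding jac_tr[OF i0(1) x i] j0 by (rule linear_0[OF Dtr_linear[OF i0(1) i(1)]])
qed

lemma spray_has_derivative:
  assumes i: "i \<in> charts F" and z: "fst z \<in> V i"
  shows "(spray i has_derivative (\<lambda>k. (snd k, - (frechet_derivative (\<lambda>y. Gam i y (snd z) (snd z)) (at (fst z)) (fst k)
      + Gam i (fst z) (snd k) (snd z) + Gam i (fst z) (snd z) (snd k))))) (at z)"
  unfolding spray_def[abs_def]
  by (intro has_derivative_Pair has_derivative_minus has_derivative_bilinear_field[where p=fst and v=snd and w=snd and x=z,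
          OF open_V[OF i] Gam_bilinear[OF i] Gam_smooth[OF i] z])
    (assumption | rule bounded_linear_imp_has_derivative bounded_linear_fst bounded_linear_snd)+

abbreviation "DGam i y v w \<equiv> frechet_derivative (\<lambda>y. Gam i y v w) (at y)"

text \<open>The variational equation \<open>Dgs_ode\<close> written in components; symmetry of the
  Christoffel symbols merges the two mixed terms.\<close>

lemma jac_derivs:
  assumes i: "i \<in> charts F" "geo v t \<in> cdom F i"
  shows "(jac i v w has_vector_derivative snd (Dgs i v t w)) (at t)"
    and "((\<lambda>t. snd (Dgs i v t w)) has_vector_derivative
       - (DGam i (fst (gs i v t)) (snd (gs i v t)) (snd (gs i v t)) (jac i v w t)
         + 2 *\<^sub>R Gam i (fst (gs i v t)) (snd (gs i v t)) (snd (Dgs i v t w)))) (at t)"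
proof -
  note z = gs_V[OF i(2)]
  have d: "((\<lambda>t. Dgs i v t w) has_vector_derivative (snd (Dgs i v t w),
     - (DGam i (fst (gs i v t)) (snd (gs i v t)) (snd (gs i v t)) (fst (Dgs i v t w))
         + Gam i (fst (gs i v t)) (snd (Dgs i v t w)) (snd (gs i v t)) + Gam i (fst (gs i v t)) (snd (gs i v t)) (snd (Dgs i v t w))))) (at t)"
    using Dgs_ode[OF i] unfolding frechet_derivative_at[OF spray_has_derivative[OF i(1) z], symmetric] .
  show "(jac i v w has_vector_derivative snd (Dgs i v t w)) (at t)"
    using bounded_linear.has_vector_derivative[OF bounded_linear_fst d] by (simp add: jac_def[abs_def])
  show "((\<lambda>t. snd (Dgs i v t w)) has_vector_derivative
       - (DGam i (fst (gs i v t)) (snd (gs i v t)) (snd (gs i v t)) (jac i v w t)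
         + 2 *\<^sub>R Gam i (fst (gs i v t)) (snd (gs i v t)) (snd (Dgs i v t w)))) (at t)"
    using bounded_linear.has_vector_derivative[OF bounded_linear_snd d]
      Gam_sym[OF i(1) z, of "snd (Dgs i v t w)" "snd (gs i v t)"]
    by (simp add: jac_def scaleR_2 add.assoc)
qed

text \<open>The derivative of the inner product along the geodesic is the variation of the constant energy, so
  no curvature identity is needed.\<close>

lemma gauss:
  assumes i: "i \<in> charts F" "geo v t \<in> cdom F i"
  shows "cm i (fst (gs i v t)) (snd (gs i v t)) (jac i v w t) = t * cm0 v w"
proof -
  define th where "th i t = cm i (fst (gs i v t)) (snd (gs i v t)) (jac i v w t)" for i t
  have th_chart: "th i t = th j t"
    if i: "i \<in> charts F" "geo v t \<in> cdom F i" and j: "j \<in> charts F" "geo v t \<in> cdom F j" for i j t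
  proof -
    have v: "coord F i (geo v t) \<in> VV i j" using i j by auto
    have "gs j v t = Ttr i j (gs i v t)" unfolding gs_def
      by (rule gstate_tr[OF i(1) j(1) geo_germ_geo]) (use i j in auto)
    then show ?thesis unfolding th_def jac_tr[OF i j] Ttr_def[OF i(1) j(1)]
      by (simp add: gs_fst cm_tr[OF i(1) j(1) v])
  qed
  define ch where "ch t = (SOME i. i \<in> charts F \<and> geo v t \<in> cdom F i)" for t
  have ch: "ch t \<in> charts F" "geo v t \<in> cdom F (ch t)" for t
    using someI_ex[of "\<lambda>i. i \<in> charts F \<and> geo v t \<in> cdom F i"] germ_obtain_chart[OF geo_germ_geo]
    unfolding ch_def by blast+
  define h where "h t = th (ch t) t - t * cm0 v w" for t
  have "(h has_real_derivative 0) (at t)" for t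
  proof -
    let ?i = "ch t"
    let ?x = "fst (gs ?i v t)" and ?u = "snd (gs ?i v t)" and ?k = "jac ?i v w t" and ?l = "snd (Dgs ?i v t w)"
    note c = ch[of t]
    note x = gs_V[OF c(2)]
    obtain e where e: "e > 0" "\<And>s. \<bar>s - t\<bar> < e \<Longrightarrow> geo v s \<in> cdom F ?i"
      using continuous_near[OF germ_isCont[OF geo_germ_geo] open_cdom[OF c(1)] c(2)] by blast
    have dx: "((\<lambda>s. fst (gs ?i v s)) has_vector_derivative ?u) (at t)"
      using bounded_linear.has_vector_derivative[OF bounded_linear_fst gs_deriv[OF c]] by (simp add: spray_def)
    have du: "((\<lambda>s. snd (gs ?i v s)) has_vector_derivative - Gam ?i ?x ?u ?u) (at t)"
      using bounded_linear.has_vector_derivative[OF bounded_linear_snd gs_deriv[OF c]] by (simp add: spray_def)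
    have "((\<lambda>s. cm ?i (fst (gs ?i v s)) (snd (gs ?i v s)) (jac ?i v w s)) has_derivative
       (\<lambda>h. Dcm ?i ?x ?u ?k (h *\<^sub>R ?u) + cm ?i ?x (h *\<^sub>R (- Gam ?i ?x ?u ?u)) ?k + cm ?i ?x ?u (h *\<^sub>R ?l))) (at t)"
      by (rule has_derivative_bilinear_field[OF open_V[OF c(1)] cm_bilinear[OF c(1)] cm_smooth[OF c(1)] x
            dx[unfolded has_vector_derivative_def] du[unfolded has_vector_derivative_def]
            jac_derivs(1)[OF c, unfolded has_vector_derivative_def]])
    moreover have "Dcm ?i ?x ?u ?k (h *\<^sub>R ?u) + cm ?i ?x (h *\<^sub>R (- Gam ?i ?x ?u ?u)) ?k + cm ?i ?x ?u (h *\<^sub>R ?l)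
       = h *\<^sub>R (Dcm ?i ?x ?u ?k ?u - cm ?i ?x (Gam ?i ?x ?u ?u) ?k + cm ?i ?x ?u ?l)" for h
      using linear_scale[OF Dcm_linear[OF c(1) x]] bilinear_lmul[OF cm_bilinear[OF c(1) x]]
        bilinear_rmul[OF cm_bilinear[OF c(1) x]] bilinear_lneg[OF cm_bilinear[OF c(1) x]]
      by (simp add: algebra_simps)
    \<comment> \<open>After the Christoffel symbol is expressed by derivatives of the metric, the
      left side is half of the expression in \<open>denergy\<close>.\<close>
    moreover have "Dcm ?i ?x ?u ?k ?u - cm ?i ?x (Gam ?i ?x ?u ?u) ?k + cm ?i ?x ?u ?l = cm0 v w"
      using denergy[OF c, of w] unfolding Gam_char[OF c(1) x] koszul_def[OF c(1)] by (simp add: field_simps)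
    ultimately have "((\<lambda>s. th ?i s) has_vector_derivative cm0 v w) (at t)"
      by (simp add: th_def has_vector_derivative_def)
    then have "((\<lambda>s. th (ch s) s) has_vector_derivative cm0 v w) (at t)"
      by (rule has_vector_derivative_transform_near[OF _ e(1)]) (rule th_chart[OF c(1) e(2) ch], assumption)
    then show ?thesis unfolding h_def
      by (auto intro!: derivative_eq_intros simp: has_real_derivative_iff_has_vector_derivative[symmetric])
  qed
  then have "h t = h 0" using DERIV_isconst_all by blast
  moreover have "h 0 = 0"
    unfolding h_def th_def jac_0[OF ch] using bilinear_rzero[OF cm_bilinear[OF ch(1) gs_V[OF ch(2)]]] by simp
  ultimately show ?thesis using th_chart[OF i ch] by (simp add: h_def th_def)
qed

end

section \<open>The exponential map is a covering\<close>

lemma homeomorphism_restrict_open: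
  assumes h: "homeomorphism N W f g" and "open W" "open U"
  shows "\<exists>W'. open W' \<and> homeomorphism (N \<inter> U) W' f g"
proof (intro exI conjI)
  have gc: "continuous_on W g" and gf: "\<And>x. x \<in> N \<Longrightarrow> g (f x) = x" and fg: "\<And>y. y \<in> W \<Longrightarrow> f (g y) = y"
     and fN: "f ` N = W" and gW: "g ` W = N" using h unfolding homeomorphism_def by auto
  show "open (W \<inter> g -` U)" by (rule continuous_open_preimage[OF gc assms(2,3)])
  have "f ` (N \<inter> U) = W \<inter> g -` U"
  proof (intro equalityI subsetI)
    fix y assume y: "y \<in> W \<inter> g -` U"
    then have "g y \<in> N \<inter> U" using gW by auto
    then show "y \<in> f ` (N \<inter> U)" using fg y by (metis IntD1 image_eqI)
  qed (use gf fN in auto)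
  then show "homeomorphism (N \<inter> U) (W \<inter> g -` U) f g"
    by (intro homeomorphism_of_subsets[OF h]) auto
qed

locale exp_nonsingular = complete_from F x0 i0
  for F :: "('i, 'm::{t2_space,second_countable_topology}, real ^ 'n) semi_riemannian" and x0 i0 +
  assumes connected: "connected (mcarrier F)"
    and nonsing: "\<And>i v w. i \<in> charts F \<Longrightarrow> geo v 1 \<in> cdom F i \<Longrightarrow> jac i v w 1 = 0 \<Longrightarrow> w = 0"
begin

section \<open>The exponential map as a local homeomorphism\<close>

definition "ex v = geo v 1"

lemma ex_in: "ex v \<in> mcarrier F"
  unfolding ex_def by (rule germ_in[OF geo_germ_geo])

lemma ex_chart: obtains i where "i \<in> charts F" "ex v \<in> cdom F i"
  using ex_in[of v] unfolding mcarrier_def by blast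

lemma coord_ex_deriv:
  assumes "i \<in> charts F" "ex v \<in> cdom F i"
  shows "((\<lambda>u. coord F i (ex u)) has_derivative (\<lambda>w. jac i v w 1)) (at v)"
  using has_derivative_fst[OF gs_has_derivative[OF assms[unfolded ex_def]]] by (simp add: gs_fst jac_def ex_def)

lemma ex_nbhd:
  assumes "i \<in> charts F" "ex v \<in> cdom F i"
  obtains N where "open N" "v \<in> N" "\<And>u. u \<in> N \<Longrightarrow> ex u \<in> cdom F i" "\<And>w. continuous_on N (\<lambda>u. jac i u w 1)"
proof -
  obtain N where N: "open N" "v \<in> N" "\<And>u. u \<in> N \<Longrightarrow> geo u 1 \<in> cdom F i" "\<And>w. continuous_on N (\<lambda>u. Dgs i u 1 w)"
    using C1_near_all[OF assms[unfolded ex_def]] unfolding C1_near_def by blast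
  show ?thesis
    by (rule that[OF N(1,2)]) (use N(3,4) in \<open>auto simp: ex_def jac_def intro!: continuous_on_fst\<close>)
qed

lemma ex_cont: "continuous_on A ex"
proof (rule continuous_at_imp_continuous_on, rule ballI)
  fix v
  obtain i where i: "i \<in> charts F" "ex v \<in> cdom F i" by (rule ex_chart)
  obtain N where N: "open N" "v \<in> N" "\<And>u. u \<in> N \<Longrightarrow> ex u \<in> cdom F i" by (rule ex_nbhd[OF i], rule that)
  have c: "isCont (\<lambda>u. coord F i (ex u)) v" using has_derivative_continuous[OF coord_ex_deriv[OF i]] .
  have "isCont (\<lambda>u. chart_inv F i (coord F i (ex u))) v"
    by (rule isCont_o2[OF c]) (use cont_chart_inv[OF i(1)] open_V[OF i(1)] i(2) continuous_on_eq_continuous_at in blast)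
  moreover have "\<forall>\<^sub>F u in nhds v. chart_inv F i (coord F i (ex u)) = ex u"
    unfolding eventually_nhds using N chart_inv_coord[OF i(1)] by blast
  ultimately show "isCont ex v" by (simp only: isCont_cong)
qed

text \<open>An injective linear map between spaces of equal dimension is invertible, so the inverse
  function theorem applies. Differentiability of the local inverse is kept because lifts of segments
  have to be differentiated.\<close>

lemma ex_local_homeo:
  assumes i: "i \<in> charts F" "ex v \<in> cdom F i"
  obtains N W g g' where "open N" "v \<in> N" "\<And>u. u \<in> N \<Longrightarrow> ex u \<in> cdom F i" "open W"
    "homeomorphism N W (\<lambda>u. coord F i (ex u)) g" "\<And>y. y \<in> W \<Longrightarrow> (g has_derivative g' y) (at y)"
proof -
  obtain N where N: "open N" "v \<in> N" "\<And>u. u \<in> N \<Longrightarrow> ex u \<in> cdom F i" "\<And>w. continuous_on N (\<lambda>u. jac i u w 1)"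
    by (rule ex_nbhd[OF i], rule that)
  \<comment> \<open>The inverse function theorem takes the derivative as a continuous map into the
    bounded operators; continuity there is checked vector by vector.\<close>
  define f' where "f' u = Blinfun (\<lambda>w. jac i u w 1)" for u
  have f': "blinfun_apply (f' u) = (\<lambda>w. jac i u w 1)" if "u \<in> N" for u
    unfolding f'_def by (rule bounded_linear_Blinfun_apply)
      (rule has_derivative_bounded_linear[OF coord_ex_deriv[OF i(1) N(3)[OF that]]])
  have d: "((\<lambda>u. coord F i (ex u)) has_derivative blinfun_apply (f' u)) (at u)" if "u \<in> N" for u
    unfolding f'[OF that] by (rule coord_ex_deriv[OF i(1) N(3)[OF that]])
  have c: "continuous_on N f'"
    by (rule continuous_on_blinfun_componentwise) (use N(4) f' in \<open>simp cong: continuous_on_cong\<close>)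
  have lin: "linear (\<lambda>w. jac i v w 1)"
    using has_derivative_linear[OF coord_ex_deriv[OF i]] .
  have "inj (\<lambda>w. jac i v w 1)"
    unfolding linear_injective_0[OF lin] using nonsing i unfolding ex_def by blast
  then obtain h where h: "linear h" "h \<circ> (\<lambda>w. jac i v w 1) = id"
    using linear_injective_left_inverse[OF lin] by blast
  have "Blinfun h o\<^sub>L f' v = id_blinfun"
  proof (rule blinfun_eqI)
    fix w
    have "blinfun_apply (Blinfun h) = h"
      by (rule bounded_linear_Blinfun_apply) (simp add: h(1) linear_linear linear_conv_bounded_linear[symmetric])
    then show "blinfun_apply (Blinfun h o\<^sub>L f' v) w = blinfun_apply id_blinfun w"
      using fun_cong[OF h(2), of w] f'[OF N(2)] by simp
  qed
  from inverse_function_theorem[OF N(1) d c N(2) this]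
  obtain N' W g g' where I: "N' \<subseteq> N" "v \<in> N'" "open N'" "open W" "homeomorphism N' W (\<lambda>u. coord F i (ex u)) g"
    "\<And>y. y \<in> W \<Longrightarrow> (g has_derivative g' y) (at y)" by metis
  show ?thesis by (rule that[OF I(3,2) N(3) I(4,5,6)]) (use I(1) in auto)
qed

text \<open>Since e + M \<le> (1 + M)(1 + e), the logarithm of 1 + e grows at rate at most 1 + M.
  The mean value theorem needs derivatives only in the open interval, which is where the lift
  provides them.\<close>

lemma ode_comparison:
  fixes e :: "real \<Rightarrow> real"
  assumes T: "0 \<le> T" "T \<le> 1" and c: "continuous_on {0..T} e" and pos: "\<And>t. t \<in> {0..T} \<Longrightarrow> e t \<ge> 0" and M: "M \<ge> 0"
    and d: "\<And>t. t \<in> {0<..<T} \<Longrightarrow> (e has_real_derivative e' t) (at t)"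
    and b: "\<And>t. t \<in> {0<..<T} \<Longrightarrow> \<bar>e' t\<bar> \<le> e t + M"
  shows "e T \<le> (1 + e 0) * exp (1 + M)"
proof (cases "T = 0")
  case True
  have "(1 + e 0) * 1 \<le> (1 + e 0) * exp (1 + M)" using pos[of 0] T M by (intro mult_left_mono) auto
  then show ?thesis using True by simp
next
  case False
  define h where "h t = ln (1 + e t)" for t
  have d': "(h has_real_derivative e' t / (1 + e t)) (at t)" if "t \<in> {0<..<T}" for t
    unfolding h_def using pos[of t] that by (auto intro!: derivative_eq_intros d simp: divide_inverse)
  have "continuous_on {0..T} h" unfolding h_def using pos
    by (intro continuous_on_ln continuous_intros c) (auto simp: add_nonneg_eq_0_iff)
  moreover have "\<And>x. 0 < x \<Longrightarrow> x < T \<Longrightarrow> h differentiable (at x)"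
    using d' real_differentiable_def by auto
  ultimately obtain l z where z: "0 < z" "z < T" "(h has_real_derivative l) (at z)" "h T - h 0 = (T - 0) * l"
    using MVT[of 0 T h] False T by auto
  have "l = e' z / (1 + e z)" using DERIV_unique[OF z(3) d'] z by auto
  also have "\<dots> \<le> 1 + M"
  proof -
    have "e z \<ge> 0" using pos z by auto
    then have "e' z \<le> (1 + M) * (1 + e z)" using b[of z] z M by (auto simp: algebra_simps) (smt (verit) mult_nonneg_nonneg)
    then show ?thesis using \<open>e z \<ge> 0\<close> by (simp add: pos_divide_le_eq)
  qed
  finally have "T * l \<le> T * (1 + M)" using T by (intro mult_left_mono) auto
  also have "\<dots> \<le> 1 * (1 + M)" using T M by (intro mult_right_mono) auto
  finally have "h T \<le> h 0 + (1 + M)" using z(4) by simp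
  then have "exp (h T) \<le> exp (h 0) * exp (1 + M)" by (simp add: exp_add[symmetric])
  then show ?thesis using pos[of T] pos[of 0] T by (simp add: h_def)
qed

section \<open>Lifting a segment of a chart ball through the exponential map\<close>

context
  fixes i y r x b
  assumes i: "i \<in> charts F" and r: "ball y r \<subseteq> V i"
    and x: "ex x \<in> cdom F i" "coord F i (ex x) \<in> ball y r" and b: "b \<in> ball y r"
begin

definition "seg t = coord F i (ex x) + t *\<^sub>R (b - coord F i (ex x))"
definition "lift_upto T \<sigma> \<longleftrightarrow> continuous_on {0..T} \<sigma> \<and> \<sigma> 0 = x \<and>
   (\<forall>t\<in>{0..T}. ex (\<sigma> t) \<in> cdom F i \<and> coord F i (ex (\<sigma> t)) = seg t)"

lemma seg_in: "t \<in> {0..1} \<Longrightarrow> seg t \<in> ball y r"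
  using convexD_alt[OF convex_ball x(2) b, of t] by (simp add: seg_def algebra_simps)

lemma seg_cont: "continuous_on A seg"
  unfolding seg_def by (intro continuous_intros)

text \<open>For the squared length \<open>cm0 (\<sigma> t) (\<sigma> t)\<close> of the lift, the
  Gauss lemma identifies half the derivative with the product of the radial velocity and the segment
  direction \<open>w\<close>. The radial velocity has the same squared length by conservation of
  energy, and 2|g(u, w)| \<le> g(u, u) + g(w, w) gives an inequality with constants independent of
  the lift.\<close>

lemma lift_upto_bound: "\<exists>R. \<forall>T\<in>{0..1}. \<forall>\<sigma>. lift_upto T \<sigma> \<longrightarrow> norm (\<sigma> T) \<le> R"
proof -
  define w where "w = b - coord F i (ex x)"
  have "continuous_on {0..1} (\<lambda>t. cm i (seg t) w w)"
    by (rule continuous_on_compose2[OF smooth_on_imp_continuous_on[OF cm_smooth[OF i]] seg_cont])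
      (use seg_in r in auto)
  then have "bounded ((\<lambda>t. cm i (seg t) w w) ` {0..1})"
    by (intro compact_imp_bounded compact_continuous_image compact_Icc)
  then obtain M where M: "M > 0" "\<And>t. t \<in> {0..1} \<Longrightarrow> \<bar>cm i (seg t) w w\<bar> \<le> M"
    by (auto simp: bounded_pos)
  define R where "R = (1 + cm0 x x) * exp (1 + M)"
  have K0: "compact {coord F i0 x0}" "{coord F i0 x0} \<subseteq> V i0" using i0 by auto
  obtain m where m0: "m > 0" "\<And>y v. y \<in> {coord F i0 x0} \<Longrightarrow> cm i0 y v v \<ge> m * (norm v)\<^sup>2"
    by (rule cm_lower_bound[OF i0(1) K0], rule that)
  then have m: "m > 0" "\<And>v. cm0 v v \<ge> m * (norm v)\<^sup>2" by (auto simp: cm0_def)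
  have "norm (\<sigma> T) \<le> sqrt (R / m)" if T: "T \<in> {0..1}" and \<sigma>: "lift_upto T \<sigma>" for T \<sigma>
  proof -
    have sc: "continuous_on {0..T} \<sigma>" and s0: "\<sigma> 0 = x"
      and se: "\<And>t. t \<in> {0..T} \<Longrightarrow> ex (\<sigma> t) \<in> cdom F i" "\<And>t. t \<in> {0..T} \<Longrightarrow> coord F i (ex (\<sigma> t)) = seg t"
      using \<sigma> unfolding lift_upto_def by auto
    interpret c: bounded_bilinear cm0 using cm0_bilinear bilinear_conv_bounded_bilinear by blast
    have "\<exists>e'. ((\<lambda>t. cm0 (\<sigma> t) (\<sigma> t)) has_real_derivative e') (at t) \<and> \<bar>e'\<bar> \<le> cm0 (\<sigma> t) (\<sigma> t) + M"
      if t: "t \<in> {0<..<T}" for t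
    proof -
      have tT: "t \<in> {0..T}" "t \<in> {0..1}" using t T by auto
      note et = se[OF tT(1)]
      obtain N W g g' where N: "open N" "\<sigma> t \<in> N" "\<And>u. u \<in> N \<Longrightarrow> ex u \<in> cdom F i" "open W"
        "homeomorphism N W (\<lambda>u. coord F i (ex u)) g" "\<And>y. y \<in> W \<Longrightarrow> (g has_derivative g' y) (at y)"
        by (rule ex_local_homeo[OF i et(1)], rule that)
      have "seg t \<in> W" using N(2,5) et(2) unfolding homeomorphism_def by (metis imageI)
      note gd = N(6)[OF this]
      have "isCont \<sigma> t" using sc t by (metis continuous_on_interior interior_atLeastAtMost_real)
      from continuous_near[OF this N(1,2)]
      obtain d where d: "d > 0" "\<And>s. \<bar>s - t\<bar> < d \<Longrightarrow> \<sigma> s \<in> N" by blast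
      \<comment> \<open>Near t the lift is the local inverse applied to the segment; this is why it
        is differentiable.\<close>
      define \<sigma>' where "\<sigma>' = g' (seg t) w"
      have ld: "(seg has_derivative (\<lambda>h. h *\<^sub>R w)) (at t)" unfolding seg_def w_def
        by (auto intro!: derivative_eq_intros)
      have "((\<lambda>s. g (seg s)) has_vector_derivative \<sigma>') (at t)"
        using has_derivative_compose[OF ld gd] linear_scale[OF has_derivative_linear[OF gd]]
        by (simp add: has_vector_derivative_def \<sigma>'_def)
      then have sd: "(\<sigma> has_vector_derivative \<sigma>') (at t)"
      proof (rule has_vector_derivative_transform_near[where e="min d (min t (T - t))"])
        fix s assume s: "\<bar>s - t\<bar> < min d (min t (T - t))"
        then have "g (coord F i (ex (\<sigma> s))) = \<sigma> s" using d(2)[of s] N(5) unfolding homeomorphism_def by auto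
        moreover have "s \<in> {0..T}" using s by (auto simp: abs_less_iff)
        ultimately show "g (seg s) = \<sigma> s" using se(2) by simp
      qed (use d t in auto)
      \<comment> \<open>Differentiating the lifting identity in two ways identifies \<open>w\<close>
        with the image of \<sigma>' under the differential of exp.\<close>
      have "((\<lambda>s. coord F i (ex (\<sigma> s))) has_derivative (\<lambda>h. jac i (\<sigma> t) (h *\<^sub>R \<sigma>') 1)) (at t)"
        by (rule has_derivative_compose[OF sd[unfolded has_vector_derivative_def] coord_ex_deriv[OF i et(1)]])
      then have "(seg has_derivative (\<lambda>h. jac i (\<sigma> t) (h *\<^sub>R \<sigma>') 1)) (at t)"
        by (rule has_derivative_transform_within_open[of _ _ _ _ "{0<..<T}"]) (use t se(2) in auto)
      from fun_cong[OF has_derivative_unique[OF ld this], of 1] have jw: "jac i (\<sigma> t) \<sigma>' 1 = w" by simp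
      let ?u = "snd (gs i (\<sigma> t) 1)"
      have fx: "fst (gs i (\<sigma> t) 1) = seg t" using et(2) by (simp add: gs_fst ex_def)
      have sV: "seg t \<in> V i" using seg_in[OF tT(2)] r by blast
      note bl = cm_bilinear[OF i sV]
      have ga: "cm i (seg t) ?u w = cm0 (\<sigma> t) \<sigma>'"
        using gauss[OF i et(1)[unfolded ex_def], of \<sigma>'] by (simp add: fx jw)
      have en: "cm i (seg t) ?u ?u = cm0 (\<sigma> t) (\<sigma> t)"
        using energy_geo[OF i et(1)[unfolded ex_def]] by (simp add: energy_def fx)
      have p: "cm i (seg t) v v \<ge> 0" for v
        using cm_pos[OF i sV, of v] bilinear_lzero[OF bl] by (cases "v = 0") (auto intro: less_imp_le)
      have "2 * \<bar>cm i (seg t) ?u w\<bar> \<le> cm i (seg t) ?u ?u + cm i (seg t) w w"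
        using p[of "?u + w"] p[of "?u - w"] cm_sym[OF i sV, of w ?u]
        by (simp add: bilinear_ladd[OF bl] bilinear_radd[OF bl] bilinear_lsub[OF bl] bilinear_rsub[OF bl] abs_if)
      then have "\<bar>2 * cm0 (\<sigma> t) \<sigma>'\<bar> \<le> cm0 (\<sigma> t) (\<sigma> t) + M"
        using M(2)[OF tT(2)] unfolding ga en by (simp add: abs_mult)
      moreover have "((\<lambda>t. cm0 (\<sigma> t) (\<sigma> t)) has_real_derivative 2 * cm0 (\<sigma> t) \<sigma>') (at t)"
        using c.has_vector_derivative[OF sd sd] cm0_sym[of \<sigma>' "\<sigma> t"]
        by (simp add: has_real_derivative_iff_has_vector_derivative)
      ultimately show ?thesis by blast
    qed
    then obtain e' where e': "\<And>t. t \<in> {0<..<T} \<Longrightarrow> ((\<lambda>t. cm0 (\<sigma> t) (\<sigma> t)) has_real_derivative e' t) (at t)"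
      "\<And>t. t \<in> {0<..<T} \<Longrightarrow> \<bar>e' t\<bar> \<le> cm0 (\<sigma> t) (\<sigma> t) + M" by metis
    have "cm0 (\<sigma> T) (\<sigma> T) \<le> (1 + cm0 (\<sigma> 0) (\<sigma> 0)) * exp (1 + M)"
    proof (rule ode_comparison[OF _ _ _ _ _ e'])
      show "continuous_on {0..T} (\<lambda>t. cm0 (\<sigma> t) (\<sigma> t))" by (rule c.continuous_on[OF sc sc])
      show "0 \<le> cm0 (\<sigma> t) (\<sigma> t)" for t using m(2)[of "\<sigma> t"] m(1) by (meson order_trans mult_nonneg_nonneg zero_le_power2 less_imp_le)
    qed (use T M in auto)
    then have "m * (norm (\<sigma> T))\<^sup>2 \<le> R" using m(2)[of "\<sigma> T"] by (simp add: R_def s0)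
    then have "(norm (\<sigma> T))\<^sup>2 \<le> R / m" using m(1) by (simp add: field_simps)
    then show ?thesis by (rule real_le_rsqrt)
  qed
  then show ?thesis by blast
qed

lemma lift_upto_restrict: "lift_upto T \<sigma> \<Longrightarrow> S \<le> T \<Longrightarrow> lift_upto S \<sigma>" if "0 \<le> S"
  unfolding lift_upto_def using that by (auto intro: continuous_on_subset)

text \<open>Past \<open>t1\<close> the local inverse is applied to the segment; at \<open>t1\<close>
  it returns the value of \<sigma>, so the pieces join.\<close>

lemma lift_upto_continue:
  assumes \<sigma>: "lift_upto t1 \<sigma>" and t1: "0 \<le> t1" and N: "homeomorphism N W (\<lambda>u. coord F i (ex u)) g" "\<sigma> t1 \<in> N"
    "\<And>u. u \<in> N \<Longrightarrow> ex u \<in> cdom F i" and W: "\<And>t. t \<in> {t1..s} \<Longrightarrow> seg t \<in> W" and s: "t1 \<le> s"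
  shows "\<exists>\<tau>. lift_upto s \<tau>"
proof -
  have gc: "continuous_on W g" and gf: "\<And>x. x \<in> N \<Longrightarrow> g (coord F i (ex x)) = x"
    and fg: "\<And>y. y \<in> W \<Longrightarrow> coord F i (ex (g y)) = y" and gW: "g ` W = N"
    using N(1) unfolding homeomorphism_def by auto
  have sc: "continuous_on {0..t1} \<sigma>" and s0: "\<sigma> 0 = x"
      and se: "\<And>t. t \<in> {0..t1} \<Longrightarrow> ex (\<sigma> t) \<in> cdom F i \<and> coord F i (ex (\<sigma> t)) = seg t"
      using \<sigma> unfolding lift_upto_def by auto
  define \<tau> where "\<tau> t = (if t \<le> t1 then \<sigma> t else g (seg t))" for t
  have join: "g (seg t1) = \<sigma> t1" using gf[OF N(2)] se[of t1] t1 by simp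
  have "continuous_on ({0..t1} \<union> {t1..s}) \<tau>"
    unfolding \<tau>_def
  proof (rule continuous_on_cases)
    show "continuous_on {t1..s} (\<lambda>t. g (seg t))"
      by (rule continuous_on_compose2[OF gc seg_cont]) (use W in auto)
  qed (use sc join in \<open>auto\<close>)
  moreover have "{0..t1} \<union> {t1..s} = {0..s}" using t1 s by auto
  moreover have "ex (\<tau> t) \<in> cdom F i \<and> coord F i (ex (\<tau> t)) = seg t" if "t \<in> {0..s}" for t
  proof (cases "t \<le> t1")
    case True then show ?thesis using se[of t] that by (simp add: \<tau>_def)
  next
    case False
    then have "seg t \<in> W" using W that by auto
    then show ?thesis using False fg gW N(3) by (auto simp: \<tau>_def)
  qed
  ultimately have "lift_upto s \<tau>" unfolding lift_upto_def using s0 t1 by (auto simp: \<tau>_def)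
  then show ?thesis by blast
qed

text \<open>Existence of a lift up to t has locally constant truth value in t. At a limit parameter
  the end points of the earlier lifts stay in a fixed ball and have a cluster point over the limit
  of the segment; the local inverse around it continues one of these lifts.\<close>

lemma lift_exists: "\<exists>\<sigma>. lift_upto 1 \<sigma>"
proof -
  obtain R where R: "\<And>T \<sigma>. T \<in> {0..1} \<Longrightarrow> lift_upto T \<sigma> \<Longrightarrow> norm (\<sigma> T) \<le> R" using lift_upto_bound by blast
  define P where "P t \<longleftrightarrow> (\<exists>\<sigma>. lift_upto t \<sigma>)" for t
  have seg0: "seg 0 = coord F i (ex x)" by (simp add: seg_def)
  have P0: "P 0" unfolding P_def lift_upto_def by (rule exI[of _ "\<lambda>_. x"]) (use x seg0 in auto)
  have "P 1"
  proof (rule connected_local_induct[of "{0..1::real}" 0 P 1])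
    fix t :: real assume t: "t \<in> {0..1}"
    show "\<exists>Z. open Z \<and> t \<in> Z \<and> (\<forall>s\<in>{0..1} \<inter> Z. \<forall>r\<in>{0..1} \<inter> Z. P r \<longrightarrow> P s)"
    proof (cases "\<forall>s\<in>{0..<t}. P s")
      \<comment> \<open>If lifting already fails at some q < t, it fails at all parameters beyond
        q.\<close>
      case False
      then obtain q where q: "q \<in> {0..<t}" "\<not> P q" by blast
      have "\<not> P s" if "s \<in> {0..1} \<inter> {q<..}" for s
        using lift_upto_restrict[of q s] q that unfolding P_def by auto
      then show ?thesis using q(1) by (intro exI[of _ "{q<..}"]) auto
    next
      case True
      \<comment> \<open>Common form of the two cases: some lift ends, at or before t, inside a
        neighbourhood whose image W contains the rest of the segment up to t.\<close>
      have "\<exists>t1 \<sigma> N W g. t1 \<in> {0..t} \<and> lift_upto t1 \<sigma> \<and> homeomorphism N W (\<lambda>u. coord F i (ex u)) g \<and> \<sigma> t1 \<in> N \<and>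
          (\<forall>u\<in>N. ex u \<in> cdom F i) \<and> open W \<and> (\<forall>s\<in>{t1..t}. seg s \<in> W)"
      proof (cases "t = 0")
        case t0: True
        obtain N W g g' where N: "open N" "x \<in> N" "\<And>u. u \<in> N \<Longrightarrow> ex u \<in> cdom F i" "open W"
          "homeomorphism N W (\<lambda>u. coord F i (ex u)) g" "\<And>y. y \<in> W \<Longrightarrow> (g has_derivative g' y) (at y)"
          by (rule ex_local_homeo[OF i x(1)], rule that)
        obtain \<sigma> where \<sigma>: "lift_upto 0 \<sigma>" using P0 unfolding P_def by blast
        have "seg 0 \<in> W" using N(2,5) seg0 unfolding homeomorphism_def by (metis imageI)
        moreover have "\<sigma> 0 \<in> N" using \<sigma> N(2) unfolding lift_upto_def by simp
        ultimately show ?thesis using t0 \<sigma> N(3,4,5) by (intro exI[of _ 0] exI[of _ \<sigma>] exI[of _ N] exI[of _ W] exI[of _ g]) auto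
      next
        case False
        have "\<forall>s\<in>{0..<t}. \<exists>\<sigma>. lift_upto s \<sigma>" using True unfolding P_def .
        \<comment> \<open>The lifts for different s need not be compatible: only their end points
          are used, and in the end only one of them.\<close>
        from bchoice[OF this] obtain S where S: "\<And>s. s \<in> {0..<t} \<Longrightarrow> lift_upto s (S s)" by blast
        have Sc: "S s s \<in> cball 0 R" if "s \<in> {0..<t}" for s
          using R[OF _ S[OF that]] that t by simp
        have t0: "0 < t" using False t by simp
        obtain z where z: "z \<in> cball 0 R"
          "\<And>A q. open A \<Longrightarrow> z \<in> A \<Longrightarrow> q < t \<Longrightarrow> \<exists>s\<in>{max 0 q<..<t}. S s s \<in> A"
          by (rule compact_cluster_point[where c="\<lambda>s. S s s", OF compact_cball Sc t0], assumption, rule that)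
        have Ss: "ex (S s s) = chart_inv F i (seg s)" if "s \<in> {0..<t}" for s
        proof -
          have "ex (S s s) \<in> cdom F i" "coord F i (ex (S s s)) = seg s"
            using S[OF that] that unfolding lift_upto_def by auto
          then show ?thesis using chart_inv_coord[OF i] by metis
        qed
        have segt: "seg t \<in> V i" using seg_in[OF t] r by blast
        have cs: "isCont (\<lambda>s. chart_inv F i (seg s)) t"
        proof (rule isCont_o2[of _ seg])
          show "isCont seg t" using seg_cont[of UNIV] by (simp add: continuous_on_eq_continuous_at)
          show "isCont (chart_inv F i) (seg t)"
            using continuous_on_eq_continuous_at[OF open_V[OF i]] cont_chart_inv[OF i] segt by blast
        qed
        \<comment> \<open>The images of the end points run along the segment and converge to its
          point at t, so the image of their cluster point is that point by the Hausdorff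
          property.\<close>
        have exz: "ex z = chart_inv F i (seg t)"
        proof (rule ccontr)
          assume ne: "ex z \<noteq> chart_inv F i (seg t)"
          obtain A C where AC: "open A" "open C" "ex z \<in> A" "chart_inv F i (seg t) \<in> C" "A \<inter> C = {}"
            using hausdorff[OF ne] by blast
          obtain e where e: "e > 0" "\<And>s. \<bar>s - t\<bar> < e \<Longrightarrow> chart_inv F i (seg s) \<in> C"
            using continuous_near[OF cs AC(2,4)] by blast
          have oA: "open (ex -` A)" using continuous_open_preimage[OF ex_cont open_UNIV AC(1)] by simp
          have "t - e < t" using e(1) by simp
          from z(2)[OF oA _ this] AC(3) obtain s where s: "s \<in> {max 0 (t - e)<..<t}" "S s s \<in> ex -` A" by auto
          have "ex (S s s) \<in> C" using Ss[of s] e(2)[of s] s(1) by (auto simp: abs_less_iff)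
          then show False using s(2) AC(5) by auto
        qed
        then have zi: "ex z \<in> cdom F i" "coord F i (ex z) = seg t"
          using chart_inv_in[OF i segt] coord_chart_inv[OF i segt] by auto
        obtain N W g g' where N: "open N" "z \<in> N" "\<And>u. u \<in> N \<Longrightarrow> ex u \<in> cdom F i" "open W"
          "homeomorphism N W (\<lambda>u. coord F i (ex u)) g" "\<And>y. y \<in> W \<Longrightarrow> (g has_derivative g' y) (at y)"
          by (rule ex_local_homeo[OF i zi(1)], rule that)
        have sW: "seg t \<in> W" using N(2,5) zi(2) unfolding homeomorphism_def by (metis imageI)
        have "isCont seg t" using seg_cont[of UNIV] by (simp add: continuous_on_eq_continuous_at)
        from continuous_near[OF this N(4) sW]
        obtain e where e: "e > 0" "\<And>s. \<bar>s - t\<bar> < e \<Longrightarrow> seg s \<in> W" by blast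
        have "t - e < t" using e(1) by simp
        from z(2)[OF N(1,2) this] obtain s where s: "s \<in> {max 0 (t - e)<..<t}" "S s s \<in> N" by blast
        have "lift_upto s (S s)" using S s(1) by auto
        moreover have "\<forall>q\<in>{s..t}. seg q \<in> W" using e s(1) by (auto simp: abs_less_iff)
        ultimately show ?thesis using s N(3,4,5)
          by (intro exI[of _ s] exI[of _ "S s"] exI[of _ N] exI[of _ W] exI[of _ g]) auto
      qed
      then obtain t1 \<sigma> N W g where T: "t1 \<in> {0..t}" "lift_upto t1 \<sigma>" "homeomorphism N W (\<lambda>u. coord F i (ex u)) g" "\<sigma> t1 \<in> N"
          "\<forall>u\<in>N. ex u \<in> cdom F i" "open W" "\<forall>s\<in>{t1..t}. seg s \<in> W" by blast
      have cs: "isCont seg t" using seg_cont[of UNIV] by (simp add: continuous_on_eq_continuous_at)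
      have sW: "seg t \<in> W" using T(1,7) by auto
      obtain e where e: "e > 0" "\<And>s. \<bar>s - t\<bar> < e \<Longrightarrow> seg s \<in> W" using continuous_near[OF cs T(6) sW] by blast
      have "P s" if s: "s \<in> {0..1} \<inter> {..<t + e}" for s
      proof (cases "s \<le> t1")
        case True
        then show ?thesis using lift_upto_restrict[of s t1 \<sigma>] T(2) s unfolding P_def by auto
      next
        case False
        have "\<exists>\<tau>. lift_upto s \<tau>"
        proof (rule lift_upto_continue[OF T(2) _ T(3,4)])
          show "seg q \<in> W" if q: "q \<in> {t1..s}" for q
          proof (cases "q \<le> t")
            case True then show ?thesis using T(7) q by simp
          next
            case False then show ?thesis using e(2)[of q] q s by (auto simp: abs_less_iff)
          qed
        qed (use T False in auto)
        then show ?thesis unfolding P_def .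
      qed
      then show ?thesis using e(1) by (intro exI[of _ "{..<t + e}"]) auto
    qed
  qed (use P0 in auto)
  then show ?thesis unfolding P_def .
qed

end

text \<open>The chart ball is the convex base. Local homeomorphisms are cut down to the preimage of
  \<open>T\<close>, and lifted segments stay there because the segments stay in the ball.\<close>

lemma ball_chart_segment_lifting:
  assumes i: "i \<in> charts F" and r: "ball y r \<subseteq> V i"
  defines "T \<equiv> cdom F i \<inter> coord F i -` ball y r"
  shows "open T" "homeomorphism T (ball y r) (coord F i) (chart_inv F i)"
    "segment_lifting (\<lambda>u. coord F i (ex u)) (ex -` T) (ball y r)"
proof -
  show oT: "open T" unfolding T_def by (rule continuous_open_preimage[OF cont_coord[OF i] open_cdom[OF i] open_ball])
  have "coord F i ` T = ball y r"
  proof (intro equalityI subsetI)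
    fix z assume z: "z \<in> ball y r"
    then have "z \<in> V i" using r by blast
    then show "z \<in> coord F i ` T" unfolding T_def
      using coord_chart_inv[OF i] chart_inv_in[OF i] z by (intro image_eqI[of _ _ "chart_inv F i z"]) auto
  qed (auto simp: T_def)
  then show "homeomorphism T (ball y r) (coord F i) (chart_inv F i)"
    by (intro homeomorphism_of_subsets[OF homeo[OF i]]) (use r in \<open>auto simp: T_def\<close>)
  have oU: "open (ex -` T)" using continuous_open_preimage[OF ex_cont open_UNIV oT] by simp
  show "segment_lifting (\<lambda>u. coord F i (ex u)) (ex -` T) (ball y r)"
  proof
    show "open (ex -` T)" "open (ball y r)" "convex (ball y r)" by (auto simp: oU)
    show "(\<lambda>u. coord F i (ex u)) ` (ex -` T) \<subseteq> ball y r" by (auto simp: T_def)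
    show "\<exists>N W g. open N \<and> u \<in> N \<and> N \<subseteq> ex -` T \<and> open W \<and> homeomorphism N W (\<lambda>u. coord F i (ex u)) g"
      if u: "u \<in> ex -` T" for u
    proof -
      have ui: "ex u \<in> cdom F i" using u by (simp add: T_def)
      obtain N W g g' where N: "open N" "u \<in> N" "\<And>u. u \<in> N \<Longrightarrow> ex u \<in> cdom F i" "open W"
        "homeomorphism N W (\<lambda>u. coord F i (ex u)) g" "\<And>y. y \<in> W \<Longrightarrow> (g has_derivative g' y) (at y)"
        by (rule ex_local_homeo[OF i ui], rule that)
      obtain W' where W': "open W'" "homeomorphism (N \<inter> ex -` T) W' (\<lambda>u. coord F i (ex u)) g"
        using homeomorphism_restrict_open[OF N(5,4) oU] by blast
      show ?thesis
        by (rule exI[of _ "N \<inter> ex -` T"], rule exI[of _ W'], rule exI[of _ g]) (use N(1,2) oU u W' in auto)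
    qed
    show "\<exists>\<sigma>. continuous_on {0..1} \<sigma> \<and> \<sigma> ` {0..1} \<subseteq> ex -` T \<and> \<sigma> 0 = u \<and>
        (\<forall>t\<in>{0..1}. coord F i (ex (\<sigma> t)) = coord F i (ex u) + t *\<^sub>R (b - coord F i (ex u)))"
      if u: "u \<in> ex -` T" and b: "b \<in> ball y r" for u b
    proof -
      have ui: "ex u \<in> cdom F i" "coord F i (ex u) \<in> ball y r" using u by (auto simp: T_def)
      obtain \<sigma> where \<sigma>: "lift_upto i u b 1 \<sigma>" using lift_exists[OF i r ui b] by blast
      have "ex (\<sigma> t) \<in> T" if "t \<in> {0..1}" for t
        using \<sigma> seg_in[OF i r ui b that] that unfolding lift_upto_def[OF i r ui b] T_def by auto
      then show ?thesis using \<sigma> unfolding lift_upto_def[OF i r ui b] seg_def[OF i r ui b] by blast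
    qed
  qed
qed

section \<open>Surjectivity of the exponential map and the covering property\<close>

lemma ex_ball_nbhd:
  assumes "y \<in> mcarrier F"
  obtains i r where "i \<in> charts F" "y \<in> cdom F i" "r > 0" "ball (coord F i y) r \<subseteq> V i"
proof -
  obtain i where i: "i \<in> charts F" "y \<in> cdom F i" using assms unfolding mcarrier_def by blast
  obtain r where "r > 0" "ball (coord F i y) r \<subseteq> V i"
    using open_V[OF i(1)] i(2) open_contains_ball by (metis imageI)
  then show ?thesis using that i by blast
qed

text \<open>A section over a chart ball starts at any point of the preimage, so a ball that meets
  the range lies in it; connectedness spreads this over the manifold.\<close>

lemma range_ex: "range ex = mcarrier F"
proof (intro equalityI subsetI)
  fix y assume y: "y \<in> mcarrier F"
  have "ex 0 \<in> mcarrier F" by (rule ex_in)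
  show "y \<in> range ex"
  proof (rule connected_local_induct[OF connected, where P="\<lambda>y. y \<in> range ex", OF \<open>ex 0 \<in> mcarrier F\<close> _ _ y])
    fix z assume z: "z \<in> mcarrier F"
    obtain i r where i: "i \<in> charts F" "z \<in> cdom F i" "r > 0" "ball (coord F i z) r \<subseteq> V i"
      by (rule ex_ball_nbhd[OF z], rule that)
    define T where "T = cdom F i \<inter> coord F i -` ball (coord F i z) r"
    note bc = ball_chart_segment_lifting[OF i(1,4), folded T_def]
    interpret segment_lifting "\<lambda>u. coord F i (ex u)" "ex -` T" "ball (coord F i z) r" by (rule bc(3))
    have "s \<in> range ex" if sq: "s \<in> T" "q \<in> T" "q \<in> range ex" for s q
    proof -
      obtain u where u: "q = ex u" using sq(3) by blast
      then have uT: "u \<in> ex -` T" using sq(2) by simp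
      obtain \<sigma> where \<sigma>: "\<sigma> ` ball (coord F i z) r \<subseteq> ex -` T" "\<And>b. b \<in> ball (coord F i z) r \<Longrightarrow> coord F i (ex (\<sigma> b)) = b"
        by (rule section_exists[OF uT], rule that)
      have sb: "coord F i s \<in> ball (coord F i z) r" "s \<in> cdom F i" using sq(1) by (auto simp: T_def)
      have "\<sigma> (coord F i s) \<in> ex -` T" using \<sigma>(1) sb(1) by blast
      then have "ex (\<sigma> (coord F i s)) \<in> cdom F i" by (simp add: T_def)
      moreover have "coord F i (ex (\<sigma> (coord F i s))) = coord F i s" by (rule \<sigma>(2)[OF sb(1)])
      ultimately have "ex (\<sigma> (coord F i s)) = s" using chart_inv_coord[OF i(1)] sb(2) by metis
      then show ?thesis by (metis rangeI)
    qed
    moreover have "z \<in> T" using i by (simp add: T_def)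
    ultimately show "\<exists>W. open W \<and> z \<in> W \<and> (\<forall>s\<in>mcarrier F \<inter> W. \<forall>r\<in>mcarrier F \<inter> W. r \<in> range ex \<longrightarrow> s \<in> range ex)"
      using bc(1) by blast
  qed auto
qed (use ex_in in auto)

theorem exp_covering: "covering_space UNIV ex (mcarrier F)"
proof (rule covering_spaceI_segment_lifting[OF ex_cont range_ex])
  fix y assume y: "y \<in> mcarrier F"
  obtain i r where i: "i \<in> charts F" "y \<in> cdom F i" "r > 0" "ball (coord F i y) r \<subseteq> V i"
    by (rule ex_ball_nbhd[OF y], rule that)
  define T where "T = cdom F i \<inter> coord F i -` ball (coord F i y) r"
  note bc = ball_chart_segment_lifting[OF i(1,4), folded T_def]
  have "T \<subseteq> mcarrier F" "y \<in> T" using i by (auto simp: T_def mcarrier_def)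
  then have "y \<in> T \<and> open T \<and> T \<subseteq> mcarrier F \<and> homeomorphism T (ball (coord F i y) r) (coord F i) (chart_inv F i) \<and>
      segment_lifting (\<lambda>x. coord F i (ex x)) (ex -` T) (ball (coord F i y) r)"
    using bc by simp
  then show "\<exists>T h k B. y \<in> T \<and> open T \<and> T \<subseteq> mcarrier F \<and> homeomorphism T B h k \<and>
       segment_lifting (\<lambda>x. h (ex x)) (ex -` T) (B :: (real ^ 'n) set)"
    by (intro exI)
qed

end

section \<open>Primitives of positive functions on an interval\<close>

lemma is_interval_einterval: "is_interval (einterval a b)"
  unfolding is_interval_1
proof (intro ballI allI impI)
  fix x y z assume "x \<in> einterval a b" "y \<in> einterval a b" "x \<le> z \<and> z \<le> y"
  then have 1: "a < ereal x" "ereal x \<le> ereal z" "ereal z \<le> ereal y" "ereal y < b" by (auto simp: einterval_iff)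
  show "z \<in> einterval a b"
    unfolding einterval_iff using less_le_trans[OF 1(1,2)] le_less_trans[OF 1(3,4)] by blast
qed

lemma einterval_mono: "a \<le> a' \<Longrightarrow> b' \<le> b \<Longrightarrow> einterval a' b' \<subseteq> einterval a b"
  unfolding einterval_def using le_less_trans less_le_trans by blast

lemma connected_einterval: "connected (einterval a b)"
  using is_interval_einterval is_interval_connected_1 by blast

text \<open>On each compact interval of an exhaustion the integral is an increment of
  \<open>G\<close>. If all increments were at most \<open>M\<close>, continuity of the measure with
  density \<open>w\<close> along the exhaustion would bound the integral by
  \<open>M\<close>.\<close>

lemma primitive_unbounded:
  fixes w G :: "real \<Rightarrow> real"
  assumes ab: "a < b" and c: "continuous_on (einterval a b) w" and pos: "\<And>x. x \<in> einterval a b \<Longrightarrow> w x \<ge> 0"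
    and G: "\<And>x. x \<in> einterval a b \<Longrightarrow> (G has_real_derivative w x) (at x)"
    and inf: "(\<integral>\<^sup>+x\<in>einterval a b. ennreal (w x) \<partial>lborel) = \<infinity>"
  shows "\<exists>x\<in>einterval a b. \<exists>y\<in>einterval a b. x < y \<and> G y - G x > M"
proof (rule ccontr)
  assume "\<not> ?thesis"
  then have bd: "G y - G x \<le> M" if "x \<in> einterval a b" "y \<in> einterval a b" "x < y" for x y
    using that by force
  define w' where "w' x = indicator (einterval a b) x *\<^sub>R w x" for x
  have w'[measurable]: "w' \<in> borel_measurable borel"
    unfolding w'_def by (rule borel_measurable_continuous_on_indicator[OF _ c]) simp
  obtain u l :: "nat \<Rightarrow> real" where ul: "einterval a b = (\<Union>i. {l i .. u i})"
    "incseq u" "decseq l" "\<And>i. l i < u i" "\<And>i. a < l i" "\<And>i. u i < b" "l \<longlonglongrightarrow> a" "u \<longlonglongrightarrow> b"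
    by (rule einterval_Icc_approximation[OF ab], rule that)
  have sub: "{l i..u i} \<subseteq> einterval a b" for i using ul(1) by blast
  have inc: "incseq (\<lambda>i. {l i..u i})"
    using ul(2,3) by (auto simp: incseq_def decseq_def intro: order_trans)
  have "emeasure (density lborel (\<lambda>x. ennreal (w' x))) {l i..u i} \<le> ennreal M" for i
  proof -
    have "emeasure (density lborel (\<lambda>x. ennreal (w' x))) {l i..u i} = (\<integral>\<^sup>+x. ennreal (w' x) * indicator {l i..u i} x \<partial>lborel)"
      by (rule emeasure_density) auto
    also have "\<dots> = ennreal (G (u i) - G (l i))"
    proof (rule nn_integral_FTC_Icc[OF w'])
      fix x assume "x \<in> {l i..u i}"
      then have x: "x \<in> einterval a b" using sub by blast
      then show "(G has_real_derivative w' x) (at x)" "0 \<le> w' x" using G[OF x] pos[OF x] by (auto simp: w'_def)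
    qed (use ul(4)[of i] in simp)
    also have "\<dots> \<le> ennreal M"
    proof (rule ennreal_leI, rule bd)
      show "l i \<in> einterval a b" "u i \<in> einterval a b" using sub[of i] ul(4)[of i] by auto
    qed (rule ul(4))
    finally show ?thesis .
  qed
  then have "(SUP i. emeasure (density lborel (\<lambda>x. ennreal (w' x))) {l i..u i}) \<le> ennreal M"
    by (intro SUP_least)
  moreover have "(SUP i. emeasure (density lborel (\<lambda>x. ennreal (w' x))) {l i..u i}) =
      emeasure (density lborel (\<lambda>x. ennreal (w' x))) (einterval a b)"
    unfolding ul(1) by (rule SUP_emeasure_incseq[OF _ inc]) auto
  moreover have "emeasure (density lborel (\<lambda>x. ennreal (w' x))) (einterval a b) =
      (\<integral>\<^sup>+x. ennreal (w' x) * indicator (einterval a b) x \<partial>lborel)"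
    by (rule emeasure_density) auto
  moreover have "\<dots> = (\<integral>\<^sup>+x\<in>einterval a b. ennreal (w x) \<partial>lborel)"
    by (rule nn_integral_cong) (simp add: w'_def indicator_def)
  ultimately show False using inf by (simp add: top_unique)
qed

locale primitive =
  fixes a b :: ereal and w G :: "real \<Rightarrow> real"
  assumes w_cont: "continuous_on (einterval a b) w" and w_pos: "\<And>x. x \<in> einterval a b \<Longrightarrow> w x > 0"
    and G: "\<And>x. x \<in> einterval a b \<Longrightarrow> (G has_real_derivative w x) (at x)"
begin

lemma between: "x \<in> einterval a b \<Longrightarrow> y \<in> einterval a b \<Longrightarrow> x \<le> z \<Longrightarrow> z \<le> y \<Longrightarrow> z \<in> einterval a b"
  using is_interval_einterval[of a b] unfolding is_interval_1 by blast

lemma strict: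
  assumes "x \<in> einterval a b" "y \<in> einterval a b" "x < y"
  shows "G x < G y"
proof (rule DERIV_pos_imp_increasing[OF assms(3)])
  fix z assume "x \<le> z" "z \<le> y"
  then have "z \<in> einterval a b" using between assms by blast
  then show "\<exists>d. (G has_real_derivative d) (at z) \<and> d > 0" using G w_pos by blast
qed

lemma inj: "inj_on G (einterval a b)"
  by (rule inj_onI) (metis strict less_irrefl linorder_less_linear)

lemma cont: "continuous_on (einterval a b) G"
  using G DERIV_isCont continuous_at_imp_continuous_on by blast

lemma open_range: "open (G ` einterval a b)"
  by (rule invariance_of_domain[OF cont open_einterval inj])

lemma connected_range: "connected (G ` einterval a b)"
  by (rule connected_continuous_image[OF cont connected_einterval])

definition "inverse_G = inv_into (einterval a b) G"

lemma inverse_G: "x \<in> einterval a b \<Longrightarrow> inverse_G (G x) = x"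
  unfolding inverse_G_def by (rule inv_into_f_f[OF inj])

lemma inverse_G_in: "y \<in> G ` einterval a b \<Longrightarrow> inverse_G y \<in> einterval a b"
  unfolding inverse_G_def by (rule inv_into_into)

lemma G_inverse_G: "y \<in> G ` einterval a b \<Longrightarrow> G (inverse_G y) = y"
  unfolding inverse_G_def by (rule f_inv_into_f)

lemma inverse_G_deriv:
  assumes y: "y \<in> G ` einterval a b"
  shows "(inverse_G has_real_derivative inverse (w (inverse_G y))) (at y)"
proof -
  obtain e where e: "e > 0" "\<And>s. \<bar>s - y\<bar> < e \<Longrightarrow> s \<in> G ` einterval a b"
    using open_real_ball_ex[OF open_range y] by blast
  define x where "x = inverse_G y"
  have x: "x \<in> einterval a b" "G x = y" using inverse_G_in[OF y] G_inverse_G[OF y] by (auto simp: x_def)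
  obtain d where d: "d > 0" "\<And>s. \<bar>s - x\<bar> < d \<Longrightarrow> s \<in> einterval a b"
    using open_real_ball_ex[OF open_einterval x(1)] by blast
  have dx: "z \<in> einterval a b" if "x - d/2 \<le> z" "z \<le> x + d/2" for z
    by (rule d(2)) (use that d(1) in \<open>auto simp: abs_less_iff\<close>)
  have "isCont inverse_G (G x)"
    by (rule isCont_inverse_function2[of "x - d/2" x "x + d/2"])
      (use d(1) inverse_G[OF dx] DERIV_isCont[OF G[OF dx]] in auto)
  then have "isCont inverse_G y" by (simp add: x)
  then show ?thesis
    by (intro DERIV_inverse_function[of G "w (inverse_G y)" inverse_G y "y - e" "y + e"])
      (use G[OF x(1)] w_pos[OF x(1)] e G_inverse_G x_def in \<open>auto simp: abs_less_iff\<close>)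
qed

text \<open>Divergence on the left of \<open>c0\<close> gives increments of \<open>G\<close> there
  larger than G(c0) - y, hence a value below y; divergence on the right gives one above. The range
  is an interval.\<close>

lemma range_UNIV:
  assumes c0: "c0 \<in> einterval a b"
    and "(\<integral>\<^sup>+x\<in>einterval a (ereal c0). ennreal (w x) \<partial>lborel) = \<infinity>"
    and "(\<integral>\<^sup>+x\<in>einterval (ereal c0) b. ennreal (w x) \<partial>lborel) = \<infinity>"
  shows "G ` einterval a b = UNIV"
proof (intro equalityI subsetI)
  fix y :: real
  have ac: "a < ereal c0" "ereal c0 < b" using c0 by (auto simp: einterval_iff)
  have s1: "einterval a (ereal c0) \<subseteq> einterval a b" "einterval (ereal c0) b \<subseteq> einterval a b"
    by (rule einterval_mono[OF order_refl less_imp_le[OF ac(2)]], rule einterval_mono[OF less_imp_le[OF ac(1)] order_refl])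
  have "\<exists>x\<in>einterval a (ereal c0). \<exists>x'\<in>einterval a (ereal c0). x < x' \<and> G x' - G x > G c0 - y"
    by (rule primitive_unbounded[OF ac(1) continuous_on_subset[OF w_cont s1(1)] _ _ assms(2)])
      (use G less_imp_le[OF w_pos] subsetD[OF s1(1)] in auto)
  then obtain x x' where x': "x \<in> einterval a (ereal c0)" "x' \<in> einterval a (ereal c0)" "G x' - G x > G c0 - y"
    by blast
  then have x: "x \<in> einterval a b" "x' \<in> einterval a b" "x' < c0" "G x' - G x > G c0 - y"
    using s1 by (blast, blast, simp_all add: einterval_iff)
  have lo: "G x < y" using strict[OF x(2) c0 x(3)] x(4) by simp
  have "\<exists>z\<in>einterval (ereal c0) b. \<exists>z'\<in>einterval (ereal c0) b. z < z' \<and> G z' - G z > y - G c0"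
    by (rule primitive_unbounded[OF ac(2) continuous_on_subset[OF w_cont s1(2)] _ _ assms(3)])
      (use G less_imp_le[OF w_pos] subsetD[OF s1(2)] in auto)
  then obtain z z' where z': "z \<in> einterval (ereal c0) b" "z' \<in> einterval (ereal c0) b" "G z' - G z > y - G c0"
    by blast
  then have z: "z \<in> einterval a b" "z' \<in> einterval a b" "c0 < z" "G z' - G z > y - G c0"
    using s1 by (blast, blast, simp_all add: einterval_iff)
  have hi: "y < G z'" using strict[OF c0 z(1,3)] z(4) by simp
  have "is_interval (G ` einterval a b)" using connected_range by (simp add: is_interval_connected_1)
  then show "y \<in> G ` einterval a b"
    unfolding is_interval_1 using lo hi x(1) z(2) by (meson imageI less_imp_le)
qed auto

end

lemma primitive_exists:
  assumes w: "continuous_on (einterval a b) w" "\<And>x. x \<in> einterval a b \<Longrightarrow> w x > 0" and t0: "t0 \<in> einterval a b"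
  obtains G where "primitive a b w G" "G t0 = 0"
proof -
  have ab: "a < b" using t0 by (auto simp: einterval_iff intro: less_trans)
  obtain F where F: "\<And>x. a < ereal x \<Longrightarrow> ereal x < b \<Longrightarrow> (F has_vector_derivative w x) (at x)"
  proof -
    have "isCont w x" if "a < ereal x" "ereal x < b" for x
      using w(1) open_einterval that by (simp add: continuous_on_eq_continuous_at einterval_iff)
    then show ?thesis using einterval_antiderivative[OF ab, of w] that by blast
  qed
  have "primitive a b w (\<lambda>x. F x - F t0)"
  proof
    fix x assume "x \<in> einterval a b"
    then have "(F has_real_derivative w x) (at x)" using F by (simp add: einterval_iff has_real_derivative_iff_has_vector_derivative)
    then show "((\<lambda>x. F x - F t0) has_real_derivative w x) (at x)" by (auto intro!: derivative_eq_intros)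
  qed (use w in auto)
  then show ?thesis using that by simp
qed

section \<open>Generalized Robertson--Walker spacetimes\<close>

locale grw_space = riemannian F
  for F :: "('i, 'm::{t2_space,second_countable_topology}, real ^ 'n) semi_riemannian" +
  fixes a b :: ereal and f :: "real \<Rightarrow> real" and c0 :: real
  assumes f_smooth: "smooth_on (einterval a b) f" and f_pos: "\<And>\<tau>. \<tau> \<in> einterval a b \<Longrightarrow> f \<tau> > 0"
    and c0: "c0 \<in> einterval a b"
    and inf1: "(\<integral>\<^sup>+\<tau>\<in>einterval a (ereal c0). ennreal (f \<tau> powr (-2) * (1 / (f \<tau>)\<^sup>2 + 1) powr (-1/2)) \<partial>lborel) = \<infinity>"
    and inf2: "(\<integral>\<^sup>+\<tau>\<in>einterval (ereal c0) b. ennreal (f \<tau> powr (-2) * (1 / (f \<tau>)\<^sup>2 + 1) powr (-1/2)) \<partial>lborel) = \<infinity>"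
begin

abbreviation "I \<equiv> einterval a b"
abbreviation "M \<equiv> grw a b f F"

text \<open>\<open>fiber_speed D\<close> is \<open>ds/d\<tau>\<close> for the arc length \<open>s\<close> of the fiber component of a geodesic
  with constants \<open>D\<close> and \<open>c = 1\<close>; for \<open>D = 0\<close> it is \<open>1 / f\<close>.\<close>

definition "time_speed D \<tau> = sqrt (1 / (f \<tau>)\<^sup>2 - D)"
definition "fiber_speed D \<tau> = inverse ((f \<tau>)\<^sup>2) * inverse (time_speed D \<tau>)"

section \<open>Regularity of the speeds and divergence of their integrals\<close>

lemma time_speed_pos: "D \<le> 0 \<Longrightarrow> \<tau> \<in> I \<Longrightarrow> time_speed D \<tau> > 0"
proof -
  assume "D \<le> 0" "\<tau> \<in> I"
  have "1 / (f \<tau>)\<^sup>2 > 0" using f_pos[OF \<open>\<tau> \<in> I\<close>] by simp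
  then have "1 / (f \<tau>)\<^sup>2 - D > 0" using \<open>D \<le> 0\<close> by linarith
  then show ?thesis unfolding time_speed_def by (rule real_sqrt_gt_zero)
qed

lemma time_speed_smooth: "D \<le> 0 \<Longrightarrow> smooth_on I (time_speed D)"
proof -
  assume D: "D \<le> 0"
  have "1 / (f \<tau>)\<^sup>2 - D > 0" if "\<tau> \<in> I" for \<tau> using time_speed_pos[OF D that] by (simp add: time_speed_def)
  moreover have "(f \<tau>)\<^sup>2 \<noteq> 0" if "\<tau> \<in> I" for \<tau> using f_pos[OF that] by simp
  ultimately show ?thesis unfolding time_speed_def
    by (intro smooth_on_sqrt smooth_on_diff smooth_on_divide smooth_on_const smooth_on_power f_smooth open_einterval)
qed

lemma fiber_speed_pos: "D \<le> 0 \<Longrightarrow> \<tau> \<in> I \<Longrightarrow> fiber_speed D \<tau> > 0"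
  using time_speed_pos[of D \<tau>] f_pos[of \<tau>] by (simp add: fiber_speed_def)

lemma fiber_speed_cont: "D \<le> 0 \<Longrightarrow> continuous_on I (fiber_speed D)"
proof -
  assume D: "D \<le> 0"
  have nz: "\<forall>\<tau>\<in>I. (f \<tau>)\<^sup>2 \<noteq> 0" "\<forall>\<tau>\<in>I. time_speed D \<tau> \<noteq> 0"
    using f_pos time_speed_pos[OF D] by (auto simp: less_imp_neq[THEN not_sym])
  show ?thesis unfolding fiber_speed_def
    using nz by (intro continuous_on_mult continuous_on_inverse continuous_on_power
        smooth_on_imp_continuous_on[OF f_smooth] smooth_on_imp_continuous_on[OF time_speed_smooth[OF D]]) auto
qed

text \<open>The left side is \<open>fiber_speed (-1)\<close>. With q the inverse square of f, the
  comparison is q - D \<le> (1 - D)(q + 1), which uses D \<le> 0.\<close>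

lemma fiber_speed_lower:
  assumes D: "D \<le> 0" and t: "\<tau> \<in> I"
  shows "f \<tau> powr (-2) * (1 / (f \<tau>)\<^sup>2 + 1) powr (-1/2) \<le> sqrt (1 - D) * fiber_speed D \<tau>"
proof -
  have fp: "f \<tau> > 0" by (rule f_pos[OF t])
  have q: "1 / (f \<tau>)\<^sup>2 > 0" using fp by simp
  have "q - D \<le> (1 - D) * (q + 1)" if "q > 0" for q :: real
  proof -
    have "- D * q \<ge> 0" using D that by (intro mult_nonneg_nonneg) auto
    then show ?thesis by (simp add: algebra_simps)
  qed
  from this[OF q]
  have "time_speed D \<tau> \<le> sqrt (1 - D) * sqrt (1 / (f \<tau>)\<^sup>2 + 1)"
    unfolding time_speed_def by (metis real_sqrt_le_mono real_sqrt_mult)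
  then have 1: "inverse (sqrt (1 / (f \<tau>)\<^sup>2 + 1)) \<le> sqrt (1 - D) * inverse (time_speed D \<tau>)"
    using time_speed_pos[OF D t] q by (simp add: field_simps add_pos_pos)
  have "(1 / (f \<tau>)\<^sup>2 + 1) powr (-1/2) = inverse (sqrt (1 / (f \<tau>)\<^sup>2 + 1))"
    using q by (simp add: powr_minus powr_half_sqrt)
  moreover have "f \<tau> powr (-2) = inverse ((f \<tau>)\<^sup>2)"
    using fp powr_realpow[of "f \<tau>" 2] by (simp add: powr_minus)
  ultimately show ?thesis
    using mult_left_mono[OF 1, of "inverse ((f \<tau>)\<^sup>2)"] by (simp add: fiber_speed_def mult_ac)
qed

lemma fiber_speed_infinite:
  assumes D: "D \<le> 0" and A: "A \<subseteq> I" "A \<in> sets borel"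
    and inf: "(\<integral>\<^sup>+\<tau>\<in>A. ennreal (f \<tau> powr (-2) * (1 / (f \<tau>)\<^sup>2 + 1) powr (-1/2)) \<partial>lborel) = \<infinity>"
  shows "(\<integral>\<^sup>+\<tau>\<in>A. ennreal (fiber_speed D \<tau>) \<partial>lborel) = \<infinity>"
proof -
  have m: "(\<lambda>\<tau>. ennreal (fiber_speed D \<tau>) * indicator A \<tau>) \<in> borel_measurable lborel"
  proof -
    have "(\<lambda>\<tau>. indicator A \<tau> *\<^sub>R fiber_speed D \<tau>) \<in> borel_measurable borel"
      by (rule borel_measurable_continuous_on_indicator[OF A(2) continuous_on_subset[OF fiber_speed_cont[OF D] A(1)]])
    then have "(\<lambda>\<tau>. ennreal (indicator A \<tau> *\<^sub>R fiber_speed D \<tau>)) \<in> borel_measurable borel" by measurable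
    moreover have "ennreal (indicator A \<tau> *\<^sub>R fiber_speed D \<tau>) = ennreal (fiber_speed D \<tau>) * indicator A \<tau>" for \<tau>
      by (simp add: indicator_def)
    ultimately show ?thesis by simp
  qed
  have "(\<integral>\<^sup>+\<tau>\<in>A. ennreal (f \<tau> powr (-2) * (1 / (f \<tau>)\<^sup>2 + 1) powr (-1/2)) \<partial>lborel)
     \<le> (\<integral>\<^sup>+\<tau>. ennreal (sqrt (1 - D)) * (ennreal (fiber_speed D \<tau>) * indicator A \<tau>) \<partial>lborel)"
  proof (rule nn_integral_mono)
    fix \<tau> :: real
    show "ennreal (f \<tau> powr (-2) * (1 / (f \<tau>)\<^sup>2 + 1) powr (-1/2)) * indicator A \<tau> \<le>
       ennreal (sqrt (1 - D)) * (ennreal (fiber_speed D \<tau>) * indicator A \<tau>)"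
    proof (cases "\<tau> \<in> A")
      case True
      then have "\<tau> \<in> I" using A by blast
      from fiber_speed_lower[OF D this] fiber_speed_pos[OF D this] show ?thesis
        using True D by (simp add: ennreal_mult[symmetric] ennreal_leI)
    qed simp
  qed
  also have "\<dots> = ennreal (sqrt (1 - D)) * (\<integral>\<^sup>+\<tau>\<in>A. ennreal (fiber_speed D \<tau>) \<partial>lborel)"
    by (rule nn_integral_cmult[OF m])
  finally have "ennreal (sqrt (1 - D)) * (\<integral>\<^sup>+\<tau>\<in>A. ennreal (fiber_speed D \<tau>) \<partial>lborel) = \<infinity>"
    using inf by (simp add: top_unique)
  then show ?thesis by (simp add: ennreal_mult_eq_top_iff)
qed

lemma fiber_primitive_surj:
  assumes D: "D \<le> 0" and G: "primitive a b (fiber_speed D) G"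
  shows "G ` I = UNIV"
proof -
  have ac: "a < ereal c0" "ereal c0 < b" using c0 by (auto simp: einterval_iff)
  have s: "einterval a (ereal c0) \<subseteq> I" "einterval (ereal c0) b \<subseteq> I"
    by (rule einterval_mono[OF order_refl less_imp_le[OF ac(2)]], rule einterval_mono[OF less_imp_le[OF ac(1)] order_refl])
  show ?thesis
    by (rule primitive.range_UNIV[OF G c0 fiber_speed_infinite[OF D s(1) _ inf1] fiber_speed_infinite[OF D s(2) _ inf2]]) auto
qed

text \<open>For D = 0 the fiber speed is 1/f and its primitive is conformal time. It takes all real
  values by the divergent integrals, so its inverse h is a curve defined for all parameters; paired
  with a unit speed curve of F it is lightlike.\<close>

lemma conformal_time_inverse:
  obtains h where "\<And>t. h t \<in> I" "\<And>t. (h has_real_derivative f (h t)) (at t)"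
proof -
  obtain G where PG: "primitive a b (fiber_speed 0) G"
    using primitive_exists[OF fiber_speed_cont[of 0] fiber_speed_pos[of 0] c0] by auto
  interpret primitive a b "fiber_speed 0" G by (rule PG)
  have U: "G ` I = UNIV" using fiber_primitive_surj[OF _ PG] by simp
  have "inverse (fiber_speed 0 \<tau>) = f \<tau>" if "\<tau> \<in> I" for \<tau>
    using f_pos[OF that] by (simp add: fiber_speed_def time_speed_def real_sqrt_divide power2_eq_square)
  then show ?thesis
    using that[of inverse_G] inverse_G_in inverse_G_deriv U by (metis UNIV_I)
qed

section \<open>Curves in the warped product\<close>

lemma grw_simps [simp]:
  "charts M = charts F" "cdom M i = I \<times> cdom F i" "coord M i (\<tau>, x) = (\<tau>, coord F i x)"
  "metric M i (\<tau>, x) (s, v) (s', v') = - (s * s') + (f \<tau>)\<^sup>2 * metric F i x v v'"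
  by (simp_all add: grw_def)

lemma grw_carrier: "mcarrier M = I \<times> mcarrier F"
  by (auto simp: mcarrier_def)

lemma grw_velocity:
  assumes "(\<tau> has_real_derivative \<tau>') (at t)" "((\<lambda>t. coord F i (c t)) has_vector_derivative v) (at t)"
  shows "velocity M (\<lambda>t. (\<tau> t, c t)) i t = (\<tau>', v)"
  unfolding velocity_def
  by (rule vector_derivative_at) (use has_vector_derivative_Pair[OF assms(1)[unfolded has_real_derivative_iff_has_vector_derivative] assms(2)] in simp)

lemma grw_smooth_curve:
  assumes J: "open J" and \<tau>: "smooth_on J \<tau>" "\<tau> ` J \<subseteq> I" and c: "smooth_curve F J c"
  shows "smooth_curve M J (\<lambda>t. (\<tau> t, c t))"
  unfolding smooth_curve_def
proof (intro conjI J ballI)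
  have cc: "continuous_on J c" "c ` J \<subseteq> mcarrier F"
    "\<And>i. i \<in> charts F \<Longrightarrow> smooth_on {t\<in>J. c t \<in> cdom F i} (\<lambda>t. coord F i (c t))"
    using c unfolding smooth_curve_def by auto
  show "continuous_on J (\<lambda>t. (\<tau> t, c t))"
    by (intro continuous_on_Pair smooth_on_imp_continuous_on[OF \<tau>(1)] cc)
  show "(\<lambda>t. (\<tau> t, c t)) ` J \<subseteq> mcarrier M" using \<tau>(2) cc(2) unfolding grw_carrier by auto
  fix i assume "i \<in> charts M"
  then have i: "i \<in> charts F" by simp
  have e: "{t \<in> J. (\<tau> t, c t) \<in> cdom M i} = {t\<in>J. c t \<in> cdom F i}" using \<tau>(2) by auto
  have "{t\<in>J. c t \<in> cdom F i} = J \<inter> c -` cdom F i" by auto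
  then have o: "open {t\<in>J. c t \<in> cdom F i}" using continuous_open_preimage[OF cc(1) J open_cdom[OF i]] by simp
  show "smooth_on {t \<in> J. (\<tau> t, c t) \<in> cdom M i} (\<lambda>t. coord M i (\<tau> t, c t))"
    unfolding e unfolding grw_simps by (rule smooth_on_Pair[OF o smooth_on_subset[OF \<tau>(1)] cc(3)[OF i]]) auto
qed

lemma germs_smooth_curve:
  assumes J: "open J" and g: "\<And>t. t \<in> J \<Longrightarrow> geo_germ c t"
  shows "smooth_curve F J c"
  unfolding smooth_curve_def
proof (intro conjI J ballI)
  show "continuous_on J c" using g germ_isCont continuous_at_imp_continuous_on by blast
  show "c ` J \<subseteq> mcarrier F" using g germ_in by blast
  show "smooth_on {t \<in> J. c t \<in> cdom F i} (\<lambda>t. coord F i (c t))" if i: "i \<in> charts F" for i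
    using smooth_on_fst[OF germ_preimage_open[OF J g open_cdom[OF i]] germ_smooth[OF J g i]]
    by (simp add: gstate_def)
qed

end

locale grw_hyperbolic = grw_space F a b f c0
  for F :: "('i, 'm::{t2_space,second_countable_topology}, real ^ 'n) semi_riemannian" and a b f c0 +
  assumes hyp: "globally_hyperbolic (grw a b f F) grw_time"
begin

text \<open>The time part contributes -(k f)^2 to the metric and the fiber part at most (A k f)^2,
  where k bounds the speed of \<open>c\<close>. Slopes A of absolute value at most 1, negative ones
  included, therefore keep the curve causal.\<close>

lemma causal_lift:
  assumes h: "\<And>t. h t \<in> I" "\<And>t. (h has_real_derivative f (h t)) (at t)"
    and g: "\<And>t. t \<in> {\<alpha><..<\<beta>} \<Longrightarrow> geo_germ c t"
    and e: "\<And>t i. t \<in> {\<alpha><..<\<beta>} \<Longrightarrow> i \<in> charts F \<Longrightarrow> c t \<in> cdom F i \<Longrightarrow> energy i (gstate i c t) \<le> k\<^sup>2" and k: "k > 0"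
    and A: "\<bar>A\<bar> \<le> 1" and st: "s < t" "\<And>u. u \<in> {s..t} \<Longrightarrow> A * u + B \<in> {\<alpha><..<\<beta>}"
  shows "causal_segment M grw_time (\<lambda>u. (h (k * u), c (A * u + B))) s t"
  unfolding causal_segment_def
proof (intro conjI exI ballI impI)
  define J where "J = {u. A * u + B \<in> {\<alpha><..<\<beta>}}"
  have "J = (\<lambda>u. A * u + B) -` {\<alpha><..<\<beta>}" by (auto simp: J_def)
  then have oJ: "open J" using continuous_open_preimage[of UNIV "\<lambda>u. A * u + B" "{\<alpha><..<\<beta>}"]
    by (auto intro!: continuous_intros)
  show "{s..t} \<subseteq> J" using st by (auto simp: J_def)
  have gJ: "geo_germ (\<lambda>u. c (A * u + B)) u" if "u \<in> J" for u
    by (rule germ_affine[OF g]) (use that in \<open>simp add: J_def\<close>)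
  have hs: "smooth_on UNIV h"
    by (rule smooth_on_ode[OF open_UNIV open_einterval f_smooth])
      (use h in \<open>auto simp: has_real_derivative_iff_has_vector_derivative[symmetric]\<close>)
  have "smooth_on UNIV (\<lambda>u. h (k * u))"
    by (rule smooth_on_compose[OF open_UNIV open_UNIV hs]) (intro smooth_on_mult smooth_on_const smooth_on_ident open_UNIV, simp)
  then have hk: "smooth_on J (\<lambda>u. h (k * u))" by (rule smooth_on_subset) simp
  show "smooth_curve M J (\<lambda>u. (h (k * u), c (A * u + B)))"
    by (rule grw_smooth_curve[OF oJ hk _ germs_smooth_curve[OF oJ gJ]]) (use h in auto)
  fix u i assume u: "u \<in> {s..t}" and "i \<in> charts M" "(h (k * u), c (A * u + B)) \<in> cdom M i"
  then have i: "i \<in> charts F" "c (A * u + B) \<in> cdom F i" by auto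
  have uJ: "u \<in> J" using st(2)[OF u] by (simp add: J_def)
  have gu: "geo_germ c (A * u + B)" by (rule g[OF st(2)[OF u]])
  let ?v = "A *\<^sub>R velocity F c i (A * u + B)"
  have dh: "((\<lambda>u. h (k * u)) has_real_derivative k * f (h (k * u))) (at u)"
  proof -
    have "((\<lambda>u. k * u) has_real_derivative k) (at u)" by (auto intro!: derivative_eq_intros)
    from DERIV_chain2[where f=h and g="\<lambda>u. k * u", OF h(2) this] show ?thesis by (simp add: mult.commute)
  qed
  have "gstate i (\<lambda>s. c (A * s + B)) u = (coord F i (c (A * u + B)), ?v)"
    by (rule gstate_affine[OF gu i])
  then have "((\<lambda>s. coord F i (c (A * s + B))) has_vector_derivative ?v) (at u)"
    using bounded_linear.has_vector_derivative[OF bounded_linear_fst germ_gstate_deriv[OF gJ[OF uJ] i]]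
    by (simp add: spray_def gstate_def)
  from grw_velocity[OF dh this]
  have vel: "velocity M (\<lambda>u. (h (k * u), c (A * u + B))) i u = (k * f (h (k * u)), ?v)" .
  have fp: "f (h (k * u)) > 0" using f_pos h by blast
  have mb: "bilinear (metric F i (c (A * u + B)))" by (rule metric_bilinear[OF i])
  have en: "metric F i (c (A * u + B)) (velocity F c i (A * u + B)) (velocity F c i (A * u + B)) \<le> k\<^sup>2" (is "?E \<le> _")
    using e[OF st(2)[OF u] i] by (simp add: energy_def gstate_def cm_def chart_inv_coord[OF i])
  have E0: "?E \<ge> 0" using metric_pos[OF i, of "velocity F c i (A * u + B)"] bilinear_lzero[OF mb]
    by (cases "velocity F c i (A * u + B) = 0") (auto intro: less_imp_le)
  have "A * A * ?E \<le> 1 * ?E"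
    using A E0 by (intro mult_right_mono) (auto simp: abs_square_le_1 power2_eq_square[symmetric])
  then have m: "metric F i (c (A * u + B)) ?v ?v \<le> k\<^sup>2"
    using en by (simp add: bilinear_lmul[OF mb] bilinear_rmul[OF mb])
  show "future_causal_vec M grw_time i (h (k * u), c (A * u + B)) (velocity M (\<lambda>u. (h (k * u), c (A * u + B))) i u)"
    unfolding vel future_causal_vec_def grw_time_def
  proof (intro conjI)
    show "(k * f (h (k * u)), ?v) \<noteq> 0" using k fp by (simp add: zero_prod_def)
    have "(f (h (k * u)))\<^sup>2 * metric F i (c (A * u + B)) ?v ?v \<le> (f (h (k * u)))\<^sup>2 * k\<^sup>2"
      by (rule mult_left_mono[OF m]) simp
    then show "metric M i (h (k * u), c (A * u + B)) (k * f (h (k * u)), ?v) (k * f (h (k * u)), ?v) \<le> 0"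
      unfolding grw_simps by (simp add: power2_eq_square mult_ac)
    show "metric M i (h (k * u), c (A * u + B)) (1, 0) (k * f (h (k * u)), ?v) < 0"
      unfolding grw_simps using k fp bilinear_lzero[OF mb] by simp
  qed
qed (use st in auto)

text \<open>The causal lift of \<open>c\<close> up to the parameter \<open>s < \<beta>\<close> can be continued to a common end point \<open>q\<close> by running
  back along \<open>c\<close>, so all these lifts stay in one causal diamond.\<close>

lemma geodesic_precompact:
  assumes ab: "\<alpha> < 0" "0 < \<beta>" and g: "\<And>t. t \<in> {\<alpha><..<\<beta>} \<Longrightarrow> geo_germ c t"
  shows "\<exists>K. compact K \<and> K \<subseteq> mcarrier F \<and> c ` {0..<\<beta>} \<subseteq> K"
proof -
  obtain h where h: "\<And>t. h t \<in> I" "\<And>t. (h has_real_derivative f (h t)) (at t)" by (rule conformal_time_inverse, rule that)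
  have z: "0 \<in> {\<alpha><..<\<beta>}" using ab by simp
  obtain j where j: "j \<in> charts F" "c 0 \<in> cdom F j" using germ_obtain_chart[OF g[OF z]] by blast
  define E where "E = energy j (gstate j c 0)"
  \<comment> \<open>The speed of \<open>c\<close> is the square root of the energy E; adding 1 keeps
    k positive even for a constant geodesic.\<close>
  define k where "k = sqrt \<bar>E\<bar> + 1"
  have k: "k > 0" by (simp add: k_def add_nonneg_pos)
  have Ek: "E \<le> k\<^sup>2"
  proof -
    have "E \<le> (sqrt \<bar>E\<bar>)\<^sup>2" by simp
    also have "\<dots> \<le> k\<^sup>2" unfolding k_def by (rule power_mono) auto
    finally show ?thesis .
  qed
  have e: "energy i (gstate i c t) \<le> k\<^sup>2" if "t \<in> {\<alpha><..<\<beta>}" "i \<in> charts F" "c t \<in> cdom F i" for t i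
    using energy_const[OF g that(1) z that(2,3) j] Ek by (simp add: E_def)
  note lift = causal_lift[OF h g e k]
  define p where "p = (h 0, c 0)"
  \<comment> \<open>The clock parameter 2 \<beta> leaves time to go from 0 to any s < \<beta> and
    back without exceeding the outward speed.\<close>
  define q where "q = (h (k * (2 * \<beta>)), c 0)"
  have carr: "(h t, c s) \<in> mcarrier M" if "s \<in> {\<alpha><..<\<beta>}" for t s
    unfolding grw_carrier using h germ_in[OF g[OF that]] by auto
  have pq: "p \<in> mcarrier M" "q \<in> mcarrier M" using carr[OF z] by (auto simp: p_def q_def)
  define Q where "Q = causal_future M grw_time p \<inter> causal_past M grw_time q"
  have "compact Q" using hyp pq unfolding globally_hyperbolic_def Q_def by blast
  then have "compact (snd ` Q)" by (intro compact_continuous_image continuous_on_snd continuous_on_id)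
  moreover have "snd ` Q \<subseteq> mcarrier F" unfolding Q_def causal_future_def grw_carrier by auto
  moreover have "c s \<in> snd ` Q" if s: "s \<in> {0..<\<beta>}" for s
  proof -
    define P where "P = (h (k * s), c s)"
    have PM: "P \<in> mcarrier M" unfolding P_def by (rule carr) (use s ab in auto)
    have 1: "P \<in> causal_future M grw_time p"
    proof (cases "s = 0")
      case True then show ?thesis unfolding causal_future_def using PM by (simp add: P_def p_def)
    next
      case False
      have "causal_segment M grw_time (\<lambda>u. (h (k * u), c (1 * u + 0))) 0 s"
        by (rule lift) (use s ab False in auto)
      from causal_curve.segment[OF this]
      have "\<exists>\<gamma> s t. causal_curve M grw_time \<gamma> s t \<and> \<gamma> s = p \<and> \<gamma> t = P"
        by (intro exI[of _ "\<lambda>u. (h (k * u), c (1 * u + 0))"] exI[of _ 0] exI[of _ s]) (simp add: P_def p_def)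
      then show ?thesis unfolding causal_future_def using PM by blast
    qed
    have 2: "q \<in> causal_future M grw_time P"
    proof -
      \<comment> \<open>The affine map with s \<mapsto> s and 2 \<beta> \<mapsto> 0: it runs back
        along \<open>c\<close> to its start. Its slope has absolute value s / (2 \<beta> - s), at
        most 1 because s < \<beta>.\<close>
      define A where "A = - (s / (2 * \<beta> - s))"
      define B where "B = 2 * \<beta> * s / (2 * \<beta> - s)"
      have d: "2 * \<beta> - s > 0" using s by auto
      have AB: "A * u + B = s * (2 * \<beta> - u) / (2 * \<beta> - s)" for u
        by (simp add: A_def B_def diff_divide_distrib right_diff_distrib mult.commute mult.left_commute)
      have "causal_segment M grw_time (\<lambda>u. (h (k * u), c (A * u + B))) s (2 * \<beta>)"
      proof (rule lift)
        show "\<bar>A\<bar> \<le> 1" using s d by (simp add: A_def)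
        show "s < 2 * \<beta>" using d by simp
        show "A * u + B \<in> {\<alpha><..<\<beta>}" if u: "u \<in> {s..2 * \<beta>}" for u
        proof -
          have "0 \<le> A * u + B" unfolding AB using s u d by simp
          moreover have "A * u + B \<le> s" unfolding AB using s u d
            by (simp add: pos_divide_le_eq mult_left_mono)
          ultimately show ?thesis using s ab by auto
        qed
      qed
      from causal_curve.segment[OF this]
      have "\<exists>\<gamma> s t. causal_curve M grw_time \<gamma> s t \<and> \<gamma> s = P \<and> \<gamma> t = q"
        by (intro exI[of _ "\<lambda>u. (h (k * u), c (A * u + B))"] exI[of _ s] exI[of _ "2 * \<beta>"])
          (use d in \<open>auto simp: P_def q_def AB\<close>)
      then show ?thesis unfolding causal_future_def using pq by blast
    qed
    have "P \<in> Q" unfolding Q_def causal_past_def using 1 2 PM by blast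
    then show ?thesis unfolding P_def by force
  qed
  ultimately show ?thesis by (intro exI[of _ "snd ` Q"]) blast
qed

end

section \<open>The Jacobi equation in a chart\<close>

text \<open>In a chart the Jacobi equation is the linearised geodesic equation.\<close>

lemma jacobi_equation_in_chart:
  fixes M :: "('i, 'm, 'e::euclidean_space) semi_riemannian"
  assumes S: "open S" "\<And>\<eta>. \<eta> \<in> S \<Longrightarrow> bilinear (Gm \<eta>)" "\<And>v w. smooth_on S (\<lambda>\<eta>. Gm \<eta> v w)"
    "\<And>\<eta> v w. \<eta> \<in> S \<Longrightarrow> Gm \<eta> v w = Gm \<eta> w v"
    and chr: "\<And>\<eta> v w. \<eta> \<in> S \<Longrightarrow> christoffel M i (chart_inv M i \<eta>) v w = Gm \<eta> v w"
    and e: "e > 0"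
    and X: "\<And>s. \<bar>s - t\<bar> < e \<Longrightarrow> X s \<in> S" "\<And>s. \<bar>s - t\<bar> < e \<Longrightarrow> \<gamma> s = chart_inv M i (X s)" "coord M i (\<gamma> t) = X t"
      "\<And>s. \<bar>s - t\<bar> < e \<Longrightarrow> velocity M \<gamma> i s = U s"
      "(X has_vector_derivative U t) (at t)" "(U has_vector_derivative - Gm (X t) (U t) (U t)) (at t)"
    and Y: "\<And>s. \<bar>s - t\<bar> < e \<Longrightarrow> (Y i has_vector_derivative E s) (at s)"
      "(E has_vector_derivative - (frechet_derivative (\<lambda>\<eta>. Gm \<eta> (U t) (U t)) (at (X t)) (Y i t) + 2 *\<^sub>R Gm (X t) (U t) (E t))) (at t)"
  shows "cov_deriv M \<gamma> (cov_deriv M \<gamma> Y) i t + curvature M i (\<gamma> t) (Y i t) (velocity M \<gamma> i t) (velocity M \<gamma> i t) = 0"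
proof -
  let ?D = "\<lambda>v w. frechet_derivative (\<lambda>\<eta>. Gm \<eta> v w) (at (X t))"
  let ?E' = "- (?D (U t) (U t) (Y i t) + 2 *\<^sub>R Gm (X t) (U t) (E t))"
  have tt: "\<bar>t - t\<bar> < e" using e by simp
  note Xt = X(1)[OF tt]
  note b = S(2)[OF Xt]
  have cov: "cov_deriv M \<gamma> Y i s = E s + Gm (X s) (U s) (Y i s)" if s: "\<bar>s - t\<bar> < e" for s
    unfolding cov_deriv_def X(2)[OF s] X(4)[OF s] chr[OF X(1)[OF s]] vector_derivative_at[OF Y(1)[OF s]] ..
  have lin: "linear (?D v w)" for v w
    by (rule has_derivative_linear[OF smooth_on_has_derivative[OF S(3) Xt]])
  have "((\<lambda>s. Gm (X s) (U s) (Y i s)) has_vector_derivative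
     ?D (U t) (Y i t) (U t) + Gm (X t) (- Gm (X t) (U t) (U t)) (Y i t) + Gm (X t) (U t) (E t)) (at t)"
    using has_derivative_bilinear_field[OF S(1-3) Xt X(5)[unfolded has_vector_derivative_def]
        X(6)[unfolded has_vector_derivative_def] Y(1)[OF tt, unfolded has_vector_derivative_def]]
    unfolding has_vector_derivative_def linear_scale[OF lin] bilinear_lmul[OF b] bilinear_rmul[OF b]
    by (simp add: scaleR_add_right)
  from has_vector_derivative_add[OF Y(2) this]
  have "((\<lambda>s. cov_deriv M \<gamma> Y i s) has_vector_derivative
     ?E' + (?D (U t) (Y i t) (U t) + Gm (X t) (- Gm (X t) (U t) (U t)) (Y i t) + Gm (X t) (U t) (E t))) (at t)"
    by (rule has_vector_derivative_transform_near[OF _ e]) (simp only: cov)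
  from vector_derivative_at[OF this]
  have vd: "vector_derivative (cov_deriv M \<gamma> Y i) (at t) =
     ?E' + (?D (U t) (Y i t) (U t) + Gm (X t) (- Gm (X t) (U t) (U t)) (Y i t) + Gm (X t) (U t) (E t))" .
  have cd: "chart_deriv M i (\<lambda>q. christoffel M i q v w) (\<gamma> t) = ?D v w" for v w
    unfolding chart_deriv_def[abs_def] X(3)
    by (rule frechet_derivative_cong_open[OF S(1) Xt chr])
  have Dsym: "?D (Y i t) (U t) = ?D (U t) (Y i t)"
    by (rule frechet_derivative_cong_open[OF S(1) Xt S(4)])
  have curv: "curvature M i (\<gamma> t) (Y i t) (U t) (U t) = ?D (U t) (U t) (Y i t) - ?D (U t) (Y i t) (U t)
     + Gm (X t) (Y i t) (Gm (X t) (U t) (U t)) - Gm (X t) (U t) (Gm (X t) (Y i t) (U t))"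
    unfolding curvature_def cd Dsym unfolding X(2)[OF tt] chr[OF Xt] ..
  have "cov_deriv M \<gamma> (cov_deriv M \<gamma> Y) i t =
     ?E' + (?D (U t) (Y i t) (U t) + Gm (X t) (- Gm (X t) (U t) (U t)) (Y i t) + Gm (X t) (U t) (E t))
     + Gm (X t) (U t) (E t + Gm (X t) (U t) (Y i t))"
    unfolding cov_deriv_def[of M \<gamma> "cov_deriv M \<gamma> Y"] vd cov[OF tt] X(4)[OF tt]
    unfolding X(2)[OF tt] chr[OF Xt] ..
  \<comment> \<open>The derivatives of the symbols cancel against those in the curvature; the
    remaining products cancel by bilinearity and symmetry of \<open>Gm\<close>.\<close>
  then show ?thesis
    unfolding X(4)[OF tt] curv
    using S(4)[OF Xt, of "Y i t" "U t"] S(4)[OF Xt, of "Y i t" "Gm (X t) (U t) (U t)"]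
    by (simp add: bilinear_lneg[OF b] bilinear_radd[OF b] scaleR_2)
qed

section \<open>Christoffel symbols of a generalized Robertson--Walker spacetime\<close>

context grw_space
begin

definition "fd \<tau> = frechet_derivative f (at \<tau>) 1"

lemma f_deriv: "\<tau> \<in> I \<Longrightarrow> (f has_real_derivative fd \<tau>) (at \<tau>)"
proof -
  assume "\<tau> \<in> I"
  from smooth_on_has_derivative[OF f_smooth this] have d: "(f has_derivative frechet_derivative f (at \<tau>)) (at \<tau>)" .
  have "frechet_derivative f (at \<tau>) = (*) (fd \<tau>)"
  proof
    show "frechet_derivative f (at \<tau>) h = fd \<tau> * h" for h
      using linear_scale[OF has_derivative_linear[OF d], of h 1] by (simp add: fd_def)
  qed
  then show ?thesis using d by (simp only: has_field_derivative_def)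
qed

lemma fd_smooth: "smooth_on I fd"
  unfolding fd_def[abs_def] by (rule smooth_on_deriv[OF f_smooth])

text \<open>The warped product formulas: the \<tau>-component is f f' g(v, v'), and the fiber
  component is that of F plus the mixed terms with factor f'/f.\<close>

definition "GM i \<eta> A W = (case \<eta> of (\<tau>, y) \<Rightarrow> case A of (s, v) \<Rightarrow> case W of (s', v') \<Rightarrow>
   (f \<tau> * fd \<tau> * cm i y v v', (fd \<tau> / f \<tau>) *\<^sub>R (s *\<^sub>R v' + s' *\<^sub>R v) + Gam i y v v'))"

lemma GM_simp [simp]: "GM i (\<tau>, y) (s, v) (s', v') =
   (f \<tau> * fd \<tau> * cm i y v v', (fd \<tau> / f \<tau>) *\<^sub>R (s *\<^sub>R v' + s' *\<^sub>R v) + Gam i y v v')"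
  by (simp add: GM_def)

context
  fixes i assumes i: "i \<in> charts F"
begin

lemma open_IV: "open (I \<times> V i)"
  by (intro open_Times open_einterval open_V[OF i])

lemma chart_inv_M: "\<tau> \<in> I \<Longrightarrow> y \<in> V i \<Longrightarrow> chart_inv M i (\<tau>, y) = (\<tau>, chart_inv F i y)"
proof -
  assume t: "\<tau> \<in> I" and y: "y \<in> V i"
  have "inj_on (coord M i) (cdom M i)"
    by (rule inj_onI) (use chart_inv_coord[OF i] in \<open>auto, metis\<close>)
  moreover have "coord M i (\<tau>, chart_inv F i y) = (\<tau>, y)" using coord_chart_inv[OF i y] by simp
  moreover have "(\<tau>, chart_inv F i y) \<in> cdom M i" using t chart_inv_in[OF i y] by simp
  ultimately show ?thesis unfolding chart_inv_def by (metis inv_into_f_f)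
qed

lemma chart_deriv_M:
  assumes t: "\<tau> \<in> I" and y: "y \<in> V i"
  shows "chart_deriv M i (\<lambda>q. metric M i q (s', v') (r, z)) (\<tau>, chart_inv F i y) (s, v) =
     2 * f \<tau> * fd \<tau> * s * cm i y v' z + (f \<tau>)\<^sup>2 * Dcm i y v' z v"
proof -
  have "((\<lambda>\<eta>. (f (fst \<eta>))\<^sup>2) has_derivative (\<lambda>k. 2 * f \<tau> * (fd \<tau> * fst k))) (at (\<tau>, y))"
  proof -
    have 1: "((\<lambda>\<eta>. f (fst \<eta>)) has_derivative (\<lambda>k. fd \<tau> * fst k)) (at (\<tau>, y))"
      using has_derivative_compose[OF bounded_linear_imp_has_derivative[OF bounded_linear_fst], of f "\<lambda>h. fd \<tau> * h" "(\<tau>, y)"]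
        f_deriv[OF t] by (simp add: has_field_derivative_def)
    show ?thesis by (rule has_derivative_eq_rhs[OF has_derivative_power[OF 1, of 2]]) (simp add: algebra_simps)
  qed
  moreover have "((\<lambda>\<eta>. cm i (snd \<eta>) v' z) has_derivative (\<lambda>k. Dcm i y v' z (snd k))) (at (\<tau>, y))"
    using has_derivative_compose[OF bounded_linear_imp_has_derivative[OF bounded_linear_snd], of "\<lambda>y. cm i y v' z" "Dcm i y v' z" "(\<tau>, y)"]
      Dcm[OF i y] by simp
  ultimately have "((\<lambda>\<eta>. - (s' * r) + (f (fst \<eta>))\<^sup>2 * cm i (snd \<eta>) v' z) has_derivative
     (\<lambda>k. 0 + ((f \<tau>)\<^sup>2 * Dcm i y v' z (snd k) + 2 * f \<tau> * (fd \<tau> * fst k) * cm i y v' z))) (at (\<tau>, y))"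
    by (intro has_derivative_add has_derivative_const) (rule has_derivative_eq_rhs, rule has_derivative_mult, auto)
  then have "((\<lambda>\<eta>. metric M i (chart_inv M i \<eta>) (s', v') (r, z)) has_derivative
     (\<lambda>k. 0 + ((f \<tau>)\<^sup>2 * Dcm i y v' z (snd k) + 2 * f \<tau> * (fd \<tau> * fst k) * cm i y v' z))) (at (\<tau>, y))"
    by (rule has_derivative_transform_within_open[OF _ open_IV]) (use t y in \<open>auto simp: chart_inv_M cm_def\<close>)
  from frechet_derivative_at[OF this, symmetric]
  show ?thesis unfolding chart_deriv_def grw_simps(3) coord_chart_inv[OF i y] by simp
qed

text \<open>\<open>GM\<close> satisfies the Koszul equation, whose solution is unique: testing with
  (1, 0) determines the \<tau>-component and testing with (0, z) the fiber component.\<close>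

lemma christoffel_M:
  assumes \<eta>: "\<eta> \<in> I \<times> V i"
  shows "christoffel M i (chart_inv M i \<eta>) V1 W = GM i \<eta> V1 W"
proof -
  obtain \<tau> y where e: "\<eta> = (\<tau>, y)" "\<tau> \<in> I" "y \<in> V i" using \<eta> by blast
  obtain s v where V: "V1 = (s, v)" by (cases V1)
  obtain s' v' where W: "W = (s', v')" by (cases W)
  note b = cm_bilinear[OF i e(3)]
  have fp: "f \<tau> > 0" by (rule f_pos[OF e(2)])
  have met: "metric M i (\<tau>, chart_inv F i y) (p, k) (r, z) = - (p * r) + (f \<tau>)\<^sup>2 * cm i y k z" for p k r z
    by (simp add: cm_def)
  let ?R = "\<lambda>z. chart_deriv M i (\<lambda>q. metric M i q W z) (\<tau>, chart_inv F i y) V1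
        + chart_deriv M i (\<lambda>q. metric M i q V1 z) (\<tau>, chart_inv F i y) W
        - chart_deriv M i (\<lambda>q. metric M i q V1 W) (\<tau>, chart_inv F i y) z"
  have R: "?R (r, z) = 2 * f \<tau> * fd \<tau> * (s * cm i y v' z + s' * cm i y v z - r * cm i y v v') + 2 * (f \<tau>)\<^sup>2 * koszul i y v v' z" for r z
    unfolding V W chart_deriv_M[OF e(2,3)] koszul_def[OF i] by (simp add: field_simps)
  have sol: "2 * metric M i (\<tau>, chart_inv F i y) (GM i \<eta> V1 W) z = ?R z" for z
  proof -
    obtain r k where z: "z = (r, k)" by (cases z)
    show ?thesis unfolding z R unfolding V W e(1) GM_simp met
        bilinear_ladd[OF b] bilinear_lmul[OF b] Gam_char[OF i e(3)]
      using fp by (simp add: field_simps power2_eq_square)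
  qed
  show ?thesis unfolding christoffel_def e(1) chart_inv_M[OF e(2,3)]
  proof (rule the_equality)
    show "\<forall>z. 2 * metric M i (\<tau>, chart_inv F i y) (GM i (\<tau>, y) V1 W) z = ?R z" using sol e(1) by simp
    fix u assume u: "\<forall>z. 2 * metric M i (\<tau>, chart_inv F i y) u z = ?R z"
    then have eq: "metric M i (\<tau>, chart_inv F i y) u z = metric M i (\<tau>, chart_inv F i y) (GM i \<eta> V1 W) z" for z
      using sol[of z] spec[OF u, of z] by linarith
    obtain p k where uu: "u = (p, k)" by (cases u)
    obtain p' k' where gg: "GM i \<eta> V1 W = (p', k')" by (cases "GM i \<eta> V1 W")
    have "p = p'" using eq[of "(1, 0)"] unfolding uu gg met bilinear_rzero[OF b] by simp
    moreover have "k = k'"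
    proof (rule cm_eqI[OF i e(3)])
      show "cm i y k z = cm i y k' z" for z using eq[of "(0, z)"] fp unfolding uu gg met by simp
    qed
    ultimately show "u = GM i (\<tau>, y) V1 W" using uu gg e(1) by simp
  qed
qed

lemma GM_bilinear:
  assumes \<eta>: "\<eta> \<in> I \<times> V i" shows "bilinear (GM i \<eta>)"
proof -
  obtain \<tau> y where e: "\<eta> = (\<tau>, y)" "y \<in> V i" using \<eta> by blast
  note b = cm_bilinear[OF i e(2)] Gam_bilinear[OF i e(2)]
  show ?thesis unfolding bilinear_def e(1)
    by (intro conjI allI linearI)
      (auto simp: bilinear_ladd[OF b(1)] bilinear_radd[OF b(1)] bilinear_lmul[OF b(1)] bilinear_rmul[OF b(1)]
        bilinear_ladd[OF b(2)] bilinear_radd[OF b(2)] bilinear_lmul[OF b(2)] bilinear_rmul[OF b(2)] algebra_simps)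
qed

lemma GM_sym: "\<eta> \<in> I \<times> V i \<Longrightarrow> GM i \<eta> V1 W = GM i \<eta> W V1"
  by (cases \<eta>, cases V1, cases W) (auto simp: cm_sym[OF i] Gam_sym[OF i] add.commute intro!: cm_sym[OF i] Gam_sym[OF i])

lemma GM_smooth: "smooth_on (I \<times> V i) (\<lambda>\<eta>. GM i \<eta> V1 W)"
proof -
  obtain s v where V: "V1 = (s, v)" by (cases V1)
  obtain s' v' where W: "W = (s', v')" by (cases W)
  note o = open_IV
  have sf: "smooth_on (I \<times> V i) (\<lambda>\<eta>. f (fst \<eta>))" "smooth_on (I \<times> V i) (\<lambda>\<eta>. fd (fst \<eta>))"
    by (rule smooth_on_compose[OF o open_einterval f_smooth smooth_on_fst[OF o smooth_on_ident[OF o]]], force)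
      (rule smooth_on_compose[OF o open_einterval fd_smooth smooth_on_fst[OF o smooth_on_ident[OF o]]], force)
  have sc: "smooth_on (I \<times> V i) (\<lambda>\<eta>. cm i (snd \<eta>) v v')" "smooth_on (I \<times> V i) (\<lambda>\<eta>. Gam i (snd \<eta>) v v')"
    by (rule smooth_on_compose[OF o open_V[OF i] cm_smooth[OF i] smooth_on_snd[OF o smooth_on_ident[OF o]]], force)
      (rule smooth_on_compose[OF o open_V[OF i] Gam_smooth[OF i] smooth_on_snd[OF o smooth_on_ident[OF o]]], force)
  have "smooth_on (I \<times> V i) (\<lambda>\<eta>. (f (fst \<eta>) * fd (fst \<eta>) * cm i (snd \<eta>) v v',
      (fd (fst \<eta>) / f (fst \<eta>)) *\<^sub>R (s *\<^sub>R v' + s' *\<^sub>R v) + Gam i (snd \<eta>) v v'))"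
    by (intro smooth_on_Pair smooth_on_add smooth_on_scaleR smooth_on_mult smooth_on_divide smooth_on_const sf sc o)
      (use f_pos in force)
  then show ?thesis unfolding V W by (rule smooth_on_cong[OF o]) (auto split: prod.splits)
qed

text \<open>The Jacobi field to be lifted has no \<tau>-component, so the symbols are differentiated
  in fiber directions only and the factors depending on \<tau> stay constant.\<close>

lemma DGM_spatial:
  assumes t: "\<tau> \<in> I" and y: "y \<in> V i"
  shows "frechet_derivative (\<lambda>\<eta>. GM i \<eta> (s, v) (s, v)) (at (\<tau>, y)) (0, \<xi>) =
    (f \<tau> * fd \<tau> * Dcm i y v v \<xi>, frechet_derivative (\<lambda>y. Gam i y v v) (at y) \<xi>)"
proof -
  have "((\<lambda>\<eta>. GM i \<eta> (s, v) (s, v)) has_derivative frechet_derivative (\<lambda>\<eta>. GM i \<eta> (s, v) (s, v)) (at (\<tau>, y))) (at (\<tau>, y))"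
    by (rule smooth_on_has_derivative[OF GM_smooth]) (use t y in auto)
  moreover have "((\<lambda>k. (\<tau>, k)) has_derivative (\<lambda>\<xi>. (0, \<xi>))) (at y)" by (intro derivative_intros)
  ultimately have "((\<lambda>k. GM i (\<tau>, k) (s, v) (s, v)) has_derivative
      (\<lambda>\<xi>. frechet_derivative (\<lambda>\<eta>. GM i \<eta> (s, v) (s, v)) (at (\<tau>, y)) (0, \<xi>))) (at y)"
    using has_derivative_compose by fast
  moreover have "((\<lambda>k. GM i (\<tau>, k) (s, v) (s, v)) has_derivative
      (\<lambda>\<xi>. (f \<tau> * fd \<tau> * Dcm i y v v \<xi>, 0 + frechet_derivative (\<lambda>y. Gam i y v v) (at y) \<xi>))) (at y)"
    unfolding GM_simp
    by (intro has_derivative_Pair has_derivative_mult_right has_derivative_add has_derivative_const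
        Dcm[OF i y] smooth_on_has_derivative[OF Gam_smooth[OF i] y])
  ultimately show ?thesis using has_derivative_unique by (metis (no_types, lifting) add_0)
qed

end

end

section \<open>Lifting Jacobi fields of the fiber\<close>

locale grw_at = grw_hyperbolic F a b f c0 + complete_from F x0 i0
  for F :: "('i, 'm::{t2_space,second_countable_topology}, real ^ 'n) semi_riemannian" and a b f c0 x0 i0 +
  fixes D0 t0 :: real
  assumes D0: "D0 \<le> 0" and t0: "t0 \<in> einterval a b"
begin

text \<open>The state and its derivative together solve an autonomous equation with smooth right
  side, so \<open>smooth_on_ode\<close> applies to the pair.\<close>

lemma jac_smooth:
  assumes i: "i \<in> charts F"
  shows "smooth_on {s. geo v s \<in> cdom F i} (jac i v w)"
proof -
  let ?T = "{s. geo v s \<in> cdom F i}"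
  have oT: "open ?T"
    using germ_preimage_open[OF open_UNIV geo_germ_geo open_cdom[OF i], of v] by simp
  let ?S = "(V i \<times> (UNIV :: (real ^ 'n) set)) \<times> (UNIV :: ((real ^ 'n) \<times> (real ^ 'n)) set)"
  have oS: "open ?S" by (intro open_Times open_VU[OF i] open_UNIV)
  let ?X = "\<lambda>p. (spray i (fst p), frechet_derivative (spray i) (at (fst p)) (snd p))"
  have "smooth_on ?S ?X"
    by (intro smooth_on_Pair oS smooth_on_compose[OF oS open_VU[OF i] spray_smooth[OF i]]
        smooth_on_deriv_app[OF open_VU[OF i] oS oS spray_smooth[OF i]] smooth_on_fst smooth_on_snd smooth_on_ident) auto
  then have "smooth_on ?T (\<lambda>s. (gs i v s, Dgs i v s w))"
  proof (rule smooth_on_ode[OF oT oS])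
    fix s assume "s \<in> ?T"
    then have s: "geo v s \<in> cdom F i" by simp
    show "(gs i v s, Dgs i v s w) \<in> ?S" using gs_V[OF s] by (cases "gs i v s") auto
    show "((\<lambda>s. (gs i v s, Dgs i v s w)) has_vector_derivative ?X (gs i v s, Dgs i v s w)) (at s)"
      using has_vector_derivative_Pair[OF gs_deriv[OF i s] Dgs_ode[OF i s]] by simp
  qed
  from smooth_on_fst[OF oT smooth_on_snd[OF oT this]] show ?thesis by (simp add: jac_def[abs_def])
qed

lemma jac_zero_chart:
  assumes i: "i \<in> charts F" "geo v t \<in> cdom F i" and j: "j \<in> charts F" "geo v t \<in> cdom F j" and z: "jac i v w t = 0"
  shows "jac j v w t = 0"
proof -
  have "coord F i (geo v t) \<in> VV i j" using i j by auto
  then show ?thesis unfolding jac_tr[OF i j] z by (rule linear_0[OF Dtr_linear[OF i(1) j(1)]])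
qed

text \<open>Along the constant geodesic the linearised equation reads J'' = 0, so J(s) = s w. This
  case is separate because a constant fiber curve has c = 0 and admits no lift with c = 1.\<close>

lemma jac_zero_velocity:
  assumes i: "i \<in> charts F" "geo 0 1 \<in> cdom F i" and z: "jac i 0 w 1 = 0"
  shows "w = 0"
proof -
  have gi: "geo 0 s \<in> cdom F i0" for s using i0 by (simp add: geo_const)
  define y where "y = coord F i0 x0"
  have y: "y \<in> V i0" using i0 by (simp add: y_def)
  have gs0: "gs i0 0 s = (y, 0)" for s
  proof -
    have "gstate i0 (geo 0) s = gstate i0 (\<lambda>_. x0) s" by (rule gstate_cong[of 1]) (auto simp: geo_const)
    then show ?thesis by (simp add: gs_def gstate_def velocity_def y_def)
  qed
  have "frechet_derivative (\<lambda>y. Gam i0 y 0 0) (at y) = frechet_derivative (\<lambda>y. 0) (at y)"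
    by (rule frechet_derivative_cong_open[OF open_V[OF i0(1)] y]) (rule bilinear_lzero[OF Gam_bilinear[OF i0(1)]])
  then have DG: "DGam i0 y 0 0 k = 0" for k by simp
  have "((\<lambda>t. snd (Dgs i0 0 t w)) has_vector_derivative 0) (at s)" for s
    using jac_derivs(2)[OF i0(1) gi, of w s] unfolding gs0 by (simp add: DG bilinear_lzero[OF Gam_bilinear[OF i0(1) y]])
  then have "snd (Dgs i0 0 s w) = snd (Dgs i0 0 0 w)" for s
    using has_vector_derivative_zero_constant[of UNIV "\<lambda>t. snd (Dgs i0 0 t w)"] by (metis UNIV_I convex_UNIV)
  then have eta: "snd (Dgs i0 0 s w) = w" for s using Dgs_0[of 0 w] by simp
  have "((\<lambda>s. jac i0 0 w s - s *\<^sub>R w) has_vector_derivative 0) (at s)" for s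
    using jac_derivs(1)[OF i0(1) gi, of w s] unfolding eta by (auto intro!: derivative_eq_intros)
  then have "jac i0 0 w 1 - 1 *\<^sub>R w = jac i0 0 w 0 - 0 *\<^sub>R w"
    using has_vector_derivative_zero_constant[of UNIV "\<lambda>s. jac i0 0 w s - s *\<^sub>R w"] by (metis UNIV_I convex_UNIV)
  then have "w = jac i0 0 w 1" using jac_0[OF i0(1) gi] by simp
  also have "\<dots> = 0" by (rule jac_zero_chart[OF i i0(1) gi z])
  finally show ?thesis .
qed

context
  fixes v w :: "real ^ 'n" and i1 assumes v: "v \<noteq> 0" and w: "w \<noteq> 0"
    and i1: "i1 \<in> charts F" "geo v 1 \<in> cdom F i1" and conj: "jac i1 v w 1 = 0"
begin

text \<open>The Gauss lemma at parameter 1, where the field vanishes.\<close>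

lemma perp: "cm0 v w = 0"
  using gauss[OF i1, of w] bilinear_rzero[OF cm_bilinear[OF i1(1) gs_V[OF i1(2)]]] by (simp add: conj)

section \<open>The lifted geodesic and its conjugate point\<close>

definition "len = sqrt (cm0 v v)"

lemma len: "len > 0" "len\<^sup>2 = cm0 v v"
  using cm0_pos[OF v] by (auto simp: len_def)

text \<open>\<open>G1\<close> is the affine parameter as a function of \<tau>, and \<tau> is its
  inverse; the arc length of the fiber curve is a second primitive in \<tau>. The last three
  conclusions, which recover the parameter from \<tau>, serve to prove inextendibility.\<close>

lemma lift_param:
  obtains \<tau> \<sigma> J G1 where "open J" "is_interval J" "0 \<in> J" "\<tau> 0 = t0" "\<sigma> 0 = 0" "\<sigma> ` J = UNIV"
    "\<And>t. t \<in> J \<Longrightarrow> \<tau> t \<in> I" "\<And>t. t \<in> J \<Longrightarrow> (\<tau> has_real_derivative time_speed D0 (\<tau> t)) (at t)"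
    "\<And>t. t \<in> J \<Longrightarrow> (\<sigma> has_real_derivative 1 / (len * (f (\<tau> t))\<^sup>2)) (at t)"
    "continuous_on I G1" "G1 ` I = J" "\<And>t. t \<in> J \<Longrightarrow> G1 (\<tau> t) = t"
proof -
  have c1: "continuous_on I (\<lambda>\<tau>. inverse (time_speed D0 \<tau>))"
    by (intro continuous_on_inverse smooth_on_imp_continuous_on[OF time_speed_smooth[OF D0]])
      (use time_speed_pos[OF D0] in \<open>auto simp: less_imp_neq[THEN not_sym]\<close>)
  obtain G1 where G1: "primitive a b (\<lambda>\<tau>. inverse (time_speed D0 \<tau>)) G1" "G1 t0 = 0"
    by (rule primitive_exists[OF c1 _ t0], simp add: time_speed_pos[OF D0], rule that)
  obtain G2 where G2: "primitive a b (fiber_speed D0) G2" "G2 t0 = 0"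
    by (rule primitive_exists[OF fiber_speed_cont[OF D0] fiber_speed_pos[OF D0] t0], assumption, rule that)
  interpret p1: primitive a b "\<lambda>\<tau>. inverse (time_speed D0 \<tau>)" G1 by (rule G1)
  interpret p2: primitive a b "fiber_speed D0" G2 by (rule G2)
  define \<tau> where "\<tau> = p1.inverse_G"
  \<comment> \<open>Division by \<open>len\<close> turns arc length into the parameter of
    \<open>geo v\<close>.\<close>
  define \<sigma> where "\<sigma> t = G2 (\<tau> t) / len" for t
  show ?thesis
  proof (rule that[of "G1 ` I" \<tau> \<sigma> G1])
    show "open (G1 ` I)" by (rule p1.open_range)
    show "is_interval (G1 ` I)" using p1.connected_range by (simp add: is_interval_connected_1)
    show "0 \<in> G1 ` I" using t0 G1(2) by (metis imageI)
    show tau0: "\<tau> 0 = t0" using p1.inverse_G[OF t0] G1(2) by (simp add: \<tau>_def)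
    show "\<sigma> 0 = 0" by (simp add: \<sigma>_def tau0 G2(2))
    show tauI: "\<tau> t \<in> I" if "t \<in> G1 ` I" for t unfolding \<tau>_def by (rule p1.inverse_G_in[OF that])
    show taud: "(\<tau> has_real_derivative time_speed D0 (\<tau> t)) (at t)" if "t \<in> G1 ` I" for t
      using p1.inverse_G_deriv[OF that] by (simp add: \<tau>_def)
    show "(\<sigma> has_real_derivative 1 / (len * (f (\<tau> t))\<^sup>2)) (at t)" if t: "t \<in> G1 ` I" for t
    proof -
      have "((\<lambda>t. G2 (\<tau> t)) has_real_derivative fiber_speed D0 (\<tau> t) * time_speed D0 (\<tau> t)) (at t)"
        by (rule DERIV_chain2[OF p2.G[OF tauI[OF t]] taud[OF t]])
      then have "(\<sigma> has_real_derivative (fiber_speed D0 (\<tau> t) * time_speed D0 (\<tau> t)) / len) (at t)"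
        unfolding \<sigma>_def by (rule DERIV_cdivide)
      moreover have "(fiber_speed D0 (\<tau> t) * time_speed D0 (\<tau> t)) / len = 1 / (len * (f (\<tau> t))\<^sup>2)"
        using time_speed_pos[OF D0 tauI[OF t]] by (simp add: fiber_speed_def field_simps)
      ultimately show ?thesis by simp
    qed
    show "\<sigma> ` (G1 ` I) = UNIV"
    proof (intro equalityI subsetI)
      fix x :: real
      have "x * len \<in> G2 ` I" using fiber_primitive_surj[OF D0 G2(1)] by simp
      then obtain y where y: "y \<in> I" "G2 y = x * len" by auto
      then have "\<sigma> (G1 y) = x" using p1.inverse_G[OF y(1)] len by (simp add: \<sigma>_def \<tau>_def)
      then show "x \<in> \<sigma> ` (G1 ` I)" using y(1) by blast
    qed simp
    show "continuous_on I G1" by (rule p1.cont)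
    show "G1 (\<tau> t) = t" if "t \<in> G1 ` I" for t unfolding \<tau>_def by (rule p1.G_inverse_G[OF that])
  qed (rule refl)
qed

text \<open>All checks are made in the chart of M with the same index as the fiber chart, where the
  geodesic and Jacobi equations of M reduce, through \<open>GM\<close>, to those of F and to the
  first two derivatives of \<tau> and \<sigma>.\<close>

theorem conjugate_lift:
  "\<exists>J \<gamma> t. inextendible_geodesic M J \<gamma> \<and> 0 \<in> J \<and> \<gamma> 0 = (t0, x0) \<and>
      has_constant_D M J \<gamma> D0 \<and> has_constant_c F f J \<gamma> 1 \<and> conjugate_along M J \<gamma> 0 t"
proof -
  obtain \<tau> \<sigma> J G1 where J: "open J" "is_interval J" "0 \<in> J" and tau0: "\<tau> 0 = t0" and sig0: "\<sigma> 0 = 0" and sigU: "\<sigma> ` J = UNIV" and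
    tauI: "\<And>t. t \<in> J \<Longrightarrow> \<tau> t \<in> I" and taud: "\<And>t. t \<in> J \<Longrightarrow> (\<tau> has_real_derivative time_speed D0 (\<tau> t)) (at t)" and
    sigd: "\<And>t. t \<in> J \<Longrightarrow> (\<sigma> has_real_derivative 1 / (len * (f (\<tau> t))\<^sup>2)) (at t)" and
    G1: "continuous_on I G1" "G1 ` I = J" "\<And>t. t \<in> J \<Longrightarrow> G1 (\<tau> t) = t"
    by (rule lift_param, rule that)
  define \<sigma>' where "\<sigma>' t = 1 / (len * (f (\<tau> t))\<^sup>2)" for t
  define \<tau>' where "\<tau>' t = time_speed D0 (\<tau> t)" for t
  define \<gamma> where "\<gamma> t = (\<tau> t, geo v (\<sigma> t))" for t
  define Y where "Y i t = (0::real, jac i v w (\<sigma> t))" for i t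
  have fp: "f (\<tau> t) > 0" if "t \<in> J" for t by (rule f_pos[OF tauI[OF that]])
  have fpow: "(f (\<tau> t))\<^sup>2 \<noteq> 0" if "t \<in> J" for t using fp[OF that] by simp
  \<comment> \<open>For c = 1 the fiber part of the metric contributes 1/f^2, and D0 is this minus
    the square of \<tau>'.\<close>
  have \<tau>'2: "(\<tau>' t)\<^sup>2 = 1 / (f (\<tau> t))\<^sup>2 - D0" and \<tau>'p: "\<tau>' t > 0" if t: "t \<in> J" for t
  proof -
    show "\<tau>' t > 0" unfolding \<tau>'_def by (rule time_speed_pos[OF D0 tauI[OF t]])
    then show "(\<tau>' t)\<^sup>2 = 1 / (f (\<tau> t))\<^sup>2 - D0" unfolding \<tau>'_def time_speed_def by simp
  qed
  have taus: "smooth_on J \<tau>"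
    by (rule smooth_on_ode[OF J(1) open_einterval time_speed_smooth[OF D0] tauI])
      (use taud in \<open>auto simp: has_real_derivative_iff_has_vector_derivative\<close>)
  have ftaud: "((\<lambda>t. f (\<tau> t)) has_real_derivative fd (\<tau> t) * \<tau>' t) (at t)" if "t \<in> J" for t
    unfolding \<tau>'_def by (rule DERIV_chain2[OF f_deriv[OF tauI[OF that]] taud[OF that]])
  have sig's: "smooth_on J \<sigma>'"
    unfolding \<sigma>'_def
    by (intro smooth_on_divide smooth_on_mult smooth_on_const smooth_on_power J(1)
        smooth_on_compose[OF J(1) open_einterval f_smooth taus]) (use tauI fp len in \<open>auto simp: less_imp_neq[THEN not_sym]\<close>)
  have sigs: "smooth_on J \<sigma>"
  proof (rule smooth_on_derivI[where f'="\<lambda>t h. \<sigma>' t * h", OF J(1)])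
    show "(\<sigma> has_derivative (\<lambda>h. \<sigma>' t * h)) (at t)" if "t \<in> J" for t
      using sigd[OF that, folded \<sigma>'_def] by (simp only: has_field_derivative_def)
    show "smooth_on J (\<lambda>t. \<sigma>' t * h)" for h
      by (rule smooth_on_mult[OF J(1) sig's smooth_on_const[OF J(1)]])
  qed
  \<comment> \<open>This is the term -2 (f'/f) \<tau>' \<sigma>' by which the fiber component of a
    geodesic of M departs from a geodesic of F; it affects the parametrisation only.\<close>
  have sig'd: "(\<sigma>' has_real_derivative - 2 * (fd (\<tau> t) / f (\<tau> t)) * \<tau>' t * \<sigma>' t) (at t)" if t: "t \<in> J" for t
  proof -
    have "((\<lambda>t. len * (f (\<tau> t))\<^sup>2) has_real_derivative len * (2 * f (\<tau> t) * (fd (\<tau> t) * \<tau>' t))) (at t)"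
      by (rule derivative_eq_intros ftaud[OF t] refl)+ simp
    moreover have "len * (f (\<tau> t))\<^sup>2 \<noteq> 0" using len(1) fp[OF t] by simp
    ultimately have "((\<lambda>t. inverse (len * (f (\<tau> t))\<^sup>2)) has_real_derivative
      - (inverse (len * (f (\<tau> t))\<^sup>2) * (len * (2 * f (\<tau> t) * (fd (\<tau> t) * \<tau>' t))) * inverse (len * (f (\<tau> t))\<^sup>2))) (at t)"
      by (rule DERIV_inverse')
    moreover have "- (inverse (len * (f (\<tau> t))\<^sup>2) * (len * (2 * f (\<tau> t) * (fd (\<tau> t) * \<tau>' t))) * inverse (len * (f (\<tau> t))\<^sup>2))
       = - 2 * (fd (\<tau> t) / f (\<tau> t)) * \<tau>' t * \<sigma>' t"
      using len(1) fp[OF t] by (simp add: \<sigma>'_def field_simps power2_eq_square)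
    ultimately show ?thesis unfolding \<sigma>'_def[abs_def] inverse_eq_divide[symmetric] by (rule DERIV_cong)
  qed
  \<comment> \<open>The value is minus the \<tau>-component of \<open>GM\<close> on the velocity: f
    f' times the squared fiber speed, which is 1/f^4.\<close>
  have tau'd: "(\<tau>' has_real_derivative - (fd (\<tau> t) / (f (\<tau> t))^3)) (at t)" if t: "t \<in> J" for t
  proof -
    have i: "((\<lambda>t. 1 / (f (\<tau> t))\<^sup>2 - D0) has_real_derivative - (2 * f (\<tau> t) * (fd (\<tau> t) * \<tau>' t)) / ((f (\<tau> t))\<^sup>2 * (f (\<tau> t))\<^sup>2)) (at t)"
      by (rule derivative_eq_intros ftaud[OF t] refl fpow[OF t])+ simp
    have p: "1 / (f (\<tau> t))\<^sup>2 - D0 > 0" using \<tau>'2[OF t] \<tau>'p[OF t] by (metis zero_less_power)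
    have "((\<lambda>t. sqrt (1 / (f (\<tau> t))\<^sup>2 - D0)) has_real_derivative
       inverse (sqrt (1 / (f (\<tau> t))\<^sup>2 - D0)) / 2 * (- (2 * f (\<tau> t) * (fd (\<tau> t) * \<tau>' t)) / ((f (\<tau> t))\<^sup>2 * (f (\<tau> t))\<^sup>2))) (at t)"
      by (rule DERIV_chain2[OF DERIV_real_sqrt[OF p] i])
    moreover have "sqrt (1 / (f (\<tau> t))\<^sup>2 - D0) = \<tau>' t" by (simp add: \<tau>'_def time_speed_def)
    moreover have "inverse (\<tau>' t) / 2 * (- (2 * f (\<tau> t) * (fd (\<tau> t) * \<tau>' t)) / ((f (\<tau> t))\<^sup>2 * (f (\<tau> t))\<^sup>2)) = - (fd (\<tau> t) / (f (\<tau> t))^3)"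
      using fp[OF t] \<tau>'p[OF t] by (simp add: field_simps power2_eq_square power3_eq_cube)
    ultimately show ?thesis unfolding \<tau>'_def[abs_def] time_speed_def[abs_def] by simp
  qed
  have dom: "\<gamma> t \<in> cdom M i \<longleftrightarrow> geo v (\<sigma> t) \<in> cdom F i" if "t \<in> J" for t i
    using tauI[OF that] by (simp add: \<gamma>_def)
  have csm: "smooth_curve F J (\<lambda>t. geo v (\<sigma> t))"
    unfolding smooth_curve_def
  proof (intro conjI J ballI)
    have gc: "continuous_on UNIV (geo v)" using germ_isCont[OF geo_germ_geo] continuous_at_imp_continuous_on by blast
    show cs: "continuous_on J (\<lambda>t. geo v (\<sigma> t))"
      by (rule continuous_on_compose2[OF gc smooth_on_imp_continuous_on[OF sigs]]) simp
    show "(\<lambda>t. geo v (\<sigma> t)) ` J \<subseteq> mcarrier F" using germ_in[OF geo_germ_geo] by auto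
    fix i assume i: "i \<in> charts F"
    have o1: "open {s. geo v s \<in> cdom F i}"
      using germ_preimage_open[OF open_UNIV geo_germ_geo open_cdom[OF i], of v] by simp
    have "{t \<in> J. geo v (\<sigma> t) \<in> cdom F i} = J \<inter> (\<lambda>t. geo v (\<sigma> t)) -` cdom F i" by auto
    then have o2: "open {t \<in> J. geo v (\<sigma> t) \<in> cdom F i}"
      using continuous_open_preimage[OF cs J(1) open_cdom[OF i]] by simp
    have "smooth_on {s. geo v s \<in> cdom F i} (gstate i (geo v))"
      using germ_smooth[OF open_UNIV geo_germ_geo i, of v] by simp
    from smooth_on_fst[OF o1 this] have "smooth_on {s. geo v s \<in> cdom F i} (\<lambda>s. coord F i (geo v s))"
      by (simp add: gstate_def)
    then show "smooth_on {t \<in> J. geo v (\<sigma> t) \<in> cdom F i} (\<lambda>t. coord F i (geo v (\<sigma> t)))"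
      by (rule smooth_on_compose[OF o2 o1 _ smooth_on_subset[OF sigs]]) auto
  qed
  have scM: "smooth_curve M J \<gamma>"
    unfolding \<gamma>_def by (rule grw_smooth_curve[OF J(1) taus _ csm]) (use tauI in auto)
  have chain: "((\<lambda>t. h (\<sigma> t)) has_vector_derivative \<sigma>' t *\<^sub>R h') (at t)"
    if "t \<in> J" "(h has_vector_derivative h') (at (\<sigma> t))" for h :: "real \<Rightarrow> real ^ 'n" and h' t
    using vector_diff_chain_at[OF sigd[OF that(1), folded \<sigma>'_def, unfolded has_real_derivative_iff_has_vector_derivative] that(2)]
    by (simp add: o_def)
  define x where "x i t = fst (gs i v (\<sigma> t))" for i t
  define u where "u i t = snd (gs i v (\<sigma> t))" for i t
  define jc where "jc i t = jac i v w (\<sigma> t)" for i t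
  define et where "et i t = snd (Dgs i v (\<sigma> t) w)" for i t
  have local: "((x i has_vector_derivative \<sigma>' t *\<^sub>R u i t) (at t)) \<and>
     ((u i has_vector_derivative \<sigma>' t *\<^sub>R (- Gam i (x i t) (u i t) (u i t))) (at t)) \<and>
     ((jc i has_vector_derivative \<sigma>' t *\<^sub>R et i t) (at t)) \<and>
     ((et i has_vector_derivative \<sigma>' t *\<^sub>R (- (DGam i (x i t) (u i t) (u i t) (jc i t) + 2 *\<^sub>R Gam i (x i t) (u i t) (et i t)))) (at t)) \<and>
     velocity M \<gamma> i t = (\<tau>' t, \<sigma>' t *\<^sub>R u i t) \<and> x i t \<in> V i \<and> coord M i (\<gamma> t) = (\<tau> t, x i t) \<and> \<gamma> t = chart_inv M i (\<tau> t, x i t)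
     \<and> velocity F (\<lambda>t. geo v (\<sigma> t)) i t = \<sigma>' t *\<^sub>R u i t \<and> cm i (x i t) (u i t) (u i t) = len\<^sup>2
     \<and> metric F i (geo v (\<sigma> t)) = cm i (x i t)"
    if t: "t \<in> J" and i: "i \<in> charts F" "geo v (\<sigma> t) \<in> cdom F i" for t i
  proof (intro conjI)
    have dx: "((\<lambda>s. fst (gs i v s)) has_vector_derivative u i t) (at (\<sigma> t))"
      using bounded_linear.has_vector_derivative[OF bounded_linear_fst gs_deriv[OF i]] by (simp add: spray_def u_def)
    show dxx: "(x i has_vector_derivative \<sigma>' t *\<^sub>R u i t) (at t)"
      unfolding x_def[abs_def] by (rule chain[OF t dx])
    show "(u i has_vector_derivative \<sigma>' t *\<^sub>R (- Gam i (x i t) (u i t) (u i t))) (at t)"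
      unfolding u_def[abs_def] x_def
      by (rule chain[OF t]) (use bounded_linear.has_vector_derivative[OF bounded_linear_snd gs_deriv[OF i]] in \<open>simp add: spray_def\<close>)
    show "(jc i has_vector_derivative \<sigma>' t *\<^sub>R et i t) (at t)"
      unfolding jc_def[abs_def] et_def by (rule chain[OF t jac_derivs(1)[OF i]])
    show "(et i has_vector_derivative \<sigma>' t *\<^sub>R (- (DGam i (x i t) (u i t) (u i t) (jc i t) + 2 *\<^sub>R Gam i (x i t) (u i t) (et i t)))) (at t)"
      unfolding jc_def et_def[abs_def] x_def u_def by (rule chain[OF t jac_derivs(2)[OF i]])
    have xc: "x i = (\<lambda>t. coord F i (geo v (\<sigma> t)))" by (simp add: x_def[abs_def] gs_fst)
    show "velocity M \<gamma> i t = (\<tau>' t, \<sigma>' t *\<^sub>R u i t)"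
      unfolding \<gamma>_def \<tau>'_def by (rule grw_velocity[OF taud[OF t] dxx[unfolded xc]])
    show "velocity F (\<lambda>t. geo v (\<sigma> t)) i t = \<sigma>' t *\<^sub>R u i t"
      unfolding velocity_def by (rule vector_derivative_at[OF dxx[unfolded xc]])
    show xV: "x i t \<in> V i" using i by (simp add: xc)
    show "coord M i (\<gamma> t) = (\<tau> t, x i t)" by (simp add: \<gamma>_def xc)
    show "\<gamma> t = chart_inv M i (\<tau> t, x i t)"
      unfolding chart_inv_M[OF i(1) tauI[OF t] xV] by (simp add: \<gamma>_def xc chart_inv_coord[OF i])
    show "cm i (x i t) (u i t) (u i t) = len\<^sup>2"
      using energy_geo[OF i] by (simp add: energy_def x_def u_def len)
    show "metric F i (geo v (\<sigma> t)) = cm i (x i t)"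
      by (intro ext) (simp add: cm_def xc chart_inv_coord[OF i])
  qed
  have open_ch: "open {t \<in> J. geo v (\<sigma> t) \<in> cdom F i}" if i: "i \<in> charts F" for i
  proof -
    have "continuous_on J (\<lambda>t. geo v (\<sigma> t))" using csm unfolding smooth_curve_def by blast
    moreover have "{t \<in> J. geo v (\<sigma> t) \<in> cdom F i} = J \<inter> (\<lambda>t. geo v (\<sigma> t)) -` cdom F i" by auto
    ultimately show ?thesis using continuous_open_preimage[OF _ J(1) open_cdom[OF i]] by simp
  qed
  have len\<sigma>: "len * \<sigma>' t = 1 / (f (\<tau> t))\<^sup>2" if "t \<in> J" for t using len(1) by (simp add: \<sigma>'_def)
  have Ud: "((\<lambda>t. (\<tau>' t, \<sigma>' t *\<^sub>R u i t)) has_vector_derivative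
      - GM i (\<tau> t, x i t) (\<tau>' t, \<sigma>' t *\<^sub>R u i t) (\<tau>' t, \<sigma>' t *\<^sub>R u i t)) (at t)"
    if t: "t \<in> J" and i: "i \<in> charts F" "geo v (\<sigma> t) \<in> cdom F i" for t i
  proof -
    note L = local[OF t i]
    have xV: "x i t \<in> V i" using L by blast
    note b = cm_bilinear[OF i(1) xV] Gam_bilinear[OF i(1) xV]
    have "((\<lambda>t. \<sigma>' t *\<^sub>R u i t) has_vector_derivative
       \<sigma>' t *\<^sub>R (\<sigma>' t *\<^sub>R (- Gam i (x i t) (u i t) (u i t))) + (- 2 * (fd (\<tau> t) / f (\<tau> t)) * \<tau>' t * \<sigma>' t) *\<^sub>R u i t) (at t)"
      using L by (intro has_vector_derivative_scaleR sig'd[OF t]) blast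
    from has_vector_derivative_Pair[OF tau'd[OF t, unfolded has_real_derivative_iff_has_vector_derivative] this]
    have d: "((\<lambda>t. (\<tau>' t, \<sigma>' t *\<^sub>R u i t)) has_vector_derivative (- (fd (\<tau> t) / (f (\<tau> t))^3),
       \<sigma>' t *\<^sub>R (\<sigma>' t *\<^sub>R (- Gam i (x i t) (u i t) (u i t))) + (- 2 * (fd (\<tau> t) / f (\<tau> t)) * \<tau>' t * \<sigma>' t) *\<^sub>R u i t)) (at t)" .
    have "f (\<tau> t) * fd (\<tau> t) * cm i (x i t) (\<sigma>' t *\<^sub>R u i t) (\<sigma>' t *\<^sub>R u i t) = f (\<tau> t) * fd (\<tau> t) * (len * \<sigma>' t)\<^sup>2"
      using L by (simp add: bilinear_lmul[OF b(1)] bilinear_rmul[OF b(1)] power2_eq_square)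
    also have "\<dots> = fd (\<tau> t) / (f (\<tau> t))^3"
      unfolding len\<sigma>[OF t] using fp[OF t] by (simp add: field_simps power2_eq_square power3_eq_cube)
    finally have e1: "f (\<tau> t) * fd (\<tau> t) * cm i (x i t) (\<sigma>' t *\<^sub>R u i t) (\<sigma>' t *\<^sub>R u i t) = fd (\<tau> t) / (f (\<tau> t))^3" .
    have e2: "(fd (\<tau> t) / f (\<tau> t)) *\<^sub>R (\<tau>' t *\<^sub>R (\<sigma>' t *\<^sub>R u i t) + \<tau>' t *\<^sub>R (\<sigma>' t *\<^sub>R u i t)) = (2 * (fd (\<tau> t) / f (\<tau> t)) * \<tau>' t * \<sigma>' t) *\<^sub>R u i t"
      by (simp add: scaleR_2[symmetric] mult_ac)
    have "- GM i (\<tau> t, x i t) (\<tau>' t, \<sigma>' t *\<^sub>R u i t) (\<tau>' t, \<sigma>' t *\<^sub>R u i t) = (- (fd (\<tau> t) / (f (\<tau> t))^3),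
       \<sigma>' t *\<^sub>R (\<sigma>' t *\<^sub>R (- Gam i (x i t) (u i t) (u i t))) + (- 2 * (fd (\<tau> t) / f (\<tau> t)) * \<tau>' t * \<sigma>' t) *\<^sub>R u i t)"
      unfolding GM_simp e1 e2 by (simp add: bilinear_lmul[OF b(2)] bilinear_rmul[OF b(2)])
    then show ?thesis using d by simp
  qed
  have geoM: "geodesic M J \<gamma>"
    unfolding geodesic_def
  proof (intro conjI scM J(2) ballI impI)
    show "J \<noteq> {}" using J(3) by blast
    fix t i assume t: "t \<in> J" and "i \<in> charts M" "\<gamma> t \<in> cdom M i"
    then have i: "i \<in> charts F" "geo v (\<sigma> t) \<in> cdom F i" using dom[OF t] by auto
    obtain e where e: "e > 0" "\<And>s. \<bar>s - t\<bar> < e \<Longrightarrow> s \<in> {t \<in> J. geo v (\<sigma> t) \<in> cdom F i}"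
      using open_real_ball_ex[OF open_ch[OF i(1)], of t] t i by blast
    have "(velocity M \<gamma> i has_vector_derivative
      - GM i (\<tau> t, x i t) (\<tau>' t, \<sigma>' t *\<^sub>R u i t) (\<tau>' t, \<sigma>' t *\<^sub>R u i t)) (at t)"
      by (rule has_vector_derivative_transform_near[OF Ud[OF t i] e(1)]) (use e(2) local[OF _ i(1)] in auto)
    note vd = vector_derivative_at[OF this]
    have xV: "(\<tau> t, x i t) \<in> I \<times> V i" using local[OF t i] tauI[OF t] by blast
    have vel: "velocity M \<gamma> i t = (\<tau>' t, \<sigma>' t *\<^sub>R u i t)" and ci: "\<gamma> t = chart_inv M i (\<tau> t, x i t)"
      using local[OF t i] by blast+
    show "cov_deriv M \<gamma> (velocity M \<gamma>) i t = 0"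
      unfolding cov_deriv_def vd vel unfolding ci christoffel_M[OF i(1) xV] by (simp add: zero_prod_def)
  qed
  \<comment> \<open>Any extension still takes values in M, so its time coordinate stays in I and
    \<open>G1\<close> of it makes sense. The difference between \<open>G1\<close> of the time
    coordinate and the parameter vanishes on J and by continuity on its closure; hence J is closed
    in the larger interval.\<close>
  have inext: "inextendible_geodesic M J \<gamma>"
    unfolding inextendible_geodesic_def
  proof (intro conjI geoM allI impI)
    fix J' \<beta> assume "geodesic M J' \<beta> \<and> J \<subseteq> J' \<and> (\<forall>t\<in>J. \<beta> t = \<gamma> t)"
    then have \<beta>: "is_interval J'" "open J'" "continuous_on J' \<beta>" "\<beta> ` J' \<subseteq> mcarrier M" "J \<subseteq> J'" "\<And>t. t \<in> J \<Longrightarrow> \<beta> t = \<gamma> t"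
      unfolding geodesic_def smooth_curve_def by auto
    have fI: "fst (\<beta> t) \<in> I" if "t \<in> J'" for t using \<beta>(4) that unfolding grw_carrier by force
    define d where "d t = G1 (fst (\<beta> t)) - t" for t
    have dc: "continuous_on J' d" unfolding d_def
      by (intro continuous_intros continuous_on_compose2[OF G1(1) continuous_on_fst[OF \<beta>(3)]]) (use fI in auto)
    have d0: "d t = 0" if "t \<in> J" for t using \<beta>(6)[OF that] G1(3)[OF that] by (simp add: d_def \<gamma>_def)
    have cl: "t \<in> J" if t: "t \<in> J'" "t \<in> closure J" for t
    proof -
      obtain s where s: "\<And>n. s n \<in> J" "s \<longlonglongrightarrow> t" using t(2) unfolding closure_sequential by blast
      have "isCont d t" using dc \<beta>(2) t(1) by (simp add: continuous_on_eq_continuous_at)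
      from isCont_tendsto_compose[OF this s(2)] have "(\<lambda>n. d (s n)) \<longlonglongrightarrow> d t" .
      moreover have "(\<lambda>n. d (s n)) = (\<lambda>n. 0)" using d0 s(1) by simp
      ultimately have "d t = 0" by (simp add: LIMSEQ_const_iff)
      then have "t = G1 (fst (\<beta> t))" by (simp add: d_def)
      then show ?thesis using fI[OF t(1)] G1(2) by blast
    qed
    have conn: "connected J'" using \<beta>(1) by (simp add: is_interval_connected_1)
    have "t \<in> J" if t: "t \<in> J'" for t
    proof (rule connected_local_induct[where P="\<lambda>t. t \<in> J", OF conn subsetD[OF \<beta>(5) J(3)] J(3) _ t])
      fix s assume s: "s \<in> J'"
      show "\<exists>W. open W \<and> s \<in> W \<and> (\<forall>q\<in>J' \<inter> W. \<forall>r\<in>J' \<inter> W. r \<in> J \<longrightarrow> q \<in> J)"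
      proof (cases "s \<in> J")
        case True then show ?thesis using J(1) by (intro exI[of _ J]) auto
      next
        case False
        then have "s \<in> - closure J" using cl[OF s] by blast
        moreover have "J \<subseteq> closure J" by (rule closure_subset)
        ultimately show ?thesis by (intro exI[of _ "- closure J"]) auto
      qed
    qed
    then show "J' = J" using \<beta>(5) by blast
  qed
  have cD: "has_constant_D M J \<gamma> D0"
    unfolding has_constant_D_def
  proof (intro ballI impI)
    fix t i assume t: "t \<in> J" and "i \<in> charts M" "\<gamma> t \<in> cdom M i"
    then have i: "i \<in> charts F" "geo v (\<sigma> t) \<in> cdom F i" using dom[OF t] by auto
    note L = local[OF t i]
    have "x i t \<in> V i" using L by blast
    note b = cm_bilinear[OF i(1) this]
    have vel: "velocity M \<gamma> i t = (\<tau>' t, \<sigma>' t *\<^sub>R u i t)" and m: "metric F i (geo v (\<sigma> t)) = cm i (x i t)"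
      and l: "cm i (x i t) (u i t) (u i t) = len\<^sup>2" using L by blast+
    have "metric M i (\<gamma> t) (velocity M \<gamma> i t) (velocity M \<gamma> i t) = - (\<tau>' t)\<^sup>2 + (f (\<tau> t))\<^sup>2 * (len * \<sigma>' t)\<^sup>2"
      unfolding vel \<gamma>_def grw_simps m bilinear_lmul[OF b] bilinear_rmul[OF b] l by (simp add: power2_eq_square)
    also have "\<dots> = D0" unfolding \<tau>'2[OF t] len\<sigma>[OF t] using fp[OF t] by (simp add: field_simps power2_eq_square)
    finally show "metric M i (\<gamma> t) (velocity M \<gamma> i t) (velocity M \<gamma> i t) = D0" .
  qed
  have cc: "has_constant_c F f J \<gamma> 1"
    unfolding has_constant_c_def Let_def
  proof (intro ballI impI)
    fix t i assume t: "t \<in> J" and i1: "i \<in> charts F" and "(snd \<circ> \<gamma>) t \<in> cdom F i"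
    then have i: "i \<in> charts F" "geo v (\<sigma> t) \<in> cdom F i" by (auto simp: \<gamma>_def)
    note L = local[OF t i]
    have "x i t \<in> V i" using L by blast
    note b = cm_bilinear[OF i(1) this]
    have sg: "snd \<circ> \<gamma> = (\<lambda>t. geo v (\<sigma> t))" "(fst \<circ> \<gamma>) t = \<tau> t" by (auto simp: \<gamma>_def)
    have vel: "velocity F (\<lambda>t. geo v (\<sigma> t)) i t = \<sigma>' t *\<^sub>R u i t" and m: "metric F i (geo v (\<sigma> t)) = cm i (x i t)"
      and l: "cm i (x i t) (u i t) (u i t) = len\<^sup>2" using L by blast+
    have "f (\<tau> t) ^ 4 * cm i (x i t) (\<sigma>' t *\<^sub>R u i t) (\<sigma>' t *\<^sub>R u i t) = f (\<tau> t) ^ 4 * (len * \<sigma>' t)\<^sup>2"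
      unfolding bilinear_lmul[OF b] bilinear_rmul[OF b] l by (simp add: power2_eq_square)
    also have "\<dots> = 1" unfolding len\<sigma>[OF t] using fp[OF t] by (simp add: field_simps power2_eq_square power4_eq_xxxx)
    finally show "f ((fst \<circ> \<gamma>) t) ^ 4 * metric F i ((snd \<circ> \<gamma>) t) (velocity F (snd \<circ> \<gamma>) i t) (velocity F (snd \<circ> \<gamma>) i t) = 1"
      unfolding sg vel m .
  qed
  have jacM: "jacobi_field M J \<gamma> Y"
    unfolding jacobi_field_def smooth_field_along_def
  proof (intro conjI ballI impI)
    fix i assume "i \<in> charts M"
    then have i: "i \<in> charts F" by simp
    have e: "{t \<in> J. \<gamma> t \<in> cdom M i} = {t \<in> J. geo v (\<sigma> t) \<in> cdom F i}" using dom by blast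
    have o1: "open {s. geo v s \<in> cdom F i}"
      using germ_preimage_open[OF open_UNIV geo_germ_geo open_cdom[OF i], of v] by simp
    note o2 = open_ch[OF i]
    show "smooth_on {t \<in> J. \<gamma> t \<in> cdom M i} (Y i)"
      unfolding e Y_def[abs_def]
      by (rule smooth_on_Pair[OF o2 smooth_on_const[OF o2]],
          rule smooth_on_compose[OF o2 o1 jac_smooth[OF i] smooth_on_subset[OF sigs]]) auto
    fix j t assume "j \<in> charts M" and t: "t \<in> J" and "\<gamma> t \<in> cdom M i \<inter> cdom M j"
    then have j: "j \<in> charts F" and ti: "geo v (\<sigma> t) \<in> cdom F i" and tj: "geo v (\<sigma> t) \<in> cdom F j" using dom[OF t] by auto
    have xx: "coord F i (geo v (\<sigma> t)) \<in> VV i j" using ti tj by auto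
    have "((\<lambda>\<eta>. (fst \<eta>, tr i j (snd \<eta>))) has_derivative (\<lambda>k. (fst k, Dtr i j (coord F i (geo v (\<sigma> t))) (snd k)))) (at (\<tau> t, coord F i (geo v (\<sigma> t))))"
      using has_derivative_compose[OF bounded_linear_imp_has_derivative[OF bounded_linear_snd], of "tr i j"
          "Dtr i j (coord F i (geo v (\<sigma> t)))" "(\<tau> t, coord F i (geo v (\<sigma> t)))"] Dtr[OF i j xx]
      by (intro has_derivative_Pair bounded_linear_imp_has_derivative bounded_linear_fst) simp
    then have "((\<lambda>\<eta>. coord M j (chart_inv M i \<eta>)) has_derivative (\<lambda>k. (fst k, Dtr i j (coord F i (geo v (\<sigma> t))) (snd k)))) (at (\<tau> t, coord F i (geo v (\<sigma> t))))"
      by (rule has_derivative_transform_within_open[OF _ open_IV[OF i]])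
        (use tauI[OF t] ti in \<open>auto simp: chart_inv_M[OF i] tr_def\<close>)
    from frechet_derivative_at[OF this, symmetric]
    have "chart_deriv M i (coord M j) (\<gamma> t) (Y i t) = (0, Dtr i j (coord F i (geo v (\<sigma> t))) (jac i v w (\<sigma> t)))"
      unfolding chart_deriv_def \<gamma>_def grw_simps(3) Y_def by simp
    then show "Y j t = chart_deriv M i (coord M j) (\<gamma> t) (Y i t)"
      unfolding Y_def jac_tr[OF i ti j tj] by simp
  next
    fix t i assume t: "t \<in> J" and "i \<in> charts M" "\<gamma> t \<in> cdom M i"
    then have i: "i \<in> charts F" "geo v (\<sigma> t) \<in> cdom F i" using dom[OF t] by auto
    obtain e where e: "e > 0" "\<And>s. \<bar>s - t\<bar> < e \<Longrightarrow> s \<in> {t \<in> J. geo v (\<sigma> t) \<in> cdom F i}"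
      using open_real_ball_ex[OF open_ch[OF i(1)], of t] t i by blast
    have es: "s \<in> J" "geo v (\<sigma> s) \<in> cdom F i" if "\<bar>s - t\<bar> < e" for s using e(2)[OF that] by auto
    note L = local[OF t i]
    have xV: "x i t \<in> V i" using L by blast
    note b = cm_bilinear[OF i(1) xV] Gam_bilinear[OF i(1) xV]
    define X where "X s = (\<tau> s, x i s)" for s
    define U where "U s = (\<tau>' s, \<sigma>' s *\<^sub>R u i s)" for s
    define E where "E s = (0::real, \<sigma>' s *\<^sub>R et i s)" for s
    have Xd: "(X has_vector_derivative U t) (at t)"
      unfolding X_def[abs_def] U_def \<tau>'_def
      using has_vector_derivative_Pair[OF taud[OF t, unfolded has_real_derivative_iff_has_vector_derivative]] L by blast
    have Yd: "(Y i has_vector_derivative E s) (at s)" if s: "\<bar>s - t\<bar> < e" for s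
    proof -
      have "(jc i has_vector_derivative \<sigma>' s *\<^sub>R et i s) (at s)" using local[OF es(1)[OF s] i(1) es(2)[OF s]] by blast
      from has_vector_derivative_Pair[OF has_vector_derivative_const this] show ?thesis
        by (simp add: Y_def[abs_def] E_def jc_def[abs_def])
    qed
    have "((\<lambda>s. \<sigma>' s *\<^sub>R et i s) has_vector_derivative
       \<sigma>' t *\<^sub>R (\<sigma>' t *\<^sub>R (- (DGam i (x i t) (u i t) (u i t) (jc i t) + 2 *\<^sub>R Gam i (x i t) (u i t) (et i t))))
       + (- 2 * (fd (\<tau> t) / f (\<tau> t)) * \<tau>' t * \<sigma>' t) *\<^sub>R et i t) (at t)"
      using L by (intro has_vector_derivative_scaleR sig'd[OF t]) blast
    from has_vector_derivative_Pair[OF has_vector_derivative_const this]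
    have Ed: "(E has_vector_derivative (0,
       \<sigma>' t *\<^sub>R (\<sigma>' t *\<^sub>R (- (DGam i (x i t) (u i t) (u i t) (jc i t) + 2 *\<^sub>R Gam i (x i t) (u i t) (et i t))))
       + (- 2 * (fd (\<tau> t) / f (\<tau> t)) * \<tau>' t * \<sigma>' t) *\<^sub>R et i t)) (at t)" unfolding E_def[abs_def] .
    have quad: "Dcm i (x i t) (c *\<^sub>R p) (c *\<^sub>R p) k = c\<^sup>2 * Dcm i (x i t) p p k" for c p k
      using linear_scale[OF Dcm_lin(1)[OF i(1) xV], of c p "c *\<^sub>R p" k] linear_scale[OF Dcm_lin(2)[OF i(1) xV], of p c p k]
      by (simp add: power2_eq_square)
    have quadG: "DGam i (x i t) (c *\<^sub>R p) (c *\<^sub>R p) k = c\<^sup>2 *\<^sub>R DGam i (x i t) p p k" for c p k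
    proof -
      have "((\<lambda>y. c\<^sup>2 *\<^sub>R Gam i y p p) has_derivative (\<lambda>k. c\<^sup>2 *\<^sub>R DGam i (x i t) p p k)) (at (x i t))"
        by (rule has_derivative_scaleR_right[OF smooth_on_has_derivative[OF Gam_smooth[OF i(1)] xV]])
      then have "((\<lambda>y. Gam i y (c *\<^sub>R p) (c *\<^sub>R p)) has_derivative (\<lambda>k. c\<^sup>2 *\<^sub>R DGam i (x i t) p p k)) (at (x i t))"
        by (rule has_derivative_transform_within_open[OF _ open_V[OF i(1)] xV])
          (simp add: bilinear_lmul[OF Gam_bilinear[OF i(1)]] bilinear_rmul[OF Gam_bilinear[OF i(1)]] power2_eq_square)
      from fun_cong[OF frechet_derivative_at[OF this, symmetric]] show ?thesis .
    qed
    \<comment> \<open>The first variation of the energy, which vanishes by orthogonality; it is the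
      bracket in the \<tau>-component of the linearised equation below.\<close>
    have den: "Dcm i (x i t) (u i t) (u i t) (jc i t) + 2 * cm i (x i t) (u i t) (et i t) = 0"
      using denergy[OF i, of w] perp by (simp add: x_def u_def jc_def et_def)
    have "frechet_derivative (\<lambda>\<eta>. GM i \<eta> (U t) (U t)) (at (X t)) (Y i t) + 2 *\<^sub>R GM i (X t) (U t) (E t) =
       (f (\<tau> t) * fd (\<tau> t) * (\<sigma>' t)\<^sup>2 * (Dcm i (x i t) (u i t) (u i t) (jc i t) + 2 * cm i (x i t) (u i t) (et i t)),
        (\<sigma>' t)\<^sup>2 *\<^sub>R DGam i (x i t) (u i t) (u i t) (jc i t) + 2 *\<^sub>R ((fd (\<tau> t) / f (\<tau> t)) *\<^sub>R (\<tau>' t *\<^sub>R (\<sigma>' t *\<^sub>R et i t))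
          + (\<sigma>' t)\<^sup>2 *\<^sub>R Gam i (x i t) (u i t) (et i t)))"
      unfolding U_def X_def Y_def E_def jc_def[symmetric] DGM_spatial[OF i(1) tauI[OF t] xV] GM_simp quad quadG
        bilinear_lmul[OF b(1)] bilinear_rmul[OF b(1)] bilinear_lmul[OF b(2)] bilinear_rmul[OF b(2)]
      by (simp add: power2_eq_square algebra_simps)
    then have Ed': "(E has_vector_derivative - (frechet_derivative (\<lambda>\<eta>. GM i \<eta> (U t) (U t)) (at (X t)) (Y i t) + 2 *\<^sub>R GM i (X t) (U t) (E t))) (at t)"
      using Ed unfolding den by (simp add: power2_eq_square algebra_simps)
    show "cov_deriv M \<gamma> (cov_deriv M \<gamma> Y) i t + curvature M i (\<gamma> t) (Y i t) (velocity M \<gamma> i t) (velocity M \<gamma> i t) = 0"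
    proof (rule jacobi_equation_in_chart[OF open_IV[OF i(1)] GM_bilinear[OF i(1)] GM_smooth[OF i(1)] GM_sym[OF i(1)] christoffel_M[OF i(1)] e(1),
          where X=X and U=U and E=E])
      show "X s \<in> I \<times> V i" "\<gamma> s = chart_inv M i (X s)" "velocity M \<gamma> i s = U s" if s: "\<bar>s - t\<bar> < e" for s
        using local[OF es(1)[OF s] i(1) es(2)[OF s]] tauI[OF es(1)[OF s]] unfolding X_def U_def by blast+
      show "coord M i (\<gamma> t) = X t" using L unfolding X_def by blast
      show "(U has_vector_derivative - GM i (X t) (U t) (U t)) (at t)"
        unfolding U_def[abs_def] X_def by (rule Ud[OF t i])
    qed (use Xd Yd Ed' in auto)
  qed
  \<comment> \<open>Surjectivity of \<sigma> lets the lift reach the zero of the field at fiber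
    parameter 1; the parameter found is not 0 because \<sigma> vanishes there.\<close>
  have "1 \<in> \<sigma> ` J" using sigU by simp
  then obtain t1 where t1: "t1 \<in> J" "\<sigma> t1 = 1" by auto
  have z0: "field_zero_at M \<gamma> Y 0"
    unfolding field_zero_at_def using dom[OF J(3)] jac_0 by (auto simp: Y_def sig0 zero_prod_def)
  have z1: "field_zero_at M \<gamma> Y t1"
    unfolding field_zero_at_def using dom[OF t1(1)] jac_zero_chart[OF i1 _ _ conj] by (auto simp: Y_def t1(2) zero_prod_def)
  \<comment> \<open>If the lifted field vanished everywhere, surjectivity of \<sigma> would make the
    fiber field vanish around 0, where its derivative is \<open>w\<close>.\<close>
  have nz: "\<exists>u\<in>J. \<not> field_zero_at M \<gamma> Y u"
  proof (rule ccontr)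
    assume "\<not> ?thesis"
    then have z: "jac i0 v w (\<sigma> t) = 0" if "t \<in> J" "geo v (\<sigma> t) \<in> cdom F i0" for t
      using that i0(1) dom[OF that(1)] unfolding field_zero_at_def Y_def by (auto simp: zero_prod_def)
    have g0: "geo v 0 \<in> cdom F i0" using i0 geo_0 by simp
    obtain e where e: "e > 0" "\<And>s. \<bar>s - 0\<bar> < e \<Longrightarrow> geo v s \<in> cdom F i0"
      using continuous_near[OF germ_isCont[OF geo_germ_geo] open_cdom[OF i0(1)] g0] by blast
    have zs: "jac i0 v w s = 0" if s: "\<bar>s - 0\<bar> < e" for s
    proof -
      have "s \<in> \<sigma> ` J" using sigU by simp
      then show ?thesis using z e(2)[OF s] by auto
    qed
    have "((\<lambda>s. 0) has_vector_derivative w) (at 0)"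
      by (rule has_vector_derivative_transform_near[OF jac_derivs(1)[OF i0(1) g0, of w, unfolded Dgs_0 snd_conv] e(1) zs])
    then have "w = 0" using vector_derivative_unique_at[OF _ has_vector_derivative_const] by blast
    then show False using w by simp
  qed
  have "conjugate_along M J \<gamma> 0 t1"
    unfolding conjugate_along_def using J(3) t1 sig0 jacM z0 z1 nz by (intro conjI exI[of _ Y]) auto
  moreover have "\<gamma> 0 = (t0, x0)" by (simp add: \<gamma>_def tau0 sig0 geo_0)
  ultimately show ?thesis using inext J(3) cD cc by blast
qed

end

end

theorem corollary7:
  fixes F :: "('i, 'm::{t2_space,second_countable_topology}, real ^ 'n) semi_riemannian"
    and f :: "real \<Rightarrow> real" and a b :: ereal
    and c0 D0 t0 :: real and x0 :: 'm
  assumes "riemannian_manifold F"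
    and "connected (mcarrier F)"
    and "smooth_on (einterval a b) f"
    and "\<forall>\<tau>\<in>einterval a b. f \<tau> > 0"
    and "globally_hyperbolic (grw a b f F) grw_time"
    and "c0 \<in> einterval a b"
    and "(\<integral>\<^sup>+\<tau>\<in>einterval a (ereal c0).
            ennreal (f \<tau> powr (-2) * (1 / (f \<tau>)\<^sup>2 + 1) powr (-1/2)) \<partial>lborel) = \<infinity>"
    and "(\<integral>\<^sup>+\<tau>\<in>einterval (ereal c0) b.
            ennreal (f \<tau> powr (-2) * (1 / (f \<tau>)\<^sup>2 + 1) powr (-1/2)) \<partial>lborel) = \<infinity>"
    and "D0 \<le> 0"
    and "t0 \<in> einterval a b" and "x0 \<in> mcarrier F"
    and "\<forall>J \<gamma>. inextendible_geodesic (grw a b f F) J \<gamma> \<and> 0 \<in> J \<and> \<gamma> 0 = (t0, x0) \<and>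
            has_constant_D (grw a b f F) J \<gamma> D0 \<and> has_constant_c F f J \<gamma> 1 \<longrightarrow>
            (\<forall>t. \<not> conjugate_along (grw a b f F) J \<gamma> 0 t)"
  shows "\<exists>p. covering_space (UNIV :: (real ^ 'n) set) p (mcarrier F)"
proof -
  obtain i0 where i0: "i0 \<in> charts F" "x0 \<in> cdom F i0" using assms(11) unfolding mcarrier_def by blast
  interpret grw_hyperbolic F a b f c0
    by unfold_locales (use assms(1,3-8) in auto)
  interpret complete_from F x0 i0
    by unfold_locales (use i0 geodesic_precompact in auto)
  interpret grw_at F a b f c0 x0 i0 D0 t0
    by unfold_locales (use assms(9,10) in auto)
  interpret exp_nonsingular F x0 i0
  proof unfold_locales
    show "connected (mcarrier F)" by (rule assms(2))
    fix i v w assume i: "i \<in> charts F" "geo v 1 \<in> cdom F i" and z: "jac i v w 1 = 0"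
    show "w = 0"
    proof (cases "v = 0")
      case True
      then show ?thesis using jac_zero_velocity i z by blast
    next
      case False
      show ?thesis
      proof (rule ccontr)
        assume "w \<noteq> 0"
        from conjugate_lift[OF False this i z] show False using assms(12) by blast
      qed
    qed
  qed
  show ?thesis using exp_covering by blast
qed

end
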